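(* Let $\sigma\in(\mathbb{C}/\frac{2\pi i}{\log q}\mathbb{Z})^r$ and assume that the Satake parameters do not contain $-q^{\pm\frac12}$, i.e. $q^{\sigma_i}\notin\{-q^{1/2},-q^{-1/2}\}$ for all $i$. Let $\pi_L$ be the unique irreducible constituent of $\mathrm{I}^\sigma_{W_r}$ having a nonzero $L_r$-fixed vector and $\pi_K$ the unique irreducible constituent having a nonzero $K_r$-fixed vector. Then $\pi_L=\pi_K$.
   Context: $p$ odd; $E/F$ ramified quadratic extension of $p$-adic fields, $x\mapsto\bar x$ the Galois involution, $\varpi_E$ uniformizer with $\varpi_E^2\in F$, $q$ residue cardinality, $|\varpi_E|_E=q^{-1}$. $W_r=\bigoplus_{i=1}^{2r}Ee_i$ with skew-Hermitian form of matrix $\begin{pmatrix}0&1_r\\-1_r&0\end{pmatrix}$, $G_r=\mathrm{U}(W_r)(F)$. $P_r$ is the Borel subgroup of elements $\begin{pmatrix}a&b\\0&{}^t\bar a^{-1}\end{pmatrix}$ with $a$ lower triangular, $\delta_{P_r}$ its modulus character; for $\sigma$, $\chi^\sigma(\mathrm{diag}(a_1,\dots,a_r,\ast)n)=\prod|a_i|_E^{\sigma_i}$ and $\mathrm{I}^\sigma_{W_r}=\mathrm{Ind}_{P_r}^{G_r}(\delta_{P_r}^{1/2}\chi^\sigma)$ (normalized induction). $K_r$ is the stabilizer of $\bigoplus_{i=1}^{2r}\mathcal{O}_Ee_i$ and $L_r$ the stabilizer of $\bigoplus_{i=1}^r\mathcal{O}_Ee_i\oplus\bigoplus_{i=r+1}^{2r}\varpi_E\mathcal{O}_Ee_i$.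 *)

theory Defs
  imports
    "HOL-Analysis.Analysis"
    "HOL-Algebra.Algebra"
    "HOL-Algebra.Algebraic_Closure_Type"
    "Jordan_Normal_Form.Matrix"
begin

section \<open>\<open>p\<close>-adic fields and ramified quadratic extensions\<close>

text \<open>
  All fields live inside one ambient field, the type \<open>'e\<close>; a subfield is a set \<open>K\<close> of
  elements.  The function \<open>v\<close> is the (multiplicative) absolute value, not the additive valuation.
\<close>

definition nonarch_abs_on :: "'e::field set \<Rightarrow> ('e \<Rightarrow> real) \<Rightarrow> bool" where
  "nonarch_abs_on K v \<longleftrightarrow>
     (\<forall>x\<in>K. 0 \<le> v x \<and> (v x = 0 \<longleftrightarrow> x = 0)) \<and>
     (\<forall>x\<in>K. \<forall>y\<in>K. v (x * y) = v x * v y) \<and>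
     (\<forall>x\<in>K. \<forall>y\<in>K. v (x + y) \<le> max (v x) (v y))"

definition integers_of :: "('e::field \<Rightarrow> real) \<Rightarrow> 'e set \<Rightarrow> 'e set" where
  "integers_of v K = {x \<in> K. v x \<le> 1}"

definition max_ideal_of :: "('e::field \<Rightarrow> real) \<Rightarrow> 'e set \<Rightarrow> 'e set" where
  "max_ideal_of v K = {x \<in> K. v x < 1}"

definition uniformizer :: "('e::field \<Rightarrow> real) \<Rightarrow> 'e set \<Rightarrow> 'e \<Rightarrow> bool" where
  "uniformizer v K w \<longleftrightarrow> w \<noteq> 0 \<and> w \<in> K \<and> max_ideal_of v K = (\<lambda>x. w * x) ` integers_of v K"

definition residue_classes :: "('e::field \<Rightarrow> real) \<Rightarrow> 'e set \<Rightarrow> 'e set set" where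
  "residue_classes v K =
     integers_of v K //
       {(x, y). x \<in> integers_of v K \<and> y \<in> integers_of v K \<and> x - y \<in> max_ideal_of v K}"

definition residue_card :: "('e::field \<Rightarrow> real) \<Rightarrow> 'e set \<Rightarrow> nat" where
  "residue_card v K = card (residue_classes v K)"

text \<open>
  A \<open>p\<close>-adic field: a field of characteristic 0 (class \<open>field_char_0\<close>), complete for a discrete
  non-archimedean absolute value, with finite residue field of characteristic \<open>p\<close>.  A uniformizer
  is nonzero and of absolute value less than 1, so its existence says that the absolute value is
  both nontrivial and discrete.
\<close>

definition padic_field :: "nat \<Rightarrow> ('e::field_char_0 \<Rightarrow> real) \<Rightarrow> 'e set \<Rightarrow> bool" where
  "padic_field p v K \<longleftrightarrow>
     Factorial_Ring.prime p \<and> subfield K ring_of_type_algebra \<and> nonarch_abs_on K v \<and>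
     Metric_space.mcomplete K (\<lambda>x y. v (x - y)) \<and>
     (\<exists>w. uniformizer v K w) \<and> finite (residue_classes v K) \<and> v (of_nat p) < 1"

text \<open>
  \<open>E/F\<close> is a quadratic extension of \<open>p\<close>-adic fields, \<open>E\<close> being the whole type; \<open>cj\<close> is the
  Galois involution (the nontrivial automorphism of \<open>E\<close> over \<open>F\<close>).  Ramified means: a uniformizer
  of \<open>F\<close> does not stay a uniformizer of \<open>E\<close>.  The last three assumptions fix a uniformizer \<open>unif\<close> with
  \<open>unif\<^sup>2 \<in> F\<close> and normalize \<open>v\<close> by \<open>v unif = 1/q\<close>, so \<open>v\<close> is the absolute value of \<open>E\<close> (its restriction to
  \<open>F\<close> is the square of the normalized absolute value of \<open>F\<close>).
\<close>

locale ramified_quadratic_extension =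
  fixes p :: nat and v :: "'e::field_char_0 \<Rightarrow> real" and F :: "'e set"
    and cj :: "'e \<Rightarrow> 'e" and unif :: 'e
  assumes E_padic: "padic_field p v (UNIV :: 'e set)"
    and F_padic: "padic_field p v F"
    and quadratic: "ring.dimension (ring_of_type_algebra :: 'e ring) 2 F UNIV"
    and cj_iso: "cj \<in> ring_iso (ring_of_type_algebra :: 'e ring) (ring_of_type_algebra :: 'e ring)"
    and cj_fixes: "\<And>x. x \<in> F \<Longrightarrow> cj x = x"
    and cj_nontrivial: "cj \<noteq> id"
    and ramified: "\<And>w. uniformizer v F w \<Longrightarrow> \<not> uniformizer v UNIV w"
    and uniformizer_E: "uniformizer v UNIV unif"
    and uniformizer_sq: "unif ^ 2 \<in> F"
    and abs_normalized: "v unif = 1 / real (residue_card v F)"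


section \<open>Locally profinite groups: modulus character\<close>

definition compact_open_subgroup :: "('g, 'b) monoid_scheme \<Rightarrow> 'g topology \<Rightarrow> 'g set \<Rightarrow> bool" where
  "compact_open_subgroup G T U \<longleftrightarrow> subgroup U G \<and> openin T U \<and> compactin T U"

text \<open>The generalized index \<open>[A : B] = [A : A \<inter> B] / [B : A \<inter> B]\<close> of two commensurable subgroups;
  for compact open subgroups it is the quotient of their Haar measures.\<close>

definition gen_index :: "('g, 'b) monoid_scheme \<Rightarrow> 'g set \<Rightarrow> 'g set \<Rightarrow> real" where
  "gen_index G A B =
     real (card (rcosets\<^bsub>G\<lparr>carrier := A\<rparr>\<^esub> (A \<inter> B))) /
     real (card (rcosets\<^bsub>G\<lparr>carrier := B\<rparr>\<^esub> (A \<inter> B)))"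

text \<open>
  The modulus of \<open>g\<close> is the common value of \<open>[g U g\<^sup>-\<^sup>1 : U]\<close> over all compact open subgroups \<open>U\<close>,
  that is, the factor by which conjugation \<open>x \<mapsto> g x g\<^sup>-\<^sup>1\<close> scales Haar measure.  For a
  parabolic subgroup with unipotent radical \<open>N\<close> this is \<open>\<bar>det (Ad g | Lie N)\<bar>\<close>, the convention
  under which normalized induction uses functions with \<open>f (p x) = \<delta>(p)\<^sup>1\<^sup>/\<^sup>2 \<chi>(p) f x\<close>.
\<close>

definition modulus :: "('g, 'b) monoid_scheme \<Rightarrow> 'g topology \<Rightarrow> 'g \<Rightarrow> real" where
  "modulus G T g =
     (THE d. \<forall>U. compact_open_subgroup G T U \<longrightarrow>
        d = gen_index G ((\<lambda>x. g \<otimes>\<^bsub>G\<^esub> x \<otimes>\<^bsub>G\<^esub> inv\<^bsub>G\<^esub> g) ` U) U)"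


section \<open>Complex representations\<close>

abbreviation complex_ring :: "complex ring" where
  "complex_ring \<equiv> ring_of_type_algebra"

text \<open>A representation is a complex vector space (a module over \<open>complex_ring\<close>, whose fields
  \<open>mult\<close> and \<open>one\<close> carry no meaning) together with an action.\<close>

record ('v, 'g) rep = "(complex, 'v) module" +
  act :: "'g \<Rightarrow> 'v \<Rightarrow> 'v"

definition subrep :: "('g, 'b) monoid_scheme \<Rightarrow> ('v, 'g) rep \<Rightarrow> 'v set \<Rightarrow> bool" where
  "subrep G V A \<longleftrightarrow> submodule A complex_ring V \<and> (\<forall>g\<in>carrier G. \<forall>x\<in>A. act V g x \<in> A)"

definition quotient_rep :: "('v, 'g) rep \<Rightarrow> 'v set \<Rightarrow> ('v set, 'g) rep" where
  "quotient_rep V B =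
     \<lparr>carrier = a_rcosets\<^bsub>V\<^esub> B, mult = (\<lambda>_ _. undefined), one = undefined,
      ring.zero = B, ring.add = set_add V,
      module.smult = (\<lambda>c S. \<Union>x\<in>S. B +>\<^bsub>V\<^esub> (c \<odot>\<^bsub>V\<^esub> x)),
      act = (\<lambda>g S. \<Union>x\<in>S. B +>\<^bsub>V\<^esub> act V g x)\<rparr>"

definition irreducible_rep :: "('g, 'b) monoid_scheme \<Rightarrow> ('v, 'g) rep \<Rightarrow> bool" where
  "irreducible_rep G V \<longleftrightarrow>
     carrier V \<noteq> {\<zero>\<^bsub>V\<^esub>} \<and> (\<forall>A. subrep G V A \<longrightarrow> A = {\<zero>\<^bsub>V\<^esub>} \<or> A = carrier V)"

definition rep_iso :: "('g, 'b) monoid_scheme \<Rightarrow> ('v, 'g) rep \<Rightarrow> ('w, 'g) rep \<Rightarrow> bool" where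
  "rep_iso G V W \<longleftrightarrow>
     (\<exists>T. T \<in> iso (add_monoid V) (add_monoid W) \<and>
        (\<forall>c. \<forall>x\<in>carrier V. T (c \<odot>\<^bsub>V\<^esub> x) = c \<odot>\<^bsub>W\<^esub> T x) \<and>
        (\<forall>g\<in>carrier G. \<forall>x\<in>carrier V. T (act V g x) = act W g (T x)))"

definition has_nonzero_fixed :: "'g set \<Rightarrow> ('v, 'g) rep \<Rightarrow> bool" where
  "has_nonzero_fixed H V \<longleftrightarrow>
     (\<exists>x\<in>carrier V. x \<noteq> \<zero>\<^bsub>V\<^esub> \<and> (\<forall>h\<in>H. act V h x = x))"

definition irreducible_constituent ::
    "('g, 'b) monoid_scheme \<Rightarrow> ('v, 'g) rep \<Rightarrow> ('v set, 'g) rep \<Rightarrow> bool" where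
  "irreducible_constituent G V \<pi> \<longleftrightarrow>
     (\<exists>A B. subrep G V A \<and> subrep G V B \<and> B \<subseteq> A \<and>
        \<pi> = quotient_rep (V\<lparr>carrier := A\<rparr>) B \<and> irreducible_rep G \<pi>)"

text \<open>\<open>\<pi>\<close> is, up to isomorphism, the unique irreducible constituent of \<open>V\<close> with a nonzero
  \<open>H\<close>-fixed vector.\<close>

definition unique_constituent_with_fixed ::
    "('g, 'b) monoid_scheme \<Rightarrow> ('v, 'g) rep \<Rightarrow> 'g set \<Rightarrow> ('v set, 'g) rep \<Rightarrow> bool" where
  "unique_constituent_with_fixed G V H \<pi> \<longleftrightarrow>
     irreducible_constituent G V \<pi> \<and> has_nonzero_fixed H \<pi> \<and>
     (\<forall>\<pi>'. irreducible_constituent G V \<pi>' \<and> has_nonzero_fixed H \<pi>' \<longrightarrow> rep_iso G \<pi>' \<pi>)"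

text \<open>Smooth (unnormalized) induction of a character \<open>\<tau>\<close> of \<open>P\<close>.  Functions on \<open>G\<close> are represented
  by functions on the whole type vanishing off \<open>G\<close>; \<open>G\<close> acts by right translation.\<close>

definition induced_rep ::
    "('g, 'b) monoid_scheme \<Rightarrow> 'g topology \<Rightarrow> 'g set \<Rightarrow> ('g \<Rightarrow> complex) \<Rightarrow> ('g \<Rightarrow> complex, 'g) rep" where
  "induced_rep G T P \<tau> =
     \<lparr>carrier = {f. (\<forall>x. x \<notin> carrier G \<longrightarrow> f x = 0) \<and>
                   (\<forall>b\<in>P. \<forall>x\<in>carrier G. f (b \<otimes>\<^bsub>G\<^esub> x) = \<tau> b * f x) \<and>
                   (\<exists>U. subgroup U G \<and> openin T U \<and>
                      (\<forall>u\<in>U. \<forall>x\<in>carrier G. f (x \<otimes>\<^bsub>G\<^esub> u) = f x))},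
      mult = (\<lambda>_ _. undefined), one = undefined,
      ring.zero = (\<lambda>_. 0), ring.add = (\<lambda>f f' x. f x + f' x),
      module.smult = (\<lambda>c f x. c * f x),
      act = (\<lambda>g f x. if x \<in> carrier G then f (x \<otimes>\<^bsub>G\<^esub> g) else 0)\<rparr>"


section \<open>The quasi-split unitary group of a skew-Hermitian space\<close>

text \<open>Indices start at 0: the basis vector \<open>e\<^sub>i\<close> of \<open>W\<^sub>r\<close> (\<open>1 \<le> i \<le> 2r\<close>) has index \<open>i - 1\<close>.
  Matrices act on column vectors.\<close>

definition skew_gram :: "nat \<Rightarrow> 'e::field mat" where
  "skew_gram r = four_block_mat (0\<^sub>m r r) (1\<^sub>m r) (- 1\<^sub>m r) (0\<^sub>m r r)"

definition skew_form :: "('e::field \<Rightarrow> 'e) \<Rightarrow> nat \<Rightarrow> 'e vec \<Rightarrow> 'e vec \<Rightarrow> 'e" where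
  "skew_form cj r x y = scalar_prod x (skew_gram r *\<^sub>v map_vec cj y)"

definition unitary_group :: "('e::field \<Rightarrow> 'e) \<Rightarrow> nat \<Rightarrow> 'e mat monoid" where
  "unitary_group cj r =
     \<lparr>carrier = {g \<in> carrier_mat (2 * r) (2 * r).
         invertible_mat g \<and>
         (\<forall>x\<in>carrier_vec (2 * r). \<forall>y\<in>carrier_vec (2 * r).
            skew_form cj r (g *\<^sub>v x) (g *\<^sub>v y) = skew_form cj r x y)},
      mult = (*), one = 1\<^sub>m (2 * r)\<rparr>"

text \<open>The \<open>insert 0\<close> only matters for \<open>n = 0\<close>.\<close>

definition mat_dist :: "('e::field \<Rightarrow> real) \<Rightarrow> nat \<Rightarrow> 'e mat \<Rightarrow> 'e mat \<Rightarrow> real" where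
  "mat_dist v n A B =
     Max (insert 0 ((\<lambda>(i, j). v (A $$ (i, j) - B $$ (i, j))) ` ({..<n} \<times> {..<n})))"

definition mat_topology :: "('e::field \<Rightarrow> real) \<Rightarrow> nat \<Rightarrow> 'e mat topology" where
  "mat_topology v n = Metric_space.mtopology (carrier_mat n n) (mat_dist v n)"

definition unitary_topology :: "('e::field \<Rightarrow> real) \<Rightarrow> ('e \<Rightarrow> 'e) \<Rightarrow> nat \<Rightarrow> 'e mat topology" where
  "unitary_topology v cj r =
     subtopology (mat_topology v (2 * r)) (carrier (unitary_group cj r))"

definition borel_subgroup :: "('e::field \<Rightarrow> 'e) \<Rightarrow> nat \<Rightarrow> 'e mat set" where
  "borel_subgroup cj r =
     {g \<in> carrier (unitary_group cj r).
        \<exists>a\<in>carrier_mat r r. \<exists>b\<in>carrier_mat r r. \<exists>d\<in>carrier_mat r r.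
          upper_triangular (transpose_mat a) \<and>
          inverts_mat (transpose_mat (map_mat cj a)) d \<and>
          g = four_block_mat a b (0\<^sub>m r r) d}"

definition borel_modulus :: "('e::field \<Rightarrow> real) \<Rightarrow> ('e \<Rightarrow> 'e) \<Rightarrow> nat \<Rightarrow> 'e mat \<Rightarrow> real" where
  "borel_modulus v cj r =
     modulus ((unitary_group cj r)\<lparr>carrier := borel_subgroup cj r\<rparr>)
       (subtopology (mat_topology v (2 * r)) (borel_subgroup cj r))"

text \<open>The character \<open>\<chi>\<^sup>\<sigma>\<close> depends on each \<open>\<sigma> i\<close> only modulo \<open>2\<pi>\<i>/log q\<close>, as \<open>v\<close> takes values in
  powers of \<open>q\<close>.\<close>

definition borel_char :: "('e::field \<Rightarrow> real) \<Rightarrow> nat \<Rightarrow> (nat \<Rightarrow> complex) \<Rightarrow> 'e mat \<Rightarrow> complex" where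
  "borel_char v r \<sigma> g = (\<Prod>i<r. complex_of_real (v (g $$ (i, i))) powr \<sigma> i)"

definition principal_series ::
    "('e::field \<Rightarrow> real) \<Rightarrow> ('e \<Rightarrow> 'e) \<Rightarrow> nat \<Rightarrow> (nat \<Rightarrow> complex) \<Rightarrow> ('e mat \<Rightarrow> complex, 'e mat) rep" where
  "principal_series v cj r \<sigma> =
     induced_rep (unitary_group cj r) (unitary_topology v cj r) (borel_subgroup cj r)
       (\<lambda>b. complex_of_real (sqrt (borel_modulus v cj r b)) * borel_char v r \<sigma> b)"

definition stabilizer :: "('e::field \<Rightarrow> 'e) \<Rightarrow> nat \<Rightarrow> 'e vec set \<Rightarrow> 'e mat set" where
  "stabilizer cj r \<Lambda> = {g \<in> carrier (unitary_group cj r). (\<lambda>x. g *\<^sub>v x) ` \<Lambda> = \<Lambda>}"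

definition lattice_K :: "('e::field \<Rightarrow> real) \<Rightarrow> nat \<Rightarrow> 'e vec set" where
  "lattice_K v r = {x \<in> carrier_vec (2 * r). \<forall>i<2 * r. x $ i \<in> integers_of v UNIV}"

definition lattice_L :: "('e::field \<Rightarrow> real) \<Rightarrow> 'e \<Rightarrow> nat \<Rightarrow> 'e vec set" where
  "lattice_L v unif r = {x \<in> carrier_vec (2 * r).
     (\<forall>i<r. x $ i \<in> integers_of v UNIV) \<and>
     (\<forall>i\<in>{r..<2 * r}. x $ i \<in> (\<lambda>y. unif * y) ` integers_of v UNIV)}"

definition group_K :: "('e::field \<Rightarrow> real) \<Rightarrow> ('e \<Rightarrow> 'e) \<Rightarrow> nat \<Rightarrow> 'e mat set" where
  "group_K v cj r = stabilizer cj r (lattice_K v r)"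

definition group_L :: "('e::field \<Rightarrow> real) \<Rightarrow> ('e \<Rightarrow> 'e) \<Rightarrow> 'e \<Rightarrow> nat \<Rightarrow> 'e mat set" where
  "group_L v cj unif r = stabilizer cj r (lattice_L v unif r)"

end

(*
  Let f_K and f_L be the vectors of the principal series fixed by K_r and L_r, normalized to take the value 1
  at the identity. By the Iwasawa decomposition each spans the line of fixed vectors, so each singles out one
  constituent, and the two constituents agree as soon as f_K and f_L generate each other.

  The average of f_K over L_r is c times f_L with c = int_{L_r} f_K, and likewise with K and L exchanged. Both
  integrals are computed by induction along the chain of subgroups stabilizing longer and longer parts of the
  isotropic flag: an element is either reduced into the next smaller group by K_r \<inter> L_r, or after an additional
  Weyl reflection, and the reflections belonging to K_r and to L_r differ by the torus element
  diag(.., varpi_E, ..). Counting the two kinds of elements amounts to counting their (isotropic) rows modulo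
  varpi_E, and up to positive constants the integrals are prod_i (1 + q^(1/2) q^(sigma_i)) and
  prod_i (1 + q^(1/2) q^(-sigma_i)). They vanish exactly at the excluded Satake parameters.
*)

theory Submission
  imports Defs "Jordan_Normal_Form.Determinant"
begin

text \<open>No Haar measure is set up: an integral over a compact group becomes a finite sum over
  representatives modulo a congruence level. Level 1 is enough for the two integrals, because an
  element of one parahoric that is trivial to level 1 lies in the other
  (\<open>congr_one_Ks\<close>). The factors q^(1/2) come from two different reductions. On the
  lattice of K the form reduces to an alternating form, for which every row is isotropic. On the
  lattice of L, after division by \<open>unif\<close>, it reduces to a split quadratic form, because
  \<open>cj\<close> is trivial on the residue field and \<open>cj unif = - unif\<close>. Hence the
  elements without and with a reflection at position m occur in the ratio 1 : q^(m+1) for K and q^m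
  : 1 for L. The square root of the modulus of the torus element with \<open>1 / unif\<close> at
  position m is q^(m+1/2), halfway between, and q^(1/2) remains in both cases. The modulus is a
  definite description over all compact open subgroups, so a compact open subgroup of the Borel
  subgroup must be exhibited before any index can be counted. Uniqueness of the constituents rests
  on one property of the fixed line: subrepresentations that miss it have a sum that misses
  it.\<close>

locale odd_ramified_extension = ramified_quadratic_extension p v F cj unif
  for p :: nat and v :: "'e::field_char_0 \<Rightarrow> real" and F cj unif +
  assumes odd_p: "odd p"
begin

abbreviation q :: nat where "q \<equiv> residue_card v F"

section \<open>The absolute value of E and its value group\<close>

lemma v_nonneg [simp]: "0 \<le> v x"
  and v_eq_0 [simp]: "v x = 0 \<longleftrightarrow> x = 0"
  and v_mult: "v (x * y) = v x * v y"
  and v_add: "v (x + y) \<le> max (v x) (v y)"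
  using E_padic by (auto simp: padic_field_def nonarch_abs_on_def)

lemma v_0 [simp]: "v 0 = 0" by simp

lemma v_1 [simp]: "v 1 = 1"
  using v_mult[of 1 1] by simp

lemma v_pos [simp]: "0 < v x \<longleftrightarrow> x \<noteq> 0"
  using v_nonneg[of x] v_eq_0[of x] by linarith

lemma v_minus [simp]: "v (- x) = v x"
proof -
  have "(v (-1))\<^sup>2 = 1" using v_mult[of "-1" "-1"] by (simp add: power2_eq_square)
  then have "v (-1) = 1" using v_nonneg[of "-1"] by (auto simp: power2_eq_1_iff)
  then show ?thesis using v_mult[of "-1" x] by simp
qed

lemma v_minus_commute: "v (x - y) = v (y - x)"
  using v_minus[of "x - y"] by simp

lemma v_power: "v (x ^ n) = v x ^ n"
  by (induction n) (auto simp: v_mult)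

lemma v_inverse: "v (inverse x) = inverse (v x)"
proof (cases "x = 0")
  case False
  then have "v x * v (inverse x) = 1" by (simp flip: v_mult)
  then show ?thesis by (metis inverse_unique)
qed simp

lemma v_divide: "v (x / y) = v x / v y"
  by (simp add: divide_inverse v_mult v_inverse)

lemma v_diff: "v (x - y) \<le> max (v x) (v y)"
  using v_add[of x "- y"] by simp

lemma v_add_le: "v x \<le> c \<Longrightarrow> v y \<le> c \<Longrightarrow> v (x + y) \<le> c"
  using v_add[of x y] by linarith

lemma v_diff_le: "v x \<le> c \<Longrightarrow> v y \<le> c \<Longrightarrow> v (x - y) \<le> c"
  using v_diff[of x y] by linarith

lemma v_add_less: "v x < c \<Longrightarrow> v y < c \<Longrightarrow> v (x + y) < c"
  using v_add[of x y] by linarith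

lemma v_diff_less: "v x < c \<Longrightarrow> v y < c \<Longrightarrow> v (x - y) < c"
  using v_diff[of x y] by linarith

lemma v_sum_le:
  assumes "\<And>i. i \<in> I \<Longrightarrow> v (f i) \<le> c" "0 \<le> c"
  shows "v (sum f I) \<le> c"
  using assms by (induction I rule: infinite_finite_induct) (auto intro!: v_add_le)

lemma v_sum_less:
  assumes "\<And>i. i \<in> I \<Longrightarrow> v (f i) < c" "0 < c"
  shows "v (sum f I) < c"
  using assms by (induction I rule: infinite_finite_induct) (auto intro!: v_add_less)

lemma v_add_dominant: "v y < v x \<Longrightarrow> v (x + y) = v x"
  using v_add[of x y] v_diff[of "x + y" y] by (auto simp: max_def split: if_splits)

lemma v_diff_dominant: "v y < v x \<Longrightarrow> v (x - y) = v x"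
  using v_add_dominant[of "- y" x] by simp

lemma v_unif: "v unif = 1 / q"
  by (rule abs_normalized)

lemma unif_nz [simp]: "unif \<noteq> 0"
  using uniformizer_E by (auto simp: uniformizer_def)

lemma v_unif_less_1: "v unif < 1"
proof -
  have "unif * 1 \<in> (\<lambda>x. unif * x) ` integers_of v UNIV"
    by (rule imageI) (simp add: integers_of_def)
  then show ?thesis
    using uniformizer_E unfolding uniformizer_def max_ideal_of_def by auto
qed

lemma q_gt_1: "1 < q"
proof -
  have "q \<noteq> 0" using v_unif by (metis div_by_0 of_nat_0 unif_nz v_eq_0)
  moreover have "1 < real q"
    using v_unif v_unif_less_1 \<open>q \<noteq> 0\<close> by (simp add: divide_less_eq)
  ultimately show ?thesis by (metis of_nat_1 of_nat_less_iff)
qed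

lemma real_q_gt_1: "1 < real q" and real_q_pos: "0 < real q"
  using q_gt_1 by auto

lemma v_lt_1_unif: "v x < 1 \<Longrightarrow> v x \<le> v unif"
proof -
  assume "v x < 1"
  then have "x \<in> (\<lambda>x. unif * x) ` integers_of v UNIV"
    using uniformizer_E by (auto simp: uniformizer_def max_ideal_of_def)
  then obtain y where "x = unif * y" "v y \<le> 1" by (auto simp: integers_of_def)
  then show ?thesis by (simp add: v_mult mult_left_le)
qed

lemma q_powi_inject: "real q powi k = real q powi l \<longleftrightarrow> k = l"
  using real_q_gt_1 power_int_strict_increasing[of k l "real q"] power_int_strict_increasing[of l k "real q"]
  by (metis less_irrefl linorder_neqE)

text \<open>Multiplying \<open>x\<close> by a power of \<open>unif\<close> brings its absolute value
  into the interval (1/q, 1], where \<open>v_lt_1_unif\<close> leaves only the value 1. The exponent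
  is the ceiling of the base-q logarithm.\<close>

lemma v_powr_unit:
  assumes "x \<noteq> 0"
  obtains k :: int where "v x = real q powi k"
proof -
  define k where "k = \<lceil>log q (v x)\<rceil>"
  have q1: "1 < real q" by (rule real_q_gt_1)
  have vx: "v x = q powr (log q (v x))" using assms q1 by simp
  define c where "c = (if k \<ge> 0 then unif ^ nat k else inverse (unif ^ nat (- k)))"
  have c: "v c = q powr (- k)"
  proof (cases "k \<ge> 0")
    case True
    then have "real_of_int k = real (nat k)" by simp
    then show ?thesis using q1 True
      by (simp only: c_def if_True v_power v_unif powr_minus) (simp add: powr_minus powr_realpow power_one_over divide_inverse power_inverse flip: powr_realpow)
  next
    case False
    then have "real q powr (- real_of_int k) = real q ^ nat (- k)"
      using q1 by (simp flip: powr_realpow)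
    then show ?thesis using q1 False
      by (simp only: c_def if_False v_power v_inverse v_unif) (simp add: power_one_over)
  qed
  have "v (x * c) = q powr (log q (v x) - k)"
    using vx c q1 by (simp add: v_mult powr_diff powr_minus field_simps)
  moreover have "log q (v x) - k \<le> 0" "-1 < log q (v x) - k"
    unfolding k_def by linarith+
  moreover have "q powr -1 < q powr (log q (v x) - k)"
    using q1 \<open>-1 < log q (v x) - k\<close> by (intro powr_less_mono) auto
  ultimately have "v unif < v (x * c)" using q1 by (simp add: v_unif powr_minus divide_inverse)
  then have "1 \<le> v (x * c)" using v_lt_1_unif[of "x * c"] by linarith
  then have "log q (v x) - k \<ge> 0" using \<open>v (x * c) = _\<close> q1
    by (metis powr_less_one not_le)
  then have "log q (v x) = k" using \<open>log q (v x) - k \<le> 0\<close> by linarith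
  then have "v x = q powr (real_of_int k)" using vx by simp
  also have "\<dots> = real q powi k" using q1 by (subst powr_real_of_int') auto
  finally have "v x = real q powi k" .
  then show ?thesis by (rule that)
qed

lemma v_step: "v x < v y \<Longrightarrow> v x \<le> v y / q"
proof (cases "y = 0")
  case False
  assume "v x < v y"
  then have "v (x / y) < 1" using False by (simp add: v_divide)
  from v_lt_1_unif[OF this] False show ?thesis
    by (simp add: v_divide v_unif divide_simps mult.commute split: if_splits)
qed auto

lemma v_of_nat_le: "v (of_nat n) \<le> 1"
  by (induction n) (auto intro: v_add_le)

text \<open>With \<open>p = 2 * k + 1\<close> and \<open>v p < 1\<close>, a value
  \<open>v 2 < 1\<close> would force \<open>v 1 < 1\<close>. Here oddness of p enters: since 2 is a
  unit, an element can be recovered from \<open>x + cj x\<close> and \<open>x - cj x\<close> without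
  loss.\<close>

lemma v_2 [simp]: "v 2 = 1"
proof (rule ccontr)
  assume "v 2 \<noteq> 1"
  then have *: "v 2 < 1" using v_of_nat_le[of 2] by simp
  obtain k where k: "p = 2 * k + 1" using odd_p by (elim oddE)
  have "v (of_nat p) < 1" using E_padic by (auto simp: padic_field_def)
  moreover have "v (2 * of_nat k) < 1"
    using * v_of_nat_le[of k] by (simp add: v_mult) (metis mult_left_le v_nonneg le_less_trans)
  ultimately have "v (of_nat p - 2 * of_nat k) < 1" by (rule v_diff_less)
  moreover have "of_nat p - 2 * of_nat k = (1 :: 'e)" by (simp add: k)
  ultimately show False by simp
qed

section \<open>The subfield F, the Galois involution and the effect of ramification\<close>

lemma subfield_F: "subfield F (ring_of_type_algebra :: 'e ring)"
  using F_padic by (auto simp: padic_field_def)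

lemma subring_F: "subring F (ring_of_type_algebra :: 'e ring)"
  by (rule subfieldE(1)[OF subfield_F])

lemma a_inv_type: "\<ominus>\<^bsub>(ring_of_type_algebra :: 'a::field ring)\<^esub> x = - x"
proof -
  interpret R: ring "ring_of_type_algebra :: 'a ring" by (rule ring_from_type_algebra)
  show ?thesis
    by (rule R.minus_equality) (auto simp: ring_of_type_algebra_def)
qed

lemma F_0 [simp]: "0 \<in> F" and F_1 [simp]: "1 \<in> F"
  and F_minus [simp]: "x \<in> F \<Longrightarrow> - x \<in> F"
  and F_add [simp]: "x \<in> F \<Longrightarrow> y \<in> F \<Longrightarrow> x + y \<in> F"
  and F_mult [simp]: "x \<in> F \<Longrightarrow> y \<in> F \<Longrightarrow> x * y \<in> F"
  using subringE[OF subring_F] by (auto simp: a_inv_type) (auto simp: ring_of_type_algebra_def)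

lemma F_diff [simp]: "x \<in> F \<Longrightarrow> y \<in> F \<Longrightarrow> x - y \<in> F"
  using F_add[of x "- y"] by simp

lemma F_sum: "(\<And>i. i \<in> I \<Longrightarrow> f i \<in> F) \<Longrightarrow> sum f I \<in> F"
  by (induction I rule: infinite_finite_induct) auto

lemma F_inverse [simp]: "x \<in> F \<Longrightarrow> inverse x \<in> F"
proof (cases "x = 0")
  case False
  assume x: "x \<in> F"
  interpret R: field "ring_of_type_algebra :: 'e ring" by (rule field_from_type_algebra)
  have *: "carrier (ring_of_type_algebra :: 'e ring) - {\<zero>\<^bsub>ring_of_type_algebra\<^esub>} = UNIV - {0}"
    by (auto simp: ring_of_type_algebra_def)
  have "x \<in> F - {\<zero>\<^bsub>ring_of_type_algebra\<^esub>}" using x False by (auto simp: ring_of_type_algebra_def)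
  from R.subfield_m_inv(1,2)[OF subfield_F this] obtain y where "y \<in> F" "x * y = 1"
    by (auto simp: ring_of_type_algebra_def)
  then show ?thesis by (metis inverse_unique)
qed auto

lemma F_divide [simp]: "x \<in> F \<Longrightarrow> y \<in> F \<Longrightarrow> x / y \<in> F"
  by (simp add: divide_inverse)

lemma cj_add [simp]: "cj (x + y) = cj x + cj y"
  and cj_mult [simp]: "cj (x * y) = cj x * cj y"
  and cj_1 [simp]: "cj 1 = 1"
  and bij_cj: "bij cj"
proof -
  have h: "cj \<in> Ring.ring_hom (ring_of_type_algebra :: 'e ring) (ring_of_type_algebra :: 'e ring)"
    and b: "bij_betw cj (carrier (ring_of_type_algebra :: 'e ring)) (carrier (ring_of_type_algebra :: 'e ring))"
    using cj_iso by (auto simp: ring_iso_def)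
  show "cj (x + y) = cj x + cj y" "cj (x * y) = cj x * cj y" "cj 1 = 1" "bij cj"
    using ring_hom_memE(2)[OF h, of x y] ring_hom_memE(3)[OF h, of x y] ring_hom_memE(4)[OF h] b
    by (simp_all add: ring_of_type_algebra_def)
qed

lemma cj_0 [simp]: "cj 0 = 0"
  using cj_add[of 0 0] by simp

lemma cj_minus [simp]: "cj (- x) = - cj x"
  using cj_add[of x "- x"] by (simp add: eq_neg_iff_add_eq_0 add.commute)

lemma cj_diff [simp]: "cj (x - y) = cj x - cj y"
  using cj_add[of x "- y"] by simp

lemma cj_eq_0 [simp]: "cj x = 0 \<longleftrightarrow> x = 0"
  using bij_cj cj_0 by (metis bij_pointE)

lemma cj_inverse [simp]: "cj (inverse x) = inverse (cj x)"
proof (cases "x = 0")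
  case False
  then have "cj x * cj (inverse x) = 1" by (simp flip: cj_mult)
  then show ?thesis by (metis inverse_unique)
qed simp

lemma cj_divide [simp]: "cj (x / y) = cj x / cj y"
  by (simp add: divide_inverse)

lemma cj_sum: "cj (sum f I) = (\<Sum>i\<in>I. cj (f i))"
  by (induction I rule: infinite_finite_induct) auto

text \<open>If \<open>unif\<close> were in \<open>F\<close>, it would be a uniformizer of both
  fields, which \<open>ramified\<close> excludes.\<close>

lemma unif_notin_F: "unif \<notin> F"
proof
  assume "unif \<in> F"
  have "max_ideal_of v F = (\<lambda>x. unif * x) ` integers_of v F"
  proof (intro Set.set_eqI iffI)
    fix x assume x: "x \<in> max_ideal_of v F"
    then have "x / unif \<in> integers_of v F"
      using v_lt_1_unif[of x] \<open>unif \<in> F\<close> by (auto simp: max_ideal_of_def integers_of_def v_divide)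
    then show "x \<in> (\<lambda>x. unif * x) ` integers_of v F"
      by (intro image_eqI[of _ _ "x / unif"]) auto
  next
    fix x assume "x \<in> (\<lambda>x. unif * x) ` integers_of v F"
    then obtain y where "x = unif * y" "y \<in> F" "v y \<le> 1" by (auto simp: integers_of_def)
    then have "v x \<le> v unif" by (simp add: v_mult mult_left_le)
    with \<open>x = unif * y\<close> \<open>y \<in> F\<close> show "x \<in> max_ideal_of v F"
      using \<open>unif \<in> F\<close> v_unif_less_1 by (auto simp: max_ideal_of_def)
  qed
  then have "uniformizer v F unif" using \<open>unif \<in> F\<close> by (auto simp: uniformizer_def)
  then show False using ramified uniformizer_E by blast
qed

text \<open>Since \<open>unif\<close> is not in \<open>F\<close>, the elements 1 and
  \<open>unif\<close> are independent over \<open>F\<close>, hence a basis of the two-dimensional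
  space E.\<close>

lemma E_decomp: obtains a b where "a \<in> F" "b \<in> F" "x = a + b * unif"
proof -
  interpret R: ring "ring_of_type_algebra :: 'e ring" by (rule ring_from_type_algebra)
  interpret R: field "ring_of_type_algebra :: 'e ring" by (rule field_from_type_algebra)
  have S1: "R.Span F [1] = F"
    by (auto simp: R.line_extension_mem_iff) (auto simp: ring_of_type_algebra_def)
  have "1 \<notin> R.Span F []" by simp (simp add: ring_of_type_algebra_def)
  then have i1: "R.independent F [1]"
    by (intro R.li_Cons[OF _ _ R.li_Nil]) (auto simp: ring_of_type_algebra_def)
  have i: "R.independent F [unif, 1]"
    by (rule R.li_Cons[OF _ _ i1]) (use S1 unif_notin_F in \<open>auto simp: ring_of_type_algebra_def\<close>)
  have "R.Span F [unif, 1] = UNIV"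
  proof (rule R.independent_length_eq_dimension[OF subfield_F quadratic i, THEN iffD1])
  qed (auto simp: ring_of_type_algebra_def)
  then have "x \<in> R.line_extension F unif (R.Span F [1])" by auto
  then obtain k w where "k \<in> F" "w \<in> F" "x = k * unif + w"
    unfolding S1 R.line_extension_mem_iff by (auto simp: ring_of_type_algebra_def)
  then show ?thesis using that[of w k] by (simp add: add.commute)
qed

text \<open>As \<open>unif ^ 2\<close> is fixed, \<open>unif\<close> goes to plus or minus itself;
  the plus sign would make \<open>cj\<close> trivial on all of F + F unif.\<close>

lemma cj_unif [simp]: "cj unif = - unif"
proof -
  have "cj unif ^ 2 = unif ^ 2"
    using cj_fixes[OF uniformizer_sq] by (simp add: power2_eq_square)
  then have "cj unif = unif \<or> cj unif = - unif" by (simp add: power2_eq_iff)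
  moreover have "cj unif \<noteq> unif"
  proof
    assume *: "cj unif = unif"
    have "cj x = x" for x
    proof -
      obtain a b where "a \<in> F" "b \<in> F" "x = a + b * unif" by (rule E_decomp)
      then show ?thesis using cj_fixes * by simp
    qed
    then show False using cj_nontrivial by auto
  qed
  ultimately show ?thesis by blast
qed

lemma cj_cj [simp]: "cj (cj x) = x"
proof -
  obtain a b where "a \<in> F" "b \<in> F" "x = a + b * unif" by (rule E_decomp)
  then show ?thesis using cj_fixes by simp
qed

lemma F_iff: "x \<in> F \<longleftrightarrow> cj x = x"
proof
  assume *: "cj x = x"
  obtain a b where ab: "a \<in> F" "b \<in> F" "x = a + b * unif" by (rule E_decomp)
  then have "2 * (b * unif) = 0" using * cj_fixes by (simp add: algebra_simps eq_neg_iff_add_eq_0)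
  then show "x \<in> F" using ab by simp
qed (rule cj_fixes)

text \<open>The value group of \<open>F\<close> has index 2 in that of \<open>E\<close>; this is where ramification enters.\<close>

lemma v_F: assumes "x \<in> F" "x \<noteq> 0" obtains k :: int where "v x = real q powi (2 * k)"
proof -
  have q1: "1 < real q" by (rule real_q_gt_1)
  obtain w where w: "uniformizer v F w" using F_padic by (auto simp: padic_field_def)
  have wF: "w \<in> F" "w \<noteq> 0" using w by (auto simp: uniformizer_def)
  have mi: "max_ideal_of v F = (\<lambda>x. w * x) ` integers_of v F" using w by (auto simp: uniformizer_def)
  have w1: "w * 1 \<in> max_ideal_of v F" unfolding mi by (rule imageI) (auto simp: integers_of_def)
  have vw: "v w < 1" using w1 by (auto simp: max_ideal_of_def)
  have small: "v y \<le> v w" if "y \<in> F" "v y < 1" for y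
  proof -
    have "y \<in> (\<lambda>x. w * x) ` integers_of v F" using that mi by (auto simp: max_ideal_of_def)
    then show ?thesis by (auto simp: integers_of_def v_mult mult_left_le)
  qed
  \<comment> \<open>An odd exponent leads to a contradiction: powers of \<open>unif ^ 2\<close>,
    which lie in \<open>F\<close>, move \<open>y\<close> to an element of \<open>F\<close> of
    absolute value \<open>v unif\<close>. The uniformizer \<open>w\<close> of \<open>F\<close> then
    has this absolute value too, so it is a uniformizer of E.\<close>
  have odd_k: "even k" if k: "y \<in> F" "y \<noteq> 0" "v y = real q powi k" for y k
  proof (rule ccontr)
    assume "odd k"
    then obtain l where l: "k = 2 * l + 1" by (elim oddE)
    define z where "z = (if l + 1 \<ge> 0 then y * (unif ^ 2) ^ nat (l + 1) else y / (unif ^ 2) ^ nat (- l - 1))"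
    have zF: "z \<in> F"
    proof -
      have "(unif ^ 2) ^ n \<in> F" for n using uniformizer_sq by (induction n) auto
      then show ?thesis using k by (auto simp: z_def)
    qed
    have vz: "v z = v unif"
    proof (cases "l + 1 \<ge> 0")
      case True
      define j where "j = nat (l + 1)"
      have j: "k = 2 * int j - 1" using l True by (simp add: j_def)
      have "v z = real q powi (2 * int j - 1) * (1 / q) ^ (2 * j)"
        using True k by (simp add: z_def v_mult v_power v_unif power_mult j flip: j_def)
      also have "\<dots> = 1 / q" using q1
        by (simp add: power_int_diff power_one_over flip: power_mult) (simp add: power_int_def nat_mult_distrib flip: power_mult)
      finally show ?thesis by (simp add: v_unif)
    next
      case False
      define j where "j = nat (- l - 1)"
      have j: "k = - 2 * int j - 1" using l False by (simp add: j_def)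
      have "v z = real q powi (- (2 * int j) - 1) / (1 / q) ^ (2 * j)"
        using False k by (simp add: z_def v_divide v_power v_unif power_mult j flip: j_def)
      also have "\<dots> = 1 / q" using q1
        by (simp add: power_int_diff power_int_minus power_one_over divide_simps flip: power_mult)
          (simp add: power_int_def nat_mult_distrib flip: power_mult)
      finally show ?thesis by (simp add: v_unif)
    qed
    have "v unif \<le> v w" using small[OF zF] vz v_unif_less_1 by simp
    moreover have "v w \<le> v unif" by (rule v_lt_1_unif[OF vw])
    ultimately have ww: "v w = v unif" by simp
    have "uniformizer v UNIV w"
      unfolding uniformizer_def
    proof (intro conjI Set.set_eqI iffI)
      fix x assume "x \<in> max_ideal_of v UNIV"
      then have "v x \<le> v w" using v_lt_1_unif ww by (auto simp: max_ideal_of_def)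
      then have "x / w \<in> integers_of v UNIV" using wF by (auto simp: integers_of_def v_divide)
      then show "x \<in> (\<lambda>x. w * x) ` integers_of v UNIV" using wF by (intro image_eqI[of _ _ "x / w"]) auto
    next
      fix x assume "x \<in> (\<lambda>x. w * x) ` integers_of v UNIV"
      then show "x \<in> max_ideal_of v UNIV" using vw
        by (auto simp: integers_of_def max_ideal_of_def v_mult) (metis mult_left_le v_nonneg le_less_trans)
    qed (use wF in auto)
    then show False using ramified[OF w] by simp
  qed
  obtain k where k: "v x = real q powi k" using v_powr_unit[OF assms(2)] .
  then obtain l where "k = 2 * l" using odd_k[OF assms k] by (elim evenE)
  then show ?thesis using k that by blast
qed

text \<open>By \<open>v_F\<close> the absolute values of nonzero \<open>a\<close> and
  \<open>b\<close> are even powers of q, so that of \<open>b * unif\<close> is an odd power. The two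
  summands never tie, and the larger one decides.\<close>

lemma v_decomp:
  assumes "a \<in> F" "b \<in> F"
  shows "v (a + b * unif) = max (v a) (v b / q)"
proof -
  have q1: "1 < real q" by (rule real_q_gt_1)
  have eq: "v (b * unif) = v b / q" by (simp add: v_mult v_unif)
  have "v a \<noteq> v (b * unif)" if nz: "a \<noteq> 0" "b \<noteq> 0"
  proof
    assume *: "v a = v (b * unif)"
    obtain k where k: "v a = real q powi (2 * k)" by (rule v_F[OF assms(1) nz(1)])
    obtain l where l: "v b = real q powi (2 * l)" by (rule v_F[OF assms(2) nz(2)])
    have "real q powi (2 * k) = real q powi (2 * l - 1)"
      using * k l q1 by (simp add: v_mult v_unif power_int_diff)
    then have "2 * k = 2 * l - 1" using q1 by (simp add: q_powi_inject)
    then show False by presburger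
  qed
  then consider "a = 0" | "b = 0" | "v a < v (b * unif)" | "v (b * unif) < v a" by fastforce
  then show ?thesis
  proof cases
    case 3 then show ?thesis using v_add_dominant[OF 3] eq by (simp add: add.commute)
  next
    case 4 then show ?thesis using v_add_dominant[OF 4] eq by simp
  qed (auto simp: eq max_absorb1 max_absorb2)
qed

lemma v_cj [simp]: "v (cj x) = v x"
proof -
  obtain a b where "a \<in> F" "b \<in> F" "x = a + b * unif" by (rule E_decomp)
  then show ?thesis using v_decomp[of a b] v_decomp[of a "- b"] cj_fixes by simp
qed

text \<open>A fixed element lies in \<open>F\<close> and its absolute value is an even power of q,
  so the bound 1/q improves to 1/q^2.\<close>

lemma cj_fixed_unif_le:
  assumes "cj x = x" "v x \<le> v unif" shows "v x \<le> v unif / q"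
proof (cases "x = 0")
  case False
  obtain k where k: "v x = real q powi (2 * k)" using v_F[OF _ False] assms F_iff by metis
  have q1: "1 < real q" by (rule real_q_gt_1)
  have "v x \<noteq> v unif"
  proof
    assume "v x = v unif"
    then have "real q powi (2 * k) = real q powi (- 1)" using k q1 by (simp add: v_unif power_int_minus divide_inverse)
    then have "2 * k = - 1" unfolding q_powi_inject .
    then show False by presburger
  qed
  then show ?thesis using assms(2) v_step[of x unif] by simp
qed simp

text \<open>Dividing by \<open>unif\<close> turns a negated element into one of \<open>F\<close>, so
  its own absolute value is an odd power of q and cannot be 1.\<close>

lemma cj_antifixed_le:
  assumes "cj x = - x" "v x \<le> 1" shows "v x \<le> v unif"
proof -
  have "cj (x / unif) = x / unif" using assms by simp
  then have *: "x / unif \<in> F" using F_iff by blast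
  show ?thesis
  proof (cases "x = 0")
    case False
    obtain k where k: "v (x / unif) = real q powi (2 * k)" using v_F[OF *] False by auto
    have q1: "1 < real q" by (rule real_q_gt_1)
    have "v x \<noteq> 1"
    proof
      assume "v x = 1"
      then have "real q powi (2 * k) = real q powi 1" using k q1 by (simp add: v_unif v_divide)
      then have "2 * k = 1" using q1 by (simp only: q_powi_inject)
      then show False by presburger
    qed
    then show ?thesis using assms(2) by (intro v_lt_1_unif) auto
  qed auto
qed

text \<open>The difference is negated by \<open>cj\<close>, so \<open>cj_antifixed_le\<close>
  applies: the involution acts trivially on the residue field.\<close>

lemma cj_residue: "v x \<le> 1 \<Longrightarrow> v (cj x - x) < 1"
proof -
  assume "v x \<le> 1"
  then have "v (cj x - x) \<le> v unif" by (intro cj_antifixed_le v_diff_le) auto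
  then show ?thesis using v_unif_less_1 by linarith
qed

text \<open>The F-component of \<open>x\<close> is the representative sought: the other component is
  half of \<open>x - cj x\<close>, which is small by \<open>cj_residue\<close>. Thus E and F have
  the same residue field.\<close>

lemma residue_F: assumes "v x \<le> 1" shows "\<exists>a\<in>F. v a \<le> 1 \<and> v (x - a) < 1"
proof -
  obtain a b where ab: "a \<in> F" "b \<in> F" "x = a + b * unif" by (rule E_decomp)
  have "2 * b * unif = x - cj x" using ab cj_fixes by (simp add: algebra_simps)
  then have "v (b * unif) < 1" using cj_residue[OF assms] v_minus_commute[of x "cj x"]
    by (metis mult.assoc mult_1 v_2 v_mult)
  moreover have "v a \<le> 1" using v_decomp[OF ab(1,2)] ab assms by simp
  ultimately show ?thesis using ab by auto
qed

section \<open>Representatives of the residue field\<close>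

definition residue_reps :: "'e set" where
  "residue_reps = (SOME T. T \<subseteq> F \<and> card T = q \<and> 0 \<in> T \<and> (\<forall>x\<in>T. v x \<le> 1) \<and>
     (\<forall>x. v x \<le> 1 \<longrightarrow> (\<exists>!t. t \<in> T \<and> v (x - t) < 1)))"

text \<open>By \<open>residue_F\<close> the classes of integers of E are those of integers of F, so
  the q representatives can be taken in \<open>F\<close>, where \<open>cj\<close> fixes them. The
  class of 0 is represented by 0 itself, so that vanishing modulo \<open>unif\<close> becomes an
  equation.\<close>

lemma residue_reps:
  "residue_reps \<subseteq> F" "card residue_reps = q" "0 \<in> residue_reps"
  "\<And>x. x \<in> residue_reps \<Longrightarrow> v x \<le> 1"
  "\<And>x. v x \<le> 1 \<Longrightarrow> \<exists>!t. t \<in> residue_reps \<and> v (x - t) < 1"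
proof -
  define I where "I = integers_of v F"
  define R where "R = {(x, y). x \<in> I \<and> y \<in> I \<and> x - y \<in> max_ideal_of v F}"
  have I: "x \<in> I \<longleftrightarrow> x \<in> F \<and> v x \<le> 1" for x by (simp add: I_def integers_of_def)
  have R: "(x, y) \<in> R \<longleftrightarrow> x \<in> I \<and> y \<in> I \<and> v (x - y) < 1" for x y
    by (auto simp: R_def I max_ideal_of_def)
  have eq: "equiv I R"
  proof (rule equivI)
    show "R \<subseteq> I \<times> I" using R by auto
    show "refl_on I R" by (auto simp: refl_on_def R)
    show "sym R" by (rule symI) (auto simp: R v_minus_commute)
    show "trans R"
    proof (rule transI)
      fix x y z assume "(x, y) \<in> R" "(y, z) \<in> R"
      then show "(x, z) \<in> R" using v_add_less[of "x - y" 1 "y - z"] by (auto simp: R)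
    qed
  qed
  define pick where "pick C = (if 0 \<in> C then 0 else SOME x. x \<in> C)" for C :: "'e set"
  define T where "T = pick ` (I // R)"
  have pick: "pick C \<in> C" if C: "C \<in> I // R" for C
  proof -
    obtain x where "x \<in> I" "C = R `` {x}" using C by (auto elim: quotientE)
    then have "x \<in> C" using equiv_class_self[OF eq] by blast
    then show ?thesis by (auto simp: pick_def intro: someI)
  qed
  have CI: "C \<subseteq> I" if "C \<in> I // R" for C using that eq by (meson in_quotient_imp_subset)
  have inj: "inj_on pick (I // R)"
  proof (rule inj_onI)
    fix C D assume C: "C \<in> I // R" and D: "D \<in> I // R" and e: "pick C = pick D"
    show "C = D" using quotient_disj[OF eq C D] pick[OF C] pick[OF D] e by auto
  qed
  have q: "q = card (I // R)" by (simp add: residue_card_def residue_classes_def I_def R_def)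
  have z: "0 \<in> I" by (simp add: I)
  have P: "T \<subseteq> F \<and> card T = q \<and> 0 \<in> T \<and> (\<forall>x\<in>T. v x \<le> 1) \<and>
     (\<forall>x. v x \<le> 1 \<longrightarrow> (\<exists>!t. t \<in> T \<and> v (x - t) < 1))"
  proof (intro conjI allI impI ballI)
    show "T \<subseteq> F" using pick CI I by (force simp: T_def)
    show "card T = q" unfolding T_def q by (rule card_image[OF inj])
    have c0: "R `` {0} \<in> I // R" by (rule quotientI[OF z])
    have "pick (R `` {0}) = 0" using equiv_class_self[OF eq z] by (simp add: pick_def)
    then show "0 \<in> T" unfolding T_def using c0 by force
    show "v x \<le> 1" if "x \<in> T" for x using that pick CI I by (force simp: T_def)
    fix x assume "v x \<le> 1"
    then obtain a where a: "a \<in> I" "v (x - a) < 1" using residue_F I by metis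
    define t where "t = pick (R `` {a})"
    have c: "R `` {a} \<in> I // R" by (rule quotientI[OF a(1)])
    have "(a, t) \<in> R" using pick[OF c] by (simp add: t_def)
    then have "v (a - t) < 1" using R by blast
    then have t: "t \<in> T" "v (x - t) < 1"
      using v_add_less[of "x - a" 1 "a - t"] a c by (auto simp: T_def t_def)
    show "\<exists>!t. t \<in> T \<and> v (x - t) < 1"
    proof (rule ex1I[of _ t])
      fix t' assume t': "t' \<in> T \<and> v (x - t') < 1"
      obtain C where C: "C \<in> I // R" "t = pick C" using t by (auto simp: T_def)
      obtain D where D: "D \<in> I // R" "t' = pick D" using t' by (auto simp: T_def)
      have "v (t' - t) < 1" using v_diff_less[of "x - t" 1 "x - t'"] t t' by simp
      then have "(t', t) \<in> R" using R pick[OF C(1)] pick[OF D(1)] CI[OF C(1)] CI[OF D(1)] C D by blast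
      then have "D = C" using quotient_eqI[OF eq D(1) C(1)] pick[OF C(1)] pick[OF D(1)] C D by blast
      then show "t' = t" using C D by simp
    qed (use t in simp)
  qed
  have Q: "residue_reps \<subseteq> F \<and> card residue_reps = q \<and> 0 \<in> residue_reps \<and> (\<forall>x\<in>residue_reps. v x \<le> 1) \<and>
     (\<forall>x. v x \<le> 1 \<longrightarrow> (\<exists>!t. t \<in> residue_reps \<and> v (x - t) < 1))"
    unfolding residue_reps_def by (rule someI[where P = "\<lambda>T. T \<subseteq> F \<and> card T = q \<and> 0 \<in> T \<and> (\<forall>x\<in>T. v x \<le> 1) \<and>
     (\<forall>x. v x \<le> 1 \<longrightarrow> (\<exists>!t. t \<in> T \<and> v (x - t) < 1))", OF P])
  show "residue_reps \<subseteq> F" "card residue_reps = q" "0 \<in> residue_reps"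
  "\<And>x. x \<in> residue_reps \<Longrightarrow> v x \<le> 1"
  "\<And>x. v x \<le> 1 \<Longrightarrow> \<exists>!t. t \<in> residue_reps \<and> v (x - t) < 1" using Q by blast+
qed

lemma finite_residue_reps: "finite residue_reps"
  using residue_reps(2) q_gt_1 by (metis card.infinite not_one_less_zero)

definition res :: "'e \<Rightarrow> 'e" where
  "res x = (THE t. t \<in> residue_reps \<and> v (x - t) < 1)"

lemma res: assumes "v x \<le> 1" shows "res x \<in> residue_reps" "v (x - res x) < 1"
  using theI'[OF residue_reps(5)[OF assms]] by (auto simp: res_def)

lemma res_eq: "v x \<le> 1 \<Longrightarrow> t \<in> residue_reps \<Longrightarrow> v (x - t) < 1 \<Longrightarrow> res x = t"
  using residue_reps(5) res by blast

lemma res_eq_iff: assumes "v x \<le> 1" "v y \<le> 1" shows "res x = res y \<longleftrightarrow> v (x - y) < 1"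
proof
  assume "res x = res y"
  then show "v (x - y) < 1" using res(2)[OF assms(1)] res(2)[OF assms(2)]
      v_diff_less[of "x - res x" 1 "y - res y"] by simp
next
  assume "v (x - y) < 1"
  then have "v (x - res y) < 1" using res(2)[OF assms(2)] v_add_less[of "x - y" 1 "y - res y"] by simp
  then show "res x = res y" using res_eq assms res by blast
qed

lemma res_reps: "t \<in> residue_reps \<Longrightarrow> res t = t"
  using res_eq residue_reps(4) by simp

lemma res_eq_0_iff: "v x \<le> 1 \<Longrightarrow> res x = 0 \<longleftrightarrow> v x < 1"
  using res_eq_iff[of x 0] res_reps[OF residue_reps(3)] by simp

lemma rep_lt_1: "t \<in> residue_reps \<Longrightarrow> v t < 1 \<Longrightarrow> t = 0"
  using res_eq_0_iff[of t] res_reps by simp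

lemma v_rep: "t \<in> residue_reps \<Longrightarrow> t \<noteq> 0 \<Longrightarrow> v t = 1"
  using rep_lt_1 residue_reps(4) by (meson linorder_not_le order_antisym)

end

section \<open>Constituents of a representation with a line of fixed vectors\<close>

lemma UN_eq_const: "(\<And>y. y \<in> S \<Longrightarrow> f y = z) \<Longrightarrow> x \<in> S \<Longrightarrow> (\<Union>y\<in>S. f y) = z"
  by blast

locale group_rep = Group.group G + module complex_ring V
  for G :: "('g, 'b) monoid_scheme" (structure) and V :: "('v, 'g) rep" +
  assumes act_closed [simp]: "g \<in> carrier G \<Longrightarrow> x \<in> carrier V \<Longrightarrow> act V g x \<in> carrier V"
    and act_add: "g \<in> carrier G \<Longrightarrow> x \<in> carrier V \<Longrightarrow> y \<in> carrier V \<Longrightarrow>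
      act V g (x \<oplus>\<^bsub>V\<^esub> y) = act V g x \<oplus>\<^bsub>V\<^esub> act V g y"
    and act_smult: "g \<in> carrier G \<Longrightarrow> x \<in> carrier V \<Longrightarrow> act V g (c \<odot>\<^bsub>V\<^esub> x) = c \<odot>\<^bsub>V\<^esub> act V g x"
    and act_one: "x \<in> carrier V \<Longrightarrow> act V \<one> x = x"
    and act_mult: "g \<in> carrier G \<Longrightarrow> h \<in> carrier G \<Longrightarrow> x \<in> carrier V \<Longrightarrow>
      act V (g \<otimes> h) x = act V g (act V h x)"
begin

lemma in_complex_ring [simp]: "c \<in> carrier complex_ring"
  by (simp add: ring_of_type_algebra_def)

lemma smult_minus_one: "x \<in> carrier V \<Longrightarrow> (-1) \<odot>\<^bsub>V\<^esub> x = \<ominus>\<^bsub>V\<^esub> x"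
proof -
  assume x: "x \<in> carrier V"
  have one: "1 \<odot>\<^bsub>V\<^esub> x = x" using smult_one[OF x] by (simp add: ring_of_type_algebra_def)
  have "((-1) \<oplus>\<^bsub>complex_ring\<^esub> 1) \<odot>\<^bsub>V\<^esub> x = (-1) \<odot>\<^bsub>V\<^esub> x \<oplus>\<^bsub>V\<^esub> 1 \<odot>\<^bsub>V\<^esub> x"
    by (rule smult_l_distr) (auto simp: x)
  moreover have "((-1) \<oplus>\<^bsub>complex_ring\<^esub> 1) \<odot>\<^bsub>V\<^esub> x = \<zero>\<^bsub>V\<^esub>"
    using smult_l_null[OF x] by (simp add: ring_of_type_algebra_def)
  ultimately show ?thesis using one x by (metis M.minus_equality in_complex_ring smult_closed)
qed

lemma act_zero: "g \<in> carrier G \<Longrightarrow> act V g \<zero>\<^bsub>V\<^esub> = \<zero>\<^bsub>V\<^esub>"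
  using act_add[of g "\<zero>\<^bsub>V\<^esub>" "\<zero>\<^bsub>V\<^esub>"] by (metis M.add.l_cancel_one act_closed M.zero_closed M.l_zero)

lemma act_minus: "g \<in> carrier G \<Longrightarrow> x \<in> carrier V \<Longrightarrow> act V g (\<ominus>\<^bsub>V\<^esub> x) = \<ominus>\<^bsub>V\<^esub> act V g x"
  by (metis act_closed act_smult smult_minus_one)

lemma act_diff: "g \<in> carrier G \<Longrightarrow> x \<in> carrier V \<Longrightarrow> y \<in> carrier V \<Longrightarrow>
    act V g (x \<ominus>\<^bsub>V\<^esub> y) = act V g x \<ominus>\<^bsub>V\<^esub> act V g y"
  by (simp add: a_minus_def act_add act_minus)

lemma smult_diff: "x \<in> carrier V \<Longrightarrow> y \<in> carrier V \<Longrightarrow>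
    c \<odot>\<^bsub>V\<^esub> (x \<ominus>\<^bsub>V\<^esub> y) = c \<odot>\<^bsub>V\<^esub> x \<ominus>\<^bsub>V\<^esub> c \<odot>\<^bsub>V\<^esub> y"
  by (simp add: a_minus_def smult_r_distr smult_r_minus)

lemma subrepI:
  assumes "A \<subseteq> carrier V" "\<zero>\<^bsub>V\<^esub> \<in> A" "\<And>x y. x \<in> A \<Longrightarrow> y \<in> A \<Longrightarrow> x \<oplus>\<^bsub>V\<^esub> y \<in> A"
    "\<And>c x. x \<in> A \<Longrightarrow> c \<odot>\<^bsub>V\<^esub> x \<in> A" "\<And>g x. g \<in> carrier G \<Longrightarrow> x \<in> A \<Longrightarrow> act V g x \<in> A"
  shows "subrep G V A"
  unfolding subrep_def
proof (intro conjI submoduleI ballI)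
  show "\<ominus>\<^bsub>V\<^esub> x \<in> A" if "x \<in> A" for x
    using assms(4)[OF that, of "-1"] smult_minus_one that assms(1) by auto
qed (use assms in auto)

lemma subrepD:
  assumes "subrep G V A"
  shows "A \<subseteq> carrier V" "x \<in> A \<Longrightarrow> x \<in> carrier V" "\<zero>\<^bsub>V\<^esub> \<in> A"
    "x \<in> A \<Longrightarrow> y \<in> A \<Longrightarrow> x \<oplus>\<^bsub>V\<^esub> y \<in> A"
    "x \<in> A \<Longrightarrow> y \<in> A \<Longrightarrow> x \<ominus>\<^bsub>V\<^esub> y \<in> A"
    "x \<in> A \<Longrightarrow> \<ominus>\<^bsub>V\<^esub> x \<in> A"
    "x \<in> A \<Longrightarrow> c \<odot>\<^bsub>V\<^esub> x \<in> A" "g \<in> carrier G \<Longrightarrow> x \<in> A \<Longrightarrow> act V g x \<in> A"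
proof -
  have s: "submodule A complex_ring V" using assms by (simp add: subrep_def)
  show 1: "A \<subseteq> carrier V" by (rule submoduleE(1)[OF s])
  show "x \<in> A \<Longrightarrow> x \<in> carrier V" using 1 by auto
  show "x \<in> A \<Longrightarrow> y \<in> A \<Longrightarrow> x \<oplus>\<^bsub>V\<^esub> y \<in> A" by (rule submoduleE(5)[OF s])
  show "x \<in> A \<Longrightarrow> \<ominus>\<^bsub>V\<^esub> x \<in> A" by (rule submoduleE(3)[OF s])
  show "x \<in> A \<Longrightarrow> y \<in> A \<Longrightarrow> x \<ominus>\<^bsub>V\<^esub> y \<in> A"
    unfolding a_minus_def by (intro submoduleE(5)[OF s] submoduleE(3)[OF s])
  show "x \<in> A \<Longrightarrow> c \<odot>\<^bsub>V\<^esub> x \<in> A" by (rule submoduleE(4)[OF s]) auto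
  show "g \<in> carrier G \<Longrightarrow> x \<in> A \<Longrightarrow> act V g x \<in> A" using assms by (auto simp: subrep_def)
  show "\<zero>\<^bsub>V\<^esub> \<in> A" using submodule.axioms(1)[OF s] subgroup.one_closed by fastforce
qed

lemma group_rep_subrep:
  assumes "subrep G V A" shows "group_rep G (V\<lparr>carrier := A\<rparr>)"
proof -
  have s: "submodule A complex_ring V" using assms by (simp add: subrep_def)
  have m: "module complex_ring (V\<lparr>carrier := A\<rparr>)"
    by (rule submodule.submodule_is_module[OF s]) (rule module_axioms)
  show ?thesis
    unfolding group_rep_def group_rep_axioms_def
    using m is_group subrepD[OF assms] act_add act_smult act_one act_mult by auto
qed

lemma subrep_of_subrep:
  assumes "subrep G V A"
  shows "subrep G (V\<lparr>carrier := A\<rparr>) C \<longleftrightarrow> subrep G V C \<and> C \<subseteq> A"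
proof
  assume C: "subrep G (V\<lparr>carrier := A\<rparr>) C"
  interpret M: group_rep G "V\<lparr>carrier := A\<rparr>" by (rule group_rep_subrep[OF assms])
  show "subrep G V C \<and> C \<subseteq> A"
    using M.subrepD[OF C] subrepD[OF assms] by (auto intro!: subrepI)
next
  assume C: "subrep G V C \<and> C \<subseteq> A"
  interpret M: group_rep G "V\<lparr>carrier := A\<rparr>" by (rule group_rep_subrep[OF assms])
  show "subrep G (V\<lparr>carrier := A\<rparr>) C"
    using C subrepD[of C] by (intro M.subrepI) auto
qed

section \<open>Cosets and quotient representations\<close>

abbreviation cs :: "'v set \<Rightarrow> 'v \<Rightarrow> 'v set" where "cs B x \<equiv> B +>\<^bsub>V\<^esub> x"

context
  fixes B assumes B: "subrep G V B"
begin

lemma abelian_subgroup_subrep: "abelian_subgroup B V"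
proof (rule abelian_subgroupI3)
  show "additive_subgroup B V"
    using B by (auto simp: subrep_def additive_subgroup_def submodule_def)
qed (rule M.abelian_group_axioms)


lemma cs_mem: "x \<in> carrier V \<Longrightarrow> y \<in> cs B x \<longleftrightarrow> y \<in> carrier V \<and> y \<ominus>\<^bsub>V\<^esub> x \<in> B"
  using abelian_subgroup.a_rcos_module[OF abelian_subgroup_subrep, of x y]
    abelian_subgroup.a_elemrcos_carrier[OF abelian_subgroup_subrep, of x y]
  by (auto simp: a_minus_def)

lemma cs_self: "x \<in> carrier V \<Longrightarrow> x \<in> cs B x"
  by (rule abelian_subgroup.a_rcos_self[OF abelian_subgroup_subrep])

lemma cs_eq: "x \<in> carrier V \<Longrightarrow> y \<in> carrier V \<Longrightarrow> cs B x = cs B y \<longleftrightarrow> x \<ominus>\<^bsub>V\<^esub> y \<in> B"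
  using abelian_subgroup.a_repr_independence'[OF abelian_subgroup_subrep, of x y] cs_self cs_mem
  by metis

lemma cs_zero: "cs B \<zero>\<^bsub>V\<^esub> = B"
  by (rule abelian_subgroup.a_rcos_const[OF abelian_subgroup_subrep subrepD(3)[OF B]])

lemma cs_eq_B: "x \<in> carrier V \<Longrightarrow> cs B x = B \<longleftrightarrow> x \<in> B"
  using cs_eq[of x "\<zero>\<^bsub>V\<^esub>"] cs_zero M.minus_equality[of "\<zero>\<^bsub>V\<^esub>" "\<zero>\<^bsub>V\<^esub>"]
  by (simp add: a_minus_def)

abbreviation (input) Q where "Q \<equiv> quotient_rep V B"

lemma carrier_Q: "carrier Q = cs B ` carrier V"
  by (auto simp: quotient_rep_def A_RCOSETS_def' a_r_coset_def')

lemma zero_Q: "\<zero>\<^bsub>Q\<^esub> = B"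
  by (simp add: quotient_rep_def)

lemma add_Q: "x \<in> carrier V \<Longrightarrow> y \<in> carrier V \<Longrightarrow> cs B x \<oplus>\<^bsub>Q\<^esub> cs B y = cs B (x \<oplus>\<^bsub>V\<^esub> y)"
  by (simp add: quotient_rep_def abelian_subgroup.a_rcos_sum[OF abelian_subgroup_subrep])

lemma smult_Q: assumes "x \<in> carrier V" shows "c \<odot>\<^bsub>Q\<^esub> cs B x = cs B (c \<odot>\<^bsub>V\<^esub> x)"
proof -
  have "cs B (c \<odot>\<^bsub>V\<^esub> y) = cs B (c \<odot>\<^bsub>V\<^esub> x)" if "y \<in> cs B x" for y
    using that assms subrepD(7)[OF B, of "y \<ominus>\<^bsub>V\<^esub> x" c] by (simp add: cs_eq cs_mem smult_diff)
  then show ?thesis unfolding quotient_rep_def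
    by (simp only: rep.simps module.simps) (rule UN_eq_const[OF _ cs_self[OF assms]])
qed

lemma act_Q: assumes "g \<in> carrier G" "x \<in> carrier V" shows "act Q g (cs B x) = cs B (act V g x)"
proof -
  have "cs B (act V g y) = cs B (act V g x)" if "y \<in> cs B x" for y
    using that assms subrepD(8)[OF B, of g "y \<ominus>\<^bsub>V\<^esub> x"] by (simp add: cs_eq cs_mem act_diff)
  then show ?thesis unfolding quotient_rep_def
    by (simp only: rep.simps) (rule UN_eq_const[OF _ cs_self[OF assms(2)]])
qed

lemma comm_group_Q: "comm_group (add_monoid Q)"
proof (rule comm_groupI)
  fix S S' S'' assume "S \<in> carrier (add_monoid Q)" "S' \<in> carrier (add_monoid Q)" "S'' \<in> carrier (add_monoid Q)"
  then obtain x y z where [simp]: "x \<in> carrier V" "S = cs B x" "y \<in> carrier V" "S' = cs B y"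
    "z \<in> carrier V" "S'' = cs B z" using carrier_Q by auto
  show "S \<otimes>\<^bsub>add_monoid Q\<^esub> S' \<in> carrier (add_monoid Q)" by (simp add: add_Q carrier_Q)
  show "S \<otimes>\<^bsub>add_monoid Q\<^esub> S' \<otimes>\<^bsub>add_monoid Q\<^esub> S'' = S \<otimes>\<^bsub>add_monoid Q\<^esub> (S' \<otimes>\<^bsub>add_monoid Q\<^esub> S'')"
    by (simp add: add_Q M.a_assoc)
  show "S \<otimes>\<^bsub>add_monoid Q\<^esub> S' = S' \<otimes>\<^bsub>add_monoid Q\<^esub> S" by (simp add: add_Q M.a_comm)
next
  show "\<one>\<^bsub>add_monoid Q\<^esub> \<in> carrier (add_monoid Q)"
    by (simp add: carrier_Q zero_Q) (metis M.zero_closed cs_zero imageI)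
next
  fix S assume "S \<in> carrier (add_monoid Q)"
  then obtain x where x: "x \<in> carrier V" "S = cs B x" using carrier_Q by auto
  show "\<one>\<^bsub>add_monoid Q\<^esub> \<otimes>\<^bsub>add_monoid Q\<^esub> S = S"
    using add_Q[of "\<zero>\<^bsub>V\<^esub>" x] x cs_zero zero_Q by simp
  show "\<exists>S'\<in>carrier (add_monoid Q). S' \<otimes>\<^bsub>add_monoid Q\<^esub> S = \<one>\<^bsub>add_monoid Q\<^esub>"
    using add_Q[of "\<ominus>\<^bsub>V\<^esub> x" x] x cs_zero zero_Q carrier_Q
    by (intro bexI[of _ "cs B (\<ominus>\<^bsub>V\<^esub> x)"]) (auto simp: M.l_neg)
qed

lemma inv_Q: assumes "x \<in> carrier V" shows "inv\<^bsub>add_monoid Q\<^esub> cs B x = cs B (\<ominus>\<^bsub>V\<^esub> x)"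
proof -
  interpret Q: comm_group "add_monoid Q" by (rule comm_group_Q)
  have "cs B (\<ominus>\<^bsub>V\<^esub> x) \<otimes>\<^bsub>add_monoid Q\<^esub> cs B x = \<one>\<^bsub>add_monoid Q\<^esub>"
    using add_Q[of "\<ominus>\<^bsub>V\<^esub> x" x] assms cs_zero zero_Q by (simp add: M.l_neg)
  then show ?thesis using assms carrier_Q by (intro Q.inv_equality) auto
qed

lemma subrep_Q_image:
  assumes C: "subrep G V C" shows "subrep G Q (cs B ` C)"
  unfolding subrep_def submodule_def submodule_axioms_def
proof (intro conjI allI impI ballI subgroup.intro)
  note [simp] = subrepD(2)[OF C]
  show "cs B ` C \<subseteq> carrier (add_monoid Q)" using carrier_Q by auto
  show "Z \<otimes>\<^bsub>add_monoid Q\<^esub> Y \<in> cs B ` C" if Z: "Z \<in> cs B ` C" and Y: "Y \<in> cs B ` C" for Z Y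
  proof -
    obtain x y where xy: "x \<in> C" "Z = cs B x" "y \<in> C" "Y = cs B y" using Z Y by auto
    then have "Z \<otimes>\<^bsub>add_monoid Q\<^esub> Y = cs B (x \<oplus>\<^bsub>V\<^esub> y)" by (simp add: add_Q)
    then show ?thesis using subrepD(4)[OF C] xy by auto
  qed
  show "\<one>\<^bsub>add_monoid Q\<^esub> \<in> cs B ` C"
    using zero_Q cs_zero subrepD(3)[OF C] by force
  show "inv\<^bsub>add_monoid Q\<^esub> Z \<in> cs B ` C" if Z: "Z \<in> cs B ` C" for Z
  proof -
    obtain x where x: "x \<in> C" "Z = cs B x" using Z by auto
    then show ?thesis using inv_Q[of x] subrepD(6)[OF C] by auto
  qed
  show "c \<odot>\<^bsub>Q\<^esub> Z \<in> cs B ` C" if Z: "Z \<in> cs B ` C" for c Z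
  proof -
    obtain x where x: "x \<in> C" "Z = cs B x" using Z by auto
    then show ?thesis using smult_Q[of x] subrepD(7)[OF C] by auto
  qed
  show "act Q g Z \<in> cs B ` C" if g: "g \<in> carrier G" and Z: "Z \<in> cs B ` C" for g Z
  proof -
    obtain x where x: "x \<in> C" "Z = cs B x" using Z by auto
    then show ?thesis using act_Q[OF g, of x] subrepD(8)[OF C g] by auto
  qed
qed

lemma subrep_Q_preimage:
  assumes Z: "subrep G Q Z" shows "subrep G V {x \<in> carrier V. cs B x \<in> Z}"
proof -
  have Z': "submodule Z complex_ring Q" and
    aX: "\<And>g S. g \<in> carrier G \<Longrightarrow> S \<in> Z \<Longrightarrow> act Q g S \<in> Z" using Z by (auto simp: subrep_def)
  interpret Z: subgroup Z "add_monoid Q" using Z' by (simp add: submodule_def)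
  have sX: "c \<odot>\<^bsub>Q\<^esub> S \<in> Z" if "S \<in> Z" for c S
    using Z' that by (simp add: submodule_def submodule_axioms_def)
  show ?thesis
  proof (rule subrepI)
    show "\<zero>\<^bsub>V\<^esub> \<in> {x \<in> carrier V. cs B x \<in> Z}"
      using Z.one_closed zero_Q cs_zero by simp
    show "x \<oplus>\<^bsub>V\<^esub> y \<in> {x \<in> carrier V. cs B x \<in> Z}"
      if "x \<in> {x \<in> carrier V. cs B x \<in> Z}" "y \<in> {x \<in> carrier V. cs B x \<in> Z}" for x y
      using that Z.m_closed[of "cs B x" "cs B y"] add_Q by auto
    show "c \<odot>\<^bsub>V\<^esub> x \<in> {x \<in> carrier V. cs B x \<in> Z}" if "x \<in> {x \<in> carrier V. cs B x \<in> Z}" for c x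
      using that sX[of "cs B x" c] smult_Q by auto
    show "act V g x \<in> {x \<in> carrier V. cs B x \<in> Z}"
      if "g \<in> carrier G" "x \<in> {x \<in> carrier V. cs B x \<in> Z}" for g x
      using that aX[of g "cs B x"] act_Q by auto
  qed auto
qed

text \<open>Image and preimage under the coset map relate subrepresentations of the quotient to the
  subrepresentations of \<open>V\<close> that contain \<open>B\<close>.\<close>

lemma irreducible_quotient_iff:
  "irreducible_rep G Q \<longleftrightarrow>
    B \<noteq> carrier V \<and> (\<forall>C. subrep G V C \<longrightarrow> B \<subseteq> C \<longrightarrow> C = B \<or> C = carrier V)"
proof
  assume irr: "irreducible_rep G Q"
  show "B \<noteq> carrier V \<and> (\<forall>C. subrep G V C \<longrightarrow> B \<subseteq> C \<longrightarrow> C = B \<or> C = carrier V)"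
  proof (intro conjI allI impI)
    show "B \<noteq> carrier V"
    proof
      assume "B = carrier V"
      then have "cs B x = B" if "x \<in> carrier V" for x using that cs_eq_B by simp
      then have "carrier Q = {\<zero>\<^bsub>Q\<^esub>}" using carrier_Q zero_Q by auto
      then show False using irr by (simp add: irreducible_rep_def)
    qed
    fix C assume C: "subrep G V C" and BC: "B \<subseteq> C"
    consider "cs B ` C = {\<zero>\<^bsub>Q\<^esub>}" | "cs B ` C = carrier Q"
      using irr subrep_Q_image[OF C] by (auto simp: irreducible_rep_def)
    then show "C = B \<or> C = carrier V"
    proof cases
      case 1
      then have "C \<subseteq> B" using zero_Q cs_eq_B subrepD(2)[OF C] by (metis imageI singletonD subsetI)
      then show ?thesis using BC by auto
    next
      case 2
      have "x \<in> C" if x: "x \<in> carrier V" for x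
      proof -
        obtain c where c: "c \<in> C" "cs B x = cs B c" using 2 x carrier_Q by blast
        then have "x \<ominus>\<^bsub>V\<^esub> c \<in> C" using cs_eq x subrepD(2)[OF C] BC by auto
        then have "(x \<ominus>\<^bsub>V\<^esub> c) \<oplus>\<^bsub>V\<^esub> c \<in> C" using subrepD(4)[OF C] c by auto
        then show ?thesis using x subrepD(2)[OF C] c by (simp add: a_minus_def M.a_assoc M.l_neg)
      qed
      then show ?thesis using subrepD(1)[OF C] by auto
    qed
  qed
next
  assume *: "B \<noteq> carrier V \<and> (\<forall>C. subrep G V C \<longrightarrow> B \<subseteq> C \<longrightarrow> C = B \<or> C = carrier V)"
  show "irreducible_rep G Q"
    unfolding irreducible_rep_def
  proof (intro conjI allI impI)
    obtain x where x: "x \<in> carrier V" "x \<notin> B" using * subrepD(1)[OF B] by auto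
    then have "cs B x \<noteq> B" "cs B x \<in> carrier Q" using cs_eq_B carrier_Q by auto
    then show "carrier Q \<noteq> {\<zero>\<^bsub>Q\<^esub>}" using zero_Q by auto
    fix Z assume Z: "subrep G Q Z"
    define C where "C = {x \<in> carrier V. cs B x \<in> Z}"
    have C: "subrep G V C" unfolding C_def by (rule subrep_Q_preimage[OF Z])
    have XQ: "Z \<subseteq> carrier Q" and BX: "B \<in> Z"
      using Z zero_Q by (auto simp: subrep_def submodule_def subgroup_def)
    have XC: "Z = cs B ` C" using XQ carrier_Q by (auto simp: C_def)
    have "x \<in> C" if "x \<in> B" for x
      using cs_eq_B[of x] subrepD(2)[OF B that] that BX unfolding C_def by simp
    then have "B \<subseteq> C" by blast
    then consider "C = B" | "C = carrier V" using * C by auto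
    then show "Z = {\<zero>\<^bsub>Q\<^esub>} \<or> Z = carrier Q"
    proof cases
      case 1
      have "cs B x = B" if "x \<in> B" for x using cs_eq_B[OF subrepD(2)[OF B that]] that by blast
      then have "cs B ` B = {B}" using subrepD(3)[OF B] by (metis image_constant image_cong)
      then show ?thesis using XC 1 zero_Q by simp
    next
      case 2 then show ?thesis using XC carrier_Q by simp
    qed
  qed
qed

end

text \<open>The second isomorphism theorem applied twice: density identifies the two quotients with
  C/(C \<inter> B) and C/(C \<inter> B'), and these coincide by the last hypothesis.\<close>

lemma constituent_iso:
  assumes A: "subrep G V A" and B: "subrep G V B" "B \<subseteq> A"
    and A': "subrep G V A'" and B': "subrep G V B'" "B' \<subseteq> A'"
    and C: "subrep G V C" "C \<subseteq> A" "C \<subseteq> A'"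
    and dense: "\<And>a. a \<in> A \<Longrightarrow> \<exists>c\<in>C. a \<ominus>\<^bsub>V\<^esub> c \<in> B" "\<And>a. a \<in> A' \<Longrightarrow> \<exists>c\<in>C. a \<ominus>\<^bsub>V\<^esub> c \<in> B'"
    and int: "C \<inter> B = C \<inter> B'"
  shows "rep_iso G (quotient_rep (V\<lparr>carrier := A\<rparr>) B) (quotient_rep (V\<lparr>carrier := A'\<rparr>) B')"
proof -
  let ?M = "V\<lparr>carrier := A\<rparr>" and ?M' = "V\<lparr>carrier := A'\<rparr>"
  interpret M: group_rep G ?M by (rule group_rep_subrep[OF A])
  interpret M': group_rep G ?M' by (rule group_rep_subrep[OF A'])
  have sB: "subrep G ?M B" and sB': "subrep G ?M' B'"
    using A B A' B' by (simp_all add: subrep_of_subrep)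
  have r: "B +>\<^bsub>?M\<^esub> x = cs B x" "B' +>\<^bsub>?M'\<^esub> x = cs B' x" for x by (simp_all add: a_r_coset_def')
  note [simp] = subrepD(2)[OF A] subrepD(2)[OF A'] subrepD(2)[OF C(1)]
  \<comment> \<open>A coset is sent to the coset of any of its members in \<open>C\<close>; the fact
    \<open>same\<close> below shows that the choice does not matter.\<close>
  define T where "T S = cs B' (SOME c. c \<in> C \<and> c \<in> S)" for S
  have same: "cs B c = cs B d \<longleftrightarrow> cs B' c = cs B' d" if "c \<in> C" "d \<in> C" for c d
    using that cs_eq[OF B(1), of c d] cs_eq[OF B'(1), of c d] subrepD(5)[OF C(1), of c d] int by auto
  have T: "T (cs B c) = cs B' c" if c: "c \<in> C" for c
  proof -
    have "\<exists>d. d \<in> C \<and> d \<in> cs B c" using c cs_self[OF B(1), of c] by auto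
    then have "(SOME d. d \<in> C \<and> d \<in> cs B c) \<in> C \<and> (SOME d. d \<in> C \<and> d \<in> cs B c) \<in> cs B c" by (rule someI_ex)
    then have "(SOME d. d \<in> C \<and> d \<in> cs B c) \<in> C" "cs B (SOME d. d \<in> C \<and> d \<in> cs B c) = cs B c"
      using c cs_eq[OF B(1)] cs_mem[OF B(1), of c] by auto
    then show ?thesis using same c by (auto simp: T_def)
  qed
  have cQ: "carrier (quotient_rep ?M B) = cs B ` C"
  proof -
    have "cs B a \<in> cs B ` C" if a: "a \<in> A" for a
    proof -
      obtain c where "c \<in> C" "a \<ominus>\<^bsub>V\<^esub> c \<in> B" using dense(1)[OF a] by auto
      then have "cs B a = cs B c" using that cs_eq[OF B(1), of a c] by simp
      then show ?thesis using \<open>c \<in> C\<close> by auto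
    qed
    then show ?thesis using M.carrier_Q[OF sB] C(2) r by auto
  qed
  have cQ': "carrier (quotient_rep ?M' B') = cs B' ` C"
  proof -
    have "cs B' a \<in> cs B' ` C" if a: "a \<in> A'" for a
    proof -
      obtain c where "c \<in> C" "a \<ominus>\<^bsub>V\<^esub> c \<in> B'" using dense(2)[OF a] by auto
      then have "cs B' a = cs B' c" using that cs_eq[OF B'(1), of a c] by simp
      then show ?thesis using \<open>c \<in> C\<close> by auto
    qed
    then show ?thesis using M'.carrier_Q[OF sB'] C(3) r by auto
  qed
  have CA: "c \<in> A" "c \<in> A'" if "c \<in> C" for c using that C by auto
  have "T \<in> iso (add_monoid (quotient_rep ?M B)) (add_monoid (quotient_rep ?M' B'))"
  proof (rule isoI)
    show "T \<in> hom (add_monoid (quotient_rep ?M B)) (add_monoid (quotient_rep ?M' B'))"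
    proof (rule homI)
      fix Z Y assume "Z \<in> carrier (add_monoid (quotient_rep ?M B))" "Y \<in> carrier (add_monoid (quotient_rep ?M B))"
      then obtain x y where "x \<in> C" "Z = cs B x" "y \<in> C" "Y = cs B y" using cQ by auto
      then show "T (Z \<otimes>\<^bsub>add_monoid (quotient_rep ?M B)\<^esub> Y) =
          T Z \<otimes>\<^bsub>add_monoid (quotient_rep ?M' B')\<^esub> T Y"
        using M.add_Q[OF sB, of x y] M'.add_Q[OF sB', of x y] CA subrepD(4)[OF C(1), of x y]
        by (simp add: r T)
    qed (use cQ cQ' T in auto)
    show "bij_betw T (carrier (add_monoid (quotient_rep ?M B))) (carrier (add_monoid (quotient_rep ?M' B')))"
      using cQ cQ' T same by (auto simp: bij_betw_def inj_on_def image_image intro!: image_cong)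
  qed
  moreover have "T (c \<odot>\<^bsub>quotient_rep ?M B\<^esub> Z) = c \<odot>\<^bsub>quotient_rep ?M' B'\<^esub> T Z"
    if Z: "Z \<in> carrier (quotient_rep ?M B)" for c Z
  proof -
    obtain x where "x \<in> C" "Z = cs B x" using Z cQ by auto
    then show ?thesis
      using M.smult_Q[OF sB, of x c] M'.smult_Q[OF sB', of x c] CA subrepD(7)[OF C(1), of x c]
      by (simp add: r T)
  qed
  moreover have "T (act (quotient_rep ?M B) g Z) = act (quotient_rep ?M' B') g (T Z)"
    if g: "g \<in> carrier G" and Z: "Z \<in> carrier (quotient_rep ?M B)" for g Z
  proof -
    obtain x where "x \<in> C" "Z = cs B x" using Z cQ by auto
    then show ?thesis
      using M.act_Q[OF sB g, of x] M'.act_Q[OF sB' g, of x] CA subrepD(8)[OF C(1) g, of x]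
      by (simp add: r T)
  qed
  ultimately show ?thesis unfolding rep_iso_def by blast
qed

section \<open>Intersections, sums and generated subrepresentations\<close>

lemma subrep_inter: "subrep G V A \<Longrightarrow> subrep G V B \<Longrightarrow> subrep G V (A \<inter> B)"
  using subrepD[of A] subrepD[of B] by (intro subrepI) auto

lemma subrep_sum:
  assumes A: "subrep G V A" and B: "subrep G V B"
  shows "subrep G V {a \<oplus>\<^bsub>V\<^esub> b |a b. a \<in> A \<and> b \<in> B}" (is "subrep G V ?S")
proof (rule subrepI)
  note [simp] = subrepD(2)[OF A] subrepD(2)[OF B]
  show "?S \<subseteq> carrier V" by auto
  show "\<zero>\<^bsub>V\<^esub> \<in> ?S" using subrepD(3)[OF A] subrepD(3)[OF B] by force
  show "x \<oplus>\<^bsub>V\<^esub> y \<in> ?S" if "x \<in> ?S" "y \<in> ?S" for x y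
  proof -
    obtain a b a' b' where *: "x = a \<oplus>\<^bsub>V\<^esub> b" "y = a' \<oplus>\<^bsub>V\<^esub> b'" "a \<in> A" "a' \<in> A" "b \<in> B" "b' \<in> B"
      using \<open>x \<in> ?S\<close> \<open>y \<in> ?S\<close> by blast
    then have "x \<oplus>\<^bsub>V\<^esub> y = (a \<oplus>\<^bsub>V\<^esub> a') \<oplus>\<^bsub>V\<^esub> (b \<oplus>\<^bsub>V\<^esub> b')"
      by (simp add: M.add.m_ac)
    then show ?thesis using * subrepD(4)[OF A] subrepD(4)[OF B] by blast
  qed
  show "c \<odot>\<^bsub>V\<^esub> x \<in> ?S" if "x \<in> ?S" for c x
  proof -
    obtain a b where *: "x = a \<oplus>\<^bsub>V\<^esub> b" "a \<in> A" "b \<in> B" using \<open>x \<in> ?S\<close> by blast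
    then have "c \<odot>\<^bsub>V\<^esub> x = c \<odot>\<^bsub>V\<^esub> a \<oplus>\<^bsub>V\<^esub> c \<odot>\<^bsub>V\<^esub> b" by (simp add: smult_r_distr)
    then show ?thesis using * subrepD(7)[OF A] subrepD(7)[OF B] by blast
  qed
  show "act V g x \<in> ?S" if g: "g \<in> carrier G" and "x \<in> ?S" for g x
  proof -
    obtain a b where *: "x = a \<oplus>\<^bsub>V\<^esub> b" "a \<in> A" "b \<in> B" using \<open>x \<in> ?S\<close> by blast
    then have "act V g x = act V g a \<oplus>\<^bsub>V\<^esub> act V g b" using g by (simp add: act_add)
    then show ?thesis using * subrepD(8)[OF A g] subrepD(8)[OF B g] by blast
  qed
qed

definition gen :: "'v \<Rightarrow> 'v set" where
  "gen x = \<Inter>{A. subrep G V A \<and> x \<in> A}"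

lemma subrep_carrier: "subrep G V (carrier V)"
  by (rule subrepI) auto

lemma subrep_gen: assumes "x \<in> carrier V" shows "subrep G V (gen x)"
proof (rule subrepI)
  show "gen x \<subseteq> carrier V" using subrep_carrier assms by (auto simp: gen_def)
qed (use subrepD in \<open>auto simp: gen_def\<close>)

lemma gen_self: "x \<in> gen x"
  by (auto simp: gen_def)

lemma gen_least: "subrep G V A \<Longrightarrow> x \<in> A \<Longrightarrow> gen x \<subseteq> A"
  by (auto simp: gen_def)

end

text \<open>The axiom \<open>average\<close> abstracts averaging over a compact group \<open>H\<close>: any two smooth vectors are
  averaged by one finite set of elements of \<open>H\<close>, which is all that is needed to project to the
  \<open>H\<close>-fixed line.\<close>

locale fixed_line = group_rep +
  fixes H :: "'a set" and x0 :: 'c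
  assumes x0: "x0 \<in> carrier V" "x0 \<noteq> \<zero>\<^bsub>V\<^esub>"
    and H_sub: "H \<subseteq> carrier G"
    and x0_fixed: "h \<in> H \<Longrightarrow> act V h x0 = x0"
    and line: "x \<in> carrier V \<Longrightarrow> (\<And>h. h \<in> H \<Longrightarrow> act V h x = x) \<Longrightarrow> \<exists>c. x = c \<odot>\<^bsub>V\<^esub> x0"
    and average: "x \<in> carrier V \<Longrightarrow> y \<in> carrier V \<Longrightarrow>
      \<exists>e. (\<forall>A. subrep G V A \<longrightarrow> e ` A \<subseteq> A) \<and>
          (\<forall>a\<in>carrier V. \<forall>b\<in>carrier V. e (a \<oplus>\<^bsub>V\<^esub> b) = e a \<oplus>\<^bsub>V\<^esub> e b) \<and>
          (\<forall>h\<in>H. act V h (e x) = e x \<and> act V h (e y) = e y) \<and> e x0 = x0 \<and>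
          (\<forall>A z. subrep G V A \<longrightarrow> z \<in> carrier V \<longrightarrow> (\<forall>h\<in>H. act V h z \<ominus>\<^bsub>V\<^esub> z \<in> A) \<longrightarrow> e z \<ominus>\<^bsub>V\<^esub> z \<in> A)"
begin

lemma fixed_in_subrep:
  assumes "subrep G V A" "x \<in> A" "\<And>h. h \<in> H \<Longrightarrow> act V h x = x" "x \<noteq> \<zero>\<^bsub>V\<^esub>"
  shows "x0 \<in> A"
proof -
  have xV: "x \<in> carrier V" using assms subrepD by blast
  obtain c where c: "x = c \<odot>\<^bsub>V\<^esub> x0" using line[OF xV assms(3)] by auto
  have "c \<noteq> 0"
  proof
    assume "c = 0"
    then show False using smult_l_null[OF x0(1)] assms(4) c by (simp add: ring_of_type_algebra_def)
  qed
  then have "inverse c \<odot>\<^bsub>V\<^esub> x = x0"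
    using smult_assoc1[of "inverse c" c x0] smult_one[OF x0(1)] x0 c
    by (simp add: ring_of_type_algebra_def)
  then show ?thesis using subrepD(7)[OF assms(1,2)] by metis
qed

text \<open>Averaging \<open>x0 = a \<oplus> b\<close> fixes the left side and turns
  \<open>a\<close> and \<open>b\<close> into fixed vectors of \<open>A\<close> and \<open>B\<close>.
  They are not both zero, and a nonzero fixed vector is a multiple of \<open>x0\<close>.\<close>

lemma prime_subreps:
  assumes A: "subrep G V A" and B: "subrep G V B" and ab: "a \<in> A" "b \<in> B" "x0 = a \<oplus>\<^bsub>V\<^esub> b"
  shows "x0 \<in> A \<or> x0 \<in> B"
proof -
  have V: "a \<in> carrier V" "b \<in> carrier V" using subrepD(2)[OF A] subrepD(2)[OF B] ab by auto
  obtain e where e: "\<forall>A. subrep G V A \<longrightarrow> e ` A \<subseteq> A"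
    and e_add: "\<forall>a\<in>carrier V. \<forall>b\<in>carrier V. e (a \<oplus>\<^bsub>V\<^esub> b) = e a \<oplus>\<^bsub>V\<^esub> e b"
    and e_fix: "\<forall>h\<in>H. act V h (e a) = e a \<and> act V h (e b) = e b" and e_x0: "e x0 = x0"
    using average[OF V] by (elim exE conjE) (rule that)
  have in_AB: "e a \<in> A" "e b \<in> B" using e A B ab by blast+
  have "e a \<noteq> \<zero>\<^bsub>V\<^esub> \<or> e b \<noteq> \<zero>\<^bsub>V\<^esub>"
    using bspec[OF bspec[OF e_add V(1)] V(2)] e_x0 ab(3) x0(2) by auto
  then show ?thesis
    using fixed_in_subrep[OF A in_AB(1)] fixed_in_subrep[OF B in_AB(2)] e_fix by blast
qed

text \<open>A fixed coset contains a fixed vector: the differences \<open>act V h x - x\<close> lie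
  in \<open>B\<close>, hence averaging \<open>x\<close> does not leave its coset. That vector is a
  nonzero multiple of \<open>x0\<close>.\<close>

lemma constituent_fixed:
  assumes A: "subrep G V A" and B: "subrep G V B" "B \<subseteq> A"
  shows "has_nonzero_fixed H (quotient_rep (V\<lparr>carrier := A\<rparr>) B) \<longleftrightarrow> x0 \<in> A \<and> x0 \<notin> B"
proof -
  let ?M = "V\<lparr>carrier := A\<rparr>"
  interpret M: group_rep G ?M by (rule group_rep_subrep[OF A])
  have sB: "subrep G ?M B" using A B by (simp add: subrep_of_subrep)
  have r: "B +>\<^bsub>?M\<^esub> x = cs B x" for x by (simp add: a_r_coset_def')
  show ?thesis
  proof
    assume "has_nonzero_fixed H (quotient_rep ?M B)"
    then obtain Z where Z: "Z \<in> carrier (quotient_rep ?M B)" "Z \<noteq> B"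
      "\<And>h. h \<in> H \<Longrightarrow> act (quotient_rep ?M B) h Z = Z"
      using M.zero_Q[OF sB] by (auto simp: has_nonzero_fixed_def)
    obtain x where x: "x \<in> A" "Z = cs B x" using Z(1) M.carrier_Q[OF sB] r by auto
    have xV: "x \<in> carrier V" using subrepD(2)[OF A] x by auto
    have diff: "act V h x \<ominus>\<^bsub>V\<^esub> x \<in> B" if h: "h \<in> H" for h
    proof -
      have hG: "h \<in> carrier G" using h H_sub by auto
      have "cs B (act V h x) = cs B x"
        using M.act_Q[OF sB hG, of x] x Z(3)[OF h] r by simp
      then show ?thesis using cs_eq[OF B(1)] xV hG by simp
    qed
    obtain e where e: "\<forall>A. subrep G V A \<longrightarrow> e ` A \<subseteq> A"
      and e_fix: "\<forall>h\<in>H. act V h (e x) = e x \<and> act V h (e x) = e x"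
      and e_diff: "\<forall>A z. subrep G V A \<longrightarrow> z \<in> carrier V \<longrightarrow> (\<forall>h\<in>H. act V h z \<ominus>\<^bsub>V\<^esub> z \<in> A) \<longrightarrow> e z \<ominus>\<^bsub>V\<^esub> z \<in> A"
      using average[OF xV xV] by (elim exE conjE) (rule that)
    have e2: "\<And>h. h \<in> H \<Longrightarrow> act V h (e x) = e x" using e_fix by blast
    have ex: "e x \<in> A" using e A x by blast
    then have exV: "e x \<in> carrier V" using subrepD(2)[OF A] by auto
    have "e x \<ominus>\<^bsub>V\<^esub> x \<in> B" using e_diff B(1) xV diff by blast
    then have "cs B (e x) = cs B x" using cs_eq[OF B(1) exV xV] by simp
    then have nB: "e x \<notin> B" using Z(2) x cs_eq_B[OF B(1) exV] by auto
    then have nz: "e x \<noteq> \<zero>\<^bsub>V\<^esub>" using subrepD(3)[OF B(1)] by metis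
    have "x0 \<in> A" by (rule fixed_in_subrep[OF A ex e2 nz])
    moreover have "x0 \<notin> B"
    proof
      assume "x0 \<in> B"
      obtain c where "e x = c \<odot>\<^bsub>V\<^esub> x0" using line[OF exV e2] by auto
      then show False using nB subrepD(7)[OF B(1) \<open>x0 \<in> B\<close>] by simp
    qed
    ultimately show "x0 \<in> A \<and> x0 \<notin> B" by simp
  next
    assume x: "x0 \<in> A \<and> x0 \<notin> B"
    have "cs B x0 \<in> carrier (quotient_rep ?M B)" using x M.carrier_Q[OF sB] r by auto
    moreover have "cs B x0 \<noteq> \<zero>\<^bsub>quotient_rep ?M B\<^esub>"
      using x x0 cs_eq_B[OF B(1)] M.zero_Q[OF sB] by simp
    moreover have "act (quotient_rep ?M B) h (cs B x0) = cs B x0" if "h \<in> H" for h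
      using M.act_Q[OF sB, of h x0] that H_sub x x0_fixed r by auto
    ultimately show "has_nonzero_fixed H (quotient_rep ?M B)"
      unfolding has_nonzero_fixed_def by blast
  qed
qed

section \<open>Existence and uniqueness of the constituent that carries the fixed line\<close>

definition isolates :: "'c set \<Rightarrow> 'c set \<Rightarrow> bool" where
  "isolates A B \<longleftrightarrow> subrep G V A \<and> subrep G V B \<and> B \<subseteq> A \<and> x0 \<in> A \<and> x0 \<notin> B \<and>
     irreducible_rep G (quotient_rep (V\<lparr>carrier := A\<rparr>) B)"

lemma constituent_isolates:
  "irreducible_constituent G V \<pi> \<and> has_nonzero_fixed H \<pi> \<longleftrightarrow>
    (\<exists>A B. isolates A B \<and> \<pi> = quotient_rep (V\<lparr>carrier := A\<rparr>) B)"
  unfolding irreducible_constituent_def isolates_def using constituent_fixed by blast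

lemma irreducible_between:
  assumes "subrep G V A" "subrep G V B" "B \<subseteq> A" "irreducible_rep G (quotient_rep (V\<lparr>carrier := A\<rparr>) B)"
    "subrep G V C" "B \<subseteq> C" "C \<subseteq> A"
  shows "C = B \<or> C = A"
proof -
  interpret M: group_rep G "V\<lparr>carrier := A\<rparr>" by (rule group_rep_subrep[OF assms(1)])
  have "subrep G (V\<lparr>carrier := A\<rparr>) B" "subrep G (V\<lparr>carrier := A\<rparr>) C"
    using assms by (simp_all add: subrep_of_subrep)
  then show ?thesis using M.irreducible_quotient_iff assms by fastforce
qed

text \<open>Both quotients are compared with \<open>A \<inter> A'\<close> by means of
  \<open>constituent_iso\<close>. It has to be shown that this intersection fills each quotient and
  meets \<open>B\<close> and \<open>B'\<close> in the same set.\<close>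

lemma isolates_iso:
  assumes 1: "isolates A B" and 2: "isolates A' B'"
  shows "rep_iso G (quotient_rep (V\<lparr>carrier := A\<rparr>) B) (quotient_rep (V\<lparr>carrier := A'\<rparr>) B')"
proof -
  define C where "C = A \<inter> A'"
  \<comment> \<open>The sum of \<open>A \<inter> A'\<close> and \<open>B\<close> contains
    \<open>x0\<close>, so it differs from \<open>B\<close>; irreducibility makes it all of
    \<open>A\<close>.\<close>
  have dense: "\<exists>c\<in>A \<inter> A'. a \<ominus>\<^bsub>V\<^esub> c \<in> B"
    if i: "isolates A B" "isolates A' B'" and a: "a \<in> A" for A B A' B' a
  proof -
    let ?S = "{c \<oplus>\<^bsub>V\<^esub> b |c b. c \<in> A \<inter> A' \<and> b \<in> B}"
    have A: "subrep G V A" and A': "subrep G V A'" and B: "subrep G V B" and BA: "B \<subseteq> A" and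
      x: "x0 \<in> A" "x0 \<in> A'" "x0 \<notin> B" using i by (auto simp: isolates_def)
    note [simp] = subrepD(2)[OF A] subrepD(2)[OF B]
    have S: "subrep G V ?S" by (rule subrep_sum[OF subrep_inter[OF A A'] B])
    have "B \<subseteq> ?S"
    proof
      fix b assume "b \<in> B"
      then have "b = \<zero>\<^bsub>V\<^esub> \<oplus>\<^bsub>V\<^esub> b" by simp
      then show "b \<in> ?S" using \<open>b \<in> B\<close> subrepD(3)[OF A] subrepD(3)[OF A'] by blast
    qed
    moreover have "?S \<subseteq> A" using BA subrepD(4)[OF A] by blast
    moreover have "x0 \<in> ?S"
    proof -
      have "x0 = x0 \<oplus>\<^bsub>V\<^esub> \<zero>\<^bsub>V\<^esub>" using x0 by simp
      then show ?thesis using x subrepD(3)[OF B] by blast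
    qed
    ultimately have "?S = A"
      using irreducible_between[OF A B BA _ S] i x unfolding isolates_def by blast
    then have "a \<in> ?S" using a by simp
    then obtain c b where cb: "a = c \<oplus>\<^bsub>V\<^esub> b" "c \<in> A \<inter> A'" "b \<in> B" by blast
    have V: "b \<in> carrier V" "c \<in> carrier V" "\<ominus>\<^bsub>V\<^esub> c \<in> carrier V" using cb by auto
    have "a \<ominus>\<^bsub>V\<^esub> c = (b \<oplus>\<^bsub>V\<^esub> c) \<oplus>\<^bsub>V\<^esub> \<ominus>\<^bsub>V\<^esub> c"
      unfolding cb(1) a_minus_def using M.a_comm[OF V(1,2)] by simp
    also have "\<dots> = b \<oplus>\<^bsub>V\<^esub> (c \<oplus>\<^bsub>V\<^esub> \<ominus>\<^bsub>V\<^esub> c)" by (rule M.a_assoc[OF V])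
    also have "\<dots> = b" using M.r_neg[OF V(2)] V by simp
    finally have "a \<ominus>\<^bsub>V\<^esub> c = b" .
    then show ?thesis using cb by blast
  qed
  \<comment> \<open>Otherwise the sum of \<open>A \<inter> A' \<inter> B'\<close> and
    \<open>B\<close> would be all of \<open>A\<close> and contain \<open>x0\<close>. By
    \<open>prime_subreps\<close> one summand would contain \<open>x0\<close>, but both
    \<open>B'\<close> and \<open>B\<close> miss it.\<close>
  have int: "A \<inter> A' \<inter> B' \<subseteq> B" if i: "isolates A B" "isolates A' B'" for A B A' B'
  proof (rule ccontr)
    have A: "subrep G V A" and A': "subrep G V A'" and B: "subrep G V B" and BA: "B \<subseteq> A" and
      B': "subrep G V B'" and x: "x0 \<in> A" "x0 \<in> A'" "x0 \<notin> B" "x0 \<notin> B'"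
      using i by (auto simp: isolates_def)
    note [simp] = subrepD(2)[OF A] subrepD(2)[OF B]
    assume n: "\<not> A \<inter> A' \<inter> B' \<subseteq> B"
    let ?D = "A \<inter> A' \<inter> B'"
    let ?S = "{c \<oplus>\<^bsub>V\<^esub> b |c b. c \<in> ?D \<and> b \<in> B}"
    have D: "subrep G V ?D" by (intro subrep_inter A A' B')
    have S: "subrep G V ?S" by (rule subrep_sum[OF D B])
    have "B \<subseteq> ?S"
    proof
      fix b assume "b \<in> B"
      then have "b = \<zero>\<^bsub>V\<^esub> \<oplus>\<^bsub>V\<^esub> b" by simp
      then show "b \<in> ?S" using \<open>b \<in> B\<close> subrepD(3)[OF D] by blast
    qed
    moreover have "?D \<subseteq> ?S"
    proof
      fix d assume d: "d \<in> ?D"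
      then have "d = d \<oplus>\<^bsub>V\<^esub> \<zero>\<^bsub>V\<^esub>" by simp
      then show "d \<in> ?S" using d subrepD(3)[OF B] by blast
    qed
    moreover have "?S \<subseteq> A" using BA subrepD(4)[OF A] by blast
    ultimately have "?S = A"
      using irreducible_between[OF A B BA _ S] i n unfolding isolates_def by blast
    then obtain d b where "x0 = d \<oplus>\<^bsub>V\<^esub> b" "d \<in> ?D" "b \<in> B" using x by blast
    then show False using prime_subreps[OF D B] x by blast
  qed
  show ?thesis
  proof (rule constituent_iso[where C = "A \<inter> A'"])
    show "A \<inter> A' \<inter> B = A \<inter> A' \<inter> B'"
      using int[OF 1 2] int[OF 2 1] by blast
    show "\<exists>c\<in>A \<inter> A'. a \<ominus>\<^bsub>V\<^esub> c \<in> B" if "a \<in> A" for a using dense[OF 1 2 that] .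
    show "\<exists>c\<in>A \<inter> A'. a \<ominus>\<^bsub>V\<^esub> c \<in> B'" if "a \<in> A'" for a using dense[OF 2 1 that] by blast
  qed (use 1 2 in \<open>auto simp: isolates_def intro: subrep_inter\<close>)
qed

text \<open>In the subrepresentation generated by \<open>x0\<close>, the vectors that do not
  generate \<open>x0\<close> are closed under addition by \<open>prime_subreps\<close>. They form
  the largest proper subrepresentation, so the quotient is irreducible.\<close>

lemma isolates_exists: "\<exists>A B. isolates A B"
proof -
  define A where "A = gen x0"
  define B where "B = {y \<in> A. x0 \<notin> gen y}"
  have A: "subrep G V A" unfolding A_def by (rule subrep_gen[OF x0(1)])
  note [simp] = subrepD(2)[OF A]
  have gz: "gen \<zero>\<^bsub>V\<^esub> \<subseteq> {\<zero>\<^bsub>V\<^esub>}"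
    by (rule gen_least) (auto intro!: subrepI simp: act_zero)
  have mono: "gen y \<subseteq> gen x" if "x \<in> carrier V" "y \<in> gen x" for x y
    by (rule gen_least[OF subrep_gen[OF that(1)] that(2)])
  have B: "subrep G V B"
  proof (rule subrepI)
    show "B \<subseteq> carrier V" by (auto simp: B_def)
    show "\<zero>\<^bsub>V\<^esub> \<in> B" using gz x0 subrepD(3)[OF A] by (auto simp: B_def)
    show "x \<oplus>\<^bsub>V\<^esub> y \<in> B" if "x \<in> B" "y \<in> B" for x y
    proof -
      have xy: "x \<in> A" "y \<in> A" "x0 \<notin> gen x" "x0 \<notin> gen y" using that by (auto simp: B_def)
      have gx: "subrep G V (gen x)" and gy: "subrep G V (gen y)" using xy by (auto intro: subrep_gen)
      have "gen (x \<oplus>\<^bsub>V\<^esub> y) \<subseteq> {a \<oplus>\<^bsub>V\<^esub> b |a b. a \<in> gen x \<and> b \<in> gen y}"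
        by (rule gen_least[OF subrep_sum[OF gx gy]]) (use gen_self in blast)
      then have "x0 \<notin> gen (x \<oplus>\<^bsub>V\<^esub> y)" using prime_subreps[OF gx gy] xy by blast
      then show ?thesis using subrepD(4)[OF A xy(1,2)] by (simp add: B_def)
    qed
    show "c \<odot>\<^bsub>V\<^esub> x \<in> B" if "x \<in> B" for c x
    proof -
      have xA: "x \<in> A" "x0 \<notin> gen x" using that by (auto simp: B_def)
      then have "gen (c \<odot>\<^bsub>V\<^esub> x) \<subseteq> gen x"
        using subrepD(7)[OF subrep_gen gen_self] by (intro mono) auto
      then show ?thesis using xA subrepD(7)[OF A] by (auto simp: B_def)
    qed
    show "act V g x \<in> B" if g: "g \<in> carrier G" and "x \<in> B" for g x
    proof -
      have xA: "x \<in> A" "x0 \<notin> gen x" using that by (auto simp: B_def)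
      then have "gen (act V g x) \<subseteq> gen x"
        using subrepD(8)[OF subrep_gen g gen_self] by (intro mono) auto
      then show ?thesis using xA subrepD(8)[OF A g] by (auto simp: B_def)
    qed
  qed
  interpret M: group_rep G "V\<lparr>carrier := A\<rparr>" by (rule group_rep_subrep[OF A])
  have BA: "B \<subseteq> A" by (auto simp: B_def)
  have x: "x0 \<in> A" "x0 \<notin> B" using gen_self by (auto simp: A_def B_def)
  have sB: "subrep G (V\<lparr>carrier := A\<rparr>) B" using A B BA by (simp add: subrep_of_subrep)
  have "irreducible_rep G (quotient_rep (V\<lparr>carrier := A\<rparr>) B)"
    unfolding M.irreducible_quotient_iff[OF sB]
  proof (intro conjI allI impI)
    show "B \<noteq> carrier (V\<lparr>carrier := A\<rparr>)" using x by auto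
    fix C assume "subrep G (V\<lparr>carrier := A\<rparr>) C" and BC: "B \<subseteq> C"
    then have C: "subrep G V C" "C \<subseteq> A" using A by (simp_all add: subrep_of_subrep)
    show "C = B \<or> C = carrier (V\<lparr>carrier := A\<rparr>)"
    proof (cases "C \<subseteq> B")
      case False
      then obtain y where y: "y \<in> C" "y \<notin> B" by auto
      then have "x0 \<in> gen y" using C by (auto simp: B_def)
      then have "x0 \<in> C" using gen_least[OF C(1) y(1)] by auto
      then have "A \<subseteq> C" unfolding A_def by (rule gen_least[OF C(1)])
      then show ?thesis using C by auto
    qed (use BC in auto)
  qed
  then have "isolates A B" using A B BA x by (auto simp: isolates_def)
  then show ?thesis by blast
qed

lemma unique_constituent_iff:
  "unique_constituent_with_fixed G V H \<pi> \<longleftrightarrow>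
    (\<exists>A B. isolates A B \<and> \<pi> = quotient_rep (V\<lparr>carrier := A\<rparr>) B)"
  (is "?L \<longleftrightarrow> ?R")
proof
  assume ?L
  then show ?R using constituent_isolates unfolding unique_constituent_with_fixed_def by blast
next
  assume ?R
  then obtain A B where AB: "isolates A B" "\<pi> = quotient_rep (V\<lparr>carrier := A\<rparr>) B" by blast
  have "rep_iso G \<pi>' \<pi>" if "irreducible_constituent G V \<pi>' \<and> has_nonzero_fixed H \<pi>'" for \<pi>'
    using that AB isolates_iso[OF _ AB(1)] unfolding constituent_isolates by blast
  then show ?L using constituent_isolates AB unfolding unique_constituent_with_fixed_def by blast
qed

end

section \<open>The unitary group and its parahoric subgroups\<close>

locale unitary_setting = odd_ramified_extension p v F cj unif
  for p :: nat and v :: "'e::field_char_0 \<Rightarrow> real" and F cj unif +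
  fixes r :: nat
begin

section \<open>The skew-Hermitian form in coordinates, the adjoint and the group structure\<close>

declare index_mult_mat(1) [simp del]

abbreviation U :: "'e mat monoid" where "U \<equiv> unitary_group cj r"

text \<open>The index of the basis vector dual to \<open>e_i\<close>. Below, \<open>lev\<close> is
  the common position of a dual pair in the flag, and \<open>eps\<close> carries the signs of the
  Gram matrix.\<close>

definition pr :: "nat \<Rightarrow> nat" where "pr i = (if i < r then i + r else i - r)"
definition lev :: "nat \<Rightarrow> nat" where "lev i = (if i < r then i else i - r)"
definition eps :: "nat \<Rightarrow> 'e" where "eps i = (if i < r then 1 else - 1)"

text \<open>The form is taken on functions of the index rather than on vectors, so that rows,
  columns and linear combinations can be inserted without dimension conditions;
  \<open>skew_form_hf\<close> makes the connection.\<close>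

definition hf :: "(nat \<Rightarrow> 'e) \<Rightarrow> (nat \<Rightarrow> 'e) \<Rightarrow> 'e" where
  "hf z w = (\<Sum>a<2*r. eps a * z a * cj (w (pr a)))"

definition dl :: "nat \<Rightarrow> nat \<Rightarrow> 'e" where "dl a b = (if b = a then 1 else 0)"

definition rw :: "'e mat \<Rightarrow> nat \<Rightarrow> nat \<Rightarrow> 'e" where "rw g a b = g $$ (a, b)"

text \<open>The conjugate transpose twisted by the Gram matrix, that is, the adjoint for
  \<open>hf\<close>; on \<open>U\<close> it is the inverse.\<close>

definition adj :: "'e mat \<Rightarrow> 'e mat" where
  "adj g = mat (2*r) (2*r) (\<lambda>(i, j). eps i * eps j * cj (g $$ (pr j, pr i)))"

lemma pr_less [simp]: "i < 2*r \<Longrightarrow> pr i < 2*r"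
  and pr_pr [simp]: "i < 2*r \<Longrightarrow> pr (pr i) = i"
  and pr_neq: "i < 2*r \<Longrightarrow> pr i \<noteq> i"
  and eps_pr: "i < 2*r \<Longrightarrow> eps (pr i) = - eps i"
  and lev_pr [simp]: "i < 2*r \<Longrightarrow> lev (pr i) = lev i"
  and lev_less: "i < 2*r \<Longrightarrow> lev i < r"
  by (auto simp: pr_def eps_def lev_def)

lemma pr_eq_iff: "i < 2*r \<Longrightarrow> j < 2*r \<Longrightarrow> pr i = pr j \<longleftrightarrow> i = j"
  by (metis pr_pr)

lemma pr_swap: "i < 2*r \<Longrightarrow> j < 2*r \<Longrightarrow> pr i = j \<longleftrightarrow> i = pr j"
  by (metis pr_pr)

lemma eps_sq [simp]: "eps i * eps i = 1"
  and cj_eps [simp]: "cj (eps i) = eps i"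
  and v_eps [simp]: "v (eps i) = 1"
  and eps_nz [simp]: "eps i \<noteq> 0"
  by (auto simp: eps_def)

lemma eps_sq_assoc [simp]: "eps i * (eps i * x) = x"
  by (simp flip: mult.assoc)

lemma sum_pr: "(\<Sum>a<2*r. f (pr a)) = (\<Sum>a<2*r. f a)"
  by (rule sum.reindex_bij_witness[of _ pr pr]) auto

lemma hf_cong: "(\<And>a. a < 2*r \<Longrightarrow> z a = z' a) \<Longrightarrow> (\<And>a. a < 2*r \<Longrightarrow> w a = w' a) \<Longrightarrow> hf z w = hf z' w'"
  unfolding hf_def by (rule sum.cong) auto

lemma hf_skew: "hf w z = - cj (hf z w)"
proof -
  have "cj (hf z w) = (\<Sum>a<2*r. eps a * cj (z a) * w (pr a))"
    by (simp add: hf_def cj_sum)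
  also have "\<dots> = (\<Sum>a<2*r. eps (pr a) * cj (z (pr a)) * w (pr (pr a)))"
    by (rule sum_pr[symmetric])
  also have "\<dots> = (\<Sum>a<2*r. - (eps a * w a * cj (z (pr a))))"
    by (rule sum.cong) (auto simp: eps_pr)
  finally show ?thesis by (simp add: hf_def sum_negf)
qed

lemma hf_dl_right: "b < 2*r \<Longrightarrow> hf z (dl b) = eps (pr b) * z (pr b)"
proof -
  assume b: "b < 2*r"
  have "hf z (dl b) = (\<Sum>a<2*r. if a = pr b then eps (pr b) * z (pr b) else 0)"
    unfolding hf_def by (rule sum.cong) (auto simp: dl_def b pr_swap)
  then show ?thesis using b by simp
qed

lemma hf_add_right: "hf w (\<lambda>b. x b + y b) = hf w x + hf w y"
  by (simp add: hf_def algebra_simps sum.distrib)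

lemma hf_scale_left: "hf (\<lambda>b. c * x b) w = c * hf x w"
  by (simp add: hf_def algebra_simps sum_distrib_left)

lemma hf_scale_right: "hf w (\<lambda>b. c * x b) = cj c * hf w x"
  by (simp add: hf_def algebra_simps sum_distrib_left)

lemma hf_sum_left: "hf (\<lambda>b. \<Sum>i\<in>I. x i b) w = (\<Sum>i\<in>I. hf (x i) w)"
  unfolding hf_def by (simp add: sum_distrib_left sum_distrib_right) (rule sum.swap)

lemma hf_sum_right: "hf w (\<lambda>b. \<Sum>i\<in>I. x i b) = (\<Sum>i\<in>I. hf w (x i))"
  unfolding hf_def by (simp add: sum_distrib_left cj_sum) (rule sum.swap)

lemma mult_entry:
  "A \<in> carrier_mat (2*r) (2*r) \<Longrightarrow> B \<in> carrier_mat (2*r) (2*r) \<Longrightarrow> a < 2*r \<Longrightarrow> b < 2*r \<Longrightarrow>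
    (A * B) $$ (a, b) = (\<Sum>c<2*r. A $$ (a, c) * B $$ (c, b))"
  by (auto simp: index_mult_mat(1) scalar_prod_def atLeast0LessThan intro!: sum.cong)

lemma adj_carrier [simp]: "adj g \<in> carrier_mat (2*r) (2*r)"
  by (simp add: adj_def)

lemma dim_adj [simp]: "dim_row (adj g) = 2*r" "dim_col (adj g) = 2*r"
  by (simp_all add: adj_def)

lemma adj_entry: "i < 2*r \<Longrightarrow> j < 2*r \<Longrightarrow> adj g $$ (i, j) = eps i * eps j * cj (g $$ (pr j, pr i))"
  by (simp add: adj_def)

lemma adj_adj: "g \<in> carrier_mat (2*r) (2*r) \<Longrightarrow> adj (adj g) = g"
  by (rule eq_matI) (auto simp: adj_entry eps_pr)

lemma mult_adj_entry:
  assumes "g \<in> carrier_mat (2*r) (2*r)" "a < 2*r" "b < 2*r"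
  shows "(g * adj h) $$ (a, b) = eps b * hf (rw g a) (rw h (pr b))"
  using assms by (simp add: mult_entry hf_def sum_distrib_left adj_entry rw_def)
    (rule sum.cong, auto)

lemma skew_form_hf:
  assumes "x \<in> carrier_vec (2*r)" "y \<in> carrier_vec (2*r)"
  shows "skew_form cj r x y = hf (($) x) (($) y)"
proof -
  have S: "(skew_gram r *\<^sub>v map_vec cj y) $ i = eps i * cj (y $ pr i)" if i: "i < 2*r" for i
  proof -
    have "(skew_gram r *\<^sub>v map_vec cj y) $ i = (\<Sum>j<2*r. skew_gram r $$ (i, j) * cj (y $ j))"
      using assms i by (auto simp: skew_gram_def scalar_prod_def atLeast0LessThan intro!: sum.cong)
    also have "\<dots> = (\<Sum>j<2*r. if j = pr i then eps i * cj (y $ pr i) else 0)"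
      using i by (intro sum.cong) (auto simp: skew_gram_def pr_def eps_def)
    finally show ?thesis using i by simp
  qed
  have "skew_form cj r x y = (\<Sum>i<2*r. x $ i * (skew_gram r *\<^sub>v map_vec cj y) $ i)"
  proof -
    have "dim_vec (skew_gram r *\<^sub>v map_vec cj y) = 2*r" by (simp add: skew_gram_def mult_2)
    then show ?thesis unfolding skew_form_def by (simp only: scalar_prod_def atLeast0LessThan)
  qed
  also have "\<dots> = hf (($) x) (($) y)"
    unfolding hf_def by (rule sum.cong) (auto simp: S)
  finally show ?thesis .
qed

lemma adj_left_iff_right:
  assumes "g \<in> carrier_mat (2*r) (2*r)"
  shows "adj g * g = 1\<^sub>m (2*r) \<longleftrightarrow> g * adj g = 1\<^sub>m (2*r)"
  using assms adj_carrier mat_mult_left_right_inverse by blast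

lemma adj_mult_entry:
  assumes "g \<in> carrier_mat (2*r) (2*r)" "a < 2*r" "b < 2*r"
  shows "(adj g * g) $$ (a, b) = eps a * hf (\<lambda>c. g $$ (c, b)) (\<lambda>c. g $$ (c, pr a))"
  using assms by (simp add: mult_entry hf_def sum_distrib_left adj_entry rw_def)
    (rule sum.cong, auto)

lemma mult_vec_entry:
  "A \<in> carrier_mat (2*r) (2*r) \<Longrightarrow> x \<in> carrier_vec (2*r) \<Longrightarrow> a < 2*r \<Longrightarrow>
    (A *\<^sub>v x) $ a = (\<Sum>c<2*r. A $$ (a, c) * x $ c)"
  by (auto simp: scalar_prod_def atLeast0LessThan intro!: sum.cong)

text \<open>Testing the form on unit vectors gives \<open>adj g * g = 1\<close>, and a one-sided
  inverse of a square matrix is two-sided. In the other direction the form is preserved because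
  \<open>adj g\<close> is adjoint to \<open>g\<close> (the fact \<open>move\<close>).\<close>

lemma U_iff_adj: "g \<in> carrier U \<longleftrightarrow> g \<in> carrier_mat (2*r) (2*r) \<and> g * adj g = 1\<^sub>m (2*r)"
proof
  assume g: "g \<in> carrier U"
  then have gc: "g \<in> carrier_mat (2*r) (2*r)" and
    pres: "\<And>x y. x \<in> carrier_vec (2*r) \<Longrightarrow> y \<in> carrier_vec (2*r) \<Longrightarrow>
      skew_form cj r (g *\<^sub>v x) (g *\<^sub>v y) = skew_form cj r x y"
    by (auto simp: unitary_group_def)
  have "adj g * g = 1\<^sub>m (2*r)"
  proof (rule eq_matI)
    fix a b assume "a < dim_row (1\<^sub>m (2*r) :: 'e mat)" "b < dim_col (1\<^sub>m (2*r) :: 'e mat)"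
    then have ab: "a < 2*r" "b < 2*r" by auto
    have col: "(g *\<^sub>v unit_vec (2*r) c) $ i = g $$ (i, c)" if "c < 2*r" "i < 2*r" for c i
    proof -
      have "(g *\<^sub>v unit_vec (2*r) c) $ i = (\<Sum>d<2*r. if d = c then g $$ (i, c) else 0)"
        using that gc by (subst mult_vec_entry, simp, simp, simp) (rule sum.cong, auto)
      then show ?thesis using that by simp
    qed
    have u: "hf (($) (unit_vec (2*r) b)) (($) (unit_vec (2*r) (pr a))) = hf (dl b) (dl (pr a))"
      using ab by (intro hf_cong) (auto simp: dl_def)
    have "hf (\<lambda>c. g $$ (c, b)) (\<lambda>c. g $$ (c, pr a)) =
        hf (($) (g *\<^sub>v unit_vec (2*r) b)) (($) (g *\<^sub>v unit_vec (2*r) (pr a)))"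
      using ab by (intro hf_cong) (auto simp: col)
    also have "\<dots> = hf (dl b) (dl (pr a))"
      using pres[of "unit_vec (2*r) b" "unit_vec (2*r) (pr a)"] gc by (simp add: skew_form_hf u)
    finally show "(adj g * g) $$ (a, b) = (1\<^sub>m (2*r) :: 'e mat) $$ (a, b)"
      using ab gc by (auto simp: adj_mult_entry hf_dl_right dl_def)
  qed (use gc in auto)
  then show "g \<in> carrier_mat (2*r) (2*r) \<and> g * adj g = 1\<^sub>m (2*r)"
    using gc adj_left_iff_right by blast
next
  assume "g \<in> carrier_mat (2*r) (2*r) \<and> g * adj g = 1\<^sub>m (2*r)"
  then have gc: "g \<in> carrier_mat (2*r) (2*r)" and 1: "g * adj g = 1\<^sub>m (2*r)"
    and 2: "adj g * g = 1\<^sub>m (2*r)" using adj_left_iff_right by blast+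
  have "invertible_mat g" using gc 1 2 by (auto simp: invertible_mat_def inverts_mat_def intro!: exI[of _ "adj g"])
  moreover have "skew_form cj r (g *\<^sub>v x) (g *\<^sub>v y) = skew_form cj r x y"
    if x: "x \<in> carrier_vec (2*r)" and y: "y \<in> carrier_vec (2*r)" for x y
  proof -
    have move: "hf (($) (g *\<^sub>v x)) w = hf (($) x) (\<lambda>a. \<Sum>c<2*r. adj g $$ (a, c) * w c)" for w
    proof -
      have "hf (($) (g *\<^sub>v x)) w = (\<Sum>i<2*r. \<Sum>b<2*r. eps i * g $$ (i, b) * x $ b * cj (w (pr i)))"
        unfolding hf_def using gc x
        by (intro sum.cong) (auto simp: mult_vec_entry sum_distrib_left sum_distrib_right mult.assoc simp del: index_mult_mat_vec)
      also have "\<dots> = (\<Sum>b<2*r. \<Sum>i<2*r. eps i * g $$ (i, b) * x $ b * cj (w (pr i)))"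
        by (rule sum.swap)
      also have "\<dots> = (\<Sum>b<2*r. \<Sum>i<2*r. eps (pr i) * g $$ (pr i, b) * x $ b * cj (w (pr (pr i))))"
        by (intro sum.cong refl sum_pr[symmetric])
      also have "\<dots> = hf (($) x) (\<lambda>a. \<Sum>c<2*r. adj g $$ (a, c) * w c)"
        unfolding hf_def by (intro sum.cong) (auto simp: cj_sum sum_distrib_left adj_entry eps_pr intro!: sum.cong)
      finally show ?thesis .
    qed
    have "hf (($) (g *\<^sub>v x)) (($) (g *\<^sub>v y)) = hf (($) x) (\<lambda>a. \<Sum>c<2*r. adj g $$ (a, c) * (g *\<^sub>v y) $ c)"
      by (rule move)
    also have "\<dots> = hf (($) x) (($) ((adj g * g) *\<^sub>v y))"
      using gc y by (intro hf_cong refl) (subst assoc_mult_mat_vec, auto simp: mult_vec_entry simp del: index_mult_mat_vec)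
    finally show ?thesis using gc x y 2 by (simp add: skew_form_hf)
  qed
  ultimately show "g \<in> carrier U" using gc by (auto simp: unitary_group_def)
qed

text \<open>The entries of \<open>g * adj g\<close> are values of the form on pairs of rows. Rows
  are the useful side: membership in the parabolic subgroups below is a condition on bottom rows,
  which right multiplication by compact elements can reduce.\<close>

lemma U_iff: "g \<in> carrier U \<longleftrightarrow> g \<in> carrier_mat (2*r) (2*r) \<and>
    (\<forall>a<2*r. \<forall>b<2*r. hf (rw g a) (rw g b) = (if b = pr a then eps a else 0))"
proof -
  have "g * adj g = 1\<^sub>m (2*r) \<longleftrightarrow>
      (\<forall>a<2*r. \<forall>b<2*r. hf (rw g a) (rw g b) = (if b = pr a then eps a else 0))" (is "?L \<longleftrightarrow> ?R")
    if gc: "g \<in> carrier_mat (2*r) (2*r)"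
  proof
    assume L: ?L
    show ?R
    proof (intro allI impI)
      fix a b assume ab: "a < 2*r" "b < 2*r"
      have "(g * adj g) $$ (a, pr b) = eps (pr b) * hf (rw g a) (rw g b)"
        using gc ab by (simp add: mult_adj_entry)
      then have "eps (pr b) * hf (rw g a) (rw g b) = (if a = pr b then 1 else 0)"
        using L ab by simp
      then have "eps (pr b) * (eps (pr b) * hf (rw g a) (rw g b)) = eps (pr b) * (if a = pr b then 1 else 0)"
        by simp
      then show "hf (rw g a) (rw g b) = (if b = pr a then eps a else 0)"
        using ab by (auto simp: pr_swap)
    qed
  next
    assume R: ?R
    show ?L by (rule eq_matI) (use gc R in \<open>auto simp: mult_adj_entry pr_eq_iff\<close>)
  qed
  then show ?thesis unfolding U_iff_adj by blast
qed

lemma U_carrier: "g \<in> carrier U \<Longrightarrow> g \<in> carrier_mat (2*r) (2*r)"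
  by (simp add: U_iff)

lemma U_rows: "g \<in> carrier U \<Longrightarrow> a < 2*r \<Longrightarrow> b < 2*r \<Longrightarrow>
    hf (rw g a) (rw g b) = (if b = pr a then eps a else 0)"
  by (simp add: U_iff)

lemma U_mult_eq [simp]: "monoid.mult U = (*)" and U_one [simp]: "\<one>\<^bsub>U\<^esub> = 1\<^sub>m (2*r)"
  by (simp_all add: unitary_group_def)

lemma hf_mult:
  assumes h: "h \<in> carrier U"
  shows "hf (\<lambda>b. \<Sum>c<2*r. z c * h $$ (c, b)) (\<lambda>b. \<Sum>c<2*r. w c * h $$ (c, b)) = hf z w"
proof -
  have "hf (\<lambda>b. \<Sum>c<2*r. z c * h $$ (c, b)) (\<lambda>b. \<Sum>c<2*r. w c * h $$ (c, b)) =
      (\<Sum>c<2*r. \<Sum>d<2*r. z c * cj (w d) * hf (rw h c) (rw h d))"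
    unfolding rw_def[abs_def] hf_sum_left hf_sum_right hf_scale_left hf_scale_right
    by (simp add: sum_distrib_left mult.assoc)
  also have "\<dots> = (\<Sum>c<2*r. \<Sum>d<2*r. if d = pr c then eps c * z c * cj (w (pr c)) else 0)"
    using U_rows[OF h] by (intro sum.cong) auto
  also have "\<dots> = hf z w"
    unfolding hf_def by (intro sum.cong) auto
  finally show ?thesis .
qed

lemma rw_mult:
  "g \<in> carrier_mat (2*r) (2*r) \<Longrightarrow> h \<in> carrier_mat (2*r) (2*r) \<Longrightarrow> a < 2*r \<Longrightarrow> b < 2*r \<Longrightarrow>
    rw (g * h) a b = (\<Sum>c<2*r. rw g a c * h $$ (c, b))"
  by (simp add: rw_def mult_entry del: index_mult_mat)

lemma U_mult [simp]:
  assumes g: "g \<in> carrier U" and h: "h \<in> carrier U" shows "g * h \<in> carrier U"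
  unfolding U_iff
proof (intro conjI allI impI)
  note gc = U_carrier[OF g] and hc = U_carrier[OF h]
  show "g * h \<in> carrier_mat (2*r) (2*r)" using gc hc by auto
  fix a b assume ab: "a < 2*r" "b < 2*r"
  have "hf (rw (g * h) a) (rw (g * h) b) =
      hf (\<lambda>b. \<Sum>c<2*r. rw g a c * h $$ (c, b)) (\<lambda>b'. \<Sum>c<2*r. rw g b c * h $$ (c, b'))"
    using gc hc ab by (intro hf_cong) (auto simp: rw_mult)
  then show "hf (rw (g * h) a) (rw (g * h) b) = (if b = pr a then eps a else 0)"
    using hf_mult[OF h] U_rows[OF g] ab by simp
qed

lemma U_adj [simp]: "g \<in> carrier U \<Longrightarrow> adj g \<in> carrier U"
  unfolding U_iff_adj using adj_adj adj_left_iff_right by auto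

lemma one_U [simp]: "1\<^sub>m (2*r) \<in> carrier U"
proof -
  have "adj (1\<^sub>m (2*r)) = 1\<^sub>m (2*r)"
    by (rule eq_matI) (auto simp: adj_entry pr_eq_iff)
  then show ?thesis by (simp add: U_iff_adj)
qed

lemma group_U: "Group.group U"
proof (rule groupI)
  fix x y z assume "x \<in> carrier U" "y \<in> carrier U" "z \<in> carrier U"
  then show "x \<otimes>\<^bsub>U\<^esub> y \<otimes>\<^bsub>U\<^esub> z = x \<otimes>\<^bsub>U\<^esub> (y \<otimes>\<^bsub>U\<^esub> z)"
    using U_carrier by (auto intro: assoc_mult_mat)
next
  fix x assume x: "x \<in> carrier U"
  then show "\<exists>y\<in>carrier U. y \<otimes>\<^bsub>U\<^esub> x = \<one>\<^bsub>U\<^esub>"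
    using U_adj[OF x] adj_left_iff_right[OF U_carrier[OF x]] U_iff_adj by auto
qed (use U_carrier in \<open>auto intro: left_mult_one_mat\<close>)

sublocale U: Group.group U by (rule group_U)

lemma inv_U: "g \<in> carrier U \<Longrightarrow> inv\<^bsub>U\<^esub> g = adj g"
  using adj_left_iff_right[OF U_carrier, of g] U_iff_adj[of g] U_adj[of g]
  by (intro U.inv_equality) auto

lemma U_assoc: "x \<in> carrier U \<Longrightarrow> y \<in> carrier U \<Longrightarrow> z \<in> carrier U \<Longrightarrow> x * y * z = x * (y * z)"
  using U.m_assoc[of x y z] by simp

lemma U_adj_left [simp]: "g \<in> carrier U \<Longrightarrow> adj g * g = 1\<^sub>m (2*r)"
  and U_adj_right [simp]: "g \<in> carrier U \<Longrightarrow> g * adj g = 1\<^sub>m (2*r)"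
  using U.l_inv[of g] U.r_inv[of g] by (auto simp: inv_U)

lemma U_one_left [simp]: "g \<in> carrier U \<Longrightarrow> 1\<^sub>m (2*r) * g = g"
  and U_one_right [simp]: "g \<in> carrier U \<Longrightarrow> g * 1\<^sub>m (2*r) = g"
  using U.l_one[of g] U.r_one[of g] by auto

lemma adj_one [simp]: "adj (1\<^sub>m (2*r)) = 1\<^sub>m (2*r)"
  using U.inv_one by (simp add: inv_U)

lemma U_adj_cancel:
  assumes "g \<in> carrier U" "h \<in> carrier U"
  shows "adj g * (g * h) = h" "g * (adj g * h) = h" "h * g * adj g = h" "h * adj g * g = h"
proof -
  show "adj g * (g * h) = h" "g * (adj g * h) = h"
    using U_assoc[of "adj g" g h] U_assoc[of g "adj g" h] assms by simp_all
  show "h * g * adj g = h" "h * adj g * g = h"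
    using U_assoc[of h "adj g" g] U_assoc[of h g "adj g"] assms by simp_all
qed

text \<open>The size allowed to coordinate \<open>a\<close> of a lattice vector. Both lattices have
  the form \<open>v (x $ i) \<le> wt s i\<close>, which lets one argument serve \<open>K\<close> and
  \<open>L\<close>.\<close>

definition wt :: "'e \<Rightarrow> nat \<Rightarrow> real" where "wt s a = (if a < r then 1 else v s)"

text \<open>For \<open>s = 1\<close> this is \<open>K\<^sub>r\<close>, for \<open>s = unif\<close> it is \<open>L\<^sub>r\<close>.\<close>

definition Ks :: "'e \<Rightarrow> 'e mat set" where
  "Ks s = {g \<in> carrier U. \<forall>a<2*r. \<forall>b<2*r. v (g $$ (a, b)) * wt s b \<le> wt s a}"

lemma wt_pos [simp]: "s \<noteq> 0 \<Longrightarrow> 0 < wt s a" by (simp add: wt_def)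

lemma wt_nonneg [simp]: "0 \<le> wt s a" by (simp add: wt_def)

lemma wt_pr: "a < 2*r \<Longrightarrow> wt s a * wt s (pr a) = v s"
  by (auto simp: wt_def pr_def)

lemma Ks_U: "g \<in> Ks s \<Longrightarrow> g \<in> carrier U" by (simp add: Ks_def)

lemma Ks_entry: "g \<in> Ks s \<Longrightarrow> a < 2*r \<Longrightarrow> b < 2*r \<Longrightarrow> v (g $$ (a, b)) * wt s b \<le> wt s a"
  by (simp add: Ks_def)

lemma mult_entry_le:
  assumes "A \<in> carrier_mat (2*r) (2*r)" "B \<in> carrier_mat (2*r) (2*r)" "a < 2*r" "b < 2*r" "s \<noteq> 0" "0 \<le> c"
    and A: "\<And>k. k < 2*r \<Longrightarrow> v (A $$ (a, k)) * wt s k \<le> c * wt s a"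
    and B: "\<And>k. k < 2*r \<Longrightarrow> v (B $$ (k, b)) * wt s b \<le> d * wt s k"
  shows "v ((A * B) $$ (a, b)) * wt s b \<le> c * d * wt s a"
proof -
  have d: "0 \<le> d" if "0 < 2*r"
  proof -
    have "0 \<le> d * wt s 0" using B[OF that] by (rule order_trans[rotated]) simp
    then show ?thesis using assms(5) by (simp add: zero_le_mult_iff) (metis not_le wt_pos)
  qed
  have "v (A $$ (a, k) * B $$ (k, b)) \<le> c * d * wt s a / wt s b" if k: "k < 2*r" for k
  proof -
    have "(v (A $$ (a, k)) * wt s k) * (v (B $$ (k, b)) * wt s b) \<le> (c * wt s a) * (d * wt s k)"
      by (rule mult_mono[OF A[OF k] B[OF k]]) (use assms in auto)
    then have "wt s k * (v (A $$ (a, k) * B $$ (k, b)) * wt s b) \<le> wt s k * (c * d * wt s a)"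
      by (simp add: v_mult algebra_simps)
    then have "v (A $$ (a, k) * B $$ (k, b)) * wt s b \<le> c * d * wt s a"
      using assms by (simp add: mult_le_cancel_left_pos)
    then show ?thesis using assms by (simp add: pos_le_divide_eq)
  qed
  then have "v ((A * B) $$ (a, b)) \<le> c * d * wt s a / wt s b"
    using assms d by (subst mult_entry) (auto intro!: v_sum_le)
  then show ?thesis using assms by (simp add: pos_le_divide_eq)
qed

text \<open>The product of the weights of a dual pair is always \<open>v s\<close>, so each lattice
  is its own dual up to a scalar. Hence the bound for entry (pr b, pr a) of \<open>g\<close> is the
  bound for entry (a, b) of \<open>adj g\<close>.\<close>

lemma adj_entry_le:
  assumes "s \<noteq> 0" "a < 2*r" "b < 2*r" "v (g $$ (pr b, pr a)) * wt s (pr a) \<le> c * wt s (pr b)"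
  shows "v (adj g $$ (a, b)) * wt s b \<le> c * wt s a"
proof -
  have "(v (g $$ (pr b, pr a)) * wt s (pr a)) * (wt s a * wt s b) \<le> (c * wt s (pr b)) * (wt s a * wt s b)"
    using assms by (intro mult_right_mono) auto
  also have "(v (g $$ (pr b, pr a)) * wt s (pr a)) * (wt s a * wt s b) =
      (wt s a * wt s (pr a)) * (v (g $$ (pr b, pr a)) * wt s b)" by simp
  also have "(c * wt s (pr b)) * (wt s a * wt s b) = (wt s b * wt s (pr b)) * (c * wt s a)" by simp
  finally have "v s * (v (g $$ (pr b, pr a)) * wt s b) \<le> v s * (c * wt s a)"
    unfolding wt_pr[OF assms(2)] wt_pr[OF assms(3)] .
  then show ?thesis using assms by (simp add: adj_entry v_mult)
qed

lemma Ks_mult: "s \<noteq> 0 \<Longrightarrow> g \<in> Ks s \<Longrightarrow> h \<in> Ks s \<Longrightarrow> g * h \<in> Ks s"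
  using mult_entry_le[of g h _ _ s 1 1] U_carrier by (auto simp: Ks_def)

lemma Ks_adj: "s \<noteq> 0 \<Longrightarrow> g \<in> Ks s \<Longrightarrow> adj g \<in> Ks s"
  using adj_entry_le[of s _ _ g 1] by (auto simp: Ks_def)

lemma Ks_one: "1\<^sub>m (2*r) \<in> Ks s"
  by (auto simp: Ks_def)

lemma subgroupU:
  assumes "A \<subseteq> carrier U" "1\<^sub>m (2*r) \<in> A" "\<And>g h. g \<in> A \<Longrightarrow> h \<in> A \<Longrightarrow> g * h \<in> A" "\<And>g. g \<in> A \<Longrightarrow> adj g \<in> A"
  shows "subgroup A U"
  using assms by (intro subgroup.intro) (auto simp: inv_U subset_iff)

lemma subgroup_Ks: "s \<noteq> 0 \<Longrightarrow> subgroup (Ks s) U"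
  by (intro subgroupU) (auto simp: Ks_mult Ks_adj Ks_one Ks_U)

text \<open>Multiples of unit vectors of exact size \<open>wt s b\<close> detect the entry bounds.
  Conversely the bounds map the lattice into itself, and \<open>adj g\<close> satisfies them as
  well, which gives equality.\<close>

lemma stabilizer_Ks:
  assumes s: "s \<noteq> 0"
  shows "stabilizer cj r {x \<in> carrier_vec (2*r). \<forall>i<2*r. v (x $ i) \<le> wt s i} = Ks s" (is "stabilizer cj r ?\<Lambda> = _")
proof (intro Set.set_eqI iffI)
  fix g assume g: "g \<in> stabilizer cj r ?\<Lambda>"
  then have gU: "g \<in> carrier U" and st: "\<And>x. x \<in> ?\<Lambda> \<Longrightarrow> g *\<^sub>v x \<in> ?\<Lambda>" by (auto simp: stabilizer_def)
  note gc = U_carrier[OF gU]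
  show "g \<in> Ks s"
    unfolding Ks_def
  proof (intro CollectI conjI allI impI gU)
    fix a b assume ab: "a < 2*r" "b < 2*r"
    obtain c where c: "v c = wt s b"
      by (cases "b < r") (auto simp: wt_def intro: that[of 1] that[of s])
    define x where "x = c \<cdot>\<^sub>v unit_vec (2*r) b"
    have xi: "x $ i = (if i = b then c else 0)" if "i < 2*r" for i using that ab by (auto simp: x_def)
    have "x \<in> ?\<Lambda>" using xi c by (auto simp: x_def)
    then have "v ((g *\<^sub>v x) $ a) \<le> wt s a" using st ab by blast
    moreover have "(g *\<^sub>v x) $ a = g $$ (a, b) * c"
    proof -
      have "(g *\<^sub>v x) $ a = (\<Sum>d<2*r. if d = b then g $$ (a, b) * c else 0)"
        using ab gc by (subst mult_vec_entry, simp, simp add: x_def, simp) (rule sum.cong, auto simp: xi)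
      then show ?thesis using ab by simp
    qed
    ultimately show "v (g $$ (a, b)) * wt s b \<le> wt s a" using c by (simp add: v_mult)
  qed
next
  fix g assume g: "g \<in> Ks s"
  have st: "h *\<^sub>v x \<in> ?\<Lambda>" if h: "h \<in> Ks s" and x: "x \<in> ?\<Lambda>" for h x
  proof -
    have hc: "h \<in> carrier_mat (2*r) (2*r)" using h Ks_U U_carrier by blast
    have "v ((h *\<^sub>v x) $ a) \<le> wt s a" if a: "a < 2*r" for a
    proof -
      have "v (h $$ (a, c) * x $ c) \<le> wt s a" if "c < 2*r" for c
        using Ks_entry[OF h a that] x that mult_left_mono[of "v (x $ c)" "wt s c" "v (h $$ (a, c))"]
        by (simp add: v_mult)
      then show ?thesis using x hc a by (subst mult_vec_entry) (auto intro!: v_sum_le)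
    qed
    then show ?thesis using hc x by auto
  qed
  have gU: "g \<in> carrier U" using g Ks_U by blast
  have "(\<lambda>x. g *\<^sub>v x) ` ?\<Lambda> = ?\<Lambda>"
  proof
    show "(\<lambda>x. g *\<^sub>v x) ` ?\<Lambda> \<subseteq> ?\<Lambda>" using st[OF g] by blast
    show "?\<Lambda> \<subseteq> (\<lambda>x. g *\<^sub>v x) ` ?\<Lambda>"
    proof
      fix x assume x: "x \<in> ?\<Lambda>"
      have "g *\<^sub>v (adj g *\<^sub>v x) = x"
        using x U_carrier[OF gU] gU by (subst assoc_mult_mat_vec[symmetric]) auto
      then show "x \<in> (\<lambda>x. g *\<^sub>v x) ` ?\<Lambda>" using st[OF Ks_adj[OF s g] x]
        by (intro image_eqI[of x _ "adj g *\<^sub>v x"]) (simp_all only:)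
    qed
  qed
  then show "g \<in> stabilizer cj r ?\<Lambda>" using gU by (simp add: stabilizer_def)
qed

lemma group_K_eq: "group_K v cj r = Ks 1"
proof -
  have "lattice_K v r = {x \<in> carrier_vec (2*r). \<forall>i<2*r. v (x $ i) \<le> wt 1 i}"
    by (auto simp: lattice_K_def integers_of_def wt_def)
  then show ?thesis unfolding group_K_def using stabilizer_Ks[of 1] by simp
qed

lemma group_L_eq: "group_L v cj unif r = Ks unif"
proof -
  have u: "x \<in> (\<lambda>y. unif * y) ` integers_of v UNIV \<longleftrightarrow> v x \<le> v unif" for x
  proof
    assume "v x \<le> v unif"
    then have "x / unif \<in> integers_of v UNIV" by (simp add: integers_of_def v_divide)
    then show "x \<in> (\<lambda>y. unif * y) ` integers_of v UNIV" by (intro image_eqI[of _ _ "x / unif"]) auto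
  qed (auto simp: integers_of_def v_mult mult_left_le)
  have "lattice_L v unif r = {x \<in> carrier_vec (2*r). \<forall>i<2*r. v (x $ i) \<le> wt unif i}"
    unfolding lattice_L_def u by (auto simp: integers_of_def wt_def)
  then show ?thesis unfolding group_L_def using stabilizer_Ks[of unif] by simp
qed

end

section \<open>Elementary matrices and the Iwasawa decomposition\<close>

context unitary_setting
begin

section \<open>Parabolic subgroups attached to the isotropic flag\<close>

lemma v_le_0 [simp]: "v x \<le> 0 \<longleftrightarrow> x = 0"
  using v_nonneg[of x] v_eq_0[of x] by linarith

text \<open>Row \<open>r + i\<close> with \<open>m \<le> i\<close> is supported on the positions
  from \<open>r + i\<close> on. This is the stabilizer of a partial isotropic flag of row vectors,
  running from the Borel subgroup at \<open>m = 0\<close> (\<open>borel_eq\<close>) to the whole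
  group at \<open>m = r\<close>.\<close>

definition Qg :: "nat \<Rightarrow> 'e mat set" where
  "Qg m = {g \<in> carrier U. \<forall>i. m \<le> i \<longrightarrow> i < r \<longrightarrow>
     (\<forall>j<r. g $$ (r + i, j) = 0 \<and> (j < i \<longrightarrow> g $$ (r + i, r + j) = 0))}"

lemma Qg_U: "g \<in> Qg m \<Longrightarrow> g \<in> carrier U" by (simp add: Qg_def)

lemma Qg_carrier: "g \<in> Qg m \<Longrightarrow> g \<in> carrier_mat (2*r) (2*r)" using Qg_U U_carrier by blast

lemma Qg_zero: "g \<in> Qg m \<Longrightarrow> m \<le> i \<Longrightarrow> i < r \<Longrightarrow> j < r \<Longrightarrow> g $$ (r + i, j) = 0"
  "g \<in> Qg m \<Longrightarrow> m \<le> i \<Longrightarrow> i < r \<Longrightarrow> j < i \<Longrightarrow> g $$ (r + i, r + j) = 0"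
  by (auto simp: Qg_def)

lemma Qg_mono: "m \<le> m' \<Longrightarrow> Qg m \<subseteq> Qg m'" by (auto simp: Qg_def)

lemma Qg_r: "Qg r = carrier U" by (auto simp: Qg_def)

lemma sum_split: "(\<Sum>a<2*r. f a) = (\<Sum>k<r. f k) + (\<Sum>k<r. f (r + k))"
proof -
  have "{..<2*r} = {..<r} \<union> {r..<r+r}" by auto
  then have "(\<Sum>a<2*r. f a) = sum f {..<r} + sum f {r..<r+r}"
    by (simp add: sum.union_disjoint ivl_disj_int)
  also have "sum f {r..<r+r} = (\<Sum>k<r. f (r + k))"
    using sum.shift_bounds_nat_ivl[of f 0 r r] by (simp add: atLeast0LessThan add.commute)
  finally show ?thesis .
qed

text \<open>The shape of the bottom rows forces zeros in the dual columns: row \<open>a\<close> is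
  paired with row \<open>r + j\<close>, where the terms with \<open>k < j\<close> vanish by the
  shape of row \<open>r + j\<close> and those with \<open>k > j\<close> by induction, which descends
  from the last column.\<close>

lemma Qg_column:
  assumes g: "g \<in> Qg m" and j: "m \<le> j" "j < r"
  shows "g $$ (j, j) * cj (g $$ (r + j, r + j)) = 1"
    "a < 2*r \<Longrightarrow> r \<le> a \<or> a < j \<Longrightarrow> g $$ (a, j) = 0"
proof -
  have "g $$ (j, j) * cj (g $$ (r + j, r + j)) = 1 \<and>
    (\<forall>a<2*r. r \<le> a \<or> a < j \<longrightarrow> g $$ (a, j) = 0)"
    using j
  proof (induction "r - j" arbitrary: j rule: less_induct)
    case less
    have key: "g $$ (a, j) * cj (g $$ (r + j, r + j)) = (if a = j then 1 else 0)"
      if a: "a < 2*r" "r \<le> a \<or> a \<le> j" for a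
    proof -
      have z: "g $$ (a, k) * cj (g $$ (r + j, r + k)) = 0" if "k < r" "k \<noteq> j" for k
      proof (cases "k < j")
        case True then show ?thesis using Qg_zero(2)[OF g] less.prems by simp
      next
        case False
        then have "g $$ (a, k) = 0" using less.hyps[of k] less.prems that a by auto
        then show ?thesis by simp
      qed
      have "hf (rw g a) (rw g (r + j)) = (\<Sum>k<r. g $$ (a, k) * cj (g $$ (r + j, r + k)))"
        unfolding hf_def sum_split using Qg_zero(1)[OF g] less.prems
        by (simp add: eps_def pr_def rw_def add.commute)
      also have "\<dots> = (\<Sum>k<r. if k = j then g $$ (a, j) * cj (g $$ (r + j, r + j)) else 0)"
        using z by (intro sum.cong) auto
      finally have "hf (rw g a) (rw g (r + j)) = g $$ (a, j) * cj (g $$ (r + j, r + j))"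
        using less.prems by simp
      moreover have "hf (rw g a) (rw g (r + j)) = (if r + j = pr a then eps a else 0)"
        using U_rows[OF Qg_U[OF g]] a less.prems by simp
      ultimately show ?thesis using a less.prems by (auto simp: pr_def eps_def split: if_splits)
    qed
    have 1: "g $$ (j, j) * cj (g $$ (r + j, r + j)) = 1" using key[of j] less.prems by simp
    then have "g $$ (r + j, r + j) \<noteq> 0" by auto
    moreover have "g $$ (a, j) * cj (g $$ (r + j, r + j)) = 0" if "a < 2*r" "r \<le> a \<or> a < j" for a
      using key[of a] that less.prems by (auto split: if_splits)
    ultimately show ?case using 1 by simp
  qed
  then show "g $$ (j, j) * cj (g $$ (r + j, r + j)) = 1"
    "a < 2*r \<Longrightarrow> r \<le> a \<or> a < j \<Longrightarrow> g $$ (a, j) = 0" by auto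
qed

lemma Qg_mult: assumes g: "g \<in> Qg m" and h: "h \<in> Qg m" shows "g * h \<in> Qg m"
proof -
  have "(g * h) $$ (r + i, b) = 0" if i: "m \<le> i" "i < r" and b: "b < r \<or> (\<exists>j<i. b = r + j)" for i b
  proof -
    have "(g * h) $$ (r + i, b) = (\<Sum>c<2*r. g $$ (r + i, c) * h $$ (c, b))"
      using g h i b by (intro mult_entry) (auto intro: Qg_carrier)
    also have "\<dots> = (\<Sum>k<r. g $$ (r + i, k) * h $$ (k, b)) + (\<Sum>k<r. g $$ (r + i, r + k) * h $$ (r + k, b))"
      by (rule sum_split)
    also have "(\<Sum>k<r. g $$ (r + i, k) * h $$ (k, b)) = 0"
      using Qg_zero[OF g i] by (intro sum.neutral) auto
    also have "(\<Sum>k<r. g $$ (r + i, r + k) * h $$ (r + k, b)) = 0"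
    proof (intro sum.neutral ballI)
      fix k assume k: "k \<in> {..<r}"
      show "g $$ (r + i, r + k) * h $$ (r + k, b) = 0"
      proof (cases "k < i")
        case True then show ?thesis using Qg_zero[OF g i] by simp
      next
        case False
        then have mk: "m \<le> k" "k < r" using i k by auto
        have "h $$ (r + k, b) = 0"
        proof (cases "b < r")
          case True then show ?thesis using Qg_zero(1)[OF h mk] by simp
        next
          case f: False
          then obtain j where "j < i" "b = r + j" using b by blast
          then show ?thesis using Qg_zero(2)[OF h mk, of j] False by simp
        qed
        then show ?thesis by simp
      qed
    qed
    finally have "(g * h) $$ (r + i, b) = 0" by simp
    then show ?thesis .
  qed
  then show ?thesis using g h by (auto simp: Qg_def)
qed

lemma Qg_adj: assumes g: "g \<in> Qg m" shows "adj g \<in> Qg m"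
  using Qg_column(2)[OF g] Qg_U[OF g] by (auto simp: Qg_def adj_entry pr_def)

lemma Qg_one: "1\<^sub>m (2*r) \<in> Qg m"
  by (auto simp: Qg_def)

lemma subgroup_Qg: "subgroup (Qg m) U"
  by (intro subgroupU) (auto simp: Qg_mult Qg_adj Qg_one Qg_U)

text \<open>Pairing row \<open>j\<close> with row \<open>r + i\<close> yields the triangular shape
  of the lower right block from that of the upper left one, by induction on \<open>j\<close>. In the
  other direction, the relation between the diagonal blocks is the lower right block of
  \<open>adj g * g = 1\<close>.\<close>

lemma borel_eq: "borel_subgroup cj r = Qg 0"
proof (intro Set.set_eqI iffI)
  fix g assume "g \<in> borel_subgroup cj r"
  then obtain a b d where gU: "g \<in> carrier U" and abd: "a \<in> carrier_mat r r" "b \<in> carrier_mat r r" "d \<in> carrier_mat r r"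
    and up: "upper_triangular (transpose_mat a)" and ge: "g = four_block_mat a b (0\<^sub>m r r) d"
    by (auto simp: borel_subgroup_def)
  have C: "g $$ (r + i, j) = 0" if "i < r" "j < r" for i j using abd that by (simp add: ge)
  have A: "g $$ (i, j) = 0" if "i < j" "j < r" for i j
  proof -
    have "transpose_mat a $$ (j, i) = 0"
      using up that abd unfolding upper_triangular_def by auto
    then show ?thesis using abd that by (simp add: ge)
  qed
  have D: "g $$ (r + i, r + j) = 0 \<and> g $$ (j, j) \<noteq> 0" if "j < i" "i < r" for i j
  proof -
    have "g $$ (j, j) \<noteq> 0 \<and> (\<forall>i<r. j < i \<longrightarrow> g $$ (r + i, r + j) = 0)" if "j < r" for j
      using that
    proof (induction j rule: less_induct)
      case (less j)
      have key: "g $$ (j, j) * cj (g $$ (r + i, r + j)) = (if i = j then 1 else 0)" if i: "j \<le> i" "i < r" for i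
      proof -
        have "hf (rw g j) (rw g (r + i)) = (\<Sum>k<r. g $$ (j, k) * cj (g $$ (r + i, r + k)))"
          unfolding hf_def sum_split using C i
          by (simp add: eps_def pr_def rw_def add.commute)
        also have "\<dots> = (\<Sum>k<r. if k = j then g $$ (j, j) * cj (g $$ (r + i, r + j)) else 0)"
        proof (rule sum.cong)
          fix k assume k: "k \<in> {..<r}"
          consider "k < j" | "k = j" | "j < k" by linarith
          then show "g $$ (j, k) * cj (g $$ (r + i, r + k)) =
              (if k = j then g $$ (j, j) * cj (g $$ (r + i, r + j)) else 0)"
          proof cases
            case 1
            then show ?thesis using less.IH[of k] less.prems i by simp
          qed (use A k in auto)
        qed simp
        finally show ?thesis using U_rows[OF gU, of j "r + i"] i less.prems
          by (auto simp: pr_def eps_def)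
      qed
      have nz: "g $$ (j, j) \<noteq> 0" using key[of j] less.prems by auto
      moreover have "g $$ (r + i, r + j) = 0" if "i < r" "j < i" for i
        using key[of i] that nz by simp
      ultimately show ?case by blast
    qed
    then show ?thesis using that by auto
  qed
  show "g \<in> Qg 0" using gU C D by (auto simp: Qg_def)
next
  fix g assume g: "g \<in> Qg 0"
  note gc = Qg_carrier[OF g]
  define a where "a = mat r r (\<lambda>(i, j). g $$ (i, j))"
  define b where "b = mat r r (\<lambda>(i, j). g $$ (i, r + j))"
  define d where "d = mat r r (\<lambda>(i, j). g $$ (r + i, r + j))"
  have "transpose_mat (map_mat cj a) * d = 1\<^sub>m r"
  proof (rule eq_matI)
    fix i j assume "i < dim_row (1\<^sub>m r :: 'e mat)" "j < dim_col (1\<^sub>m r :: 'e mat)"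
    then have ij: "i < r" "j < r" by auto
    have "(transpose_mat (map_mat cj a) * d) $$ (i, j) = (\<Sum>k<r. cj (g $$ (k, i)) * g $$ (r + k, r + j))"
      using ij by (auto simp: index_mult_mat(1) a_def d_def scalar_prod_def atLeast0LessThan intro!: sum.cong)
    also have "\<dots> = (adj g * g) $$ (r + i, r + j)"
    proof -
      have "(adj g * g) $$ (r + i, r + j) = (\<Sum>c<2*r. adj g $$ (r + i, c) * g $$ (c, r + j))"
        using gc ij by (intro mult_entry) auto
      also have "\<dots> = (\<Sum>k<r. cj (g $$ (k, i)) * g $$ (r + k, r + j))"
        unfolding sum_split using ij Qg_column(2)[OF g, of i]
        by (simp add: adj_entry eps_def pr_def)
      finally show ?thesis by simp
    qed
    finally show "(transpose_mat (map_mat cj a) * d) $$ (i, j) = (1\<^sub>m r :: 'e mat) $$ (i, j)"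
      using Qg_U[OF g] ij by simp
  qed (auto simp: a_def d_def)
  then have inv: "inverts_mat (transpose_mat (map_mat cj a)) d"
    by (simp add: inverts_mat_def a_def)
  have ge: "g = four_block_mat a b (0\<^sub>m r r) d"
  proof (rule eq_matI)
    fix i j assume "i < dim_row (four_block_mat a b (0\<^sub>m r r) d)" "j < dim_col (four_block_mat a b (0\<^sub>m r r) d)"
    then have ij: "i < r + r" "j < r + r" by (simp_all add: a_def d_def)
    show "g $$ (i, j) = four_block_mat a b (0\<^sub>m r r) d $$ (i, j)"
      using ij Qg_zero(1)[OF g, of "i - r" j] by (auto simp: a_def b_def d_def)
  qed (use gc in \<open>auto simp: a_def d_def\<close>)
  have up: "upper_triangular (transpose_mat a)"
    using Qg_column(2)[OF g] by (auto simp: upper_triangular_def a_def)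
  have "a \<in> carrier_mat r r" "b \<in> carrier_mat r r" "d \<in> carrier_mat r r"
    by (simp_all add: a_def b_def d_def)
  then show "g \<in> borel_subgroup cj r"
    using Qg_U[OF g] inv ge up unfolding borel_subgroup_def by blast
qed

lemma Qg0_diag_mult: assumes g: "g \<in> Qg 0" and h: "h \<in> Qg 0" and i: "i < r"
  shows "(g * h) $$ (i, i) = g $$ (i, i) * h $$ (i, i)"
proof -
  have "(g * h) $$ (i, i) = (\<Sum>c<2*r. g $$ (i, c) * h $$ (c, i))"
    using g h i by (intro mult_entry) (auto intro: Qg_carrier)
  also have "\<dots> = (\<Sum>c<2*r. if c = i then g $$ (i, i) * h $$ (i, i) else 0)"
  proof (rule sum.cong)
    fix c assume "c \<in> {..<2*r}"
    then show "g $$ (i, c) * h $$ (c, i) = (if c = i then g $$ (i, i) * h $$ (i, i) else 0)"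
      using Qg_column(2)[OF h, of i c] Qg_column(2)[OF g, of c i] i
      by (cases "c < r"; cases c i rule: linorder_cases) auto
  qed simp
  finally show ?thesis using i by simp
qed

lemma Qg0_diag_nz: "g \<in> Qg 0 \<Longrightarrow> i < r \<Longrightarrow> g $$ (i, i) \<noteq> 0"
  using Qg_column(1)[of g 0 i] by auto

text \<open>A copy of the unitary group of rank \<open>m\<close>, acting on the coordinates of level
  below \<open>m\<close> only. Recording it lets compact factors commute later with torus elements
  at level \<open>m\<close>.\<close>

definition blk :: "nat \<Rightarrow> 'e mat \<Rightarrow> bool" where
  "blk m g \<longleftrightarrow> g \<in> carrier U \<and>
     (\<forall>a<2*r. \<forall>b<2*r. m \<le> lev a \<or> m \<le> lev b \<longrightarrow> g $$ (a, b) = (if a = b then 1 else 0))"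

lemma blk_U: "blk m g \<Longrightarrow> g \<in> carrier U" by (simp add: blk_def)

lemma blk_entry: "blk m g \<Longrightarrow> a < 2*r \<Longrightarrow> b < 2*r \<Longrightarrow> m \<le> lev a \<or> m \<le> lev b \<Longrightarrow>
    g $$ (a, b) = (if a = b then 1 else 0)"
  unfolding blk_def by blast

lemma blk_mono: "m \<le> m' \<Longrightarrow> blk m g \<Longrightarrow> blk m' g"
  by (auto simp: blk_def)

lemma blk_mult: assumes g: "blk m g" and h: "blk m h" shows "blk m (g * h)"
  unfolding blk_def
proof (intro conjI allI impI)
  show "g * h \<in> carrier U" using g h blk_U by simp
  fix a b assume ab: "a < 2*r" "b < 2*r" "m \<le> lev a \<or> m \<le> lev b"
  have "(g * h) $$ (a, b) = (\<Sum>c<2*r. g $$ (a, c) * h $$ (c, b))"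
    using g h ab by (intro mult_entry) (auto intro: blk_U U_carrier)
  also have "\<dots> = (if a = b then 1 else 0)"
  proof (cases "m \<le> lev a")
    case True
    then have "(\<Sum>c<2*r. g $$ (a, c) * h $$ (c, b)) = (\<Sum>c<2*r. if c = a then h $$ (a, b) else 0)"
      using ab blk_entry[OF g] by (intro sum.cong) auto
    then show ?thesis using ab True blk_entry[OF h] by simp
  next
    case False
    then have "(\<Sum>c<2*r. g $$ (a, c) * h $$ (c, b)) = (\<Sum>c<2*r. if c = b then g $$ (a, b) else 0)"
      using ab blk_entry[OF h] by (intro sum.cong) auto
    then show ?thesis using ab False blk_entry[OF g] by simp
  qed
  finally show "(g * h) $$ (a, b) = (if a = b then 1 else 0)" .
qed

lemma blk_adj: "blk m g \<Longrightarrow> blk m (adj g)"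
  by (auto simp: blk_def adj_entry pr_eq_iff)

lemma blk_one: "blk m (1\<^sub>m (2*r))"
  by (simp add: blk_def)

lemma blk_Qg: "blk m g \<Longrightarrow> g \<in> Qg m"
  by (auto simp: Qg_def blk_U blk_entry lev_def)

text \<open>An Eichler transformation: row \<open>i\<close> is prescribed, and orthogonality then
  forces the entries of column \<open>pr i\<close>. It is unitary when the prescribed row is
  isotropic with entry 1 at \<open>i\<close>.\<close>

definition rowE :: "nat \<Rightarrow> (nat \<Rightarrow> 'e) \<Rightarrow> 'e mat" where
  "rowE i \<rho> = mat (2*r) (2*r) (\<lambda>(a, b). if a = i then \<rho> b
     else if a \<noteq> pr i \<and> b = pr i then eps i * eps a * cj (\<rho> (pr a)) else if a = b then 1 else 0)"

lemma rowE_carrier [simp]: "rowE i \<rho> \<in> carrier_mat (2*r) (2*r)"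
  by (simp add: rowE_def)

lemma rowE_entry: "a < 2*r \<Longrightarrow> b < 2*r \<Longrightarrow> rowE i \<rho> $$ (a, b) = (if a = i then \<rho> b
     else if a \<noteq> pr i \<and> b = pr i then eps i * eps a * cj (\<rho> (pr a)) else if a = b then 1 else 0)"
  by (simp add: rowE_def)

lemma hf_rowE_row:
  assumes i: "i < 2*r" and a: "a < 2*r" "a \<noteq> i"
  shows "hf z (rw (rowE i \<rho>) a) =
    eps (pr a) * z (pr a) + (if a = pr i then 0 else eps a * \<rho> (pr a) * z i)"
proof -
  have "hf z (rw (rowE i \<rho>) a) =
     hf z (\<lambda>b. dl a b + (if a = pr i then 0 else eps i * eps a * cj (\<rho> (pr a))) * dl (pr i) b)"
    using i a by (intro hf_cong) (auto simp: rw_def rowE_entry dl_def pr_swap)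
  then show ?thesis using i a
    by (simp add: hf_add_right hf_scale_right hf_dl_right)
qed

lemma rowE_U:
  assumes i: "i < 2*r" and \<rho>: "\<rho> i = 1" "hf \<rho> \<rho> = 0"
  shows "rowE i \<rho> \<in> carrier U"
  unfolding U_iff
proof (intro conjI allI impI)
  fix a b assume ab: "a < 2*r" "b < 2*r"
  have row_i: "hf z (rw (rowE i \<rho>) i) = hf z \<rho>" "hf (rw (rowE i \<rho>) i) z = hf \<rho> z" for z
    using i by (auto intro!: hf_cong simp: rw_def rowE_entry)
  show "hf (rw (rowE i \<rho>) a) (rw (rowE i \<rho>) b) = (if b = pr a then eps a else 0)"
  proof (cases "b = i")
    case False
    show ?thesis
    proof (cases "a = i")
      case True
      then show ?thesis using ab i \<rho> False
        by (auto simp: row_i(2) hf_rowE_row eps_pr pr_swap pr_neq)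
    next
      case a: False
      have e: "rw (rowE i \<rho>) a i = 0" using ab i a pr_neq[OF i] by (auto simp: rw_def rowE_entry pr_swap)
      show ?thesis using ab i a False e pr_neq[OF i] \<rho>
        by (auto simp: hf_rowE_row rw_def rowE_entry pr_swap eps_pr pr_eq_iff)
    qed
  next
    case b: True
    show ?thesis
    proof (cases "a = i")
      case True then show ?thesis using b \<rho> pr_neq[OF i] by (simp add: row_i)
    next
      case False
      have "hf (rw (rowE i \<rho>) a) (rw (rowE i \<rho>) i) = - cj (hf \<rho> (rw (rowE i \<rho>) a))"
        by (subst hf_skew) (simp add: row_i)
      then show ?thesis using b ab i \<rho> False
        by (auto simp: hf_rowE_row eps_pr pr_swap)
    qed
  qed
qed simp

text \<open>This is a clearing step: off the columns \<open>i\<close> and \<open>pr i\<close>, a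
  multiple of \<open>\<rho>\<close> is subtracted from each row. A row that pairs to zero with
  \<open>\<rho>\<close>, in particular one proportional to \<open>\<rho>\<close>, also gets entry 0
  in column \<open>pr i\<close>.\<close>

lemma mult_adj_rowE:
  assumes g: "g \<in> carrier_mat (2*r) (2*r)" and ab: "a < 2*r" "b < 2*r" and i: "i < 2*r"
  shows "(g * adj (rowE i \<rho>)) $$ (a, b) = (if b = i then g $$ (a, i)
    else if b = pr i then - (eps i * hf (rw g a) \<rho>) else g $$ (a, b) - g $$ (a, i) * \<rho> b)"
proof -
  have "(g * adj (rowE i \<rho>)) $$ (a, b) = eps b * hf (rw g a) (rw (rowE i \<rho>) (pr b))"
    by (rule mult_adj_entry[OF g ab])
  moreover consider "b = i" | "b = pr i" | "b \<noteq> i" "b \<noteq> pr i" by blast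
  then have "eps b * hf (rw g a) (rw (rowE i \<rho>) (pr b)) = (if b = i then g $$ (a, i)
    else if b = pr i then - (eps i * hf (rw g a) \<rho>) else g $$ (a, b) - g $$ (a, i) * \<rho> b)"
  proof cases
    case 1
    then show ?thesis using i pr_neq[OF i] hf_rowE_row[OF i, of "pr i"] by (simp add: rw_def)
  next
    case 2
    have "hf (rw g a) (rw (rowE i \<rho>) i) = hf (rw g a) \<rho>"
      using i by (intro hf_cong) (auto simp: rw_def rowE_entry)
    then show ?thesis using 2 i pr_neq[OF i] by (simp add: eps_pr)
  next
    case 3
    then have "pr b \<noteq> i" "pr b \<noteq> pr i" using ab i by (auto simp: pr_swap pr_eq_iff)
    then have "eps b * hf (rw g a) (rw (rowE i \<rho>) (pr b)) =
        eps b * (eps b * g $$ (a, b) - eps b * \<rho> b * g $$ (a, i))"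
      using ab i 3 hf_rowE_row[OF i, of "pr b" "rw g a" \<rho>] by (simp add: rw_def eps_pr)
    also have "\<dots> = g $$ (a, b) - g $$ (a, i) * \<rho> b" by (simp add: right_diff_distrib mult.assoc)
    finally show ?thesis using 3 by simp
  qed
  ultimately show ?thesis by simp
qed

lemma blk_rowE:
  assumes "i < 2*r" "\<rho> i = 1" "hf \<rho> \<rho> = 0" "lev i < m" "\<And>b. b < 2*r \<Longrightarrow> m \<le> lev b \<Longrightarrow> \<rho> b = 0"
  shows "blk m (rowE i \<rho>)"
  using assms rowE_U[OF assms(1-3)] by (auto simp: blk_def rowE_entry)

text \<open>Only the prescribed row has to be tested: the entries of column \<open>pr i\<close> are,
  up to sign, conjugates of entries of that row, and \<open>wt_pr\<close> carries the bound
  over.\<close>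

lemma rowE_Ks:
  assumes s: "s \<noteq> 0" and i: "i < 2*r" and \<rho>: "\<rho> i = 1" "hf \<rho> \<rho> = 0"
    and le: "\<And>b. b < 2*r \<Longrightarrow> v (\<rho> b) * wt s b \<le> wt s i"
  shows "rowE i \<rho> \<in> Ks s"
  unfolding Ks_def
proof (intro CollectI conjI allI impI)
  show "rowE i \<rho> \<in> carrier U" by (rule rowE_U[OF i \<rho>])
  fix a b assume ab: "a < 2*r" "b < 2*r"
  show "v (rowE i \<rho> $$ (a, b)) * wt s b \<le> wt s a"
  proof (cases "a \<noteq> i \<and> a \<noteq> pr i \<and> b = pr i")
    case True
    have "(v (\<rho> (pr a)) * wt s (pr a)) * (wt s a * wt s (pr i)) \<le> wt s i * (wt s a * wt s (pr i))"
      using le[of "pr a"] ab by (intro mult_right_mono) auto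
    also have "(v (\<rho> (pr a)) * wt s (pr a)) * (wt s a * wt s (pr i)) =
       (wt s a * wt s (pr a)) * (v (\<rho> (pr a)) * wt s (pr i))" by simp
    also have "wt s i * (wt s a * wt s (pr i)) = (wt s i * wt s (pr i)) * wt s a" by simp
    finally have "v s * (v (\<rho> (pr a)) * wt s (pr i)) \<le> v s * wt s a"
      unfolding wt_pr[OF ab(1)] wt_pr[OF i] .
    then show ?thesis using True ab i s by (simp add: rowE_entry v_mult)
  next
    case False
    then show ?thesis using ab i le[of b] by (auto simp: rowE_entry)
  qed
qed

section \<open>Monomial matrices: swaps of levels and reflections\<close>

definition mono_mat :: "(nat \<Rightarrow> nat) \<Rightarrow> (nat \<Rightarrow> 'e) \<Rightarrow> 'e mat" where
  "mono_mat \<pi> d = mat (2*r) (2*r) (\<lambda>(a, b). if b = \<pi> a then d a else 0)"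

lemma mono_carrier [simp]: "mono_mat \<pi> d \<in> carrier_mat (2*r) (2*r)"
  by (simp add: mono_mat_def)

lemma mono_entry: "a < 2*r \<Longrightarrow> b < 2*r \<Longrightarrow> mono_mat \<pi> d $$ (a, b) = (if b = \<pi> a then d a else 0)"
  by (simp add: mono_mat_def)

text \<open>The swaps, reflections and torus elements all use involutions, so \<open>\<pi>\<close>
  is its own inverse and no second permutation is carried along. The last clause is unitarity of the
  coefficients.\<close>

definition monomial :: "(nat \<Rightarrow> nat) \<Rightarrow> (nat \<Rightarrow> 'e) \<Rightarrow> bool" where
  "monomial \<pi> d \<longleftrightarrow> (\<forall>a<2*r. \<pi> a < 2*r \<and> \<pi> (\<pi> a) = a \<and> \<pi> (pr a) = pr (\<pi> a) \<and>
     eps (\<pi> a) * d a * cj (d (pr a)) = eps a)"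

lemma mono_U:
  assumes m: "monomial \<pi> d" shows "mono_mat \<pi> d \<in> carrier U"
  unfolding U_iff
proof (intro conjI allI impI)
  fix a b assume ab: "a < 2*r" "b < 2*r"
  have row: "hf (rw (mono_mat \<pi> d) a) (rw (mono_mat \<pi> d) b) =
     hf (\<lambda>c. d a * dl (\<pi> a) c) (\<lambda>c. d b * dl (\<pi> b) c)"
    using ab by (intro hf_cong) (auto simp: rw_def mono_entry dl_def)
  have ma: "\<pi> a < 2*r" "\<pi> (\<pi> a) = a" "\<pi> (pr a) = pr (\<pi> a)" "eps (\<pi> a) * d a * cj (d (pr a)) = eps a"
    and mb: "\<pi> b < 2*r" "\<pi> (\<pi> b) = b" "\<pi> (pr b) = pr (\<pi> b)" using m ab by (auto simp: monomial_def)
  have "\<pi> a = pr (\<pi> b) \<longleftrightarrow> b = pr a"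
  proof
    assume "\<pi> a = pr (\<pi> b)"
    then have "\<pi> (\<pi> a) = \<pi> (\<pi> (pr b))" using mb(3) by metis
    moreover have "\<pi> (\<pi> (pr b)) = pr b" using m pr_less[OF ab(2)] unfolding monomial_def by blast
    ultimately show "b = pr a" using ma(2) ab by simp
  next
    assume "b = pr a"
    then have "pr (\<pi> b) = pr (pr (\<pi> a))" using ma(3) by metis
    then show "\<pi> a = pr (\<pi> b)" using ma(1) by simp
  qed
  then show "hf (rw (mono_mat \<pi> d) a) (rw (mono_mat \<pi> d) b) = (if b = pr a then eps a else 0)"
    unfolding row hf_scale_left hf_scale_right hf_dl_right[OF mb(1)]
    using ma(4) pr_pr[OF ma(1)] ma(3) by (auto simp: dl_def algebra_simps)
qed simp

lemma mult_monomial: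
  assumes "g \<in> carrier_mat (2*r) (2*r)" "monomial \<pi> d" "a < 2*r" "b < 2*r"
  shows "(g * mono_mat \<pi> d) $$ (a, b) = g $$ (a, \<pi> b) * d (\<pi> b)"
proof -
  have "(g * mono_mat \<pi> d) $$ (a, b) = (\<Sum>c<2*r. if c = \<pi> b then g $$ (a, \<pi> b) * d (\<pi> b) else 0)"
    using assms by (subst mult_entry, simp, simp, simp, simp, intro sum.cong)
      (auto simp: mono_entry monomial_def)
  then show ?thesis using assms by (simp add: monomial_def)
qed

lemma monomial_mult:
  assumes "g \<in> carrier_mat (2*r) (2*r)" "monomial \<pi> d" "a < 2*r" "b < 2*r"
  shows "(mono_mat \<pi> d * g) $$ (a, b) = d a * g $$ (\<pi> a, b)"
proof -
  have "(mono_mat \<pi> d * g) $$ (a, b) = (\<Sum>c<2*r. if c = \<pi> a then d a * g $$ (\<pi> a, b) else 0)"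
    using assms by (subst mult_entry, simp, simp, simp, simp, intro sum.cong)
      (auto simp: mono_entry monomial_def)
  then show ?thesis using assms by (simp add: monomial_def)
qed

lemma mono_Ks:
  assumes "monomial \<pi> d" "\<And>a. a < 2*r \<Longrightarrow> v (d a) * wt s (\<pi> a) \<le> wt s a"
  shows "mono_mat \<pi> d \<in> Ks s"
  using assms mono_U[OF assms(1)] by (auto simp: Ks_def mono_entry)

lemma blk_mono_mat:
  assumes "monomial \<pi> d" "\<And>a. a < 2*r \<Longrightarrow> m \<le> lev a \<Longrightarrow> \<pi> a = a \<and> d a = 1"
  shows "blk m (mono_mat \<pi> d)"
proof -
  have "b = \<pi> a \<longleftrightarrow> a = b" if "a < 2*r" "b < 2*r" "m \<le> lev b" for a b
    using assms that unfolding monomial_def by metis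
  then show ?thesis using assms mono_U[OF assms(1)] by (auto simp: blk_def mono_entry)
qed

definition tau :: "nat \<Rightarrow> nat \<Rightarrow> nat \<Rightarrow> nat" where
  "tau j m k = (if k = j then m else if k = m then j else k)"

lemma tau_tau [simp]: "tau j m (tau j m k) = k"
  and tau_less: "j < r \<Longrightarrow> m < r \<Longrightarrow> tau j m k < r \<longleftrightarrow> k < r"
  by (auto simp: tau_def)

definition swap_perm :: "nat \<Rightarrow> nat \<Rightarrow> nat \<Rightarrow> nat" where
  "swap_perm j m a = (if a < r then tau j m a else r + tau j m (a - r))"

lemma swap_monomial:
  assumes "j < r" "m < r" shows "monomial (swap_perm j m) (\<lambda>_. 1)"
  unfolding monomial_def
proof (intro allI impI)
  fix a assume a: "a < 2*r"
  show "swap_perm j m a < 2*r \<and> swap_perm j m (swap_perm j m a) = a \<and>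
      swap_perm j m (pr a) = pr (swap_perm j m a) \<and> eps (swap_perm j m a) * 1 * cj 1 = eps a"
  proof (cases "a < r")
    case True
    then show ?thesis using tau_less[OF assms, of a] by (simp add: swap_perm_def pr_def eps_def)
  next
    case False
    then have "a - r < r" using a by simp
    then show ?thesis using False tau_less[OF assms, of "a - r"] by (simp add: swap_perm_def pr_def eps_def)
  qed
qed

definition flip_perm :: "nat \<Rightarrow> nat \<Rightarrow> nat" where
  "flip_perm m a = (if lev a = m then pr a else a)"

definition flip_coeff :: "'e \<Rightarrow> nat \<Rightarrow> nat \<Rightarrow> 'e" where
  "flip_coeff s m a = (if a = m then - (1 / cj s) else if a = r + m then s else 1)"

text \<open>The element of \<open>Ks s\<close> exchanging \<open>e\<^sub>m\<close> with a multiple of \<open>e\<^sub>r\<^sub>+\<^sub>m\<close>.\<close>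

definition flip :: "'e \<Rightarrow> nat \<Rightarrow> 'e mat" where "flip s m = mono_mat (flip_perm m) (flip_coeff s m)"

lemma flip_monomial:
  assumes s: "s \<noteq> 0" and m: "m < r" shows "monomial (flip_perm m) (flip_coeff s m)"
  unfolding monomial_def
proof (intro allI impI)
  fix a assume a: "a < 2*r"
  have lm: "lev a = m \<longleftrightarrow> a = m \<or> a = r + m" using m a by (auto simp: lev_def)
  show "flip_perm m a < 2*r \<and> flip_perm m (flip_perm m a) = a \<and>
      flip_perm m (pr a) = pr (flip_perm m a) \<and>
      eps (flip_perm m a) * flip_coeff s m a * cj (flip_coeff s m (pr a)) = eps a"
  proof (cases "lev a = m")
    case True
    then have "a = m \<or> a = r + m" using lm by simp
    then have "eps (pr a) * flip_coeff s m a * cj (flip_coeff s m (pr a)) = eps a"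
      using m s by (elim disjE) (simp_all add: flip_coeff_def pr_def eps_def)
    then show ?thesis using a True by (simp add: flip_perm_def)
  next
    case False
    then have "a \<noteq> m" "a \<noteq> r + m" "pr a \<noteq> m" "pr a \<noteq> r + m" using lm m a by (auto simp: pr_def lev_def)
    then show ?thesis using a False by (simp add: flip_perm_def flip_coeff_def)
  qed
qed

lemma flip_Ks:
  assumes s: "s \<noteq> 0" and m: "m < r" shows "flip s m \<in> Ks s"
  unfolding flip_def
proof (rule mono_Ks[OF flip_monomial[OF s m]])
  fix a assume a: "a < 2*r"
  consider "a = m" | "a = r + m" | "a \<noteq> m" "a \<noteq> r + m" by blast
  then show "v (flip_coeff s m a) * wt s (flip_perm m a) \<le> wt s a"
  proof cases
    case 3
    then have "lev a \<noteq> m" using a m by (auto simp: lev_def)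
    then show ?thesis using 3 by (simp add: flip_coeff_def flip_perm_def)
  qed (use s m in \<open>simp_all add: flip_coeff_def flip_perm_def wt_def lev_def pr_def v_divide\<close>)
qed

lemma blk_flip: "s \<noteq> 0 \<Longrightarrow> m < r \<Longrightarrow> blk (Suc m) (flip s m)"
  unfolding flip_def by (intro blk_mono_mat flip_monomial)
    (auto simp: flip_coeff_def flip_perm_def lev_def split: if_splits)

section \<open>Row elimination and the Iwasawa decomposition\<close>

lemma Qg_blk_mult:
  assumes g: "g \<in> Qg m" and k: "blk m k" shows "g * k \<in> Qg m"
  by (rule Qg_mult[OF g blk_Qg[OF k]])

text \<open>The pivot lies in the second half, and strictly dominates the first half. Strictness
  makes the quotients of first-half entries by the pivot at most 1/q, as \<open>Ks unif\<close>
  demands; with a pivot in the first half, quotients of size 1 are admissible for both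
  groups.\<close>

definition ftype :: "nat \<Rightarrow> 'e mat \<Rightarrow> bool" where
  "ftype m g \<longleftrightarrow> (\<exists>j\<le>m. \<forall>k\<le>m. v (g $$ (r + m, k)) < v (g $$ (r + m, r + j)))"

lemma ex_max_nat: fixes f :: "nat \<Rightarrow> real" shows "\<exists>j\<le>m. \<forall>k\<le>m. f k \<le> f j"
proof -
  have "finite (f ` {..m})" "f ` {..m} \<noteq> {}" by auto
  then have "Max (f ` {..m}) \<in> f ` {..m}" by (rule Max_in)
  then obtain j where "j \<le> m" "f j = Max (f ` {..m})" by (metis (no_types, lifting) atMost_iff imageE)
  then show ?thesis by (intro exI[of _ j]) auto
qed

text \<open>A swap brings the largest entry of the relevant half to level \<open>m\<close>, and
  \<open>rowE\<close> then clears all other entries of level at most \<open>m\<close>. Both factors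
  lie in \<open>Ks 1\<close> and in \<open>Ks unif\<close>, so the reduction itself does not
  distinguish the two groups.\<close>

lemma row_elimination:
  assumes g: "g \<in> Qg (Suc m)" and m: "m < r"
  obtains k \<eta> where "k \<in> Ks 1" "k \<in> Ks unif" "blk (Suc m) k" "\<eta> \<noteq> 0"
    "\<And>b. b < 2*r \<Longrightarrow> lev b \<le> m \<Longrightarrow>
      (g * k) $$ (r + m, b) = (if b = (if ftype m g then r + m else m) then \<eta> else 0)"
proof -
  define z where "z b = g $$ (r + m, b)" for b
  define i where "i = (if ftype m g then r + m else m)"
  note gU = Qg_U[OF g] and gc = Qg_carrier[OF g]
  have i2: "i < 2*r" "lev i = m" using m by (auto simp: i_def lev_def)
  have z0: "z j = 0" if "m < j" "j < r" for j
    using Qg_column(2)[OF g, of j "r + m"] that m by (simp add: z_def)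
  \<comment> \<open>If all entries of level at most \<open>m\<close> vanished, row
    \<open>r + m\<close> would be orthogonal to row \<open>m\<close>: at higher levels the
    first-half entries of both rows are zero by \<open>Qg_column\<close>.\<close>
  have active: "\<exists>b<2*r. lev b \<le> m \<and> z b \<noteq> 0"
  proof (rule ccontr)
    assume n: "\<not> ?thesis"
    have "hf (rw g m) z = (\<Sum>a<2*r. 0)"
      unfolding hf_def
    proof (rule sum.cong)
      fix a assume a: "a \<in> {..<2*r}"
      show "eps a * rw g m a * cj (z (pr a)) = 0"
      proof (cases "lev a \<le> m")
        case True then show ?thesis using n a by auto
      next
        case False
        show ?thesis
        proof (cases "a < r")
          case True then show ?thesis using False Qg_column(2)[OF g, of a m] m by (simp add: lev_def rw_def)
        next
          case f: False
          then have "z (pr a) = 0" using False z0[of "pr a"] a by (auto simp: lev_def pr_def)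
          then show ?thesis by simp
        qed
      qed
    qed simp
    moreover have "hf (rw g m) z = hf (rw g m) (rw g (r + m))" by (simp add: z_def[abs_def] rw_def[abs_def])
    ultimately show False using U_rows[OF gU, of m "r + m"] m by (simp add: pr_def)
  qed
  have "\<exists>j\<le>m. z (if ftype m g then r + j else j) \<noteq> 0 \<and>
     (\<forall>k\<le>m. v (z k) \<le> (if ftype m g then v (z (r + j)) / q else v (z j)) \<and>
            v (z (r + k)) \<le> v (z (if ftype m g then r + j else j)))"
  proof (cases "ftype m g")
    case True
    obtain j where j: "j \<le> m" "\<forall>k\<le>m. v (z (r + k)) \<le> v (z (r + j))"
      using ex_max_nat[of m "\<lambda>k. v (z (r + k))"] by auto
    obtain l where l: "l \<le> m" "\<forall>k\<le>m. v (z k) < v (z (r + l))" using True by (auto simp: ftype_def z_def)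
    have lt: "v (z k) < v (z (r + j))" if "k \<le> m" for k using l j that by force
    have "0 < v (z (r + j))" using v_nonneg[of "z 0"] lt[of 0] by linarith
    then have "z (r + j) \<noteq> 0" by simp
    then show ?thesis using True j lt v_step by auto
  next
    case False
    obtain j where j: "j \<le> m" "\<forall>k\<le>m. v (z k) \<le> v (z j)"
      using ex_max_nat[of m "\<lambda>k. v (z k)"] by auto
    have le: "v (z (r + k)) \<le> v (z j)" if "k \<le> m" for k
      using False that j unfolding ftype_def z_def by (meson not_le order_trans less_imp_le)
    have "z j \<noteq> 0"
    proof
      assume zj: "z j = 0"
      obtain b where b: "b < 2*r" "lev b \<le> m" "z b \<noteq> 0" using active by auto
      show False
      proof (cases "b < r")
        case True then show False using b j zj by (simp add: lev_def)
      next
        case f: False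
        then have "v (z b) \<le> v (z j)" using le[of "b - r"] b by (simp add: lev_def)
        then show False using b zj by simp
      qed
    qed
    then show ?thesis using False j le by auto
  qed
  then obtain j where j: "j \<le> m" and zj: "z (if ftype m g then r + j else j) \<noteq> 0" and
    dom1: "\<And>k. k \<le> m \<Longrightarrow> v (z k) \<le> (if ftype m g then v (z (r + j)) / q else v (z j))" and
    dom2: "\<And>k. k \<le> m \<Longrightarrow> v (z (r + k)) \<le> v (z (if ftype m g then r + j else j))" by blast
  define S where "S = mono_mat (swap_perm j m) (\<lambda>_. 1)"
  have jr: "j < r" using j m by simp
  note sm = swap_monomial[OF jr m]
  define z1 where "z1 b = z (swap_perm j m b)" for b
  have z1: "(g * S) $$ (r + m, b) = z1 b" if "b < 2*r" for b
    using mult_monomial[OF gc sm, of "r + m" b] that m by (simp add: S_def z1_def z_def)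
  have z1i: "z1 i = z (if ftype m g then r + j else j)" "z1 i \<noteq> 0"
    using m zj by (auto simp: z1_def i_def swap_perm_def tau_def)
  \<comment> \<open>Cutting off the levels above \<open>m\<close> keeps \<open>rowE\<close> in the
    block. Isotropy survives, because above level \<open>m\<close> one coordinate of every dual pair
    of \<open>z1\<close> is already zero.\<close>
  define \<rho> where "\<rho> b = (if lev b \<le> m then z1 b / z1 i else 0)" for b
  have \<rho>i: "\<rho> i = 1" using z1i i2 by (simp add: \<rho>_def)
  have z10: "z1 b = 0" if "m < lev b" "b < r" for b
    using that z0[of b] j by (simp add: z1_def swap_perm_def tau_def lev_def)
  have S_U: "S \<in> carrier U" unfolding S_def by (rule mono_U[OF sm])
  have hz: "hf z1 z1 = 0"
  proof -
    have "hf z1 z1 = hf (rw (g * S) (r + m)) (rw (g * S) (r + m))"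
      by (intro hf_cong) (auto simp: rw_def z1)
    then show ?thesis using U_rows[OF U_mult[OF gU S_U], of "r + m" "r + m"] m by (simp add: pr_def)
  qed
  have h\<rho>: "z1 i * cj (z1 i) * hf \<rho> \<rho> = hf z1 z1"
    unfolding hf_def sum_distrib_left
  proof (rule sum.cong)
    fix a assume a: "a \<in> {..<2*r}"
    then have "lev (pr a) = lev a" by simp
    moreover have "z1 a * cj (z1 (pr a)) = 0" if "m < lev a"
      using z10[of a] z10[of "pr a"] a that by (cases "a < r") (auto simp: pr_def lev_def)
    ultimately show "z1 i * cj (z1 i) * (eps a * \<rho> a * cj (\<rho> (pr a))) = eps a * z1 a * cj (z1 (pr a))"
      using z1i(2) by (auto simp: \<rho>_def)
  qed simp
  then have \<rho>0: "hf \<rho> \<rho> = 0" using hz z1i by simp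
  have hz\<rho>: "hf z1 \<rho> = 0"
  proof -
    have "hf z1 \<rho> = z1 i * hf \<rho> \<rho>"
      unfolding hf_def sum_distrib_left
      by (rule sum.cong) (use z1i(2) in \<open>auto simp: \<rho>_def\<close>)
    then show ?thesis using \<rho>0 by simp
  qed
  define E where "E = rowE i \<rho>"
  have dom1': "v (z1 k) \<le> (if ftype m g then v (z1 i) / q else v (z1 i))" if "k \<le> m" for k
  proof -
    have "swap_perm j m k \<le> m" using that j m by (auto simp: swap_perm_def tau_def)
    then show ?thesis using dom1[of "swap_perm j m k"] z1i by (simp add: z1_def split: if_splits)
  qed
  have dom2': "v (z1 (r + k)) \<le> v (z1 i)" if "k \<le> m" for k
  proof -
    have "swap_perm j m (r + k) = r + swap_perm j m k" "swap_perm j m k \<le> m"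
      using that j m by (auto simp: swap_perm_def tau_def)
    then show ?thesis using dom2 z1i by (simp add: z1_def)
  qed
  have \<rho>e: "v (\<rho> k) \<le> (if ftype m g then 1 / q else 1)" if "k < r" for k
    using dom1'[of k] that z1i real_q_pos by (auto simp: \<rho>_def v_divide lev_def divide_simps)
  have \<rho>f: "v (\<rho> (r + k)) \<le> 1" if "k < r" for k
    using dom2'[of k] that z1i by (auto simp: \<rho>_def v_divide lev_def)
  have E_Ks: "E \<in> Ks s" if s: "s = 1 \<or> s = unif" for s
    unfolding E_def
  proof (rule rowE_Ks[OF _ i2(1) \<rho>i \<rho>0])
    show "s \<noteq> 0" using s by auto
    fix b assume b: "b < 2*r"
    have vu: "v unif = 1 / q" by (rule v_unif)
    have q1: "1 / real q \<le> 1" using real_q_gt_1 by simp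
    show "v (\<rho> b) * wt s b \<le> wt s i"
    proof (cases "b < r")
      case True
      then show ?thesis using \<rho>e[of b] s vu m q1 by (auto simp: wt_def i_def split: if_splits)
    next
      case False
      then have "v (\<rho> b) \<le> 1" using \<rho>f[of "b - r"] b by auto
      then show ?thesis using s vu m q1 False mult_right_mono[of "v (\<rho> b)" 1 "1 / real q"] real_q_gt_1
        by (auto simp: wt_def i_def split: if_splits)
    qed
  qed
  have S_Ks: "S \<in> Ks s" for s
    unfolding S_def by (rule mono_Ks[OF sm]) (use tau_less[OF jr m] in \<open>auto simp: swap_perm_def wt_def\<close>)
  have E_blk: "blk (Suc m) E"
    unfolding E_def by (rule blk_rowE[OF i2(1) \<rho>i \<rho>0]) (auto simp: i2 \<rho>_def)
  have S_blk: "blk (Suc m) S"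
    unfolding S_def by (rule blk_mono_mat[OF sm]) (use j m in \<open>auto simp: swap_perm_def tau_def lev_def\<close>)
  have E_U: "E \<in> carrier U" using E_blk blk_U by blast
  show ?thesis
  proof (rule that[of "S * adj E" "z1 i"])
    show "S * adj E \<in> Ks 1" by (intro Ks_mult Ks_adj S_Ks E_Ks) auto
    show "S * adj E \<in> Ks unif" by (intro Ks_mult Ks_adj S_Ks E_Ks) auto
    show "blk (Suc m) (S * adj E)" by (intro blk_mult blk_adj S_blk E_blk)
    show "z1 i \<noteq> 0" by (rule z1i)
    fix b assume b: "b < 2*r" "lev b \<le> m"
    have hrw: "hf (rw (g * S) (r + m)) \<rho> = 0"
      using hz\<rho> hf_cong[of "rw (g * S) (r + m)" z1 \<rho> \<rho>] z1 by (simp add: rw_def)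
    have "g * (S * adj E) = (g * S) * adj E" using gU S_U E_U by (simp add: U_assoc)
    then have "(g * (S * adj E)) $$ (r + m, b) = (if b = i then z1 i
        else if b = pr i then 0 else z1 b - z1 i * \<rho> b)"
      using mult_adj_rowE[of "g * S" "r + m" b i \<rho>] b i2 m hrw z1 U_carrier[OF U_mult[OF gU S_U]]
      by (simp add: E_def)
    then show "(g * (S * adj E)) $$ (r + m, b) = (if b = (if ftype m g then r + m else m) then z1 i else 0)"
      using b z1i by (auto simp: \<rho>_def simp flip: i_def)
  qed
qed

text \<open>Nothing has to be assumed at levels above \<open>m\<close>: there the first-half entries
  of row \<open>r + m\<close> vanish by \<open>Qg_column\<close>, and the second-half entries are
  unrestricted.\<close>

lemma row_in_Qg:
  assumes g: "g \<in> Qg (Suc m)" and m: "m < r"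
    and row: "\<And>b. b < 2*r \<Longrightarrow> lev b \<le> m \<Longrightarrow> b \<noteq> r + m \<Longrightarrow> g $$ (r + m, b) = 0"
  shows "g \<in> Qg m"
proof -
  have "g $$ (r + m, j) = 0 \<and> (j < m \<longrightarrow> g $$ (r + m, r + j) = 0)" if "j < r" for j
  proof (cases "j \<le> m")
    case True then show ?thesis using row[of j] row[of "r + j"] that m by (auto simp: lev_def)
  next
    case False then show ?thesis using Qg_column(2)[OF g, of j "r + m"] that m by auto
  qed
  then have "g $$ (r + i, j) = 0 \<and> (j < i \<longrightarrow> g $$ (r + i, r + j) = 0)" if "m \<le> i" "i < r" "j < r" for i j
    using Qg_zero[OF g, of i j] that by (cases "i = m") auto
  then show ?thesis using Qg_U[OF g] unfolding Qg_def by blast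
qed

lemma step_ftype:
  assumes "g \<in> Qg (Suc m)" "m < r" "ftype m g"
  obtains k where "k \<in> Ks 1" "k \<in> Ks unif" "blk (Suc m) k" "g * k \<in> Qg m"
proof -
  obtain k \<eta> where k: "k \<in> Ks 1" "k \<in> Ks unif" "blk (Suc m) k"
    "\<And>b. b < 2*r \<Longrightarrow> lev b \<le> m \<Longrightarrow> (g * k) $$ (r + m, b) = (if b = r + m then \<eta> else 0)"
    using row_elimination[OF assms(1,2)] assms(3) by metis
  then have "g * k \<in> Qg m"
    using Qg_blk_mult[OF assms(1) k(3)] by (intro row_in_Qg[OF _ assms(2)]) auto
  then show ?thesis using k that by blast
qed

text \<open>The reduced row is a multiple of the unit row at \<open>m\<close>, in the wrong half,
  and \<open>flip s m\<close> carries it to \<open>r + m\<close>. Only this reflection depends on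
  \<open>s\<close>.\<close>

lemma step_etype:
  assumes "g \<in> Qg (Suc m)" "m < r" "\<not> ftype m g" and s: "s \<noteq> 0"
  obtains k where "k \<in> Ks 1" "k \<in> Ks unif" "blk (Suc m) k" "g * k * flip s m \<in> Qg m"
proof -
  obtain k \<eta> where k: "k \<in> Ks 1" "k \<in> Ks unif" "blk (Suc m) k"
    "\<And>b. b < 2*r \<Longrightarrow> lev b \<le> m \<Longrightarrow> (g * k) $$ (r + m, b) = (if b = m then \<eta> else 0)"
    using row_elimination[OF assms(1,2)] assms(3) by metis
  have gk: "g * k \<in> Qg (Suc m)" by (rule Qg_blk_mult[OF assms(1) k(3)])
  have "g * k * flip s m \<in> Qg m"
  proof (rule row_in_Qg[OF Qg_blk_mult[OF gk blk_flip[OF s assms(2)]] assms(2)])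
    fix b assume b: "b < 2*r" "lev b \<le> m" "b \<noteq> r + m"
    have "(g * k * flip s m) $$ (r + m, b) = (g * k) $$ (r + m, flip_perm m b) * flip_coeff s m (flip_perm m b)"
      unfolding flip_def using assms(2) b by (intro mult_monomial Qg_carrier[OF gk] flip_monomial s) auto
    moreover have "flip_perm m b \<noteq> m" "flip_perm m b < 2*r" "lev (flip_perm m b) \<le> m"
      using b assms(2) by (auto simp: flip_perm_def pr_def lev_def split: if_splits)
    ultimately show "(g * k * flip s m) $$ (r + m, b) = 0" using k(4) by simp
  qed
  then show ?thesis using k that by blast
qed

text \<open>One row is reduced at each step, in the block of the current size. That the compact
  factor stays in \<open>blk m\<close> is more than the decomposition asks for;
  \<open>sph_tor\<close> depends on it.\<close>

lemma iwasawa: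
  assumes "s = 1 \<or> s = unif" "g \<in> Qg m" "m \<le> r"
  obtains k where "k \<in> Ks s" "blk m k" "g * k \<in> Qg 0"
  using assms(2,3)
proof (induction m arbitrary: g thesis)
  case 0
  show ?case by (rule 0(1)[of "1\<^sub>m (2*r)"]) (use 0 Qg_U Ks_one blk_one in auto)
next
  case (Suc m)
  have s: "s \<noteq> 0" using assms(1) by auto
  have m: "m < r" using Suc by simp
  obtain k where k: "k \<in> Ks s" "blk (Suc m) k" "g * k \<in> Qg m"
  proof (cases "ftype m g")
    case True
    then show ?thesis using step_ftype[OF Suc.prems(2) m] assms(1) that by metis
  next
    case False
    obtain k where k: "k \<in> Ks 1" "k \<in> Ks unif" "blk (Suc m) k" "g * k * flip s m \<in> Qg m"
      using step_etype[OF Suc.prems(2) m False s] by metis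
    have "g * (k * flip s m) \<in> Qg m"
      using k blk_U[OF blk_flip[OF s m]] blk_U Qg_U[OF Suc.prems(2)] by (simp add: U_assoc)
    then show ?thesis
      using k assms(1) by (intro that[of "k * flip s m"] Ks_mult[OF s] blk_mult blk_flip flip_Ks s m) auto
  qed
  obtain k' where k': "k' \<in> Ks s" "blk m k'" "g * k * k' \<in> Qg 0"
    using Suc.IH[OF _ k(3)] m by auto
  have "g * (k * k') \<in> Qg 0"
    using k k' blk_U Qg_U[OF Suc.prems(2)] by (simp add: U_assoc)
  then show ?case
    using k k' by (intro Suc.prems(1)[of "k * k'"] Ks_mult[OF s] blk_mult) (auto intro: blk_mono[of m "Suc m"])
qed

end

section \<open>Generalized indices and the modulus\<close>

lemma finite_image_determined:
  assumes "finite (f ` S)" "\<And>x y. x \<in> S \<Longrightarrow> y \<in> S \<Longrightarrow> f x = f y \<Longrightarrow> g x = g y"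
  shows "finite (g ` S)"
proof -
  have "g x = (g \<circ> inv_into S f) (f x)" if "x \<in> S" for x
    using assms(2)[OF that, of "inv_into S f (f x)"] that by (simp add: inv_into_into f_inv_into_f)
  then have "g ` S = (g \<circ> inv_into S f) ` (f ` S)" by (force simp: image_image)
  then show ?thesis using assms(1) by simp
qed

lemma card_image_iff_determined:
  assumes "\<And>x y. x \<in> S \<Longrightarrow> y \<in> S \<Longrightarrow> f x = f y \<longleftrightarrow> g x = g y"
  shows "card (f ` S) = card (g ` S)"
proof -
  define h where "h = g \<circ> inv_into S f"
  have h: "h (f x) = g x" if "x \<in> S" for x
    using assms[OF that, of "inv_into S f (f x)"] that by (simp add: h_def inv_into_into f_inv_into_f)
  have "bij_betw h (f ` S) (g ` S)"
    using h assms by (auto simp: bij_betw_def inj_on_def image_image intro!: image_cong)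
  then show ?thesis by (rule bij_betw_same_card)
qed

context Group.group
begin

section \<open>Indices of subgroups\<close>

abbreviation rcs :: "'a set \<Rightarrow> 'a set \<Rightarrow> 'a set set" where "rcs A D \<equiv> (\<lambda>x. D #> x) ` A"

definition idx :: "'a set \<Rightarrow> 'a set \<Rightarrow> nat" where "idx A D = card (rcs A D)"

lemma r_coset_eq_iff:
  assumes "subgroup D G" "x \<in> carrier G" "y \<in> carrier G"
  shows "D #> x = D #> y \<longleftrightarrow> x \<otimes> inv y \<in> D"
  using assms rcos_self[OF assms(2,1)] repr_independence[of x D y]
    subgroup.rcos_module[OF assms(1) is_group assms(3,2)] by metis

lemma rcosets_rcs: "A \<subseteq> carrier G \<Longrightarrow> rcosets\<^bsub>G\<lparr>carrier := A\<rparr>\<^esub> D = rcs A D"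
  by (auto simp: RCOSETS_def r_coset_def)

lemma gen_index_idx: "A \<subseteq> carrier G \<Longrightarrow> B \<subseteq> carrier G \<Longrightarrow>
    gen_index G A B = real (idx A (A \<inter> B)) / real (idx B (A \<inter> B))"
  by (simp add: gen_index_def rcosets_rcs idx_def)

text \<open>The tower law as a bijection: a coset of \<open>D\<close> in \<open>A\<close> is
  determined by its coset of \<open>B\<close> and, relative to a chosen representative, a coset of
  \<open>D\<close> in \<open>B\<close>. This form gives cardinality and finiteness together.\<close>

lemma idx_bij:
  assumes A: "subgroup A G" and B: "subgroup B G" and D: "subgroup D G" and BA: "B \<subseteq> A" and DB: "D \<subseteq> B"
  shows "\<exists>f. bij_betw f (rcs A B \<times> rcs B D) (rcs A D)"
proof -
  note [simp] = subgroup.mem_carrier[OF A] subgroup.mem_carrier[OF B] subgroup.mem_carrier[OF D]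
  have subs: "D \<subseteq> carrier G" "B \<subseteq> carrier G" by auto
  define \<rho> where "\<rho> C = (SOME x. x \<in> A \<and> C = B #> x)" for C
  have \<rho>: "\<rho> C \<in> A \<and> C = B #> \<rho> C" if "C \<in> rcs A B" for C
    unfolding \<rho>_def by (rule someI_ex) (use that in auto)
  define f where "f = (\<lambda>(C, S). S #> \<rho> C)"
  have f: "f (C, D #> b) = D #> (b \<otimes> \<rho> C)" if "C \<in> rcs A B" "b \<in> B" for C b
    using \<rho>[OF that(1)] that(2) subs by (simp add: f_def coset_mult_assoc)
  have "inj_on f (rcs A B \<times> rcs B D)"
  proof (rule inj_onI)
    fix x y assume "x \<in> rcs A B \<times> rcs B D" "y \<in> rcs A B \<times> rcs B D" and e: "f x = f y"
    then obtain C b C' b' where x: "x = (C, D #> b)" "C \<in> rcs A B" "b \<in> B"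
      and y: "y = (C', D #> b')" "C' \<in> rcs A B" "b' \<in> B" by auto
    have r: "\<rho> C \<in> carrier G" "\<rho> C' \<in> carrier G" using \<rho> x y by auto
    have e': "D #> (b \<otimes> \<rho> C) = D #> (b' \<otimes> \<rho> C')" using e f x y by simp
    then have "(b \<otimes> \<rho> C) \<otimes> inv (b' \<otimes> \<rho> C') \<in> D"
      using x y r r_coset_eq_iff[OF D] by simp
    then have "(b \<otimes> \<rho> C) \<otimes> inv (b' \<otimes> \<rho> C') \<in> B" using DB by auto
    then have "B #> (b \<otimes> \<rho> C) = B #> (b' \<otimes> \<rho> C')"
      using x y r r_coset_eq_iff[OF B] by simp
    then have "B #> \<rho> C = B #> \<rho> C'"
      using x y r subs coset_mult_assoc[of B b "\<rho> C"] coset_mult_assoc[of B b' "\<rho> C'"]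
      by (simp add: subgroup.rcos_const[OF B is_group])
    then have CC: "C = C'" using \<rho> x y by metis
    have "(D #> b) #> \<rho> C = (D #> b') #> \<rho> C" using e' CC x y r subs by (simp add: coset_mult_assoc)
    then have "((D #> b) #> \<rho> C) #> inv \<rho> C = ((D #> b') #> \<rho> C) #> inv \<rho> C" by simp
    then have "D #> b = D #> b'" using x y r subs by (simp add: coset_mult_assoc m_assoc)
    then show "x = y" using x y CC by simp
  qed
  moreover have "f ` (rcs A B \<times> rcs B D) = rcs A D"
  proof
    show "f ` (rcs A B \<times> rcs B D) \<subseteq> rcs A D"
    proof
      fix z assume "z \<in> f ` (rcs A B \<times> rcs B D)"
      then obtain C b where C: "C \<in> rcs A B" "b \<in> B" "z = f (C, D #> b)" by auto
      then have "z = D #> (b \<otimes> \<rho> C)" "b \<otimes> \<rho> C \<in> A"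
        using f \<rho>[OF C(1)] BA subgroup.m_closed[OF A] by auto
      then show "z \<in> rcs A D" by auto
    qed
    show "rcs A D \<subseteq> f ` (rcs A B \<times> rcs B D)"
    proof
      fix z assume "z \<in> rcs A D"
      then obtain a where a: "a \<in> A" "z = D #> a" by auto
      define C where "C = B #> a"
      have C: "C \<in> rcs A B" using a by (auto simp: C_def)
      have r: "\<rho> C \<in> A" "B #> a = B #> \<rho> C" using \<rho>[OF C] by (auto simp: C_def)
      define b where "b = a \<otimes> inv \<rho> C"
      have b: "b \<in> B" using r r_coset_eq_iff[OF B, of a "\<rho> C"] a by (simp add: b_def)
      have "b \<otimes> \<rho> C = a" using r a by (simp add: b_def m_assoc)
      then have "z = f (C, D #> b)" using f[OF C b] a by simp
      then show "z \<in> f ` (rcs A B \<times> rcs B D)" using C b by auto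
    qed
  qed
  ultimately show ?thesis unfolding bij_betw_def by blast
qed

lemma subgroup_nonempty: "subgroup A G \<Longrightarrow> A \<noteq> {}"
  using subgroup.one_closed by auto

lemma idx_mult:
  assumes "subgroup A G" "subgroup B G" "subgroup D G" "B \<subseteq> A" "D \<subseteq> B"
  shows "idx A D = idx A B * idx B D"
    "finite (rcs A D) \<longleftrightarrow> finite (rcs A B) \<and> finite (rcs B D)"
proof -
  obtain f where f: "bij_betw f (rcs A B \<times> rcs B D) (rcs A D)" using idx_bij[OF assms] by auto
  show "idx A D = idx A B * idx B D"
    using bij_betw_same_card[OF f] by (simp add: idx_def card_cartesian_product)
  have "rcs A B \<noteq> {}" "rcs B D \<noteq> {}" using subgroup_nonempty assms by auto
  then show "finite (rcs A D) \<longleftrightarrow> finite (rcs A B) \<and> finite (rcs B D)"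
    using bij_betw_finite[OF f] by (auto simp: finite_cartesian_product_iff)
qed

lemma idx_pos: "subgroup A G \<Longrightarrow> finite (rcs A D) \<Longrightarrow> 0 < idx A D"
  using subgroup_nonempty by (auto simp: idx_def card_gt_0_iff)

lemma finite_rcs_restrict:
  assumes "subgroup A G" "subgroup E G" "subgroup B G" "B \<subseteq> A" "finite (rcs A (A \<inter> E))"
  shows "finite (rcs B (B \<inter> E))"
proof (rule finite_image_determined[where f = "\<lambda>x. (A \<inter> E) #> x"])
  show "finite ((\<lambda>x. (A \<inter> E) #> x) ` B)"
    using assms(4,5) by (meson finite_subset image_mono)
  fix x y assume xy: "x \<in> B" "y \<in> B" "(A \<inter> E) #> x = (A \<inter> E) #> y"
  then have c: "x \<in> carrier G" "y \<in> carrier G" using subgroup.mem_carrier[OF assms(3)] by auto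
  then have "x \<otimes> inv y \<in> E" using xy r_coset_eq_iff[OF subgroups_Inter_pair[OF assms(1,2)]] by auto
  moreover have "x \<otimes> inv y \<in> B"
    using xy subgroup.m_closed[OF assms(3)] subgroup.m_inv_closed[OF assms(3)] by auto
  ultimately show "(B \<inter> E) #> x = (B \<inter> E) #> y"
    using c r_coset_eq_iff[OF subgroups_Inter_pair[OF assms(3,2)]] by auto
qed

section \<open>Conjugation and commensurable subgroups\<close>

definition conj_set :: "'a \<Rightarrow> 'a set \<Rightarrow> 'a set" where
  "conj_set g A = (\<lambda>x. g \<otimes> x \<otimes> inv g) ` A"

lemma conj_mult: "g \<in> carrier G \<Longrightarrow> x \<in> carrier G \<Longrightarrow> y \<in> carrier G \<Longrightarrow>
    (g \<otimes> x \<otimes> inv g) \<otimes> (g \<otimes> y \<otimes> inv g) = g \<otimes> (x \<otimes> y) \<otimes> inv g"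
  by (metis (no_types, lifting) inv_closed inv_solve_right m_assoc m_closed)

lemma conj_inv: "g \<in> carrier G \<Longrightarrow> x \<in> carrier G \<Longrightarrow>
    inv (g \<otimes> x \<otimes> inv g) = g \<otimes> inv x \<otimes> inv g"
  by (simp add: inv_mult_group m_assoc)

lemma conj_inj: "g \<in> carrier G \<Longrightarrow> inj_on (\<lambda>x. g \<otimes> x \<otimes> inv g) (carrier G)"
  by (rule inj_onI) (simp add: m_assoc)

lemma subgroup_conj:
  assumes "subgroup A G" "g \<in> carrier G" shows "subgroup (conj_set g A) G"
proof (rule subgroup.intro)
  note [simp] = subgroup.mem_carrier[OF assms(1)] assms(2)
  show "conj_set g A \<subseteq> carrier G" by (auto simp: conj_set_def)
  have "g \<otimes> \<one> \<otimes> inv g = \<one>" by simp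
  then show "\<one> \<in> conj_set g A" using subgroup.one_closed[OF assms(1)] unfolding conj_set_def by (metis imageI)
  show "x \<otimes> y \<in> conj_set g A" if "x \<in> conj_set g A" "y \<in> conj_set g A" for x y
    using that subgroup.m_closed[OF assms(1)] by (auto simp: conj_set_def conj_mult)
  show "inv x \<in> conj_set g A" if "x \<in> conj_set g A" for x
    using that subgroup.m_inv_closed[OF assms(1)] by (auto simp: conj_set_def conj_inv)
qed

lemma conj_conj: "g \<in> carrier G \<Longrightarrow> h \<in> carrier G \<Longrightarrow> A \<subseteq> carrier G \<Longrightarrow>
    conj_set g (conj_set h A) = conj_set (g \<otimes> h) A"
  unfolding conj_set_def image_image
  by (intro image_cong refl) (auto simp: m_assoc inv_mult_group subset_iff)

lemma conj_inter: "g \<in> carrier G \<Longrightarrow> A \<subseteq> carrier G \<Longrightarrow> B \<subseteq> carrier G \<Longrightarrow>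
    conj_set g (A \<inter> B) = conj_set g A \<inter> conj_set g B"
  unfolding conj_set_def by (rule inj_on_image_Int[OF conj_inj])

lemma idx_conj:
  assumes A: "subgroup A G" and D: "subgroup D G" and g: "g \<in> carrier G"
  shows "idx (conj_set g A) (conj_set g D) = idx A D"
    "finite (rcs (conj_set g A) (conj_set g D)) \<longleftrightarrow> finite (rcs A D)"
proof -
  note [simp] = subgroup.mem_carrier[OF A] g
  let ?c = "\<lambda>x. g \<otimes> x \<otimes> inv g"
  have e: "rcs (conj_set g A) (conj_set g D) = (\<lambda>x. conj_set g D #> ?c x) ` A"
    by (simp add: conj_set_def image_image)
  have iff: "conj_set g D #> ?c x = conj_set g D #> ?c y \<longleftrightarrow> D #> x = D #> y" if "x \<in> A" "y \<in> A" for x y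
  proof -
    have c: "x \<otimes> inv y \<in> carrier G" using that by simp
    have "?c x \<otimes> inv (?c y) = ?c (x \<otimes> inv y)" using that by (simp add: conj_inv conj_mult)
    moreover have "?c (x \<otimes> inv y) \<in> conj_set g D \<longleftrightarrow> x \<otimes> inv y \<in> D"
      unfolding conj_set_def by (rule inj_on_image_mem_iff[OF conj_inj[OF g] c subgroup.subset[OF D]])
    ultimately show ?thesis
      using that r_coset_eq_iff[OF D] r_coset_eq_iff[OF subgroup_conj[OF D g]] by simp
  qed
  show "idx (conj_set g A) (conj_set g D) = idx A D"
    unfolding idx_def e by (rule card_image_iff_determined) (rule iff)
  show "finite (rcs (conj_set g A) (conj_set g D)) \<longleftrightarrow> finite (rcs A D)"
    unfolding e using finite_image_determined[of "\<lambda>x. conj_set g D #> ?c x" A "\<lambda>x. D #> x"]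
      finite_image_determined[of "\<lambda>x. D #> x" A "\<lambda>x. conj_set g D #> ?c x"] iff by blast
qed

definition commens :: "'a set \<Rightarrow> 'a set \<Rightarrow> bool" where
  "commens A B \<longleftrightarrow> subgroup A G \<and> subgroup B G \<and> finite (rcs A (A \<inter> B)) \<and> finite (rcs B (A \<inter> B))"

lemma commens_sym: "commens A B \<Longrightarrow> commens B A"
  by (simp add: commens_def Int_commute)

lemma commens_conj:
  assumes "commens A B" "g \<in> carrier G" shows "commens (conj_set g A) (conj_set g B)"
proof -
  have s: "subgroup A G" "subgroup B G" "subgroup (A \<inter> B) G" "A \<subseteq> carrier G" "B \<subseteq> carrier G"
    using assms by (auto simp: commens_def subgroups_Inter_pair subgroup.subset)
  show ?thesis
    using assms s subgroup_conj idx_conj(2)[OF s(1,3) assms(2)] idx_conj(2)[OF s(2,3) assms(2)]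
    by (simp add: commens_def conj_inter)
qed

lemma gen_index_via:
  assumes "subgroup A G" "subgroup B G" "subgroup D G" "D \<subseteq> A" "D \<subseteq> B" "finite (rcs A D)" "finite (rcs B D)"
  shows "gen_index G A B = real (idx A D) / real (idx B D)"
proof -
  have AB: "subgroup (A \<inter> B) G" by (rule subgroups_Inter_pair[OF assms(1,2)])
  have 1: "idx A D = idx A (A \<inter> B) * idx (A \<inter> B) D" "idx B D = idx B (A \<inter> B) * idx (A \<inter> B) D"
    using idx_mult(1)[OF assms(1) AB assms(3)] idx_mult(1)[OF assms(2) AB assms(3)] assms by auto
  have "finite (rcs (A \<inter> B) D)" using idx_mult(2)[OF assms(1) AB assms(3)] assms by auto
  then have "idx (A \<inter> B) D \<noteq> 0" using idx_pos[OF AB] by auto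
  then show ?thesis using 1 assms by (simp add: gen_index_idx subgroup.subset)
qed

text \<open>All three indices are expressed through the triple intersection, which has finite index
  in each group, and the common factor cancels.\<close>

lemma gen_index_cocycle:
  assumes AB: "commens A B" and BC: "commens B C" and AC: "commens A C"
  shows "gen_index G A C = gen_index G A B * gen_index G B C"
proof -
  define D where "D = A \<inter> B \<inter> C"
  have s: "subgroup A G" "subgroup B G" "subgroup C G" using assms by (auto simp: commens_def)
  have D: "subgroup D G" unfolding D_def by (intro subgroups_Inter_pair s)
  have fin: "finite (rcs E (E \<inter> Y \<inter> Z))" if "commens E Y" "commens E Z" for E Y Z
  proof -
    have s: "subgroup E G" "subgroup Y G" "subgroup Z G" "subgroup (E \<inter> Y) G"
      using that by (auto simp: commens_def subgroups_Inter_pair)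
    have "finite (rcs (E \<inter> Y) (E \<inter> Y \<inter> Z))"
      by (rule finite_rcs_restrict[OF s(1,3,4)]) (use that in \<open>auto simp: commens_def\<close>)
    then show ?thesis
      using that idx_mult(2)[OF s(1) s(4) subgroups_Inter_pair[OF s(4,3)]] by (auto simp: commens_def)
  qed
  have fA: "finite (rcs A D)" using fin[OF AB AC] by (simp add: D_def)
  have fB: "finite (rcs B D)" using fin[OF commens_sym[OF AB] BC] by (simp add: D_def Int_commute)
  have "C \<inter> B \<inter> A = D" by (auto simp: D_def)
  then have fC: "finite (rcs C D)" using fin[OF commens_sym[OF BC] commens_sym[OF AC]] by simp
  have "idx B D \<noteq> 0" using idx_pos[OF s(2) fB] by simp
  moreover have DA: "D \<subseteq> A" "D \<subseteq> B" "D \<subseteq> C" by (auto simp: D_def)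
  ultimately show ?thesis
    using gen_index_via[OF s(1,2) D DA(1,2) fA fB] gen_index_via[OF s(2,3) D DA(2,3) fB fC]
      gen_index_via[OF s(1,3) D DA(1,3) fA fC] by simp
qed

lemma gen_index_pos: "commens A B \<Longrightarrow> 0 < gen_index G A B"
  using idx_pos by (auto simp: commens_def gen_index_idx subgroup.subset)

lemma commens_refl: "subgroup A G \<Longrightarrow> commens A A"
proof -
  assume A: "subgroup A G"
  have "rcs A A \<subseteq> {A}" using subgroup.rcos_const[OF A is_group] by auto
  then show ?thesis using A finite_subset by (auto simp: commens_def)
qed

lemma gen_index_self: "subgroup A G \<Longrightarrow> gen_index G A A = 1"
  using gen_index_cocycle[of A A A] gen_index_pos[of A A] commens_refl[of A] by auto

lemma gen_index_conj:
  assumes "commens A B" "g \<in> carrier G"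
  shows "gen_index G (conj_set g A) (conj_set g B) = gen_index G A B"
proof -
  have s: "subgroup A G" "subgroup B G" "subgroup (A \<inter> B) G"
    using assms by (auto simp: commens_def subgroups_Inter_pair)
  show ?thesis using s assms subgroup_conj[OF s(1)] subgroup_conj[OF s(2)]
    by (simp add: gen_index_idx subgroup.subset idx_conj(1) flip: conj_inter)
qed

text \<open>Passing from \<open>A\<close> to \<open>B\<close> multiplies and divides by
  \<open>gen_index G A B\<close>, since this index is invariant under conjugation. Hence the modulus
  is well defined.\<close>

lemma gen_index_conj_indep:
  assumes g: "g \<in> carrier G" and c: "commens A B" "commens (conj_set g A) A" "commens (conj_set g B) B"
    "commens (conj_set g A) B"
  shows "gen_index G (conj_set g A) A = gen_index G (conj_set g B) B"
proof -
  have "gen_index G (conj_set g A) A * gen_index G A B = gen_index G (conj_set g A) B"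
    using gen_index_cocycle[OF c(2,1,4)] by simp
  also have "\<dots> = gen_index G (conj_set g A) (conj_set g B) * gen_index G (conj_set g B) B"
    by (rule gen_index_cocycle[OF commens_conj[OF c(1) g] c(3,4)])
  also have "\<dots> = gen_index G A B * gen_index G (conj_set g B) B"
    using gen_index_conj[OF c(1) g] by simp
  finally show ?thesis using gen_index_pos[OF c(1)] by simp
qed

end

section \<open>Topology and the modulus of the Borel subgroup\<close>

context unitary_setting
begin

section \<open>The topology in terms of matrix entries\<close>

lemma mat_dist_le: "mat_dist v n A B \<le> c \<longleftrightarrow> 0 \<le> c \<and> (\<forall>i<n. \<forall>j<n. v (A $$ (i, j) - B $$ (i, j)) \<le> c)"
  unfolding mat_dist_def by (subst Max_le_iff) auto

lemma mat_dist_less: "mat_dist v n A B < c \<longleftrightarrow> 0 < c \<and> (\<forall>i<n. \<forall>j<n. v (A $$ (i, j) - B $$ (i, j)) < c)"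
  unfolding mat_dist_def by (subst Max_less_iff) auto

lemma mat_dist_nonneg: "0 \<le> mat_dist v n A B"
  using mat_dist_le[of n A B "mat_dist v n A B"] by simp

lemma mat_dist_entry: "i < n \<Longrightarrow> j < n \<Longrightarrow> v (A $$ (i, j) - B $$ (i, j)) \<le> mat_dist v n A B"
  using mat_dist_le[of n A B "mat_dist v n A B"] by simp

lemma Metric_space_mat: "Metric_space (carrier_mat n n) (mat_dist v n)"
proof
  show "0 \<le> mat_dist v n A B" for A B by (rule mat_dist_nonneg)
  show "mat_dist v n A B = mat_dist v n B A" for A B
    by (rule order_antisym) (auto simp: mat_dist_le mat_dist_nonneg v_minus_commute mat_dist_entry
      intro: order_trans[OF _ mat_dist_entry])
  show "mat_dist v n A B = 0 \<longleftrightarrow> A = B" if "A \<in> carrier_mat n n" "B \<in> carrier_mat n n" for A B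
  proof
    assume "mat_dist v n A B = 0"
    then have "v (A $$ (i, j) - B $$ (i, j)) \<le> 0" if "i < n" "j < n" for i j
      using mat_dist_entry[OF that, of A B] by simp
    then show "A = B" using that by (intro eq_matI) auto
  next
    assume "A = B"
    then show "mat_dist v n A B = 0" using mat_dist_le[of n A B 0] mat_dist_nonneg[of n A B] by simp
  qed
  show "mat_dist v n A C \<le> mat_dist v n A B + mat_dist v n B C" for A B C
    unfolding mat_dist_le
  proof (intro conjI allI impI)
    fix i j assume "i < n" "j < n"
    then show "v (A $$ (i, j) - C $$ (i, j)) \<le> mat_dist v n A B + mat_dist v n B C"
      using v_add[of "A $$ (i, j) - B $$ (i, j)" "B $$ (i, j) - C $$ (i, j)"]
        mat_dist_entry[of i n j A B] mat_dist_entry[of i n j B C] mat_dist_nonneg[of n A B] mat_dist_nonneg[of n B C]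
      by simp
  qed (simp add: mat_dist_nonneg)
qed

definition near :: "real \<Rightarrow> 'e mat \<Rightarrow> 'e mat \<Rightarrow> bool" where
  "near \<epsilon> x y \<longleftrightarrow> (\<forall>a<2*r. \<forall>b<2*r. v (y $$ (a, b) - x $$ (a, b)) < \<epsilon>)"

lemma near_dist: "0 < \<epsilon> \<Longrightarrow> near \<epsilon> x y \<longleftrightarrow> mat_dist v (2*r) x y < \<epsilon>"
  by (auto simp: near_def mat_dist_less v_minus_commute)

lemma openin_near:
  assumes S: "S \<subseteq> carrier_mat (2*r) (2*r)"
  shows "openin (subtopology (mat_topology v (2*r)) S) Z \<longleftrightarrow>
    Z \<subseteq> S \<and> (\<forall>x\<in>Z. \<exists>\<epsilon>>0. \<forall>y\<in>S. near \<epsilon> x y \<longrightarrow> y \<in> Z)"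
proof -
  interpret MM: Metric_space "carrier_mat (2*r) (2*r)" "mat_dist v (2*r)" by (rule Metric_space_mat)
  interpret SM: Submetric "carrier_mat (2*r) (2*r)" "mat_dist v (2*r)" S by unfold_locales (rule S)
  have "subtopology (mat_topology v (2*r)) S = SM.sub.mtopology"
    unfolding mat_topology_def SM.mtopology_submetric ..
  moreover have "SM.sub.mball x \<epsilon> \<subseteq> Z \<longleftrightarrow> (\<forall>y\<in>S. near \<epsilon> x y \<longrightarrow> y \<in> Z)" if "0 < \<epsilon>" "x \<in> S" for x \<epsilon>
    using that by (auto simp: SM.sub.mball_def near_dist)
  ultimately have eq: "openin (subtopology (mat_topology v (2*r)) S) Z \<longleftrightarrow>
      Z \<subseteq> S \<and> (\<forall>x. x \<in> Z \<longrightarrow> (\<exists>\<epsilon>>0. SM.sub.mball x \<epsilon> \<subseteq> Z))"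
    and ball: "\<And>x \<epsilon>. 0 < \<epsilon> \<Longrightarrow> x \<in> S \<Longrightarrow> SM.sub.mball x \<epsilon> \<subseteq> Z \<longleftrightarrow> (\<forall>y\<in>S. near \<epsilon> x y \<longrightarrow> y \<in> Z)"
    by (simp_all add: SM.sub.openin_mtopology)
  have "(\<exists>\<epsilon>>0. SM.sub.mball x \<epsilon> \<subseteq> Z) \<longleftrightarrow> (\<exists>\<epsilon>>0. \<forall>y\<in>S. near \<epsilon> x y \<longrightarrow> y \<in> Z)" if "x \<in> S" for x
    using ball[OF _ that] by (intro ex_cong1 conj_cong refl)
  then show ?thesis unfolding eq by auto
qed

lemma entry_bound: obtains C where "0 < C" "\<And>a b. a < 2*r \<Longrightarrow> b < 2*r \<Longrightarrow> v (h $$ (a, b)) \<le> C"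
proof
  let ?C = "1 + (\<Sum>p\<in>{..<2*r}\<times>{..<2*r}. v (h $$ p))"
  show "0 < ?C" by (intro add_pos_nonneg sum_nonneg) auto
  fix a b assume "a < 2*r" "b < 2*r"
  then have "v (h $$ (a, b)) \<le> (\<Sum>p\<in>{..<2*r}\<times>{..<2*r}. v (h $$ p))"
    by (intro member_le_sum) auto
  then show "v (h $$ (a, b)) \<le> ?C" by simp
qed

lemma near_mult:
  assumes h: "h \<in> carrier_mat (2*r) (2*r)" and \<epsilon>: "0 < \<epsilon>"
  obtains \<delta> where "0 < \<delta>"
    "\<And>x y. x \<in> carrier_mat (2*r) (2*r) \<Longrightarrow> y \<in> carrier_mat (2*r) (2*r) \<Longrightarrow> near \<delta> x y \<Longrightarrow>
      near \<epsilon> (h * x) (h * y) \<and> near \<epsilon> (x * h) (y * h)"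
proof -
  obtain C where C: "0 < C" "\<And>a b. a < 2*r \<Longrightarrow> b < 2*r \<Longrightarrow> v (h $$ (a, b)) \<le> C"
    using entry_bound by blast
  show ?thesis
  proof (rule that[of "\<epsilon> / C"])
    show "0 < \<epsilon> / C" using \<epsilon> C by simp
    fix x y assume xy: "x \<in> carrier_mat (2*r) (2*r)" "y \<in> carrier_mat (2*r) (2*r)" "near (\<epsilon> / C) x y"
    have lt: "v u * v d < \<epsilon>" if "v u \<le> C" "v d < \<epsilon> / C" for u d
    proof -
      have "v u * v d \<le> C * v d" using that by (simp add: mult_right_mono)
      also have "\<dots> < \<epsilon>" using that C by (simp add: field_simps)
      finally show ?thesis .
    qed
    have "v ((h * y) $$ (a, b) - (h * x) $$ (a, b)) < \<epsilon>" "v ((y * h) $$ (a, b) - (x * h) $$ (a, b)) < \<epsilon>"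
      if ab: "a < 2*r" "b < 2*r" for a b
    proof -
      have "(h * y) $$ (a, b) - (h * x) $$ (a, b) = (\<Sum>c<2*r. h $$ (a, c) * (y $$ (c, b) - x $$ (c, b)))"
        using h xy ab by (simp add: mult_entry algebra_simps sum_subtractf)
      also have "v \<dots> < \<epsilon>"
        using xy(3) ab C by (intro v_sum_less) (auto simp: v_mult near_def \<epsilon> intro!: lt)
      finally show "v ((h * y) $$ (a, b) - (h * x) $$ (a, b)) < \<epsilon>" .
      have "(y * h) $$ (a, b) - (x * h) $$ (a, b) = (\<Sum>c<2*r. h $$ (c, b) * (y $$ (a, c) - x $$ (a, c)))"
        using h xy ab by (simp add: mult_entry algebra_simps sum_subtractf)
      also have "v \<dots> < \<epsilon>"
        using xy(3) ab C by (intro v_sum_less) (auto simp: v_mult near_def \<epsilon> intro!: lt)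
      finally show "v ((y * h) $$ (a, b) - (x * h) $$ (a, b)) < \<epsilon>" .
    qed
    then show "near \<epsilon> (h * x) (h * y) \<and> near \<epsilon> (x * h) (y * h)" by (simp add: near_def)
  qed
qed

text \<open>A neighbourhood of the identity is moved to any \<open>x\<close> of the subgroup by
  multiplication with \<open>adj x\<close>, whose effect on radii is bounded by its entries.\<close>

lemma open_subgroup_iff:
  assumes S: "subgroup S U" and Z: "subgroup Z U" "Z \<subseteq> S"
  shows "openin (subtopology (mat_topology v (2*r)) S) Z \<longleftrightarrow>
    (\<exists>\<epsilon>>0. \<forall>y\<in>S. near \<epsilon> (1\<^sub>m (2*r)) y \<longrightarrow> y \<in> Z)"
proof -
  have SU: "S \<subseteq> carrier U" by (rule subgroup.subset[OF S])
  have Sc: "S \<subseteq> carrier_mat (2*r) (2*r)" using SU U_carrier by blast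
  show ?thesis
    unfolding openin_near[OF Sc]
  proof safe
    assume "\<forall>x\<in>Z. \<exists>\<epsilon>>0. \<forall>y\<in>S. near \<epsilon> x y \<longrightarrow> y \<in> Z"
    then show "\<exists>\<epsilon>>0. \<forall>y\<in>S. near \<epsilon> (1\<^sub>m (2*r)) y \<longrightarrow> y \<in> Z"
      using subgroup.one_closed[OF Z(1)] by auto
  next
    fix x \<epsilon> assume x: "x \<in> Z" and \<epsilon>: "0 < \<epsilon>" "\<forall>y\<in>S. near \<epsilon> (1\<^sub>m (2*r)) y \<longrightarrow> y \<in> Z"
    have xU: "x \<in> carrier U" using x Z SU by auto
    obtain \<delta> where \<delta>: "0 < \<delta>" "\<And>u y. u \<in> carrier_mat (2*r) (2*r) \<Longrightarrow> y \<in> carrier_mat (2*r) (2*r) \<Longrightarrow>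
      near \<delta> u y \<Longrightarrow> near \<epsilon> (adj x * u) (adj x * y) \<and> near \<epsilon> (u * adj x) (y * adj x)"
      using near_mult[OF adj_carrier \<epsilon>(1)] by blast
    show "\<exists>\<epsilon>>0. \<forall>y\<in>S. near \<epsilon> x y \<longrightarrow> y \<in> Z"
    proof (intro exI[of _ \<delta>] conjI ballI impI \<delta>(1))
      fix y assume y: "y \<in> S" "near \<delta> x y"
      have yU: "y \<in> carrier U" using y SU by auto
      have "near \<epsilon> (adj x * x) (adj x * y)"
        using \<delta>(2)[OF U_carrier[OF xU] U_carrier[OF yU] y(2)] by simp
      then have n: "near \<epsilon> (1\<^sub>m (2*r)) (adj x * y)" using xU by simp
      have "inv\<^bsub>U\<^esub> x \<otimes>\<^bsub>U\<^esub> y \<in> S"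
        using x y Z by (intro subgroup.m_closed[OF S] subgroup.m_inv_closed[OF S]) auto
      then have "adj x * y \<in> Z" using \<epsilon>(2) n xU by (simp add: inv_U)
      then have "x \<otimes>\<^bsub>U\<^esub> (adj x * y) \<in> Z" by (rule subgroup.m_closed[OF Z(1) x])
      then show "y \<in> Z" using xU yU by (simp add: U_adj_cancel)
    qed
  qed (use Z in auto)
qed

text \<open>By induction on the number of digits: the residue of \<open>x\<close> is the first
  digit, and \<open>(x - res x) / unif\<close> is again an integer, to which the previous
  approximation applies.\<close>

lemma residue_approx:
  "\<exists>\<phi> :: 'e \<Rightarrow> 'e. finite (\<phi> ` {x. v x \<le> 1}) \<and>
     (\<forall>x y. v x \<le> 1 \<longrightarrow> v y \<le> 1 \<longrightarrow> \<phi> x = \<phi> y \<longrightarrow> v (x - y) \<le> (1 / q) ^ N)"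
proof (induction N)
  case 0
  have "finite ((\<lambda>_. 0 :: 'e) ` {x. v x \<le> 1})" by (rule finite_subset[of _ "{0}"]) auto
  then show ?case by (intro exI[of _ "\<lambda>_. 0"]) (auto intro: v_diff_le)
next
  case (Suc N)
  then obtain \<phi> :: "'e \<Rightarrow> 'e" where fin: "finite (\<phi> ` {x. v x \<le> 1})"
    and \<phi>: "\<And>x y. v x \<le> 1 \<Longrightarrow> v y \<le> 1 \<Longrightarrow> \<phi> x = \<phi> y \<Longrightarrow> v (x - y) \<le> (1 / q) ^ N" by blast
  define t where "t x = (x - res x) / unif" for x
  have t: "v (t x) \<le> 1" if "v x \<le> 1" for x
    using v_lt_1_unif[OF res(2)[OF that]] by (simp add: t_def v_divide)
  have inj: "v (x - y) \<le> (1 / q) ^ Suc N" if "v x \<le> 1" "v y \<le> 1" "res x = res y" "\<phi> (t x) = \<phi> (t y)" for x y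
  proof -
    have "t x - t y = (x - y) / unif" using that(3) by (simp add: t_def diff_divide_distrib)
    then have "x - y = unif * (t x - t y)" by simp
    then have "v (x - y) = v (t x - t y) / q" by (simp add: v_mult v_unif)
    also have "\<dots> \<le> (1 / q) ^ N / q" using \<phi>[OF t[OF that(1)] t[OF that(2)] that(4)] by (rule divide_right_mono) simp
    finally show ?thesis by simp
  qed
  define c where "c x = (res x, \<phi> (t x))" for x
  have "c ` {x. v x \<le> 1} \<subseteq> residue_reps \<times> \<phi> ` {x. v x \<le> 1}" using t res by (auto simp: c_def)
  then have fc: "finite (c ` {x. v x \<le> 1})" using fin finite_residue_reps finite_subset by blast
  \<comment> \<open>The pair \<open>c x\<close> is replaced by a chosen integer with the same pair,
    so that the approximation again takes values in the field and the induction can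
    continue.\<close>
  define \<psi> where "\<psi> x = (SOME y. v y \<le> 1 \<and> c y = c x)" for x
  have \<psi>: "v (\<psi> x) \<le> 1 \<and> c (\<psi> x) = c x" if "v x \<le> 1" for x
    unfolding \<psi>_def by (rule someI[where x = x]) (use that in simp)
  have "finite (\<psi> ` {x. v x \<le> 1})"
    by (rule finite_image_determined[OF fc]) (auto simp: \<psi>_def)
  moreover have "v (x - y) \<le> (1 / q) ^ Suc N" if "v x \<le> 1" "v y \<le> 1" "\<psi> x = \<psi> y" for x y
    using \<psi>[OF that(1)] \<psi>[OF that(2)] that inj by (auto simp: c_def)
  ultimately show ?case by (intro exI[of _ \<psi>]) blast
qed

text \<open>Congruence to level \<open>N\<close> after rescaling to coordinates of the lattice of
  \<open>Ks s\<close>. Measured in this way, it is preserved by multiplication with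
  \<open>Ks s\<close> on either side.\<close>

definition congr :: "nat \<Rightarrow> 'e \<Rightarrow> 'e mat \<Rightarrow> 'e mat \<Rightarrow> bool" where
  "congr N s x y \<longleftrightarrow> (\<forall>a<2*r. \<forall>b<2*r. v (x $$ (a, b) - y $$ (a, b)) * wt s b \<le> (1 / q) ^ N * wt s a)"

definition wl :: "'e \<Rightarrow> nat \<Rightarrow> 'e" where "wl s a = (if a < r then 1 else s)"

lemma v_wl [simp]: "v (wl s a) = wt s a" and wl_nz [simp]: "s \<noteq> 0 \<Longrightarrow> wl s a \<noteq> 0"
  by (auto simp: wl_def wt_def)

lemma Ks_finite_cong:
  assumes s: "s \<noteq> 0"
  obtains \<Phi> :: "'e mat \<Rightarrow> nat \<times> nat \<Rightarrow> 'e" where "finite (\<Phi> ` Ks s)"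
    "\<And>x y. x \<in> Ks s \<Longrightarrow> y \<in> Ks s \<Longrightarrow> \<Phi> x = \<Phi> y \<Longrightarrow> congr N s x y"
proof -
  obtain \<phi> :: "'e \<Rightarrow> 'e" where fin: "finite (\<phi> ` {x. v x \<le> 1})"
    and \<phi>: "\<And>x y. v x \<le> 1 \<Longrightarrow> v y \<le> 1 \<Longrightarrow> \<phi> x = \<phi> y \<Longrightarrow> v (x - y) \<le> (1 / q) ^ N"
    using residue_approx[of N] by blast
  let ?I = "{..<2*r} \<times> {..<2*r}"
  define c where "c x = (\<lambda>(a, b). x $$ (a, b) * wl s b / wl s a)" for x :: "'e mat"
  have c1: "v (c x (a, b)) \<le> 1" if "x \<in> Ks s" "a < 2*r" "b < 2*r" for x a b
    using Ks_entry[OF that] s wt_pos[OF s, of a] by (simp add: c_def v_mult v_divide)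
  define \<Phi> where "\<Phi> x = restrict (\<lambda>p. \<phi> (c x p)) ?I" for x
  show ?thesis
  proof (rule that[of \<Phi>])
    have "\<Phi> x \<in> PiE ?I (\<lambda>_. \<phi> ` {x. v x \<le> 1})" if x: "x \<in> Ks s" for x
      unfolding \<Phi>_def restrict_PiE_iff
    proof
      fix p assume "p \<in> ?I"
      then have "c x p \<in> {x. v x \<le> 1}" using c1[OF x, of "fst p" "snd p"] by (auto simp: mem_Times_iff)
      then show "\<phi> (c x p) \<in> \<phi> ` {x. v x \<le> 1}" by (rule imageI)
    qed
    then have "\<Phi> ` Ks s \<subseteq> PiE ?I (\<lambda>_. \<phi> ` {x. v x \<le> 1})" by blast
    moreover have "finite (PiE ?I (\<lambda>_. \<phi> ` {x. v x \<le> 1}))"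
      by (rule finite_PiE) (use fin in auto)
    ultimately show "finite (\<Phi> ` Ks s)" by (rule finite_subset)
    fix x y assume xy: "x \<in> Ks s" "y \<in> Ks s" "\<Phi> x = \<Phi> y"
    show "congr N s x y"
      unfolding congr_def
    proof (intro allI impI)
      fix a b assume ab: "a < 2*r" "b < 2*r"
      have "\<phi> (c x (a, b)) = \<phi> (c y (a, b))"
        using fun_cong[OF xy(3), of "(a, b)"] ab by (simp add: \<Phi>_def)
      then have "v (c x (a, b) - c y (a, b)) \<le> (1 / q) ^ N" using \<phi> c1 xy ab by blast
      moreover have "c x (a, b) - c y (a, b) = (x $$ (a, b) - y $$ (a, b)) * wl s b / wl s a"
        by (simp add: c_def diff_divide_distrib left_diff_distrib)
      ultimately show "v (x $$ (a, b) - y $$ (a, b)) * wt s b \<le> (1 / q) ^ N * wt s a"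
        using wt_pos[OF s, of a] by (simp add: v_mult v_divide pos_divide_le_eq)
    qed
  qed
qed

lemma congr_near:
  assumes s: "s = 1 \<or> s = unif" and \<epsilon>: "0 < \<epsilon>"
  obtains N where "\<And>x y. congr N s x y \<Longrightarrow> near \<epsilon> y x"
proof -
  have q1: "1 < real q" by (rule real_q_gt_1)
  have "1 / real q < 1" using q1 by simp
  then obtain N where N: "(1 / real q) ^ N < \<epsilon> / q"
    using real_arch_pow_inv[of "\<epsilon> / q" "1 / real q"] \<epsilon> q1 by auto
  have "v (x $$ (a, b) - y $$ (a, b)) < \<epsilon>" if c: "congr N s x y" and ab: "a < 2*r" "b < 2*r" for x y a b
  proof -
    let ?d = "v (x $$ (a, b) - y $$ (a, b))"
    have "?d * wt s b \<le> (1 / q) ^ N * wt s a" using c ab by (simp add: congr_def)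
    also have "\<dots> \<le> (1 / q) ^ N" using s q1 by (auto simp: wt_def v_unif mult_left_le)
    finally have 1: "?d * wt s b < \<epsilon> / q" using N by simp
    have "?d * (1 / q) \<le> ?d * wt s b" using s q1 by (intro mult_left_mono) (auto simp: wt_def v_unif)
    then have "?d * (1 / q) < \<epsilon> / q" using 1 by simp
    then show ?thesis using q1 by (simp add: divide_less_cancel)
  qed
  then show ?thesis by (intro that[of N]) (auto simp: near_def)
qed

lemma congr_mult:
  assumes s: "s \<noteq> 0" and k: "k \<in> Ks s" and c: "congr N s x y"
    and xy: "x \<in> carrier_mat (2*r) (2*r)" "y \<in> carrier_mat (2*r) (2*r)"
  shows "congr N s (k * x) (k * y)" "congr N s (x * k) (y * k)"
proof -
  have kc: "k \<in> carrier_mat (2*r) (2*r)" using k Ks_U U_carrier by blast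
  have d: "v ((x - y) $$ (a, b)) * wt s b \<le> (1 / q) ^ N * wt s a" if "a < 2*r" "b < 2*r" for a b
    using c xy that by (simp add: congr_def)
  have xyc: "x - y \<in> carrier_mat (2*r) (2*r)" using xy by (simp add: minus_carrier_mat)
  have q0: "0 \<le> (1 / real q) ^ N" by simp
  show "congr N s (k * x) (k * y)"
    unfolding congr_def
  proof (intro allI impI)
    fix a b assume ab: "a < 2*r" "b < 2*r"
    have "(k * x) $$ (a, b) - (k * y) $$ (a, b) = (k * (x - y)) $$ (a, b)"
      using kc xy ab by (simp add: mult_minus_distrib_mat)
    then show "v ((k * x) $$ (a, b) - (k * y) $$ (a, b)) * wt s b \<le> (1 / q) ^ N * wt s a"
      using mult_entry_le[OF kc xyc ab s, of 1 "(1 / q) ^ N"] Ks_entry[OF k] d ab by simp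
  qed
  show "congr N s (x * k) (y * k)"
    unfolding congr_def
  proof (intro allI impI)
    fix a b assume ab: "a < 2*r" "b < 2*r"
    have "(x * k) $$ (a, b) - (y * k) $$ (a, b) = ((x - y) * k) $$ (a, b)"
      using kc xy ab by (simp add: minus_mult_distrib_mat)
    then show "v ((x * k) $$ (a, b) - (y * k) $$ (a, b)) * wt s b \<le> (1 / q) ^ N * wt s a"
      using mult_entry_le[OF xyc kc ab s, of "(1 / q) ^ N" 1] Ks_entry[OF k] d ab by simp
  qed
qed

text \<open>The radius 1/q covers the strictest bound that occurs, the one of \<open>Ks unif\<close>
  for entries with \<open>r \<le> a\<close> and \<open>b < r\<close>.\<close>

lemma Ks_near:
  assumes s: "s = 1 \<or> s = unif" and g: "g \<in> carrier U" and n: "near (1 / q) (1\<^sub>m (2*r)) g"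
  shows "g \<in> Ks s"
  unfolding Ks_def
proof (intro CollectI conjI allI impI g)
  fix a b assume ab: "a < 2*r" "b < 2*r"
  have q1: "1 < real q" by (rule real_q_gt_1)
  have d: "v (g $$ (a, b) - (if a = b then 1 else 0)) < 1 / q" using n ab by (simp add: near_def)
  show "v (g $$ (a, b)) * wt s b \<le> wt s a"
  proof (cases "a = b")
    case True
    have "1 / real q < 1" using q1 by simp
    then have "v (g $$ (a, b) - 1) \<le> 1" using d True by simp
    then have "v (g $$ (a, b) - 1 + 1) \<le> 1" by (intro v_add_le) auto
    then show ?thesis using True by (simp add: mult_right_le_one_le mult_left_le_one_le)
  next
    case False
    then have "v (g $$ (a, b)) \<le> 1 / q" using d by simp
    then have "v (g $$ (a, b)) * wt s b \<le> 1 / q * 1"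
      using s q1 by (intro mult_mono) (auto simp: wt_def v_unif)
    also have "\<dots> \<le> wt s a" using s q1 by (auto simp: wt_def v_unif)
    finally show ?thesis .
  qed
qed

section \<open>The Borel subgroup as a topological group and its modulus\<close>

abbreviation PG where "PG \<equiv> U\<lparr>carrier := Qg 0\<rparr>"
abbreviation PT where "PT \<equiv> subtopology (mat_topology v (2*r)) (Qg 0)"

sublocale PG: Group.group PG
  by (rule U.subgroup_imp_group[OF subgroup_Qg])

lemma inv_PG: "x \<in> Qg 0 \<Longrightarrow> inv\<^bsub>PG\<^esub> x = adj x"
  using U.m_inv_consistent[OF subgroup_Qg, of x 0] inv_U Qg_U by metis

lemma subgroup_PG: "subgroup A PG \<longleftrightarrow> subgroup A U \<and> A \<subseteq> Qg 0"
proof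
  assume A: "subgroup A PG"
  then have "A \<subseteq> Qg 0" using subgroup.subset by fastforce
  moreover have "subgroup A U" by (rule U.incl_subgroup[OF subgroup_Qg A])
  ultimately show "subgroup A U \<and> A \<subseteq> Qg 0" by simp
qed (use U.subgroup_incl[OF _ subgroup_Qg] in blast)

lemma Qg0_carrier: "Qg 0 \<subseteq> carrier_mat (2*r) (2*r)"
  using Qg_carrier by blast

lemma open_conj:
  assumes A: "subgroup A PG" "openin PT A" and g: "g \<in> Qg 0"
  shows "openin PT (PG.conj_set g A)"
proof -
  have cA: "subgroup (PG.conj_set g A) PG" by (rule PG.subgroup_conj[OF A(1)]) (use g in simp)
  obtain \<epsilon> where \<epsilon>: "0 < \<epsilon>" "\<forall>y\<in>Qg 0. near \<epsilon> (1\<^sub>m (2*r)) y \<longrightarrow> y \<in> A"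
    using A open_subgroup_iff[OF subgroup_Qg, of A 0] by (auto simp: subgroup_PG)
  note gU = Qg_U[OF g] and gc = Qg_carrier[OF g]
  obtain \<delta> where \<delta>: "0 < \<delta>" "\<And>x y. x \<in> carrier_mat (2*r) (2*r) \<Longrightarrow> y \<in> carrier_mat (2*r) (2*r) \<Longrightarrow>
      near \<delta> x y \<Longrightarrow> near \<epsilon> (g * x) (g * y) \<and> near \<epsilon> (x * g) (y * g)"
    using near_mult[OF gc \<epsilon>(1)] by blast
  obtain \<delta>' where \<delta>': "0 < \<delta>'" "\<And>x y. x \<in> carrier_mat (2*r) (2*r) \<Longrightarrow> y \<in> carrier_mat (2*r) (2*r) \<Longrightarrow>
      near \<delta>' x y \<Longrightarrow> near \<delta> (adj g * x) (adj g * y) \<and> near \<delta> (x * adj g) (y * adj g)"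
    using near_mult[OF adj_carrier \<delta>(1)] by blast
  have "y \<in> PG.conj_set g A" if y: "y \<in> Qg 0" "near \<delta>' (1\<^sub>m (2*r)) y" for y
  proof -
    note yU = Qg_U[OF y(1)]
    have "near \<delta> (adj g * 1\<^sub>m (2*r)) (adj g * y)" using \<delta>'(2)[OF _ _ y(2)] U_carrier[OF yU] by simp
    then have "near \<epsilon> (adj g * 1\<^sub>m (2*r) * g) (adj g * y * g)"
      using \<delta>(2) U_carrier[OF yU] by (metis adj_carrier mult_carrier_mat one_carrier_mat)
    then have "near \<epsilon> (1\<^sub>m (2*r)) (adj g * y * g)" using gU by simp
    then have "adj g * y * g \<in> A" using \<epsilon>(2) y g by (simp add: Qg_mult Qg_adj)
    moreover have "y = g * (adj g * y * g) * adj g" using gU yU by (simp add: U_assoc U_adj_cancel)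
    ultimately show ?thesis unfolding PG.conj_set_def using inv_PG[OF g] by (intro image_eqI[of _ _ "adj g * y * g"]) auto
  qed
  then show ?thesis
    using cA \<delta>'(1) open_subgroup_iff[OF subgroup_Qg, of "PG.conj_set g A" 0] by (auto simp: subgroup_PG)
qed

text \<open>The cosets of the open subgroup \<open>Z\<close> by elements of \<open>A\<close> form an
  open cover of \<open>A\<close>. Cosets are equal or disjoint, so a finite subcover contains all of
  them.\<close>

lemma finite_index_compact:
  assumes A: "subgroup A PG" "compactin PT A" and Z: "subgroup Z PG" "openin PT Z"
  shows "finite (PG.rcs A (A \<inter> Z))"
proof -
  have AP: "A \<subseteq> Qg 0" and ZP: "Z \<subseteq> Qg 0" using A Z by (auto simp: subgroup_PG)
  let ?c = "\<lambda>x. Z #>\<^bsub>PG\<^esub> x"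
  have mem: "y \<in> ?c x \<longleftrightarrow> y * adj x \<in> Z" if "x \<in> Qg 0" "y \<in> Qg 0" for x y
    using subgroup.rcos_module[OF Z(1) PG.is_group, of x y] that by (simp add: inv_PG)
  have sub: "?c x \<subseteq> Qg 0" if "x \<in> Qg 0" for x
    using PG.r_coset_subset_G[of Z x] ZP that by simp
  have op: "openin PT (?c x)" if x: "x \<in> Qg 0" for x
    unfolding openin_near[OF Qg0_carrier]
  proof (intro conjI ballI sub[OF x])
    fix y assume y: "y \<in> ?c x"
    then have yP: "y \<in> Qg 0" using sub[OF x] by auto
    obtain \<epsilon> where \<epsilon>: "0 < \<epsilon>" "\<forall>u\<in>Qg 0. near \<epsilon> (y * adj x) u \<longrightarrow> u \<in> Z"
      using Z(2) y mem[OF x yP] unfolding openin_near[OF Qg0_carrier] by blast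
    obtain \<delta> where \<delta>: "0 < \<delta>" "\<And>u w. u \<in> carrier_mat (2*r) (2*r) \<Longrightarrow> w \<in> carrier_mat (2*r) (2*r) \<Longrightarrow>
      near \<delta> u w \<Longrightarrow> near \<epsilon> (adj x * u) (adj x * w) \<and> near \<epsilon> (u * adj x) (w * adj x)"
      using near_mult[OF adj_carrier \<epsilon>(1)] by blast
    show "\<exists>\<epsilon>>0. \<forall>u\<in>Qg 0. near \<epsilon> y u \<longrightarrow> u \<in> ?c x"
    proof (intro exI[of _ \<delta>] conjI ballI impI \<delta>(1))
      fix u assume u: "u \<in> Qg 0" "near \<delta> y u"
      then have "near \<epsilon> (y * adj x) (u * adj x)" using \<delta>(2) Qg_carrier yP by blast
      then show "u \<in> ?c x" using \<epsilon>(2) u x mem by (simp add: Qg_mult Qg_adj)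
    qed
  qed
  have cover: "A \<subseteq> \<Union>(?c ` A)" using AP PG.rcos_self[OF _ Z(1)] by auto
  have "\<forall>W\<in>?c ` A. openin PT W" using op AP by blast
  then obtain \<F> where \<F>: "finite \<F>" "\<F> \<subseteq> ?c ` A" "A \<subseteq> \<Union>\<F>"
    using A(2) cover unfolding compactin_def by meson
  have "?c ` A \<subseteq> \<F>"
  proof
    fix S assume "S \<in> ?c ` A"
    then obtain x where x: "x \<in> A" "S = ?c x" by auto
    then obtain W where W: "W \<in> \<F>" "x \<in> W" using \<F>(3) by blast
    then obtain y where y: "y \<in> A" "W = ?c y" using \<F>(2) by blast
    have "?c y = ?c x"
      by (rule PG.repr_independence[OF _ _ Z(1)]) (use W y AP in auto)
    then show "S \<in> \<F>" using x y W by metis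
  qed
  then have fin: "finite (?c ` A)" using \<F> finite_subset by blast
  show ?thesis
  proof (rule finite_image_determined[OF fin])
    fix x y assume xy: "x \<in> A" "y \<in> A" "?c x = ?c y"
    have c: "x \<in> carrier PG" "y \<in> carrier PG" using xy AP by auto
    have "x \<otimes>\<^bsub>PG\<^esub> inv\<^bsub>PG\<^esub> y \<in> Z" using xy c PG.r_coset_eq_iff[OF Z(1)] by blast
    moreover have "x \<otimes>\<^bsub>PG\<^esub> inv\<^bsub>PG\<^esub> y \<in> A"
      using xy subgroup.m_closed[OF A(1)] subgroup.m_inv_closed[OF A(1)] by blast
    ultimately show "(A \<inter> Z) #>\<^bsub>PG\<^esub> x = (A \<inter> Z) #>\<^bsub>PG\<^esub> y"
      using c PG.r_coset_eq_iff[OF PG.subgroups_Inter_pair[OF A(1) Z(1)]] by blast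
  qed
qed

abbreviation cosub where "cosub \<equiv> compact_open_subgroup PG PT"

lemma commens_cos: "cosub A \<Longrightarrow> cosub B \<Longrightarrow> PG.commens A B"
  using finite_index_compact[of A B] finite_index_compact[of B A]
  by (auto simp: compact_open_subgroup_def PG.commens_def Int_commute)

text \<open>Compactness is used for \<open>A\<close> and \<open>B\<close> only: the finiteness of
  the index in the conjugate of \<open>A\<close> is obtained inside \<open>A\<close>, against the
  open subgroup \<open>B\<close> conjugated by the inverse of \<open>g\<close>, and then
  transported.\<close>

lemma commens_conj_cos:
  assumes A: "cosub A" and B: "cosub B" and g: "g \<in> Qg 0"
  shows "PG.commens (PG.conj_set g A) B"
proof -
  have gP: "g \<in> carrier PG" "inv\<^bsub>PG\<^esub> g \<in> carrier PG" using g PG.inv_closed by auto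
  have s: "subgroup A PG" "subgroup B PG" "openin PT A" "openin PT B" "compactin PT A" "compactin PT B"
    using A B by (auto simp: compact_open_subgroup_def)
  note sA = PG.subgroup_conj[OF s(1) gP(1)] and sB = PG.subgroup_conj[OF s(2) gP(2)]
  have oA: "openin PT (PG.conj_set g A)" by (rule open_conj[OF s(1,3) g])
  have oB: "openin PT (PG.conj_set (inv\<^bsub>PG\<^esub> g) B)" by (rule open_conj[OF s(2,4)]) (use gP in simp)
  have 1: "finite (PG.rcs B (B \<inter> PG.conj_set g A))" by (rule finite_index_compact[OF s(2,6) sA oA])
  have "finite (PG.rcs A (A \<inter> PG.conj_set (inv\<^bsub>PG\<^esub> g) B))" by (rule finite_index_compact[OF s(1,5) sB oB])
  then have "finite (PG.rcs (PG.conj_set g A) (PG.conj_set g (A \<inter> PG.conj_set (inv\<^bsub>PG\<^esub> g) B)))"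
    using PG.idx_conj(2)[OF s(1) PG.subgroups_Inter_pair[OF s(1) sB] gP(1)] by blast
  moreover have "PG.conj_set g (A \<inter> PG.conj_set (inv\<^bsub>PG\<^esub> g) B) = PG.conj_set g A \<inter> B"
  proof -
    have "PG.conj_set g (PG.conj_set (inv\<^bsub>PG\<^esub> g) B) = PG.conj_set \<one>\<^bsub>PG\<^esub> B"
      using PG.conj_conj[OF gP subgroup.subset[OF s(2)]] PG.r_inv[OF gP(1)] by simp
    also have "\<dots> = (\<lambda>x. x) ` B"
      unfolding PG.conj_set_def
      by (rule image_cong) (use subgroup.subset[OF s(2)] PG.r_one PG.l_one PG.inv_one in \<open>auto simp del: U_one\<close>)
    finally show ?thesis
      using PG.conj_inter[OF gP(1) subgroup.subset[OF s(1)] subgroup.subset[OF sB]] by simp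
  qed
  ultimately show ?thesis using 1 sA s(2) by (simp add: PG.commens_def Int_commute)
qed

text \<open>The index does not depend on the compact open subgroup, and the existence of one pins
  down the value, so the definite description is met.\<close>

lemma borel_modulus_eq:
  assumes A: "cosub A" and g: "g \<in> Qg 0"
  shows "borel_modulus v cj r g = gen_index PG (PG.conj_set g A) A"
proof -
  have "gen_index PG (PG.conj_set g A) A = gen_index PG (PG.conj_set g B) B" if "cosub B" for B
    using PG.gen_index_conj_indep[of g A B] g A that commens_cos commens_conj_cos by simp
  then show ?thesis
    unfolding borel_modulus_def modulus_def borel_eq
    unfolding PG.conj_set_def[symmetric] using A by (intro the_equality) blast+
qed

text \<open>The cocycle relation is applied with the conjugate of \<open>A\<close> by
  \<open>g\<close> as intermediate group; conjugating back by \<open>g\<close> turns the first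
  factor into the modulus of \<open>h\<close>.\<close>

lemma borel_modulus_mult:
  assumes A: "cosub A" and g: "g \<in> Qg 0" and h: "h \<in> Qg 0"
  shows "borel_modulus v cj r (g * h) = borel_modulus v cj r g * borel_modulus v cj r h"
proof -
  have AP: "A \<subseteq> carrier PG" "subgroup A PG"
    using A by (auto simp: compact_open_subgroup_def subgroup_PG)
  have gh: "PG.conj_set (g * h) A = PG.conj_set g (PG.conj_set h A)"
    using PG.conj_conj[of g h A] g h AP by simp
  have c: "PG.commens (PG.conj_set h A) A" "PG.commens (PG.conj_set g A) A" "PG.commens (PG.conj_set (g * h) A) A"
    using commens_conj_cos[OF A A] g h Qg_mult by auto
  have "gen_index PG (PG.conj_set (g * h) A) A =
      gen_index PG (PG.conj_set (g * h) A) (PG.conj_set g A) * gen_index PG (PG.conj_set g A) A"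
    by (rule PG.gen_index_cocycle[OF _ c(2,3)]) (use PG.commens_conj[OF c(1), of g] g gh in simp)
  also have "gen_index PG (PG.conj_set (g * h) A) (PG.conj_set g A) = gen_index PG (PG.conj_set h A) A"
    using PG.gen_index_conj[OF c(1), of g] g gh by simp
  finally show ?thesis using A g h by (simp add: borel_modulus_eq Qg_mult)
qed

lemma borel_modulus_pos: "cosub A \<Longrightarrow> g \<in> Qg 0 \<Longrightarrow> 0 < borel_modulus v cj r g"
  using PG.gen_index_pos commens_conj_cos borel_modulus_eq by simp

lemma borel_modulus_self:
  assumes A: "cosub A" and g: "g \<in> A" shows "borel_modulus v cj r g = 1"
proof -
  have s: "subgroup A PG" using A by (simp add: compact_open_subgroup_def)
  have gP: "g \<in> Qg 0" using g s by (auto simp: subgroup_PG)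
  have "PG.conj_set g A = A"
  proof
    show "PG.conj_set g A \<subseteq> A"
      unfolding PG.conj_set_def using g subgroup.m_closed[OF s] subgroup.m_inv_closed[OF s] by blast
    show "A \<subseteq> PG.conj_set g A"
    proof
      fix x assume x: "x \<in> A"
      have xP: "x \<in> Qg 0" using x s by (auto simp: subgroup_PG)
      have "inv\<^bsub>PG\<^esub> g \<otimes>\<^bsub>PG\<^esub> x \<otimes>\<^bsub>PG\<^esub> g \<in> A"
        using g x subgroup.m_closed[OF s] subgroup.m_inv_closed[OF s] by blast
      then have "adj g * x * g \<in> A" using inv_PG[OF gP] by simp
      moreover have "x = g * (adj g * x * g) * adj g"
        using Qg_U[OF gP] Qg_U[OF xP] by (simp add: U_assoc U_adj_cancel)
      ultimately show "x \<in> PG.conj_set g A"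
        unfolding PG.conj_set_def using inv_PG[OF gP] by (intro image_eqI[of _ _ "adj g * x * g"]) auto
    qed
  qed
  then show ?thesis using borel_modulus_eq[OF A gP] PG.gen_index_self[OF s] by simp
qed

end

context unitary_setting
begin

section \<open>Compactness of the integral points of the Borel subgroup\<close>

lemma Metric_space_field: "Metric_space UNIV (\<lambda>x y. v (x - y))"
proof
  show "v (x - z) \<le> v (x - y) + v (y - z)" for x y z
    using v_add[of "x - y" "y - z"] v_nonneg[of "x - y"] v_nonneg[of "y - z"] by (simp del: v_nonneg)
qed (auto simp: v_minus_commute)

lemma complete_field:
  assumes "\<And>\<epsilon>. 0 < \<epsilon> \<Longrightarrow> \<exists>N. \<forall>n\<ge>N. \<forall>m\<ge>N. v (f n - f m) < \<epsilon>"
  obtains l where "\<And>\<epsilon>. 0 < \<epsilon> \<Longrightarrow> \<forall>\<^sub>F n in sequentially. v (f n - l) < \<epsilon>"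
proof -
  interpret EM: Metric_space UNIV "\<lambda>x y. v (x - y)" by (rule Metric_space_field)
  have "EM.MCauchy f" unfolding EM.MCauchy_def using assms by blast
  moreover have "EM.mcomplete" using E_padic by (simp add: padic_field_def)
  ultimately obtain l where "limitin EM.mtopology f l sequentially" by (auto simp: EM.mcomplete_def)
  then show ?thesis using that by (auto simp: EM.limitin_metric)
qed

lemma wt_ratio:
  assumes "s = 1 \<or> s = unif" shows "wt s a / wt s b \<le> q" "1 / q \<le> wt s a / wt s b" "wt s a \<le> 1"
  using assms real_q_gt_1 less_1_mult[of "real q" "real q"] by (auto simp: wt_def v_unif divide_simps)

lemma hf_close:
  assumes "0 \<le> C" "0 \<le> \<epsilon>"
    "\<And>a. a < 2*r \<Longrightarrow> v (z a) \<le> C \<and> v (z' a) \<le> C \<and> v (z a - z' a) \<le> \<epsilon>"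
    "\<And>a. a < 2*r \<Longrightarrow> v (w a) \<le> C \<and> v (w' a) \<le> C \<and> v (w a - w' a) \<le> \<epsilon>"
  shows "v (hf z w - hf z' w') \<le> C * \<epsilon>"
proof -
  have "hf z w - hf z' w' = (\<Sum>a<2*r. eps a * (z a * cj (w (pr a)) - z' a * cj (w' (pr a))))"
    by (simp add: hf_def sum_subtractf algebra_simps)
  also have "v \<dots> \<le> C * \<epsilon>"
  proof (rule v_sum_le)
    fix a assume "a \<in> {..<2*r}"
    then have a: "a < 2*r" "pr a < 2*r" by auto
    have "v ((z a - z' a) * cj (w (pr a)) + z' a * cj (w (pr a) - w' (pr a))) \<le> C * \<epsilon>"
    proof (rule v_add_le)
      show "v ((z a - z' a) * cj (w (pr a))) \<le> C * \<epsilon>"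
        using assms(3)[OF a(1)] assms(4)[OF a(2)] assms(1,2) mult_mono[of "v (z a - z' a)" \<epsilon> "v (w (pr a))" C]
        by (simp add: v_mult mult.commute)
      show "v (z' a * cj (w (pr a) - w' (pr a))) \<le> C * \<epsilon>"
        unfolding v_mult v_cj
        using assms(3)[OF a(1)] assms(4)[OF a(2)] assms(1,2) by (intro mult_mono) auto
    qed
    moreover have "z a * cj (w (pr a)) - z' a * cj (w' (pr a)) =
        (z a - z' a) * cj (w (pr a)) + z' a * cj (w (pr a) - w' (pr a))" by (simp add: algebra_simps)
    ultimately show "v (eps a * (z a * cj (w (pr a)) - z' a * cj (w' (pr a)))) \<le> C * \<epsilon>"
      by (simp add: v_mult)
  qed (use assms in simp)
  finally show ?thesis .
qed

lemma v_eq_0_small: assumes "\<And>\<epsilon>. 0 < \<epsilon> \<Longrightarrow> \<epsilon> \<le> 1 \<Longrightarrow> v x \<le> c * \<epsilon>" "0 < c" shows "x = 0"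
proof (rule ccontr)
  assume "x \<noteq> 0"
  then have p: "0 < v x" by simp
  define \<epsilon> where "\<epsilon> = min 1 (v x / (2 * c))"
  have "0 < \<epsilon>" "\<epsilon> \<le> 1" using p assms(2) by (auto simp: \<epsilon>_def)
  then have "v x \<le> c * \<epsilon>" by (rule assms(1))
  also have "c * \<epsilon> \<le> c * (v x / (2 * c))" using assms(2) by (intro mult_left_mono) (auto simp: \<epsilon>_def)
  also have "\<dots> = v x / 2" using assms(2) by simp
  finally show False using p by simp
qed

text \<open>Entry bounds and zeros pass to the limit directly. The form relations pass by
  \<open>hf_close\<close>, with \<open>q\<close> as the bound for the entries because quotients of
  weights are at most \<open>q\<close>.\<close>

lemma closed_PKs:
  assumes s: "s = 1 \<or> s = unif" and l: "l \<in> carrier_mat (2*r) (2*r)"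
    and approx: "\<And>\<epsilon>. 0 < \<epsilon> \<Longrightarrow> \<exists>x\<in>Qg 0 \<inter> Ks s. near \<epsilon> l x"
  shows "l \<in> Qg 0 \<inter> Ks s"
proof -
  have s0: "s \<noteq> 0" using s by auto
  have d: "v (l $$ (a, b) - x $$ (a, b)) < \<epsilon>" if "near \<epsilon> l x" "a < 2*r" "b < 2*r" for \<epsilon> x a b
    using that v_minus_commute by (simp add: near_def)
  have bnd: "v (x $$ (a, b)) \<le> wt s a / wt s b" if "x \<in> Ks s" "a < 2*r" "b < 2*r" for x a b
    using Ks_entry[OF that] wt_pos[OF s0, of b] by (simp add: pos_le_divide_eq)
  have lb: "v (l $$ (a, b)) \<le> wt s a / wt s b" if ab: "a < 2*r" "b < 2*r" for a b
  proof -
    obtain x where x: "x \<in> Qg 0 \<inter> Ks s" "near (1 / q) l x" using approx[of "1 / q"] real_q_pos by auto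
    have "v (l $$ (a, b) - x $$ (a, b)) \<le> wt s a / wt s b"
      using d[OF x(2) ab] wt_ratio(2)[OF s, of a b] by linarith
    then have "v ((l $$ (a, b) - x $$ (a, b)) + x $$ (a, b)) \<le> wt s a / wt s b"
      using bnd x ab by (intro v_add_le) auto
    then show ?thesis by simp
  qed
  have "l \<in> carrier U"
    unfolding U_iff
  proof (intro conjI allI impI l)
    fix a b assume ab: "a < 2*r" "b < 2*r"
    let ?t = "if b = pr a then eps a else 0"
    have "hf (rw l a) (rw l b) - ?t = 0"
    proof (rule v_eq_0_small[where c = "real q"])
      fix \<epsilon> :: real assume \<epsilon>: "0 < \<epsilon>"
      obtain x where x: "x \<in> Qg 0 \<inter> Ks s" "near \<epsilon> l x" using approx[OF \<epsilon>] by auto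
      have "hf (rw x a) (rw x b) = ?t" using x ab U_rows Qg_U by blast
      moreover have "v (hf (rw l a) (rw l b) - hf (rw x a) (rw x b)) \<le> real q * \<epsilon>"
      proof (rule hf_close)
        have "v (rw l a c) \<le> q \<and> v (rw x a c) \<le> q \<and> v (rw l a c - rw x a c) \<le> \<epsilon>" if "a < 2*r" "c < 2*r" for a c
          using lb[OF that] bnd[of x, OF _ that] wt_ratio(1)[OF s, of a c] d[OF x(2) that] x(1)
          by (auto simp: rw_def)
        then show "c < 2*r \<Longrightarrow> v (rw l a c) \<le> q \<and> v (rw x a c) \<le> q \<and> v (rw l a c - rw x a c) \<le> \<epsilon>"
          "c < 2*r \<Longrightarrow> v (rw l b c) \<le> q \<and> v (rw x b c) \<le> q \<and> v (rw l b c - rw x b c) \<le> \<epsilon>" for c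
          using ab by blast+
      qed (use \<epsilon> in auto)
      ultimately show "v (hf (rw l a) (rw l b) - ?t) \<le> q * \<epsilon>" by simp
    qed (rule real_q_pos)
    then show "hf (rw l a) (rw l b) = ?t" by simp
  qed
  moreover have zero: "l $$ (a, b) = 0" if ab: "a < 2*r" "b < 2*r" and z: "\<And>x. x \<in> Qg 0 \<Longrightarrow> x $$ (a, b) = 0" for a b
  proof (rule v_eq_0_small[where c = 1])
    fix \<epsilon> :: real assume \<epsilon>: "0 < \<epsilon>"
    obtain x where x: "x \<in> Qg 0 \<inter> Ks s" "near \<epsilon> l x" using approx[OF \<epsilon>] by auto
    then show "v (l $$ (a, b)) \<le> 1 * \<epsilon>" using d[OF x(2) ab] z[of x] by simp
  qed simp
  moreover have "l $$ (r + i, j) = 0 \<and> (j < i \<longrightarrow> l $$ (r + i, r + j) = 0)" if "i < r" "j < r" for i j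
    using zero[of "r + i" j] zero[of "r + i" "r + j"] that Qg_zero[of _ 0] by auto
  moreover have "v (l $$ (a, b)) * wt s b \<le> wt s a" if "a < 2*r" "b < 2*r" for a b
    using lb[OF that] wt_pos[OF s0, of b] by (simp add: pos_le_divide_eq)
  ultimately show ?thesis by (simp add: Qg_def Ks_def)
qed

text \<open>Total boundedness comes from the finitely many congruence classes at each level, and
  limits exist by completeness of E entry by entry. The result supplies the compact open subgroup on
  which the modulus is evaluated.\<close>

lemma cosub_PKs:
  assumes s: "s = 1 \<or> s = unif" shows "cosub (Qg 0 \<inter> Ks s)"
proof -
  have s0: "s \<noteq> 0" using s by auto
  let ?A = "Qg 0 \<inter> Ks s"
  have sA: "subgroup ?A U" by (intro U.subgroups_Inter_pair subgroup_Qg subgroup_Ks s0)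
  have "openin PT ?A"
    unfolding open_subgroup_iff[OF subgroup_Qg sA Int_lower1]
    using Ks_near[OF s] Qg_U real_q_pos by (intro exI[of _ "1 / q"]) auto
  moreover have "compactin PT ?A"
  proof -
    interpret MM: Metric_space "carrier_mat (2*r) (2*r)" "mat_dist v (2*r)" by (rule Metric_space_mat)
    have Ac: "?A \<subseteq> carrier_mat (2*r) (2*r)" using Qg0_carrier by blast
    have tb: "MM.mtotally_bounded ?A"
      unfolding MM.mtotally_bounded_def
    proof (intro allI impI)
      fix \<epsilon> :: real assume \<epsilon>: "0 < \<epsilon>"
      obtain N where N: "\<And>x y. congr N s x y \<Longrightarrow> near \<epsilon> y x" using congr_near[OF s \<epsilon>] by blast
      obtain \<Phi> :: "'e mat \<Rightarrow> nat \<times> nat \<Rightarrow> 'e" where \<Phi>: "finite (\<Phi> ` Ks s)"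
        "\<And>x y. x \<in> Ks s \<Longrightarrow> y \<in> Ks s \<Longrightarrow> \<Phi> x = \<Phi> y \<Longrightarrow> congr N s x y" using Ks_finite_cong[OF s0] by blast
      define pk where "pk c = (SOME x. x \<in> ?A \<and> \<Phi> x = c)" for c
      have pk: "pk (\<Phi> x) \<in> ?A \<and> \<Phi> (pk (\<Phi> x)) = \<Phi> x" if "x \<in> ?A" for x
        unfolding pk_def by (rule someI[where x = x]) (use that in simp)
      have "finite (\<Phi> ` ?A)" by (rule finite_subset[OF _ \<Phi>(1)]) auto
      then have "finite (pk ` \<Phi> ` ?A)" by simp
      moreover have "pk ` \<Phi> ` ?A \<subseteq> ?A" using pk by blast
      moreover have "?A \<subseteq> (\<Union>x\<in>pk ` \<Phi> ` ?A. MM.mball x \<epsilon>)"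
      proof
        fix x assume x: "x \<in> ?A"
        have "near \<epsilon> (pk (\<Phi> x)) x" using pk[OF x] x by (intro N \<Phi>(2)) auto
        then have "x \<in> MM.mball (pk (\<Phi> x)) \<epsilon>"
          using near_dist[OF \<epsilon>] pk[OF x] x Ac by (auto simp: MM.in_mball)
        then show "x \<in> (\<Union>x\<in>pk ` \<Phi> ` ?A. MM.mball x \<epsilon>)" using x by blast
      qed
      ultimately show "\<exists>K. finite K \<and> K \<subseteq> ?A \<and> ?A \<subseteq> (\<Union>x\<in>K. MM.mball x \<epsilon>)" by blast
    qed
    have "compactin MM.mtopology ?A"
      unfolding MM.compactin_sequentially
    proof (intro conjI allI impI Ac)
      fix \<sigma> :: "nat \<Rightarrow> 'e mat" assume \<sigma>: "range \<sigma> \<subseteq> ?A"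
      obtain \<rho> where \<rho>: "strict_mono \<rho>" "MM.MCauchy (\<sigma> \<circ> \<rho>)"
        using tb \<sigma> unfolding MM.mtotally_bounded_sequentially by blast
      define f where "f n = \<sigma> (\<rho> n)" for n
      have fA: "f n \<in> ?A" for n using \<sigma> by (auto simp: f_def)
      have ent: "\<exists>l. \<forall>\<epsilon>>0. \<forall>\<^sub>F n in sequentially. v (f n $$ (a, b) - l) < \<epsilon>" if ab: "a < 2*r" "b < 2*r" for a b
      proof -
        have "\<exists>N. \<forall>n\<ge>N. \<forall>m\<ge>N. v (f n $$ (a, b) - f m $$ (a, b)) < \<epsilon>" if e: "0 < \<epsilon>" for \<epsilon>
        proof -
          obtain N where "\<forall>n n'. N \<le> n \<longrightarrow> N \<le> n' \<longrightarrow> mat_dist v (2*r) (f n) (f n') < \<epsilon>"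
            using \<rho>(2) e unfolding MM.MCauchy_def by (auto simp: f_def)
          then show ?thesis using ab unfolding mat_dist_less by blast
        qed
        then obtain l where "\<And>\<epsilon>. 0 < \<epsilon> \<Longrightarrow> \<forall>\<^sub>F n in sequentially. v (f n $$ (a, b) - l) < \<epsilon>"
          using complete_field[of "\<lambda>n. f n $$ (a, b)"] by blast
        then show ?thesis by blast
      qed
      then obtain L where L: "\<And>a b \<epsilon>. a < 2*r \<Longrightarrow> b < 2*r \<Longrightarrow> 0 < \<epsilon> \<Longrightarrow>
          \<forall>\<^sub>F n in sequentially. v (f n $$ (a, b) - L a b) < \<epsilon>" by metis
      define l where "l = mat (2*r) (2*r) (\<lambda>(a, b). L a b)"
      have lc: "l \<in> carrier_mat (2*r) (2*r)" by (simp add: l_def)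
      have ev: "\<forall>\<^sub>F n in sequentially. near \<epsilon> l (f n)" if \<epsilon>: "0 < \<epsilon>" for \<epsilon>
      proof -
        have "\<forall>\<^sub>F n in sequentially. \<forall>p\<in>{..<2*r}\<times>{..<2*r}. v (f n $$ p - l $$ p) < \<epsilon>"
          by (rule eventually_ball_finite) (use L \<epsilon> in \<open>auto simp: l_def\<close>)
        then show ?thesis by (rule eventually_mono) (auto simp: near_def)
      qed
      have lA: "l \<in> ?A"
      proof (rule closed_PKs[OF s lc])
        fix \<epsilon> :: real assume "0 < \<epsilon>"
        then obtain n where "near \<epsilon> l (f n)" using eventually_happens'[OF sequentially_bot ev] by blast
        then show "\<exists>x\<in>?A. near \<epsilon> l x" using fA by blast
      qed
      have "limitin MM.mtopology (\<sigma> \<circ> \<rho>) l sequentially"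
        unfolding MM.limitin_metric
      proof (intro conjI allI impI lc)
        fix \<epsilon> :: real assume \<epsilon>: "0 < \<epsilon>"
        show "\<forall>\<^sub>F n in sequentially. (\<sigma> \<circ> \<rho>) n \<in> carrier_mat (2*r) (2*r) \<and> mat_dist v (2*r) ((\<sigma> \<circ> \<rho>) n) l < \<epsilon>"
          using ev[OF \<epsilon>]
        proof (rule eventually_mono)
          fix n assume "near \<epsilon> l (f n)"
          then show "(\<sigma> \<circ> \<rho>) n \<in> carrier_mat (2*r) (2*r) \<and> mat_dist v (2*r) ((\<sigma> \<circ> \<rho>) n) l < \<epsilon>"
            using fA[of n] Ac near_dist[OF \<epsilon>, of l "f n"] MM.commute[of l "f n"] by (auto simp: f_def)
        qed
      qed
      then show "\<exists>l r. l \<in> ?A \<and> strict_mono r \<and> limitin MM.mtopology (\<sigma> \<circ> r) l sequentially"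
        using lA \<rho>(1) by blast
    qed
    then show ?thesis by (simp add: compactin_subtopology mat_topology_def)
  qed
  ultimately show ?thesis using sA by (simp add: compact_open_subgroup_def subgroup_PG)
qed

section \<open>Torus elements and the value of the modulus on them\<close>

definition tor_coeff :: "nat \<Rightarrow> 'e \<Rightarrow> nat \<Rightarrow> 'e" where
  "tor_coeff m x a = (if a = m then x else if a = r + m then 1 / cj x else 1)"

definition tor :: "nat \<Rightarrow> 'e \<Rightarrow> 'e mat" where "tor m x = mono_mat (\<lambda>a. a) (tor_coeff m x)"

lemma tor_monomial: "x \<noteq> 0 \<Longrightarrow> m < r \<Longrightarrow> monomial (\<lambda>a. a) (tor_coeff m x)"
  by (auto simp: monomial_def tor_coeff_def pr_def eps_def split: if_splits)

lemma tor_U: "x \<noteq> 0 \<Longrightarrow> m < r \<Longrightarrow> tor m x \<in> carrier U"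
  unfolding tor_def by (intro mono_U tor_monomial)

lemma tor_Qg0: "x \<noteq> 0 \<Longrightarrow> m < r \<Longrightarrow> tor m x \<in> Qg 0"
proof -
  assume xm: "x \<noteq> 0" "m < r"
  have "tor m x $$ (a, b) = 0" if "a < 2*r" "b < 2*r" "a \<noteq> b" for a b
    using that by (simp add: tor_def mono_entry)
  then show ?thesis using tor_U[OF xm] by (simp add: Qg_def)
qed

lemma tor_adj: assumes "x \<noteq> 0" "m < r" shows "adj (tor m x) = tor m (1 / x)"
proof (rule eq_matI)
  fix a b assume "a < dim_row (tor m (1 / x))" "b < dim_col (tor m (1 / x))"
  then have ab: "a < 2*r" "b < 2*r" by (simp_all add: tor_def mono_mat_def)
  have c: "cj (tor_coeff m x (pr a)) = tor_coeff m (1 / x) a"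
    using assms ab by (cases "a < r") (auto simp: tor_coeff_def pr_def)
  show "adj (tor m x) $$ (a, b) = tor m (1 / x) $$ (a, b)"
    using ab c by (simp add: adj_entry tor_def mono_entry pr_eq_iff)
qed (simp_all add: tor_def mono_mat_def)

lemma tor_conj_entry:
  assumes x: "x \<noteq> 0" and m: "m < r" and g: "g \<in> carrier_mat (2*r) (2*r)" and ab: "a < 2*r" "b < 2*r"
  shows "(tor m x * g * adj (tor m x)) $$ (a, b) = tor_coeff m x a * g $$ (a, b) / tor_coeff m x b"
proof -
  have "(tor m x * g * adj (tor m x)) $$ (a, b) = (tor m x * g) $$ (a, b) * tor_coeff m (1 / x) b"
    unfolding tor_adj[OF x m] unfolding tor_def
    by (rule mult_monomial[OF _ tor_monomial[OF _ m] ab]) (use x g in \<open>auto simp: mult_carrier_mat[of _ "2*r" "2*r"]\<close>)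
  also have "(tor m x * g) $$ (a, b) = tor_coeff m x a * g $$ (a, b)"
    unfolding tor_def by (rule monomial_mult[OF g tor_monomial[OF x m] ab])
  finally show ?thesis using x by (simp add: tor_coeff_def)
qed

lemma Ks1_entry: "g \<in> Ks 1 \<longleftrightarrow> g \<in> carrier U \<and> (\<forall>a<2*r. \<forall>b<2*r. v (g $$ (a, b)) \<le> 1)"
proof -
  have "wt 1 a = 1" for a by (simp add: wt_def)
  then show ?thesis by (simp add: Ks_def)
qed

text \<open>If row \<open>a\<close> reduces to a multiple of a unit row, orthogonality to the other
  rows makes the off-diagonal entries of column \<open>pr a\<close> small, apart from the one in row
  \<open>a\<close>. That entry gains a second power of \<open>unif\<close> from the isotropy of row
  \<open>a\<close>: with \<open>y\<close> the entry times the conjugate diagonal unit,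
  \<open>y - cj y\<close> is of size 1/q^2, and \<open>y + cj y\<close> is too because it lies in
  \<open>F\<close>.\<close>

lemma row_reduction_unit:
  assumes g: "g \<in> Ks 1" and a: "a < 2*r" and row: "\<And>b. b < 2*r \<Longrightarrow> b \<noteq> a \<Longrightarrow> v (g $$ (a, b)) < 1"
  shows "v (g $$ (a, a)) = 1" "\<And>i. i < 2*r \<Longrightarrow> i \<noteq> pr a \<Longrightarrow> i \<noteq> a \<Longrightarrow> v (g $$ (i, pr a)) < 1"
    "v (g $$ (a, pr a)) \<le> v unif / q"
proof -
  have pU: "g \<in> carrier U" and le: "\<And>a b. a < 2*r \<Longrightarrow> b < 2*r \<Longrightarrow> v (g $$ (a, b)) \<le> 1"
    using g by (auto simp: Ks1_entry)
  have small: "v (hf (rw g i) (rw g a) - eps (pr a) * g $$ (i, pr a) * cj (g $$ (a, a))) < 1" if i: "i < 2*r" for i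
  proof -
    have "hf (rw g i) (rw g a) = eps (pr a) * g $$ (i, pr a) * cj (g $$ (a, pr (pr a))) +
       (\<Sum>c\<in>{..<2*r} - {pr a}. eps c * g $$ (i, c) * cj (g $$ (a, pr c)))"
      unfolding hf_def rw_def using a by (intro sum.remove) auto
    then have "hf (rw g i) (rw g a) - eps (pr a) * g $$ (i, pr a) * cj (g $$ (a, a)) =
       (\<Sum>c\<in>{..<2*r} - {pr a}. eps c * g $$ (i, c) * cj (g $$ (a, pr c)))" using a by simp
    also have "v \<dots> < 1"
    proof (rule v_sum_less)
      fix c assume c: "c \<in> {..<2*r} - {pr a}"
      then have "v (g $$ (a, pr c)) < 1" using row[of "pr c"] a by (auto simp: pr_swap)
      then show "v (eps c * g $$ (i, c) * cj (g $$ (a, pr c))) < 1"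
        using le[of i c] i c by (simp add: v_mult) (metis le_less_trans mult_left_le_one_le v_nonneg)
    qed simp
    finally show ?thesis .
  qed
  have "v (eps (pr a) * g $$ (pr a, pr a) * cj (g $$ (a, a))) = 1"
  proof -
    have "v (hf (rw g (pr a)) (rw g a)) = 1" using U_rows[OF pU, of "pr a" a] a by simp
    then show ?thesis
      using v_diff_dominant[of "hf (rw g (pr a)) (rw g a) - eps (pr a) * g $$ (pr a, pr a) * cj (g $$ (a, a))" "hf (rw g (pr a)) (rw g a)"]
        small[of "pr a"] a by simp
  qed
  then have *: "v (g $$ (pr a, pr a)) * v (g $$ (a, a)) = 1" by (simp add: v_mult)
  then show aa: "v (g $$ (a, a)) = 1"
    using le[of "pr a" "pr a"] le[of a a] a
    by (metis mult.commute mult_left_le_one_le order_antisym pr_less v_nonneg)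
  show "v (g $$ (i, pr a)) < 1" if "i < 2*r" "i \<noteq> pr a" "i \<noteq> a" for i
  proof -
    have "hf (rw g i) (rw g a) = 0" using U_rows[OF pU that(1) a] that a by (auto simp: pr_swap)
    then show ?thesis using small[OF that(1)] aa by (simp add: v_mult)
  qed
  have vu: "v unif = 1 / q" by (rule v_unif)
  define y where "y = g $$ (a, pr a) * cj (g $$ (a, a))"
  have vy: "v y = v (g $$ (a, pr a))" using aa by (simp add: y_def v_mult)
  have y1: "v y \<le> v unif" unfolding vy using row[of "pr a"] a pr_neq[OF a] by (intro v_lt_1_unif) auto
  have "v (y - cj y) \<le> v unif / q"
  proof -
    have mem: "pr a \<in> {..<2*r} - {a}" using a pr_neq[OF a] by auto
    have "0 = hf (rw g a) (rw g a)" using U_rows[OF pU a a] pr_neq[OF a] by simp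
    also have "\<dots> = eps a * g $$ (a, a) * cj (g $$ (a, pr a)) + (eps (pr a) * g $$ (a, pr a) * cj (g $$ (a, pr (pr a))) +
       (\<Sum>c\<in>{..<2*r} - {a} - {pr a}. eps c * g $$ (a, c) * cj (g $$ (a, pr c))))"
      unfolding hf_def rw_def using a mem
      by (subst sum.remove[of _ a], simp, simp, subst sum.remove[of _ "pr a"]) auto
    also have "\<dots> = - (eps a * (y - cj y)) + (\<Sum>c\<in>{..<2*r} - {a} - {pr a}. eps c * g $$ (a, c) * cj (g $$ (a, pr c)))"
      using a by (simp add: y_def eps_pr algebra_simps)
    finally have "eps a * (y - cj y) = (\<Sum>c\<in>{..<2*r} - {a} - {pr a}. eps c * g $$ (a, c) * cj (g $$ (a, pr c)))"
      by (simp add: eq_neg_iff_add_eq_0)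
    moreover have "v (\<Sum>c\<in>{..<2*r} - {a} - {pr a}. eps c * g $$ (a, c) * cj (g $$ (a, pr c))) \<le> v unif / q"
    proof (rule v_sum_le)
      fix c assume c: "c \<in> {..<2*r} - {a} - {pr a}"
      have "v (g $$ (a, c)) \<le> v unif" "v (g $$ (a, pr c)) \<le> v unif"
        using row[of c] row[of "pr c"] c a by (auto intro!: v_lt_1_unif simp: pr_swap)
      then have "v (g $$ (a, c)) * v (g $$ (a, pr c)) \<le> v unif * v unif" by (intro mult_mono) auto
      then show "v (eps c * g $$ (a, c) * cj (g $$ (a, pr c))) \<le> v unif / q" by (simp add: v_mult vu)
    qed simp
    ultimately show ?thesis by (metis mult_1 v_eps v_mult)
  qed
  moreover have "v (y + cj y) \<le> v unif / q"
    by (rule cj_fixed_unif_le) (use y1 in \<open>auto intro: v_add_le\<close>)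
  ultimately have "v ((y + cj y) + (y - cj y)) \<le> v unif / q"
    using v_add_le[of "y + cj y" _ "y - cj y"] by blast
  moreover have "(y + cj y) + (y - cj y) = 2 * y" by simp
  ultimately show "v (g $$ (a, pr a)) \<le> v unif / q" using vy by (simp add: v_mult)
qed

text \<open>Conjugation scales row \<open>a\<close> and column \<open>pr a\<close> up by q, hence
  their common entry by q^2, and \<open>row_reduction_unit\<close> says that smallness of the row
  pays for all of this. The index \<open>a\<close> is whichever of \<open>m\<close> and
  \<open>r + m\<close> carries the large coefficient, so the statement covers a torus element and
  its inverse.\<close>

lemma tor_conj_Ks:
  assumes g: "g \<in> Ks 1" and m: "m < r" and x: "x \<noteq> 0" and a: "a < 2*r" "lev a = m" "v (tor_coeff m x a) = q"
  shows "tor m x * g * adj (tor m x) \<in> Ks 1 \<longleftrightarrow> (\<forall>b<2*r. b \<noteq> a \<longrightarrow> v (g $$ (a, b)) < 1)"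
proof -
  have pU: "g \<in> carrier U" and le: "\<And>a b. a < 2*r \<Longrightarrow> b < 2*r \<Longrightarrow> v (g $$ (a, b)) \<le> 1"
    using g by (auto simp: Ks1_entry)
  have q1: "1 < real q" by (rule real_q_gt_1)
  have am: "a = m \<or> a = r + m" using a m by (auto simp: lev_def split: if_splits)
  have c': "v (tor_coeff m x (pr a)) = 1 / q"
    using am
  proof
    assume "a = m"
    then show ?thesis using a(3) m by (simp add: tor_coeff_def pr_def v_divide)
  next
    assume am: "a = r + m"
    then have "1 / v x = real q" using a(3) m by (simp add: tor_coeff_def v_divide)
    then have "v x = 1 / real q" by (metis div_by_1 divide_divide_eq_right mult_1)
    then show ?thesis using am m by (simp add: tor_coeff_def pr_def)
  qed
  have co: "v (tor_coeff m x b) = 1" if "b \<noteq> a" "b \<noteq> pr a" for b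
    using am that m by (auto simp: tor_coeff_def pr_def)
  have mem: "tor m x * g * adj (tor m x) \<in> carrier U" using tor_U[OF x m] pU by simp
  have ent: "v ((tor m x * g * adj (tor m x)) $$ (i, j)) = v (tor_coeff m x i) * v (g $$ (i, j)) / v (tor_coeff m x j)"
    if "i < 2*r" "j < 2*r" for i j
    using tor_conj_entry[OF x m U_carrier[OF pU] that] by (simp add: v_mult v_divide)
  show ?thesis
  proof
    assume L: "tor m x * g * adj (tor m x) \<in> Ks 1"
    show "\<forall>b<2*r. b \<noteq> a \<longrightarrow> v (g $$ (a, b)) < 1"
    proof (intro allI impI)
      fix b assume b: "b < 2*r" "b \<noteq> a"
      have l1: "q * v (g $$ (a, b)) / v (tor_coeff m x b) \<le> 1"
      proof -
        have "v ((tor m x * g * adj (tor m x)) $$ (a, b)) \<le> 1" using L a(1) b(1) unfolding Ks1_entry by blast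
        then show ?thesis unfolding ent[OF a(1) b(1)] using a(3) by simp
      qed
      have "q * v (g $$ (a, b)) \<le> 1"
      proof (cases "b = pr a")
        case True
        then have "q * v (g $$ (a, b)) * q \<le> 1" using l1 c' by simp
        moreover have "q * v (g $$ (a, b)) * 1 \<le> q * v (g $$ (a, b)) * q" using q1 by (intro mult_left_mono) auto
        ultimately show ?thesis by simp
      next
        case False then show ?thesis using l1 co[OF b(2) False] by simp
      qed
      then have "v (g $$ (a, b)) \<le> 1 / q" using q1 by (simp add: field_simps)
      also have "\<dots> < 1" using q1 by simp
      finally show "v (g $$ (a, b)) < 1" .
    qed
  next
    assume R: "\<forall>b<2*r. b \<noteq> a \<longrightarrow> v (g $$ (a, b)) < 1"
    note red = row_reduction_unit[OF g a(1)]
    have 1: "q * v y \<le> 1" if "v y < 1" for y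
      using v_lt_1_unif[OF that] q1 by (simp add: v_unif field_simps)
    have ca: "v (tor_coeff m x i) = (if i = a then real q else if i = pr a then 1 / q else 1)" for i
      using a c' co by auto
    have "v ((tor m x * g * adj (tor m x)) $$ (i, j)) \<le> 1" if ij: "i < 2*r" "j < 2*r" for i j
    proof -
      have pa: "pr a \<noteq> a" by (rule pr_neq[OF a(1)])
      consider "i = a" "j = a" | "i = a" "j = pr a" | "i = a" "j \<noteq> a" "j \<noteq> pr a"
        | "i \<noteq> a" "j = a" | "i \<noteq> a" "i \<noteq> pr a" "j = pr a" | "i = pr a" "j \<noteq> a" | "i \<noteq> a" "i \<noteq> pr a" "j \<noteq> a" "j \<noteq> pr a" by blast
      then show ?thesis
      proof cases
        case 1 then show ?thesis using le[OF ij] q1 a(1) by (simp add: ent ca)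
      next
        case 2
        then have "v (g $$ (i, j)) \<le> 1 / (q * q)" using red(3) R by (simp add: v_unif)
        moreover have "v ((tor m x * g * adj (tor m x)) $$ (i, j)) = v (g $$ (i, j)) * (q * q)"
          using 2 pa ent[OF ij] by (simp add: ca)
        ultimately show ?thesis using q1 by (simp add: pos_le_divide_eq)
      next
        case 3
        then show ?thesis using 1[of "g $$ (i, j)"] R ij by (simp add: ent ij ca)
      next
        case 4
        have "v (tor_coeff m x i) \<le> 1" using 4 q1 ca[of i] by (simp split: if_splits)
        then have "v (tor_coeff m x i) * v (g $$ (i, j)) \<le> 1" using le[OF ij] by (simp add: mult_le_one)
        then show ?thesis using 4 q1 ca[of j] ent[OF ij] by (simp add: divide_le_eq)
      next
        case 5
        then show ?thesis using 1[of "g $$ (i, j)"] red(2)[of i] R ij pa by (simp add: ent ij ca mult.commute)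
      next
        case 6
        have "v (g $$ (i, j)) / q \<le> 1" using le[OF ij] q1 by (simp add: divide_le_eq)
        then show ?thesis using 6 le[OF ij] q1 pa ent[OF ij] by (cases "j = pr a") (simp_all add: ca)
      next
        case 7
        then show ?thesis using le[OF ij] by (simp add: ent ij ca)
      qed
    qed
    then show "tor m x * g * adj (tor m x) \<in> Ks 1" using mem by (simp add: Ks1_entry)
  qed
qed

abbreviation PK where "PK \<equiv> Qg 0 \<inter> Ks 1"

lemma PK_diag: assumes "g \<in> PK" "a < 2*r" shows "v (g $$ (a, a)) = 1"
proof -
  have le: "v (g $$ (b, b)) \<le> 1" if "b < 2*r" for b using assms that by (auto simp: Ks1_entry)
  have "v (g $$ (j, j)) = 1 \<and> v (g $$ (r + j, r + j)) = 1" if j: "j < r" for j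
  proof -
    have "v (g $$ (j, j)) * v (g $$ (r + j, r + j)) = 1"
      using arg_cong[OF Qg_column(1)[of g 0 j], of v] assms j by (simp add: v_mult)
    moreover have "v (g $$ (j, j)) * v (g $$ (r + j, r + j)) \<le> v (g $$ (j, j))"
      "v (g $$ (j, j)) * v (g $$ (r + j, r + j)) \<le> v (g $$ (r + j, r + j))"
      using le[of j] le[of "r + j"] j by (simp_all add: mult_left_le mult_right_le_one_le mult_left_le_one_le)
    ultimately show ?thesis using le[of j] le[of "r + j"] j by simp
  qed
  from this[of a] this[of "a - r"] show ?thesis using assms(2) by (cases "a < r") auto
qed

lemma subgroup_PK: "subgroup PK PG"
  using cosub_PKs[of 1] by (simp add: compact_open_subgroup_def)

lemma PK_inter_conj:
  assumes m: "m < r" and x: "x \<noteq> 0" and a: "a < 2*r" "lev a = m" "v (tor_coeff m x a) = q"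
  shows "PK \<inter> PG.conj_set (adj (tor m x)) PK = {g \<in> PK. \<forall>b<2*r. b \<noteq> a \<longrightarrow> v (g $$ (a, b)) < 1}"
proof -
  let ?T = "tor m x"
  have T: "?T \<in> Qg 0" "adj ?T \<in> Qg 0" "?T \<in> carrier U" using tor_Qg0[OF x m] Qg_adj Qg_U by auto
  have "g \<in> PG.conj_set (adj ?T) PK \<longleftrightarrow> ?T * g * adj ?T \<in> Ks 1" if g: "g \<in> PK" for g
  proof
    have gU: "g \<in> carrier U" using g Qg_U by blast
    have aa: "adj (adj ?T) = ?T" using adj_adj U_carrier[OF T(3)] by blast
    show "?T * g * adj ?T \<in> Ks 1" if gc: "g \<in> PG.conj_set (adj ?T) PK"
    proof -
      obtain y where y: "y \<in> PK" "g = adj ?T * y * ?T"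
        using gc aa inv_PG[OF T(2)] by (auto simp: PG.conj_set_def)
      have yU: "y \<in> carrier U" using y Qg_U by blast
      have "?T * g * adj ?T = y" using y(2) T yU by (simp add: U_assoc U_adj_cancel)
      then show ?thesis using y by simp
    qed
    show "g \<in> PG.conj_set (adj ?T) PK" if "?T * g * adj ?T \<in> Ks 1"
    proof -
      have "?T * g * adj ?T \<in> PK" using that g T by (auto intro: Qg_mult)
      moreover have "g = adj ?T * (?T * g * adj ?T) * ?T" using T gU by (simp add: U_assoc U_adj_cancel)
      ultimately show ?thesis
        unfolding PG.conj_set_def using aa inv_PG[OF T(2)] by (intro image_eqI[of _ _ "?T * g * adj ?T"]) auto
    qed
  qed
  then show ?thesis using tor_conj_Ks[OF _ m x a] by blast
qed

text \<open>The subgroup is the stabilizer, modulo \<open>unif\<close>, of the line of the unit row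
  at \<open>a\<close>. Its cosets therefore correspond to the reduced rows \<open>a\<close> up to
  scalars, with one free residue for each position that the triangular shape leaves open.\<close>

lemma PK_index:
  assumes m: "m < r" and x: "x \<noteq> 0" and a: "a < 2*r" "lev a = m" "v (tor_coeff m x a) = q"
  shows "PG.idx PK (PK \<inter> PG.conj_set (adj (tor m x)) PK) =
    q ^ card {b. b < 2*r \<and> (if a = m then b < m \<or> r \<le> b else r + m < b)}"
proof -
  define H where "H = PK \<inter> PG.conj_set (adj (tor m x)) PK"
  have Heq: "H = {g \<in> PK. \<forall>b<2*r. b \<noteq> a \<longrightarrow> v (g $$ (a, b)) < 1}"
    unfolding H_def by (rule PK_inter_conj[OF assms])
  have sH: "subgroup H PG"
    unfolding H_def by (intro PG.subgroups_Inter_pair subgroup_PK PG.subgroup_conj) (simp add: Qg_adj tor_Qg0[OF x m])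
  define B where "B = {b. b < 2*r \<and> (if a = m then b < m \<or> r \<le> b else r + m < b)}"
  have am: "a = m \<or> a = r + m" using a m by (auto simp: lev_def split: if_splits)
  have aB: "a \<notin> B" using am m by (auto simp: B_def)
  have finB: "finite B" by (simp add: B_def)
  have outB: "g $$ (a, b) = 0" if "g \<in> PK" "b < 2*r" "b \<notin> B" "b \<noteq> a" for g b
    using am
  proof
    assume am: "a = m"
    then show ?thesis using that m Qg_column(2)[of g 0 b a] by (auto simp: B_def)
  next
    assume am: "a = r + m"
    then show ?thesis using that m Qg_zero(1)[of g 0 m b] Qg_zero(2)[of g 0 m "b - r"]
      by (cases "b < r") (auto simp: B_def)
  qed
  have le: "v (g $$ (c, b)) \<le> 1" if "g \<in> PK" "c < 2*r" "b < 2*r" for g c b using that by (auto simp: Ks1_entry)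
  \<comment> \<open>Dividing by the diagonal unit removes the scalar, so equal values mean equal
    lines.\<close>
  define \<phi> where "\<phi> g = restrict (\<lambda>b. res (g $$ (a, b) / g $$ (a, a))) B" for g
  have quo: "v (g $$ (a, b) / g $$ (a, a)) \<le> 1" if "g \<in> PK" "b < 2*r" for g b
    using le[OF that(1) a(1) that(2)] PK_diag[OF that(1) a(1)] by (simp add: v_divide)
  have \<phi>_eq: "\<phi> g = \<phi> h \<longleftrightarrow> (\<forall>b\<in>B. v (g $$ (a, b) / g $$ (a, a) - h $$ (a, b) / h $$ (a, a)) < 1)"
    if "g \<in> PK" "h \<in> PK" for g h
  proof -
    have "\<phi> g = \<phi> h \<longleftrightarrow> (\<forall>b\<in>B. res (g $$ (a, b) / g $$ (a, a)) = res (h $$ (a, b) / h $$ (a, a)))"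
      unfolding \<phi>_def by (auto simp: restrict_def fun_eq_iff)
    also have "\<dots> \<longleftrightarrow> (\<forall>b\<in>B. v (g $$ (a, b) / g $$ (a, a) - h $$ (a, b) / h $$ (a, a)) < 1)"
      using res_eq_iff quo that by (intro ball_cong refl) (auto simp: B_def)
    finally show ?thesis .
  qed
  have key: "H #>\<^bsub>PG\<^esub> g = H #>\<^bsub>PG\<^esub> h \<longleftrightarrow> \<phi> g = \<phi> h" if g: "g \<in> PK" and h: "h \<in> PK" for g h
  proof -
    have gU: "g \<in> carrier U" "h \<in> carrier U" and gQ: "g \<in> Qg 0" "h \<in> Qg 0" using g h Qg_U by auto
    note gc = U_carrier[OF gU(1)] and hc = U_carrier[OF gU(2)]
    define k where "k = g * adj h"
    have kP: "k \<in> PK" using g h by (auto simp: k_def intro!: Qg_mult Qg_adj Ks_mult Ks_adj)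
    have coset: "H #>\<^bsub>PG\<^esub> g = H #>\<^bsub>PG\<^esub> h \<longleftrightarrow> k \<in> H"
      using PG.r_coset_eq_iff[OF sH, of g h] gQ inv_PG by (simp add: k_def)
    have g_kh: "g = k * h" using gU by (simp add: k_def U_adj_cancel)
    have ua: "v (g $$ (a, a)) = 1" "v (h $$ (a, a)) = 1" using PK_diag a g h by auto
    then have nz: "g $$ (a, a) \<noteq> 0" "h $$ (a, a) \<noteq> 0" by auto
    show ?thesis
    proof
      assume "H #>\<^bsub>PG\<^esub> g = H #>\<^bsub>PG\<^esub> h"
      then have kH: "k \<in> H" using coset by simp
      have s: "v (g $$ (a, c) - k $$ (a, a) * h $$ (a, c)) < 1" if c: "c < 2*r" for c
      proof -
        have "g $$ (a, c) = (\<Sum>d<2*r. k $$ (a, d) * h $$ (d, c))"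
          unfolding g_kh using kP Qg_carrier hc a c by (intro mult_entry) auto
        also have "\<dots> = k $$ (a, a) * h $$ (a, c) + (\<Sum>d\<in>{..<2*r} - {a}. k $$ (a, d) * h $$ (d, c))"
          using a by (intro sum.remove) auto
        finally have "g $$ (a, c) - k $$ (a, a) * h $$ (a, c) = (\<Sum>d\<in>{..<2*r} - {a}. k $$ (a, d) * h $$ (d, c))" by simp
        also have "v \<dots> < 1"
        proof (rule v_sum_less)
          fix d assume d: "d \<in> {..<2*r} - {a}"
          have "v (k $$ (a, d)) < 1" using kH d unfolding Heq by auto
          then show "v (k $$ (a, d) * h $$ (d, c)) < 1"
            using le[OF h, of d c] d c by (simp add: v_mult) (metis le_less_trans mult_right_le_one_le v_nonneg)
        qed simp
        finally show ?thesis .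
      qed
      have "v (g $$ (a, b) / g $$ (a, a) - h $$ (a, b) / h $$ (a, a)) < 1" if b: "b \<in> B" for b
      proof -
        have b2: "b < 2*r" using b by (simp add: B_def)
        have "g $$ (a, b) / g $$ (a, a) - h $$ (a, b) / h $$ (a, a) =
          ((g $$ (a, b) - k $$ (a, a) * h $$ (a, b)) * h $$ (a, a) -
           h $$ (a, b) * (g $$ (a, a) - k $$ (a, a) * h $$ (a, a))) / (g $$ (a, a) * h $$ (a, a))"
          using nz by (simp add: field_simps)
        moreover have "v ((g $$ (a, b) - k $$ (a, a) * h $$ (a, b)) * h $$ (a, a) -
           h $$ (a, b) * (g $$ (a, a) - k $$ (a, a) * h $$ (a, a))) < 1"
          using s[OF b2] s[OF a(1)] ua le[OF h a(1) b2]
          by (intro v_diff_less) (simp_all add: v_mult, metis le_less_trans mult_left_le_one_le v_nonneg)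
        ultimately show ?thesis using ua by (simp add: v_divide v_mult)
      qed
      then show "\<phi> g = \<phi> h" using \<phi>_eq[OF g h] by simp
    next
      assume "\<phi> g = \<phi> h"
      then have e: "v (g $$ (a, b) / g $$ (a, a) - h $$ (a, b) / h $$ (a, a)) < 1" if "b \<in> B" for b
        using \<phi>_eq[OF g h] that by blast
      define \<mu> where "\<mu> = g $$ (a, a) / h $$ (a, a)"
      have s: "v (g $$ (a, c) - \<mu> * h $$ (a, c)) < 1" if c: "c < 2*r" for c
      proof -
        consider "c = a" | "c \<in> B" | "c \<notin> B" "c \<noteq> a" by blast
        then show ?thesis
        proof cases
          case 1 then show ?thesis using nz by (simp add: \<mu>_def)
        next
          case 2
          have "g $$ (a, c) - \<mu> * h $$ (a, c) = g $$ (a, a) * (g $$ (a, c) / g $$ (a, a) - h $$ (a, c) / h $$ (a, a))"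
            using nz by (simp add: \<mu>_def field_simps)
          then show ?thesis using e[OF 2] ua by (simp add: v_mult)
        next
          case 3 then show ?thesis using outB[OF g c] outB[OF h c] by simp
        qed
      qed
      have "v (k $$ (a, b)) < 1" if b: "b < 2*r" "b \<noteq> a" for b
      proof -
        have 1: "k $$ (a, b) = (\<Sum>c<2*r. g $$ (a, c) * adj h $$ (c, b))"
          unfolding k_def by (rule mult_entry[OF gc adj_carrier a(1) b(1)])
        have "(\<Sum>c<2*r. h $$ (a, c) * adj h $$ (c, b)) = (h * adj h) $$ (a, b)"
          by (rule mult_entry[OF hc adj_carrier a(1) b(1), symmetric])
        then have 2: "(\<Sum>c<2*r. h $$ (a, c) * adj h $$ (c, b)) = 0" using gU b a by simp
        have "k $$ (a, b) = (\<Sum>c<2*r. g $$ (a, c) * adj h $$ (c, b)) - \<mu> * (\<Sum>c<2*r. h $$ (a, c) * adj h $$ (c, b))"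
          using 1 2 by simp
        also have "\<dots> = (\<Sum>c<2*r. (g $$ (a, c) - \<mu> * h $$ (a, c)) * adj h $$ (c, b))"
          by (simp add: sum_distrib_left sum_subtractf algebra_simps)
        also have "v \<dots> < 1"
        proof (rule v_sum_less)
          fix c assume c: "c \<in> {..<2*r}"
          have "v (adj h $$ (c, b)) \<le> 1" using le[OF h, of "pr b" "pr c"] b c by (simp add: adj_entry v_mult)
          then show "v ((g $$ (a, c) - \<mu> * h $$ (a, c)) * adj h $$ (c, b)) < 1"
            using s[of c] c by (simp add: v_mult) (metis le_less_trans mult_right_le_one_le v_nonneg)
        qed simp
        finally show ?thesis .
      qed
      then have "k \<in> H" using kP unfolding Heq by blast
      then show "H #>\<^bsub>PG\<^esub> g = H #>\<^bsub>PG\<^esub> h" using coset by simp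
    qed
  qed
  have "\<phi> ` PK = PiE B (\<lambda>_. residue_reps)"
  proof
    show "\<phi> ` PK \<subseteq> PiE B (\<lambda>_. residue_reps)"
    proof
      fix f assume "f \<in> \<phi> ` PK"
      then obtain g where g: "g \<in> PK" "f = \<phi> g" by auto
      have "res (g $$ (a, b) / g $$ (a, a)) \<in> residue_reps" if "b \<in> B" for b
        using res(1) quo[OF g(1)] that by (auto simp: B_def)
      then show "f \<in> PiE B (\<lambda>_. residue_reps)" using g by (auto simp: \<phi>_def)
    qed
    show "PiE B (\<lambda>_. residue_reps) \<subseteq> \<phi> ` PK"
    proof
      fix f assume f: "f \<in> PiE B (\<lambda>_. residue_reps)"
      \<comment> \<open>Since the coordinates lie in \<open>F\<close>, the value of the skew form on
        \<open>\<rho>\<close> is both fixed and negated by \<open>cj\<close>, hence zero. So every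
        tuple of residues is realized by a matrix \<open>rowE\<close>.\<close>
      define \<rho> where "\<rho> b = (if b = a then 1 else if b \<in> B then f b else 0)" for b
      have \<rho>F: "\<rho> b \<in> F" "v (\<rho> b) \<le> 1" for b
        using PiE_mem[OF f, of b] residue_reps(1) residue_reps(4)[of "f b"] by (simp_all add: \<rho>_def subset_iff)
      have c: "cj (hf \<rho> \<rho>) = hf \<rho> \<rho>" using cj_fixes \<rho>F by (simp add: hf_def cj_sum)
      have "2 * hf \<rho> \<rho> = hf \<rho> \<rho> + - cj (hf \<rho> \<rho>)" by (subst hf_skew[symmetric]) (rule mult_2)
      then have "2 * hf \<rho> \<rho> = 0" unfolding c by (simp only: add.right_inverse)
      then have h0: "hf \<rho> \<rho> = 0" by simp
      have \<rho>a: "\<rho> a = 1" by (simp add: \<rho>_def)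
      define E where "E = rowE a \<rho>"
      have EK: "E \<in> Ks 1" unfolding E_def by (rule rowE_Ks[OF _ a(1) \<rho>a h0]) (use \<rho>F in \<open>auto simp: wt_def\<close>)
      have "E $$ (r + i, j) = 0 \<and> (j < i \<longrightarrow> E $$ (r + i, r + j) = 0)" if ij: "i < r" "j < r" for i j
        using am
      proof
        assume am: "a = m"
        have "\<rho> (pr (r + i)) = 0" if "m < i" using that am ij by (simp add: \<rho>_def B_def pr_def)
        then show ?thesis using am ij m by (auto simp: E_def rowE_entry pr_def)
      next
        assume am: "a = r + m"
        have "\<rho> (pr (r + i)) = 0" "\<rho> j = 0" "j < m \<Longrightarrow> \<rho> (r + j) = 0"
          using am ij m by (simp_all add: \<rho>_def B_def pr_def)
        then show ?thesis using am ij m by (auto simp: E_def rowE_entry pr_def)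
      qed
      then have "E \<in> PK" using EK Ks_U by (auto simp: Qg_def)
      moreover have "\<phi> E = f"
      proof
        fix b show "\<phi> E b = f b"
        proof (cases "b \<in> B")
          case True
          then have b: "b < 2*r" "b \<noteq> a" using aB by (auto simp: B_def)
          have "E $$ (a, b) = f b" "E $$ (a, a) = 1" using a b True \<rho>a by (simp_all add: E_def rowE_entry \<rho>_def)
          then show ?thesis using True f res_reps[of "f b"] by (auto simp: \<phi>_def PiE_def)
        next
          case False then show ?thesis using f by (auto simp: \<phi>_def PiE_def extensional_def)
        qed
      qed
      ultimately show "f \<in> \<phi> ` PK" by blast
    qed
  qed
  moreover have "PG.idx PK H = card (\<phi> ` PK)"
    unfolding PG.idx_def by (rule card_image_iff_determined) (rule key)
  moreover have "card (PiE B (\<lambda>_. residue_reps)) = q ^ card B"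
    using card_PiE[OF finB, of "\<lambda>_. residue_reps"] residue_reps(2) by simp
  ultimately show ?thesis by (simp add: H_def B_def)
qed

text \<open>The two indices of the intersection have m + r and r - m - 1 free positions by
  \<open>PK_index\<close>, used for \<open>x\<close> and for its inverse; the difference is 2m +
  1.\<close>

lemma borel_modulus_tor:
  assumes m: "m < r" and x: "v x = q"
  shows "borel_modulus v cj r (tor m x) = real q ^ (2 * m + 1)"
proof -
  have q0: "0 < real q" by (rule real_q_pos)
  have x0: "x \<noteq> 0" using x q0 by auto
  let ?T = "tor m x"
  have T: "?T \<in> Qg 0" "adj ?T \<in> Qg 0" using tor_Qg0[OF x0 m] Qg_adj by auto
  have aa: "adj (adj ?T) = ?T" using adj_adj Qg_carrier[OF T(1)] by blast
  have s: "subgroup PK PG" by (rule subgroup_PK)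
  have sub: "PK \<subseteq> carrier PG" by auto
  have c1: "PG.conj_set ?T PK \<inter> PK = PK \<inter> PG.conj_set (adj (tor m (1 / x))) PK"
    using aa tor_adj[OF x0 m] by auto
  have "card {b. b < 2*r \<and> (if r + m = m then b < m \<or> r \<le> b else r + m < b)} = card {r + m<..<2*r}"
    using m by (intro arg_cong[where f = card]) auto
  also have "\<dots> = r - m - 1" using m by simp
  finally have i1: "PG.idx PK (PG.conj_set ?T PK \<inter> PK) = q ^ (r - m - 1)"
    unfolding c1 using PK_index[OF m, of "1 / x" "r + m"] m x x0 by (simp add: lev_def tor_coeff_def)
  have "PG.conj_set ?T (PG.conj_set (adj ?T) PK) = PG.conj_set (?T * adj ?T) PK"
    using PG.conj_conj[of ?T "adj ?T" PK] T sub by simp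
  also have "?T * adj ?T = \<one>\<^bsub>PG\<^esub>" using Qg_U[OF T(1)] by simp
  also have "PG.conj_set \<one>\<^bsub>PG\<^esub> PK = (\<lambda>x. x) ` PK"
    unfolding PG.conj_set_def
    by (rule image_cong) (use sub PG.r_one PG.l_one PG.inv_one in \<open>auto simp del: U_one\<close>)
  finally have c2: "PG.conj_set ?T PK \<inter> PK = PG.conj_set ?T (PK \<inter> PG.conj_set (adj ?T) PK)"
    using PG.conj_inter[of ?T PK "PG.conj_set (adj ?T) PK"] T sub
      subgroup.subset[OF PG.subgroup_conj[OF s, of "adj ?T"]] by auto
  have "{b. b < 2*r \<and> (if m = m then b < m \<or> r \<le> b else r + m < b)} = {..<m} \<union> {r..<2*r}" using m by auto
  moreover have "card ({..<m} \<union> {r..<2*r}) = m + r" using m by (subst card_Un_disjoint) auto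
  ultimately have "PG.idx PK (PK \<inter> PG.conj_set (adj ?T) PK) = q ^ (m + r)"
    using PK_index[OF m x0, of m] m x by (simp add: lev_def tor_coeff_def)
  then have i2: "PG.idx (PG.conj_set ?T PK) (PG.conj_set ?T PK \<inter> PK) = q ^ (m + r)"
    unfolding c2 using PG.idx_conj(1)[OF s PG.subgroups_Inter_pair[OF s PG.subgroup_conj[OF s]], of "adj ?T" ?T] T by simp
  have "gen_index PG (PG.conj_set ?T PK) PK = real q ^ (m + r) / real q ^ (r - m - 1)"
    using PG.gen_index_idx[OF subgroup.subset[OF PG.subgroup_conj[OF s]] sub, of ?T] T i1 i2 by simp
  also have "\<dots> = real q ^ (2 * m + 1)"
  proof -
    have "m + r = (2 * m + 1) + (r - m - 1)" using m by simp
    then have "real q ^ (m + r) = real q ^ (2 * m + 1) * real q ^ (r - m - 1)" by (metis power_add)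
    then show ?thesis using q0 by simp
  qed
  finally show ?thesis using borel_modulus_eq[OF cosub_PKs[of 1] T(1)] by simp
qed

end

section \<open>Finite averages over the parahoric subgroups\<close>

context unitary_setting
begin

lemma congr_refl: "congr N s x x" by (simp add: congr_def)

lemma congr_sym: "congr N s x y \<Longrightarrow> congr N s y x"
  by (simp add: congr_def v_minus_commute)

lemma congr_trans: assumes "congr N s x y" "congr N s y z" shows "congr N s x z"
  unfolding congr_def
proof (intro allI impI)
  fix a b assume ab: "a < 2*r" "b < 2*r"
  let ?d = "\<lambda>u w. v (u $$ (a, b) - w $$ (a, b)) * wt s b"
  have "v ((x $$ (a, b) - y $$ (a, b)) + (y $$ (a, b) - z $$ (a, b))) \<le> v (x $$ (a, b) - y $$ (a, b)) \<or>
    v ((x $$ (a, b) - y $$ (a, b)) + (y $$ (a, b) - z $$ (a, b))) \<le> v (y $$ (a, b) - z $$ (a, b))"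
    using v_add by (metis max_def)
  then have "?d x z \<le> ?d x y \<or> ?d x z \<le> ?d y z" by (auto intro: mult_right_mono)
  moreover have "?d x y \<le> (1 / q) ^ N * wt s a" "?d y z \<le> (1 / q) ^ N * wt s a"
    using assms ab unfolding congr_def by blast+
  ultimately show "?d x z \<le> (1 / q) ^ N * wt s a" by linarith
qed

text \<open>The predicate under the choice depends only on the congruence class of \<open>h\<close>,
  so the representative does too. Summing over the representatives replaces the Haar integral of a
  function that is constant on congruence classes.\<close>

definition rp :: "nat \<Rightarrow> 'e \<Rightarrow> 'e mat set \<Rightarrow> 'e mat \<Rightarrow> 'e mat" where
  "rp N s H h = (SOME h'. h' \<in> H \<and> congr N s h' h)"

definition tr :: "nat \<Rightarrow> 'e \<Rightarrow> 'e mat set \<Rightarrow> 'e mat set" where "tr N s H = rp N s H ` H"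

lemma rp: "h \<in> H \<Longrightarrow> rp N s H h \<in> H \<and> congr N s (rp N s H h) h"
  unfolding rp_def by (rule someI[where x = h]) (simp add: congr_refl)

lemma rp_eq: "congr N s h h' \<Longrightarrow> rp N s H h = rp N s H h'"
  unfolding rp_def using congr_trans congr_sym by (intro arg_cong[where f = Eps] ext) blast

lemma rp_eq_iff: "h \<in> H \<Longrightarrow> h' \<in> H \<Longrightarrow> rp N s H h = rp N s H h' \<longleftrightarrow> congr N s h h'"
  using rp rp_eq congr_trans congr_sym by metis

lemma tr_subset: "tr N s H \<subseteq> H" using rp by (auto simp: tr_def)

lemma rp_tr: "h \<in> tr N s H \<Longrightarrow> rp N s H h = h"
  using rp rp_eq by (auto simp: tr_def)

lemma tr_nonempty: "H \<noteq> {} \<Longrightarrow> tr N s H \<noteq> {}" by (simp add: tr_def)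

lemma finite_tr: assumes "s \<noteq> 0" "H \<subseteq> Ks s" shows "finite (tr N s H)"
proof -
  obtain \<Phi> :: "'e mat \<Rightarrow> nat \<times> nat \<Rightarrow> 'e" where \<Phi>: "finite (\<Phi> ` Ks s)"
    "\<And>x y. x \<in> Ks s \<Longrightarrow> y \<in> Ks s \<Longrightarrow> \<Phi> x = \<Phi> y \<Longrightarrow> congr N s x y" using Ks_finite_cong[OF assms(1)] by blast
  have "finite (\<Phi> ` H)" by (rule finite_subset[OF image_mono[OF assms(2)] \<Phi>(1)])
  then show ?thesis unfolding tr_def
    by (rule finite_image_determined) (use \<Phi>(2) assms(2) rp_eq in blast)
qed

text \<open>A map that is injective on congruence classes permutes them, since there are finitely
  many; \<open>\<phi>\<close> sees only the class.\<close>

lemma tr_sum_bij: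
  assumes fin: "finite (tr N s H)"
    and \<phi>: "\<And>h h'. h \<in> H \<Longrightarrow> h' \<in> H \<Longrightarrow> congr N s h h' \<Longrightarrow> \<phi> h = \<phi> h'"
    and \<theta>: "\<And>h. h \<in> H \<Longrightarrow> \<theta> h \<in> H"
    and inj: "\<And>h h'. h \<in> H \<Longrightarrow> h' \<in> H \<Longrightarrow> congr N s (\<theta> h) (\<theta> h') \<Longrightarrow> congr N s h h'"
  shows "(\<Sum>h\<in>tr N s H. \<phi> (\<theta> h)) = (\<Sum>h\<in>tr N s H. \<phi> h)"
proof -
  let ?T = "tr N s H"
  define g where "g h = rp N s H (\<theta> h)" for h
  have TH: "h \<in> H" if "h \<in> ?T" for h using that tr_subset by blast
  have "g ` ?T \<subseteq> ?T" using \<theta> TH by (auto simp: g_def tr_def)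
  moreover have "inj_on g ?T"
  proof (rule inj_onI)
    fix h h' assume h: "h \<in> ?T" "h' \<in> ?T" "g h = g h'"
    then have "congr N s (\<theta> h) (\<theta> h')"
      using rp_eq_iff[OF \<theta>[OF TH[OF h(1)]] \<theta>[OF TH[OF h(2)]]] unfolding g_def by blast
    then have "congr N s h h'" by (rule inj[OF TH[OF h(1)] TH[OF h(2)]])
    then have "rp N s H h = rp N s H h'" by (rule rp_eq)
    then show "h = h'" using rp_tr[OF h(1)] rp_tr[OF h(2)] by simp
  qed
  ultimately have bij: "bij_betw g ?T ?T"
    using fin by (simp add: bij_betw_def endo_inj_surj)
  have "\<phi> (g h) = \<phi> (\<theta> h)" if "h \<in> ?T" for h
    unfolding g_def using rp[OF \<theta>[OF TH[OF that]]] by (intro \<phi>) (use \<theta> TH that in auto)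
  then have "(\<Sum>h\<in>?T. \<phi> (\<theta> h)) = (\<Sum>h\<in>?T. \<phi> (g h))" by simp
  also have "\<dots> = (\<Sum>h\<in>?T. \<phi> h)" by (rule sum.reindex_bij_betw[OF bij])
  finally show ?thesis .
qed

text \<open>Invariance of the counting integral: translation by \<open>k\<close> is injective on
  classes because multiplication by \<open>adj k\<close> also preserves congruence.\<close>

lemma tr_sum_translate:
  assumes s: "s \<noteq> 0" and H: "subgroup H U" "H \<subseteq> Ks s" and k: "k \<in> H"
    and \<phi>: "\<And>h h'. h \<in> H \<Longrightarrow> h' \<in> H \<Longrightarrow> congr N s h h' \<Longrightarrow> \<phi> h = \<phi> h'"
  shows "(\<Sum>h\<in>tr N s H. \<phi> (k * h)) = (\<Sum>h\<in>tr N s H. \<phi> h)"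
    "(\<Sum>h\<in>tr N s H. \<phi> (h * k)) = (\<Sum>h\<in>tr N s H. \<phi> h)"
proof -
  have HU: "h \<in> carrier U" if "h \<in> H" for h using that H Ks_U by blast
  have ak: "adj k \<in> Ks s" using k H Ks_adj[OF s] by blast
  have m: "x * y \<in> H" if "x \<in> H" "y \<in> H" for x y
    using subgroup.m_closed[OF H(1) that] by simp
  have c: "x * y \<in> carrier_mat (2*r) (2*r)" if "x \<in> H" "y \<in> H" for x y using m[OF that] HU U_carrier by blast
  note fin = finite_tr[OF s H(2), of N]
  show "(\<Sum>h\<in>tr N s H. \<phi> (k * h)) = (\<Sum>h\<in>tr N s H. \<phi> h)"
  proof (rule tr_sum_bij[OF fin \<phi> m[OF k]])
    fix h h' assume h: "h \<in> H" "h' \<in> H" "congr N s (k * h) (k * h')"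
    then show "congr N s h h'"
      using congr_mult(1)[OF s ak h(3) c[OF k h(1)] c[OF k h(2)]] HU k by (simp add: U_adj_cancel)
  qed
  show "(\<Sum>h\<in>tr N s H. \<phi> (h * k)) = (\<Sum>h\<in>tr N s H. \<phi> h)"
  proof (rule tr_sum_bij[OF fin \<phi> m[OF _ k]])
    fix h h' assume h: "h \<in> H" "h' \<in> H" "congr N s (h * k) (h' * k)"
    then show "congr N s h h'"
      using congr_mult(2)[OF s ak h(3) c[OF h(1) k] c[OF h(2) k]] HU k by (simp add: U_adj_cancel)
  qed
qed

text \<open>The two lattices differ by at most one power of \<open>unif\<close> in each coordinate,
  so entries that are trivial to level 1 for one lattice satisfy the bounds for the other.
  Consequently both spherical functions are constant on classes of level 1 in either group.\<close>

lemma congr_one_Ks: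
  assumes s: "s = 1 \<or> s = unif" "s' = 1 \<or> s' = unif" and h: "h \<in> Ks s" "h' \<in> Ks s" and c: "congr 1 s h h'"
  shows "adj h * h' \<in> Ks s'"
proof -
  have s0: "s \<noteq> 0" using s by auto
  have hU: "h \<in> carrier U" "h' \<in> carrier U" using h Ks_U by auto
  have "congr 1 s (adj h * h) (adj h * h')"
    using congr_mult(1)[OF s0 Ks_adj[OF s0 h(1)] c] hU U_carrier by blast
  then have c1: "congr 1 s (adj h * h') (1\<^sub>m (2*r))" using hU congr_sym by simp
  define u where "u = adj h * h'"
  have uU: "u \<in> carrier U" using hU by (simp add: u_def)
  have q1: "1 < real q" by (rule real_q_gt_1)
  have d: "v (u $$ (a, b) - (if a = b then 1 else 0)) * wt s b \<le> 1 / q * wt s a" if "a < 2*r" "b < 2*r" for a b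
    using c1 that by (simp add: u_def congr_def)
  have "v (u $$ (a, b)) * wt s' b \<le> wt s' a" if ab: "a < 2*r" "b < 2*r" for a b
  proof (cases "a = b")
    case True
    have "v (u $$ (a, a) - 1) * wt s a \<le> 1 / q * wt s a" using d[of a a] ab True by simp
    then have "v (u $$ (a, a) - 1) \<le> 1 / q" by (rule mult_right_le_imp_le) (simp add: s0)
    also have "\<dots> \<le> 1" using q1 by simp
    finally have "v (u $$ (a, a) - 1 + 1) \<le> 1" by (intro v_add_le) auto
    then show ?thesis using True by (simp add: mult_left_le_one_le)
  next
    case False
    then have 1: "v (u $$ (a, b)) * wt s b \<le> 1 / q * wt s a" using d[OF ab] by simp
    have qq: "1 \<le> real q * real q" using q1 less_1_mult[of "real q" "real q"] by simp
    show ?thesis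
    proof (cases "s = 1")
      case True
      then have "v (u $$ (a, b)) \<le> 1 / q" using 1 by (simp add: wt_def split: if_splits)
      then have "v (u $$ (a, b)) * wt s' b \<le> 1 / q * 1"
        using s wt_ratio(3)[OF s(2)] by (intro mult_mono) auto
      also have "\<dots> \<le> wt s' a" using s(2) q1 by (auto simp: wt_def v_unif)
      finally show ?thesis .
    next
      case False
      then have su: "s = unif" using s by simp
      show ?thesis
      proof (cases "s' = unif")
        case True
        have "1 / q * wt s a \<le> wt s a" using q1 mult_right_mono[of "1 / real q" 1 "wt s a"] by simp
        then show ?thesis using 1 True su by simp
      next
        case False
        then have s1: "s' = 1" using s by simp
        have "v (u $$ (a, b)) * (1 / q) \<le> v (u $$ (a, b)) * wt s b"
          using q1 su by (intro mult_left_mono) (auto simp: wt_def v_unif)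
        also have "\<dots> \<le> 1 / q * 1" using 1 wt_ratio(3)[OF s(1), of a] q1
          by (meson divide_nonneg_nonneg mult_left_mono of_nat_0_le_iff order_trans zero_le_one)
        finally have "v (u $$ (a, b)) \<le> 1" using q1 by (simp add: divide_le_cancel)
        then show ?thesis using s1 by (simp add: wt_def)
      qed
    qed
  qed
  then show ?thesis using uU by (simp add: u_def Ks_def)
qed

end

section \<open>The principal series and its spherical vectors\<close>

locale principal_setting = unitary_setting p v F cj unif r
  for p :: nat and v :: "'e::field_char_0 \<Rightarrow> real" and F cj unif and r :: nat +
  fixes \<sigma> :: "nat \<Rightarrow> complex"
begin

section \<open>The inducing character and the space of smooth functions\<close>

abbreviation V where "V \<equiv> principal_series v cj r \<sigma>"

definition \<tau> :: "'e mat \<Rightarrow> complex" where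
  "\<tau> b = complex_of_real (sqrt (borel_modulus v cj r b)) * borel_char v r \<sigma> b"

definition smooth :: "('e mat \<Rightarrow> complex) \<Rightarrow> bool" where
  "smooth f \<longleftrightarrow> (\<exists>\<epsilon>>0. \<forall>u\<in>carrier U. near \<epsilon> (1\<^sub>m (2*r)) u \<longrightarrow> (\<forall>x\<in>carrier U. f (x * u) = f x))"

lemma cosub1: "cosub PK" using cosub_PKs[of 1] by simp

lemma \<tau>_mult:
  assumes b: "b \<in> Qg 0" and c: "c \<in> Qg 0" shows "\<tau> (b * c) = \<tau> b * \<tau> c"
proof -
  have "borel_char v r \<sigma> (b * c) = borel_char v r \<sigma> b * borel_char v r \<sigma> c"
    unfolding borel_char_def prod.distrib[symmetric]
    by (intro prod.cong) (auto simp: Qg0_diag_mult[OF b c] v_mult powr_times_real)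
  then show ?thesis by (simp add: \<tau>_def borel_modulus_mult[OF cosub1 b c] real_sqrt_mult)
qed

lemma \<tau>_nz: "b \<in> Qg 0 \<Longrightarrow> \<tau> b \<noteq> 0"
  using borel_modulus_pos[OF cosub1, of b] Qg0_diag_nz[of b] by (auto simp: \<tau>_def borel_char_def)

lemma Ks_Qg0_diag: assumes s: "s \<noteq> 0" and g: "g \<in> Qg 0 \<inter> Ks s" and j: "j < r"
  shows "v (g $$ (j, j)) = 1"
proof -
  have le: "v (g $$ (b, b)) \<le> 1" if "b < 2*r" for b
  proof -
    have "v (g $$ (b, b)) * wt s b \<le> 1 * wt s b" using g that Ks_entry[of g s b b] by simp
    then show ?thesis by (rule mult_right_le_imp_le) (simp add: s)
  qed
  have "v (g $$ (j, j)) * v (g $$ (r + j, r + j)) = 1"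
    using arg_cong[OF Qg_column(1)[of g 0 j], of v] g j by (simp add: v_mult)
  moreover have "v (g $$ (j, j)) * v (g $$ (r + j, r + j)) \<le> v (g $$ (j, j))"
    using le[of j] le[of "r + j"] j by (simp add: mult_left_le)
  ultimately show ?thesis using le[of j] j by simp
qed

text \<open>The modulus is 1 on a compact open subgroup, which normalizes itself, and the diagonal
  entries are units.\<close>

lemma \<tau>_unit: assumes s: "s = 1 \<or> s = unif" and b: "b \<in> Qg 0" "b \<in> Ks s" shows "\<tau> b = 1"
proof -
  have "borel_modulus v cj r b = 1" using borel_modulus_self[OF cosub_PKs[OF s]] b by simp
  moreover have "borel_char v r \<sigma> b = 1"
    unfolding borel_char_def using Ks_Qg0_diag[of s b] b s by (intro prod.neutral) auto
  ultimately show ?thesis by (simp add: \<tau>_def)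
qed

lemma \<tau>_one [simp]: "\<tau> (1\<^sub>m (2*r)) = 1"
  by (rule \<tau>_unit[of 1]) (auto simp: Qg_one Ks_one)

lemma \<tau>_tor:
  assumes m: "m < r" and x: "v x = q"
  shows "\<tau> (tor m x) = of_real (sqrt (real q ^ (2 * m + 1))) * of_nat q powr \<sigma> m"
proof -
  have "borel_char v r \<sigma> (tor m x) = (\<Prod>i<r. if i = m then of_nat q powr \<sigma> m else 1)"
    unfolding borel_char_def using x
    by (intro prod.cong) (auto simp: tor_def mono_entry tor_coeff_def)
  then show ?thesis using m by (simp add: \<tau>_def borel_modulus_tor[OF m x])
qed

text \<open>Given a radius of invariance, the full stabilizer of \<open>f\<close> under right
  translation is a subgroup that contains a neighbourhood of the identity, hence open.\<close>

lemma smooth_iff: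
  assumes "\<forall>x. x \<notin> carrier U \<longrightarrow> f x = 0"
  shows "(\<exists>Z. subgroup Z U \<and> openin (unitary_topology v cj r) Z \<and>
      (\<forall>u\<in>Z. \<forall>x\<in>carrier U. f (x \<otimes>\<^bsub>U\<^esub> u) = f x)) \<longleftrightarrow> smooth f"
proof
  assume "\<exists>Z. subgroup Z U \<and> openin (unitary_topology v cj r) Z \<and>
      (\<forall>u\<in>Z. \<forall>x\<in>carrier U. f (x \<otimes>\<^bsub>U\<^esub> u) = f x)"
  then obtain Z where Z: "subgroup Z U" "openin (unitary_topology v cj r) Z"
    "\<forall>u\<in>Z. \<forall>x\<in>carrier U. f (x * u) = f x" by auto
  obtain \<epsilon> where "0 < \<epsilon>" "\<forall>y\<in>carrier U. near \<epsilon> (1\<^sub>m (2*r)) y \<longrightarrow> y \<in> Z"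
    using Z(2) open_subgroup_iff[OF U.subgroup_self Z(1) subgroup.subset[OF Z(1)]]
    by (auto simp: unitary_topology_def)
  then show "smooth f" using Z(3) unfolding smooth_def by blast
next
  assume "smooth f"
  then obtain \<epsilon> where \<epsilon>: "0 < \<epsilon>"
    "\<And>u x. u \<in> carrier U \<Longrightarrow> near \<epsilon> (1\<^sub>m (2*r)) u \<Longrightarrow> x \<in> carrier U \<Longrightarrow> f (x * u) = f x"
    by (auto simp: smooth_def)
  define Z where "Z = {u \<in> carrier U. \<forall>x\<in>carrier U. f (x * u) = f x}"
  have Z: "subgroup Z U"
  proof (rule subgroupU)
    show "g * h \<in> Z" if "g \<in> Z" "h \<in> Z" for g h
      using that by (auto simp: Z_def simp flip: U_assoc)
    show "adj g \<in> Z" if g: "g \<in> Z" for g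
    proof -
      have gU: "g \<in> carrier U" and gf: "\<And>x. x \<in> carrier U \<Longrightarrow> f (x * g) = f x" using g by (auto simp: Z_def)
      have "f (x * adj g) = f x" if x: "x \<in> carrier U" for x
        using gf[of "x * adj g"] x gU by (simp add: U_adj_cancel)
      then show ?thesis using gU by (simp add: Z_def)
    qed
  qed (auto simp: Z_def)
  have "openin (unitary_topology v cj r) Z"
    unfolding unitary_topology_def open_subgroup_iff[OF U.subgroup_self Z subgroup.subset[OF Z]]
    using \<epsilon> by (intro exI[of _ \<epsilon>]) (auto simp: Z_def)
  then show "\<exists>Z. subgroup Z U \<and> openin (unitary_topology v cj r) Z \<and>
      (\<forall>u\<in>Z. \<forall>x\<in>carrier U. f (x \<otimes>\<^bsub>U\<^esub> u) = f x)"
    using Z by (intro exI[of _ Z]) (auto simp: Z_def)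
qed

lemma V_carrier: "f \<in> carrier V \<longleftrightarrow> (\<forall>x. x \<notin> carrier U \<longrightarrow> f x = 0) \<and>
    (\<forall>b\<in>Qg 0. \<forall>x\<in>carrier U. f (b * x) = \<tau> b * f x) \<and> smooth f"
  using smooth_iff[of f]
  by (auto simp: principal_series_def induced_rep_def borel_eq \<tau>_def)

lemma V_zero [simp]: "\<zero>\<^bsub>V\<^esub> = (\<lambda>_. 0)"
  and V_add [simp]: "f \<oplus>\<^bsub>V\<^esub> g = (\<lambda>x. f x + g x)"
  and V_smult [simp]: "c \<odot>\<^bsub>V\<^esub> f = (\<lambda>x. c * f x)"
  by (simp_all add: principal_series_def induced_rep_def)

lemma V_act: "act V h f = (\<lambda>x. if x \<in> carrier U then f (x * h) else 0)"
  by (simp add: principal_series_def induced_rep_def cong: if_cong)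

lemma smooth_combine:
  assumes "smooth f" "smooth g" shows "smooth (\<lambda>x. \<alpha> (f x) (g x))"
proof -
  obtain \<epsilon> where \<epsilon>: "0 < \<epsilon>" "\<forall>u\<in>carrier U. near \<epsilon> (1\<^sub>m (2*r)) u \<longrightarrow> (\<forall>x\<in>carrier U. f (x * u) = f x)"
    using assms by (auto simp: smooth_def)
  obtain \<delta> where \<delta>: "0 < \<delta>" "\<forall>u\<in>carrier U. near \<delta> (1\<^sub>m (2*r)) u \<longrightarrow> (\<forall>x\<in>carrier U. g (x * u) = g x)"
    using assms by (auto simp: smooth_def)
  have "near \<epsilon> (1\<^sub>m (2*r)) u" "near \<delta> (1\<^sub>m (2*r)) u" if "near (min \<epsilon> \<delta>) (1\<^sub>m (2*r)) u" for u
    using that by (auto simp: near_def)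
  then show ?thesis unfolding smooth_def using \<epsilon> \<delta> by (intro exI[of _ "min \<epsilon> \<delta>"]) auto
qed

lemma smooth_zero: "smooth (\<lambda>_. 0)"
  unfolding smooth_def by (intro exI[of _ 1]) auto

lemma smooth_act: assumes f: "smooth f" and g: "g \<in> carrier U"
  shows "smooth (\<lambda>x. if x \<in> carrier U then f (x * g) else 0)"
proof -
  obtain \<epsilon> where \<epsilon>: "0 < \<epsilon>" "\<forall>u\<in>carrier U. near \<epsilon> (1\<^sub>m (2*r)) u \<longrightarrow> (\<forall>x\<in>carrier U. f (x * u) = f x)"
    using f by (auto simp: smooth_def)
  note gc = U_carrier[OF g]
  obtain \<delta> where \<delta>: "0 < \<delta>" "\<And>x y. x \<in> carrier_mat (2*r) (2*r) \<Longrightarrow> y \<in> carrier_mat (2*r) (2*r) \<Longrightarrow>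
      near \<delta> x y \<Longrightarrow> near \<epsilon> (g * x) (g * y) \<and> near \<epsilon> (x * g) (y * g)"
    using near_mult[OF gc \<epsilon>(1)] by blast
  obtain \<delta>' where \<delta>': "0 < \<delta>'" "\<And>x y. x \<in> carrier_mat (2*r) (2*r) \<Longrightarrow> y \<in> carrier_mat (2*r) (2*r) \<Longrightarrow>
      near \<delta>' x y \<Longrightarrow> near \<delta> (adj g * x) (adj g * y) \<and> near \<delta> (x * adj g) (y * adj g)"
    using near_mult[OF adj_carrier \<delta>(1)] by blast
  have "f (x * u * g) = f (x * g)" if u: "u \<in> carrier U" "near \<delta>' (1\<^sub>m (2*r)) u" and x: "x \<in> carrier U" for u x
  proof -
    have "near \<delta> (adj g * 1\<^sub>m (2*r)) (adj g * u)" using \<delta>'(2)[OF _ _ u(2)] U_carrier[OF u(1)] by simp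
    then have "near \<epsilon> (adj g * 1\<^sub>m (2*r) * g) (adj g * u * g)"
      using \<delta>(2) U_carrier[OF u(1)] by (metis adj_carrier mult_carrier_mat one_carrier_mat)
    then have "near \<epsilon> (1\<^sub>m (2*r)) (adj g * u * g)" using g by simp
    then have "f (x * g * (adj g * u * g)) = f (x * g)" using \<epsilon>(2) u x g by simp
    moreover have "x * g * (adj g * u * g) = x * u * g" using u x g by (simp add: U_assoc U_adj_cancel)
    ultimately show ?thesis by simp
  qed
  then show ?thesis unfolding smooth_def using \<delta>'(1) by (intro exI[of _ \<delta>']) auto
qed

lemma abelian_group_V: "abelian_group V"
proof (rule abelian_groupI)
  fix f g assume "f \<in> carrier V" "g \<in> carrier V"
  then show "f \<oplus>\<^bsub>V\<^esub> g \<in> carrier V"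
    using smooth_combine[of f g "(+)"] by (auto simp: V_carrier distrib_left)
next
  show "\<zero>\<^bsub>V\<^esub> \<in> carrier V" using smooth_zero by (auto simp: V_carrier)
next
  fix f assume f: "f \<in> carrier V"
  then have "(\<lambda>x. - f x) \<in> carrier V"
    using smooth_combine[of f f "\<lambda>a b. - a"] by (auto simp: V_carrier)
  then show "\<exists>g\<in>carrier V. g \<oplus>\<^bsub>V\<^esub> f = \<zero>\<^bsub>V\<^esub>" by (intro bexI) auto
qed (auto simp: add.assoc add.commute)

lemma group_rep_V: "group_rep U V"
proof -
  have "module complex_ring V"
  proof (rule moduleI)
    show "cring complex_ring" by (rule cring_from_type_algebra)
    show "abelian_group V" by (rule abelian_group_V)
    show "c \<odot>\<^bsub>V\<^esub> f \<in> carrier V" if "f \<in> carrier V" for c f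
      using that smooth_combine[of f f "\<lambda>a b. c * a"] by (auto simp: V_carrier)
  qed (auto simp: ring_of_type_algebra_def algebra_simps)
  moreover have "act V g f \<in> carrier V" if g: "g \<in> carrier U" and f: "f \<in> carrier V" for g f
    using smooth_act[OF _ g] f g by (auto simp: V_carrier V_act Qg_U U_assoc)
  moreover have "act V (1\<^sub>m (2*r)) f = f" if "f \<in> carrier V" for f
    using that by (auto simp: V_carrier V_act fun_eq_iff)
  ultimately show ?thesis
    unfolding group_rep_def group_rep_axioms_def using U.is_group
    by (auto simp: V_act fun_eq_iff U_assoc)
qed

sublocale V: group_rep U V by (rule group_rep_V)

text \<open>The Iwasawa decomposition \<open>g = b * k\<close> leaves \<open>b\<close> ambiguous up
  to \<open>Qg 0 \<inter> Ks s\<close>, where \<open>\<tau>\<close> is trivial, so the value is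
  independent of the choice (\<open>sph_eq\<close>).\<close>

definition sph :: "'e \<Rightarrow> 'e mat \<Rightarrow> complex" where
  "sph s g = (if g \<in> carrier U then \<tau> (SOME b. b \<in> Qg 0 \<and> adj b * g \<in> Ks s) else 0)"

lemma sph_eq:
  assumes s: "s = 1 \<or> s = unif" and b: "b \<in> Qg 0" and k: "k \<in> Ks s"
  shows "sph s (b * k) = \<tau> b"
proof -
  have s0: "s \<noteq> 0" using s by auto
  have U: "b \<in> carrier U" "k \<in> carrier U" using b k Qg_U Ks_U by auto
  define c where "c = (SOME c. c \<in> Qg 0 \<and> adj c * (b * k) \<in> Ks s)"
  have "c \<in> Qg 0 \<and> adj c * (b * k) \<in> Ks s"
    unfolding c_def by (rule someI[where x = b]) (use b k U in \<open>simp add: U_adj_cancel\<close>)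
  then have c: "c \<in> Qg 0" "adj c * (b * k) \<in> Ks s" "c \<in> carrier U" using Qg_U by auto
  have "adj c * b = adj c * (b * k) * adj k" using U c by (simp add: U_assoc U_adj_cancel)
  then have "adj c * b \<in> Ks s" using Ks_mult[OF s0 c(2) Ks_adj[OF s0 k]] by simp
  moreover have cb: "adj c * b \<in> Qg 0" using b c by (intro Qg_mult Qg_adj)
  ultimately have "\<tau> (adj c * b) = 1" using \<tau>_unit[OF s] by blast
  then have "\<tau> b = \<tau> c" using \<tau>_mult[OF c(1) cb] U c by (simp add: U_adj_cancel)
  then show ?thesis using U by (simp add: sph_def c_def)
qed

lemma decomp:
  assumes "s = 1 \<or> s = unif" "g \<in> carrier U"
  obtains b k where "b \<in> Qg 0" "k \<in> Ks s" "g = b * k"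
proof -
  obtain k where k: "k \<in> Ks s" "g * k \<in> Qg 0" using iwasawa[OF assms(1), of g r] assms(2) by (auto simp: Qg_r)
  have "g = g * k * adj k" using assms(2) k Ks_U by (simp add: U_adj_cancel)
  then show ?thesis using that[of "g * k" "adj k"] k Ks_adj[of s] assms(1) by auto
qed

lemma sph_left: assumes s: "s = 1 \<or> s = unif" and b: "b \<in> Qg 0" and g: "g \<in> carrier U"
  shows "sph s (b * g) = \<tau> b * sph s g"
proof -
  obtain c k where c: "c \<in> Qg 0" "k \<in> Ks s" "g = c * k" using decomp[OF s g] .
  have "b * g = (b * c) * k" using b c Qg_U Ks_U by (simp add: U_assoc)
  then show ?thesis using sph_eq[OF s Qg_mult[OF b c(1)] c(2)] sph_eq[OF s c(1,2)] \<tau>_mult[OF b c(1)] c(3) by simp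
qed

lemma sph_right: assumes s: "s = 1 \<or> s = unif" and h: "h \<in> Ks s" and g: "g \<in> carrier U"
  shows "sph s (g * h) = sph s g"
proof -
  obtain c k where c: "c \<in> Qg 0" "k \<in> Ks s" "g = c * k" using decomp[OF s g] .
  have s0: "s \<noteq> 0" using s by auto
  have "g * h = c * (k * h)" using h c Qg_U Ks_U by (simp add: U_assoc)
  then show ?thesis using sph_eq[OF s c(1) Ks_mult[OF s0 c(2) h]] sph_eq[OF s c(1,2)] c(3) by simp
qed

lemma sph_one: assumes "s = 1 \<or> s = unif" shows "sph s (1\<^sub>m (2*r)) = 1"
  using sph_eq[OF assms Qg_one Ks_one] by simp

lemma sph_V: assumes s: "s = 1 \<or> s = unif" shows "sph s \<in> carrier V"
proof -
  have "smooth (sph s)" unfolding smooth_def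
    using Ks_near[OF s] sph_right[OF s] real_q_pos by (intro exI[of _ "1 / q"]) auto
  then show ?thesis using sph_left[OF s] by (auto simp: V_carrier sph_def)
qed

lemma sph_fixed: assumes s: "s = 1 \<or> s = unif" and h: "h \<in> Ks s" shows "act V h (sph s) = sph s"
  using sph_right[OF s h] by (auto simp: V_act fun_eq_iff sph_def)

text \<open>By the Iwasawa decomposition an invariant function is determined by its value at the
  identity.\<close>

lemma fixed_sph:
  assumes s: "s = 1 \<or> s = unif" and f: "f \<in> carrier V" and fx: "\<And>h. h \<in> Ks s \<Longrightarrow> act V h f = f"
  shows "f = f (1\<^sub>m (2*r)) \<odot>\<^bsub>V\<^esub> sph s"
proof
  fix x show "f x = (f (1\<^sub>m (2*r)) \<odot>\<^bsub>V\<^esub> sph s) x"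
  proof (cases "x \<in> carrier U")
    case True
    obtain b k where c: "b \<in> Qg 0" "k \<in> Ks s" "x = b * k" using decomp[OF s True] .
    have "f x = act V k f b" using c Qg_U by (simp add: V_act)
    also have "\<dots> = f (b * 1\<^sub>m (2*r))" using fx[OF c(2)] c Qg_U by simp
    also have "\<dots> = \<tau> b * f (1\<^sub>m (2*r))"
    proof -
      have "\<forall>b\<in>Qg 0. \<forall>x\<in>carrier U. f (b * x) = \<tau> b * f x" using f by (simp add: V_carrier)
      from bspec[OF bspec[OF this c(1)] one_U] show ?thesis .
    qed
    finally show ?thesis using sph_eq[OF s c(1,2)] c(3) by simp
  next
    case False then show ?thesis using f by (simp add: V_carrier sph_def)
  qed
qed

section \<open>Projection to fixed vectors by finite averages\<close>

definition avg :: "'e mat set \<Rightarrow> ('e mat \<Rightarrow> complex) \<Rightarrow> 'e mat \<Rightarrow> complex" where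
  "avg R f x = (\<Sum>h\<in>R. act V h f x) / of_nat (card R)"

lemma sum_act_closed:
  assumes A: "subrep U V A" "finite R" "R \<subseteq> carrier U" "f \<in> A"
  shows "(\<lambda>x. \<Sum>h\<in>R. act V h f x) \<in> A"
  using assms(2,3)
proof (induction R rule: finite_induct)
  case empty
  then show ?case using V.subrepD(3)[OF A(1)] by simp
next
  case (insert h R)
  then have "act V h f \<oplus>\<^bsub>V\<^esub> (\<lambda>x. \<Sum>h\<in>R. act V h f x) \<in> A"
    using V.subrepD(4)[OF A(1)] V.subrepD(8)[OF A(1) _ A(4)] by auto
  then show ?case using insert by simp
qed

lemma avg_closed:
  assumes "subrep U V A" "finite R" "R \<subseteq> carrier U" "f \<in> A" shows "avg R f \<in> A"
proof -
  have "(1 / of_nat (card R)) \<odot>\<^bsub>V\<^esub> (\<lambda>x. \<Sum>h\<in>R. act V h f x) \<in> A"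
    by (rule V.subrepD(7)[OF assms(1) sum_act_closed[OF assms]])
  moreover have "(1 / of_nat (card R)) \<odot>\<^bsub>V\<^esub> (\<lambda>x. \<Sum>h\<in>R. act V h f x) = avg R f"
    by (simp add: avg_def fun_eq_iff)
  ultimately show ?thesis by simp
qed

lemma V_minus: assumes "f \<in> carrier V" "g \<in> carrier V" shows "f \<ominus>\<^bsub>V\<^esub> g = (\<lambda>x. f x - g x)"
proof -
  have "(\<lambda>x. - g x) \<in> carrier V"
    using assms(2) smooth_combine[of g g "\<lambda>a b. - a"] by (auto simp: V_carrier)
  then have "\<ominus>\<^bsub>V\<^esub> g = (\<lambda>x. - g x)" using assms(2) by (intro V.M.minus_equality) auto
  then show ?thesis by (simp add: a_minus_def)
qed

text \<open>If \<open>f\<close> is invariant under the elements trivial to level \<open>N\<close>,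
  then \<open>f (x * h)\<close> depends only on the congruence class of \<open>h\<close>, and
  translation invariance of the sum applies.\<close>

lemma avg_fixed:
  assumes s: "s = 1 \<or> s = unif" and f: "f \<in> carrier V"
    and N: "\<And>u x. u \<in> Ks s \<Longrightarrow> congr N s u (1\<^sub>m (2*r)) \<Longrightarrow> x \<in> carrier U \<Longrightarrow> f (x * u) = f x"
    and k: "k \<in> Ks s"
  shows "act V k (avg (tr N s (Ks s)) f) = avg (tr N s (Ks s)) f"
proof
  fix x
  have s0: "s \<noteq> 0" using s by auto
  let ?T = "tr N s (Ks s)"
  show "act V k (avg ?T f) x = avg ?T f x"
  proof (cases "x \<in> carrier U")
    case True
    have TU: "h \<in> carrier U" if "h \<in> ?T" for h using that tr_subset Ks_U by blast
    have kU: "k \<in> carrier U" using k Ks_U by blast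
    have "(\<Sum>h\<in>?T. f (x * (k * h))) = (\<Sum>h\<in>?T. f (x * h))"
    proof (rule tr_sum_translate(1)[OF s0 subgroup_Ks[OF s0] order_refl k, where \<phi> = "\<lambda>h. f (x * h)"])
      fix h h' assume h: "h \<in> Ks s" "h' \<in> Ks s" "congr N s h h'"
      have U: "h \<in> carrier U" "h' \<in> carrier U" using h Ks_U by auto
      have "congr N s (adj h * h) (adj h * h')"
        using congr_mult(1)[OF s0 Ks_adj[OF s0 h(1)] h(3)] U U_carrier by blast
      then have "congr N s (adj h * h') (1\<^sub>m (2*r))" using U congr_sym by simp
      then have "f (x * h * (adj h * h')) = f (x * h)"
        using N[OF Ks_mult[OF s0 Ks_adj[OF s0 h(1)] h(2)]] True U by simp
      moreover have "x * h * (adj h * h') = x * h'" using True U by (simp add: U_assoc U_adj_cancel)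
      ultimately show "f (x * h) = f (x * h')" by simp
    qed
    then show ?thesis using True TU kU by (simp add: V_act avg_def U_assoc)
  next
    case False then show ?thesis by (simp add: V_act avg_def)
  qed
qed

lemma smooth_congr:
  assumes s: "s = 1 \<or> s = unif" and f: "f \<in> carrier V" "g \<in> carrier V"
  obtains N where "\<And>u x. u \<in> Ks s \<Longrightarrow> congr N s u (1\<^sub>m (2*r)) \<Longrightarrow> x \<in> carrier U \<Longrightarrow> f (x * u) = f x \<and> g (x * u) = g x"
proof -
  have "smooth f" "smooth g" using f by (auto simp: V_carrier)
  then obtain \<epsilon> \<delta> where \<epsilon>: "0 < \<epsilon>" "\<forall>u\<in>carrier U. near \<epsilon> (1\<^sub>m (2*r)) u \<longrightarrow> (\<forall>x\<in>carrier U. f (x * u) = f x)"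
    and \<delta>: "0 < \<delta>" "\<forall>u\<in>carrier U. near \<delta> (1\<^sub>m (2*r)) u \<longrightarrow> (\<forall>x\<in>carrier U. g (x * u) = g x)"
    by (auto simp: smooth_def)
  have mp: "0 < min \<epsilon> \<delta>" using \<epsilon> \<delta> by simp
  obtain N where N: "\<And>x y. congr N s x y \<Longrightarrow> near (min \<epsilon> \<delta>) y x" using congr_near[OF s mp] by blast
  have "near \<epsilon> (1\<^sub>m (2*r)) u" "near \<delta> (1\<^sub>m (2*r)) u" if "congr N s u (1\<^sub>m (2*r))" for u
    using N[OF that] by (auto simp: near_def)
  then show ?thesis using \<epsilon>(2) \<delta>(2) Ks_U by (intro that[of N]) blast
qed

lemma fixed_line_sph:
  assumes s: "s = 1 \<or> s = unif" shows "fixed_line U V (Ks s) (sph s)"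
proof -
  have s0: "s \<noteq> 0" using s by auto
  have avg: "\<exists>e. (\<forall>A. subrep U V A \<longrightarrow> e ` A \<subseteq> A) \<and>
          (\<forall>a\<in>carrier V. \<forall>b\<in>carrier V. e (a \<oplus>\<^bsub>V\<^esub> b) = e a \<oplus>\<^bsub>V\<^esub> e b) \<and>
          (\<forall>h\<in>Ks s. act V h (e x) = e x \<and> act V h (e y) = e y) \<and> e (sph s) = sph s \<and>
          (\<forall>A z. subrep U V A \<longrightarrow> z \<in> carrier V \<longrightarrow> (\<forall>h\<in>Ks s. act V h z \<ominus>\<^bsub>V\<^esub> z \<in> A) \<longrightarrow> e z \<ominus>\<^bsub>V\<^esub> z \<in> A)"
    if xy: "x \<in> carrier V" "y \<in> carrier V" for x y
  proof -
    obtain N where N: "\<And>u w. u \<in> Ks s \<Longrightarrow> congr N s u (1\<^sub>m (2*r)) \<Longrightarrow> w \<in> carrier U \<Longrightarrow>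
        x (w * u) = x w \<and> y (w * u) = y w" using smooth_congr[OF s xy] by blast
    define R where "R = tr N s (Ks s)"
    have finR: "finite R" unfolding R_def by (rule finite_tr[OF s0 order_refl])
    have RK: "R \<subseteq> Ks s" unfolding R_def by (rule tr_subset)
    have RU: "R \<subseteq> carrier U" using RK Ks_U by blast
    have "R \<noteq> {}" unfolding R_def using Ks_one by (intro tr_nonempty) auto
    then have cR: "of_nat (card R) \<noteq> (0 :: complex)" using finR by simp
    have e1: "avg R ` A \<subseteq> A" if "subrep U V A" for A using avg_closed[OF that finR RU] by blast
    have e2: "avg R (a \<oplus>\<^bsub>V\<^esub> b) = avg R a \<oplus>\<^bsub>V\<^esub> avg R b" for a b
    proof
      fix w
      have "act V h (a \<oplus>\<^bsub>V\<^esub> b) w = act V h a w + act V h b w" for h by (simp add: V_act)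
      then show "avg R (a \<oplus>\<^bsub>V\<^esub> b) w = (avg R a \<oplus>\<^bsub>V\<^esub> avg R b) w"
        by (simp add: avg_def sum.distrib add_divide_distrib)
    qed
    have e3: "act V h (avg R x) = avg R x" "act V h (avg R y) = avg R y" if "h \<in> Ks s" for h
      unfolding R_def using N by (intro avg_fixed[OF s _ _ that] xy; blast)+
    have e4: "avg R (sph s) = sph s"
    proof
      fix w
      have "(\<Sum>h\<in>R. act V h (sph s) w) = (\<Sum>h\<in>R. sph s w)" using RK sph_fixed[OF s] by (intro sum.cong) auto
      then show "avg R (sph s) w = sph s w" using cR by (simp add: avg_def)
    qed
    \<comment> \<open>The average minus \<open>z\<close> is the average of the differences
      \<open>act V h z - z\<close>, each of which lies in \<open>A\<close>.\<close>
    have e5: "avg R z \<ominus>\<^bsub>V\<^esub> z \<in> A" if A: "subrep U V A" and z: "z \<in> carrier V"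
      and d: "\<forall>h\<in>Ks s. act V h z \<ominus>\<^bsub>V\<^esub> z \<in> A" for A z
    proof -
      have az: "act V h z \<ominus>\<^bsub>V\<^esub> z = (\<lambda>w. act V h z w - z w)" if "h \<in> R" for h
        using that RU z by (intro V_minus V.act_closed) auto
      have "(\<lambda>w. \<Sum>h\<in>R'. act V h z w - z w) \<in> A" if "R' \<subseteq> R" for R'
        using finite_subset[OF that finR] that
      proof (induction R' rule: finite_induct)
        case empty then show ?case using V.subrepD(3)[OF A] by simp
      next
        case (insert h R')
        then have "(act V h z \<ominus>\<^bsub>V\<^esub> z) \<oplus>\<^bsub>V\<^esub> (\<lambda>w. \<Sum>h\<in>R'. act V h z w - z w) \<in> A"
          using d RK by (intro V.subrepD(4)[OF A]) auto
        then show ?case using insert az[of h] by simp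
      qed
      then have "(1 / of_nat (card R)) \<odot>\<^bsub>V\<^esub> (\<lambda>w. \<Sum>h\<in>R. act V h z w - z w) \<in> A"
        by (intro V.subrepD(7)[OF A]) auto
      moreover have "(1 / of_nat (card R)) \<odot>\<^bsub>V\<^esub> (\<lambda>w. \<Sum>h\<in>R. act V h z w - z w) = avg R z \<ominus>\<^bsub>V\<^esub> z"
        using cR V_minus[OF _ z, of "avg R z"] avg_closed[OF V.subrep_carrier finR RU z]
        by (simp add: avg_def fun_eq_iff sum_subtractf diff_divide_distrib)
      ultimately show ?thesis by simp
    qed
    show ?thesis
      by (intro exI[of _ "avg R"] conjI allI impI ballI)
        ((rule e1 e2 e4; assumption) | (rule e3; assumption) | (rule e5; assumption))+
  qed
  show ?thesis
  proof (intro fixed_line.intro group_rep_V fixed_line_axioms.intro avg)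
    show "sph s \<in> carrier V" by (rule sph_V[OF s])
    show "sph s \<noteq> \<zero>\<^bsub>V\<^esub>" using sph_one[OF s] by (metis V_zero zero_neq_one)
    show "Ks s \<subseteq> carrier U" using Ks_U by blast
    show "act V h (sph s) = sph s" if "h \<in> Ks s" for h by (rule sph_fixed[OF s that])
    show "\<exists>c. f = c \<odot>\<^bsub>V\<^esub> sph s" if "f \<in> carrier V" "\<And>h. h \<in> Ks s \<Longrightarrow> act V h f = f" for f
      using fixed_sph[OF s that] by blast
  qed
qed

text \<open>The projection of \<open>sph s'\<close> to the \<open>Ks s\<close>-fixed line is \<open>sph s\<close> times the average of \<open>sph s'\<close> over \<open>Ks s\<close>.\<close>

lemma sph_in_gen:
  assumes s: "s = 1 \<or> s = unif" "s' = 1 \<or> s' = unif"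
    and nz: "(\<Sum>h\<in>tr 1 s (Ks s). sph s' h) \<noteq> 0"
  shows "sph s \<in> V.gen (sph s')"
proof -
  have s0: "s \<noteq> 0" using s by auto
  let ?T = "tr 1 s (Ks s)"
  have f: "sph s' \<in> carrier V" by (rule sph_V[OF s(2)])
  have fin: "finite ?T" by (rule finite_tr[OF s0 order_refl])
  have TU: "?T \<subseteq> carrier U" using tr_subset Ks_U by blast
  have "?T \<noteq> {}" using Ks_one by (intro tr_nonempty) auto
  then have cR: "of_nat (card ?T) \<noteq> (0 :: complex)" using fin by simp
  have "sph s' (x * u) = sph s' x" if u: "u \<in> Ks s" "congr 1 s u (1\<^sub>m (2*r))" and x: "x \<in> carrier U" for u x
  proof -
    have "adj (1\<^sub>m (2*r)) * u \<in> Ks s'" by (rule congr_one_Ks[OF s Ks_one u(1) congr_sym[OF u(2)]])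
    then have "u \<in> Ks s'" using Ks_U[OF u(1)] by simp
    then show ?thesis using sph_right[OF s(2) _ x] by blast
  qed
  then have fx: "act V k (avg ?T (sph s')) = avg ?T (sph s')" if "k \<in> Ks s" for k
    by (intro avg_fixed[OF s(1) f _ that]) blast
  have G: "subrep U V (V.gen (sph s'))" by (rule V.subrep_gen[OF f])
  have inG: "avg ?T (sph s') \<in> V.gen (sph s')" by (rule avg_closed[OF G fin TU V.gen_self])
  define c where "c = avg ?T (sph s') (1\<^sub>m (2*r))"
  have "avg ?T (sph s') = c \<odot>\<^bsub>V\<^esub> sph s"
    unfolding c_def by (rule fixed_sph[OF s(1) _ fx]) (use V.subrepD(2)[OF G inG] in auto)
  moreover have "c = (\<Sum>h\<in>?T. sph s' h) / of_nat (card ?T)"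
    unfolding c_def avg_def using TU by (intro arg_cong2[where f = "(/)"] sum.cong) (auto simp: V_act)
  then have "c \<noteq> 0" using nz cR by simp
  ultimately have "sph s = (1 / c) \<odot>\<^bsub>V\<^esub> avg ?T (sph s')" by (simp add: fun_eq_iff)
  then show ?thesis using V.subrepD(7)[OF G inG, of "1 / c"] by simp
qed

end

section \<open>Rows modulo the uniformizer\<close>

context unitary_setting
begin

abbreviation Hm :: "'e \<Rightarrow> nat \<Rightarrow> 'e mat set" where "Hm s m \<equiv> Ks s \<inter> Qg m"

text \<open>Row \<open>r + m\<close> in the basis adapted to the lattice defining \<open>Ks s\<close>.\<close>

definition srow :: "'e \<Rightarrow> nat \<Rightarrow> 'e mat \<Rightarrow> nat \<Rightarrow> 'e" where
  "srow s m g b = g $$ (r + m, b) * wl s b / s"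

definition residues :: "nat \<Rightarrow> (nat \<Rightarrow> 'e) set" where
  "residues m = PiE {..m} (\<lambda>_. residue_reps)"

text \<open>The two halves of the row are reduced separately and only up to level \<open>m\<close>:
  for elements of \<open>Qg (Suc m)\<close> the higher first-half entries are zero, and the higher
  second-half entries influence neither the form nor the reduction step.\<close>

definition red :: "'e \<Rightarrow> nat \<Rightarrow> 'e mat \<Rightarrow> (nat \<Rightarrow> 'e) \<times> (nat \<Rightarrow> 'e)" where
  "red s m g = (restrict (\<lambda>j. res (srow s m g j)) {..m}, restrict (\<lambda>j. res (srow s m g (r + j))) {..m})"

definition zero_row :: "nat \<Rightarrow> nat \<Rightarrow> 'e" where "zero_row m = restrict (\<lambda>_. 0) {..m}"

text \<open>For \<open>s = 1\<close> the reduced form is alternating and isotropy is no condition.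
  For \<open>s = unif\<close> a factor \<open>unif\<close> splits off, and what remains reduces to
  the quadratic form with value \<open>\<Sum>j\<le>m. x j * y j\<close>.\<close>

definition rows :: "'e \<Rightarrow> nat \<Rightarrow> ((nat \<Rightarrow> 'e) \<times> (nat \<Rightarrow> 'e)) set" where
  "rows s m = {(x, y). x \<in> residues m \<and> y \<in> residues m \<and> (x \<noteq> zero_row m \<or> y \<noteq> zero_row m) \<and>
     (s = unif \<longrightarrow> v (\<Sum>j\<le>m. x j * y j) < 1)}"

lemma v_mult_lt_1: assumes "v a < 1" "v b \<le> 1" shows "v (a * b) < 1" "v (b * a) < 1"
proof -
  have "v a * v b \<le> v a * 1" using assms(2) by (rule mult_left_mono) simp
  then show "v (a * b) < 1" "v (b * a) < 1" using assms(1) by (simp_all add: v_mult mult.commute)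
qed

lemma subgroup_Hm: "s \<noteq> 0 \<Longrightarrow> subgroup (Hm s m) U"
  by (intro U.subgroups_Inter_pair subgroup_Qg subgroup_Ks)

lemma Hm_mult: "s \<noteq> 0 \<Longrightarrow> g \<in> Hm s m \<Longrightarrow> h \<in> Hm s m \<Longrightarrow> g * h \<in> Hm s m"
  by (auto intro: Ks_mult Qg_mult)

lemma Hm_adj: "s \<noteq> 0 \<Longrightarrow> g \<in> Hm s m \<Longrightarrow> adj g \<in> Hm s m"
  by (auto intro: Ks_adj Qg_adj)

lemma srow_le:
  assumes s: "s \<noteq> 0" and g: "g \<in> Ks s" and m: "m < r" and b: "b < 2*r" shows "v (srow s m g b) \<le> 1"
  using Ks_entry[OF g, of "r + m" b] m b s by (simp add: srow_def v_mult v_divide wt_def[of s "r + m"])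

lemma srow_f: "s \<noteq> 0 \<Longrightarrow> srow s m g (r + j) = g $$ (r + m, r + j)"
  by (simp add: srow_def wl_def)

lemma srow_e: "j < r \<Longrightarrow> srow s m g j = g $$ (r + m, j) / s"
  by (simp add: srow_def wl_def)

lemma red_eq_iff:
  assumes s: "s \<noteq> 0" and g: "g \<in> Ks s" "h \<in> Ks s" and m: "m < r"
  shows "red s m g = red s m h \<longleftrightarrow>
    (\<forall>b<2*r. lev b \<le> m \<longrightarrow> v (srow s m g b - srow s m h b) < 1)"
proof -
  have "red s m g = red s m h \<longleftrightarrow> (\<forall>j\<le>m. res (srow s m g j) = res (srow s m h j)) \<and>
     (\<forall>j\<le>m. res (srow s m g (r + j)) = res (srow s m h (r + j)))"
    by (auto simp: red_def restrict_def fun_eq_iff)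
  also have "\<dots> \<longleftrightarrow> (\<forall>j\<le>m. v (srow s m g j - srow s m h j) < 1) \<and>
     (\<forall>j\<le>m. v (srow s m g (r + j) - srow s m h (r + j)) < 1)"
    using srow_le[OF s g(1) m] srow_le[OF s g(2) m] m by (simp add: res_eq_iff)
  also have "\<dots> \<longleftrightarrow> (\<forall>b<2*r. lev b \<le> m \<longrightarrow> v (srow s m g b - srow s m h b) < 1)" (is "?L \<longleftrightarrow> ?R")
  proof
    assume L: ?L
    show ?R
    proof (intro allI impI)
      fix b assume b: "b < 2*r" "lev b \<le> m"
      show "v (srow s m g b - srow s m h b) < 1"
      proof (cases "b < r")
        case True then show ?thesis using L b by (simp add: lev_def)
      next
        case False
        then have "b = r + (b - r)" "b - r \<le> m" using b by (simp_all add: lev_def)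
        then show ?thesis using L by metis
      qed
    qed
  next
    assume R: ?R
    show ?L using R m by (auto simp: lev_def)
  qed
  finally show ?thesis .
qed

text \<open>The positions above level \<open>m\<close> contribute nothing to the entries considered:
  in the first half the row is zero there, and in the second half the rows of \<open>h\<close>
  vanish in the columns of level at most \<open>m\<close>. So the reduced row of a product depends
  on the reduced row alone.\<close>

lemma srow_mult_diff:
  assumes s: "s \<noteq> 0" and g: "g \<in> Hm s (Suc m)" "g' \<in> Hm s (Suc m)" and h: "h \<in> Hm s (Suc m)" and m: "m < r"
    and close: "\<And>b. b < 2*r \<Longrightarrow> lev b \<le> m \<Longrightarrow> v (srow s m g b - srow s m g' b) < 1"
    and b: "b < 2*r" "lev b \<le> m"
  shows "v (srow s m (g * h) b - srow s m (g' * h) b) < 1"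
proof -
  have gc: "g \<in> carrier_mat (2*r) (2*r)" "g' \<in> carrier_mat (2*r) (2*r)" and hc: "h \<in> carrier_mat (2*r) (2*r)"
    using g h Qg_carrier by auto
  have "srow s m (g * h) b - srow s m (g' * h) b =
    (\<Sum>c<2*r. (g $$ (r + m, c) - g' $$ (r + m, c)) * h $$ (c, b) * wl s b / s)"
    unfolding srow_def
    using mult_entry[OF gc(1) hc, of "r + m" b] mult_entry[OF gc(2) hc, of "r + m" b] m b
    by (simp add: sum_distrib_right sum_divide_distrib left_diff_distrib diff_divide_distrib flip: sum_subtractf)
  also have "v \<dots> < 1"
  proof (rule v_sum_less)
    fix c assume "c \<in> {..<2*r}"
    then have c: "c < 2*r" by simp
    show "v ((g $$ (r + m, c) - g' $$ (r + m, c)) * h $$ (c, b) * wl s b / s) < 1"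
    proof (cases "lev c \<le> m")
      case True
      have "(g $$ (r + m, c) - g' $$ (r + m, c)) * h $$ (c, b) * wl s b / s =
        (srow s m g c - srow s m g' c) * (h $$ (c, b) * wl s b / wl s c)"
        using s by (simp add: srow_def field_simps)
      moreover have "v (h $$ (c, b) * wl s b / wl s c) \<le> 1"
        using Ks_entry[of h s c b] h c b wt_pos[OF s, of c] by (simp add: v_mult v_divide)
      ultimately show ?thesis by (simp only: v_mult_lt_1(1)[OF close[OF c True]])
    next
      case False
      show ?thesis
      proof (cases "c < r")
        case True
        then have "g $$ (r + m, c) = 0" "g' $$ (r + m, c) = 0"
          using Qg_column(2)[of g "Suc m" c "r + m"] Qg_column(2)[of g' "Suc m" c "r + m"] g m False
          by (auto simp: lev_def)
        then show ?thesis by simp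
      next
        case cr: False
        then have c': "c = r + (c - r)" "Suc m \<le> c - r" "c - r < r" using False c by (auto simp: lev_def)
        have "h $$ (r + (c - r), b) = 0"
        proof (cases "b < r")
          case True then show ?thesis using Qg_zero(1)[of h "Suc m" "c - r" b] h c' by auto
        next
          case br: False
          then have "b - r < c - r" "b = r + (b - r)" using b c' by (auto simp: lev_def)
          then show ?thesis using Qg_zero(2)[of h "Suc m" "c - r" "b - r"] h c' by auto
        qed
        then show ?thesis using c'(1) by simp
      qed
    qed
  qed simp
  finally show ?thesis .
qed

text \<open>Right translation acts on reduced rows, and translation by \<open>adj h\<close> undoes
  it.\<close>

lemma red_mult:
  assumes s: "s \<noteq> 0" and g: "g \<in> Hm s (Suc m)" "g' \<in> Hm s (Suc m)" and h: "h \<in> Hm s (Suc m)" and m: "m < r"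
  shows "red s m (g * h) = red s m (g' * h) \<longleftrightarrow> red s m g = red s m g'"
proof -
  have imp: "red s m (x * y) = red s m (x' * y)"
    if "red s m x = red s m x'" "x \<in> Hm s (Suc m)" "x' \<in> Hm s (Suc m)" "y \<in> Hm s (Suc m)" for x x' y
  proof -
    have K: "x \<in> Ks s" "x' \<in> Ks s" "x * y \<in> Ks s" "x' * y \<in> Ks s" using that Hm_mult[OF s] by auto
    have "\<And>b. b < 2*r \<Longrightarrow> lev b \<le> m \<Longrightarrow> v (srow s m x b - srow s m x' b) < 1"
      using that(1) red_eq_iff[OF s K(1,2) m] by blast
    then show ?thesis
      unfolding red_eq_iff[OF s K(3,4) m] using srow_mult_diff[OF s that(2,3,4) m] by blast
  qed
  have U: "g \<in> carrier U" "g' \<in> carrier U" "h \<in> carrier U" using g h Qg_U by auto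
  show ?thesis
    using imp[of g g' h] imp[of "g * h" "g' * h" "adj h"] g h Hm_mult[OF s] Hm_adj[OF s] U
    by (auto simp: U_adj_cancel)
qed

lemma congr_red:
  assumes s: "s \<noteq> 0" and g: "g \<in> Ks s" "h \<in> Ks s" and m: "m < r" and c: "congr 1 s g h"
  shows "red s m g = red s m h"
  unfolding red_eq_iff[OF s g m]
proof (intro allI impI)
  fix b assume b: "b < 2*r"
  have "v (g $$ (r + m, b) - h $$ (r + m, b)) * wt s b \<le> 1 / q * v s"
  proof -
    have "v (g $$ (r + m, b) - h $$ (r + m, b)) * wt s b \<le> (1 / q) ^ 1 * wt s (r + m)"
      using c[unfolded congr_def, rule_format, of "r + m" b] b m by simp
    then show ?thesis by (simp add: wt_def[of s "r + m"])
  qed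
  moreover have "srow s m g b - srow s m h b = (g $$ (r + m, b) - h $$ (r + m, b)) * wl s b / s"
    by (simp add: srow_def diff_divide_distrib left_diff_distrib)
  ultimately have "v (srow s m g b - srow s m h b) \<le> 1 / q"
    using s by (simp add: v_mult v_divide pos_divide_le_eq)
  also have "\<dots> < 1" using real_q_gt_1 by simp
  finally show "v (srow s m g b - srow s m h b) < 1" .
qed

lemma red_residues:
  assumes s: "s \<noteq> 0" and g: "g \<in> Ks s" and m: "m < r"
  shows "fst (red s m g) \<in> residues m" "snd (red s m g) \<in> residues m"
  using srow_le[OF s g m] m res(1) by (auto simp: red_def residues_def)

text \<open>A vanishing reduction would make the diagonal entry (r + m, r + m) of
  \<open>g * adj g = 1\<close> smaller than 1.\<close>

lemma red_not_zero:
  assumes s: "s \<noteq> 0" and g: "g \<in> Hm s (Suc m)" and m: "m < r"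
  shows "fst (red s m g) \<noteq> zero_row m \<or> snd (red s m g) \<noteq> zero_row m"
proof (rule ccontr)
  assume n: "\<not> ?thesis"
  have small: "v (srow s m g b) < 1" if b: "b < 2*r" "lev b \<le> m" for b
  proof -
    have "res (srow s m g b) = 0"
    proof (cases "b < r")
      case True
      have "fst (red s m g) b = zero_row m b" using n by simp
      then show ?thesis using True b by (simp add: red_def zero_row_def lev_def)
    next
      case False
      have "snd (red s m g) (b - r) = zero_row m (b - r)" using n by simp
      then show ?thesis using False b by (simp add: red_def zero_row_def lev_def)
    qed
    then show ?thesis using res_eq_0_iff srow_le[OF s _ m b(1)] g by blast
  qed
  have gU: "g \<in> carrier U" and gc: "g \<in> carrier_mat (2*r) (2*r)" using g Qg_U Qg_carrier by auto
  have a: "adj g \<in> Hm s (Suc m)" by (rule Hm_adj[OF s g])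
  have "1 = (g * adj g) $$ (r + m, r + m)" using gU m by simp
  also have "\<dots> = (\<Sum>c<2*r. g $$ (r + m, c) * adj g $$ (c, r + m))"
    using gc m by (intro mult_entry) auto
  also have "v \<dots> < 1"
  proof (rule v_sum_less)
    fix c assume "c \<in> {..<2*r}"
    then have c: "c < 2*r" by simp
    show "v (g $$ (r + m, c) * adj g $$ (c, r + m)) < 1"
    proof (cases "lev c \<le> m")
      case True
      have "g $$ (r + m, c) * adj g $$ (c, r + m) = srow s m g c * (adj g $$ (c, r + m) * wl s (r + m) / wl s c)"
        using s by (simp add: srow_def wl_def)
      moreover have "v (adj g $$ (c, r + m) * wl s (r + m) / wl s c) \<le> 1"
        using Ks_entry[of "adj g" s c "r + m"] a c m wt_pos[OF s, of c] by (simp add: v_mult v_divide)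
      ultimately show ?thesis by (simp only: v_mult_lt_1(1)[OF small[OF c True]])
    next
      case False
      show ?thesis
      proof (cases "c < r")
        case True
        then have "g $$ (r + m, c) = 0"
          using Qg_column(2)[of g "Suc m" c "r + m"] g m False by (auto simp: lev_def)
        then show ?thesis by simp
      next
        case cr: False
        then have c': "c = r + (c - r)" "Suc m \<le> c - r" "c - r < r" using False c by (auto simp: lev_def)
        have "adj g $$ (r + (c - r), r + m) = 0"
          using Qg_zero(2)[of "adj g" "Suc m" "c - r" m] a c' by auto
        then show ?thesis using c'(1) by simp
      qed
    qed
  qed simp
  finally show False by simp
qed

text \<open>Row \<open>r + m\<close> is isotropic; in lattice coordinates this says that the sum of
  \<open>x j * cj (y j) + y j * cj (x j)\<close> vanishes. Modulo \<open>unif\<close> the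
  conjugations disappear, and 2 can be cancelled.\<close>

lemma red_isotropic:
  assumes g: "g \<in> Hm unif (Suc m)" and m: "m < r"
  shows "v (\<Sum>j\<le>m. fst (red unif m g) j * snd (red unif m g) j) < 1"
proof -
  have s: "unif \<noteq> 0" by simp
  have gK: "g \<in> Ks unif" using g by simp
  define x where "x j = srow unif m g j" for j
  define y where "y j = srow unif m g (r + j)" for j
  have le: "v (x j) \<le> 1" "v (y j) \<le> 1" if "j \<le> m" for j
    using srow_le[OF s gK m] that m by (auto simp: x_def y_def)
  have gx: "g $$ (r + m, j) = unif * x j" if "j < r" for j using that by (simp add: x_def srow_e)
  have gy: "g $$ (r + m, r + j) = y j" for j by (simp add: y_def srow_f)
  have x0: "x j = 0" if "m < j" "j < r" for j
    using Qg_column(2)[of g "Suc m" j "r + m"] g m that by (auto simp: x_def srow_e)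
  have "hf (rw g (r + m)) (rw g (r + m)) = 0" using U_rows[of g "r + m" "r + m"] g m Qg_U by (auto simp: pr_def)
  also have "hf (rw g (r + m)) (rw g (r + m)) =
      (\<Sum>j<r. unif * x j * cj (y j)) + (\<Sum>j<r. - (y j * cj (unif * x j)))"
    unfolding hf_def sum_split by (intro arg_cong2[where f = "(+)"] sum.cong)
      (auto simp: eps_def pr_def rw_def gx gy add.commute[of _ r])
  \<comment> \<open>The sign of the second half is cancelled by \<open>cj unif = - unif\<close>;
    this turns the skew-Hermitian form into a symmetric one.\<close>
  also have "\<dots> = unif * (\<Sum>j<r. x j * cj (y j) + y j * cj (x j))"
    by (simp add: sum_distrib_left sum.distrib algebra_simps)
  finally have "(\<Sum>j<r. x j * cj (y j) + y j * cj (x j)) = 0" by simp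
  moreover have "(\<Sum>j<r. x j * cj (y j) + y j * cj (x j)) = (\<Sum>j\<le>m. x j * cj (y j) + y j * cj (x j))"
    using m x0 by (intro sum.mono_neutral_right) auto
  ultimately have z: "(\<Sum>j\<le>m. x j * cj (y j) + y j * cj (x j)) = 0" by simp
  have small: "v (2 * (res (x j) * res (y j)) - (x j * cj (y j) + y j * cj (x j))) < 1" if j: "j \<le> m" for j
  proof -
    have res_le: "v (res (x j)) \<le> 1" "v (res (y j)) \<le> 1" using res(1) le[OF j] residue_reps(4) by auto
    have dx: "v (res (x j) - x j) < 1" and dy: "v (res (y j) - y j) < 1"
      using res(2) le[OF j] v_minus_commute by metis+
    have cx: "v (x j - cj (x j)) < 1" and cy: "v (y j - cj (y j)) < 1"
      using cj_residue le[OF j] v_minus_commute by metis+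
    have sm: "v (a * b) < 1" "v (b * a) < 1" if "v a \<le> 1" "v b < 1" for a b
      using v_mult_lt_1[OF that(2,1)] by auto
    have "2 * (res (x j) * res (y j)) - (x j * cj (y j) + y j * cj (x j)) =
      2 * (res (x j) * (res (y j) - y j)) + 2 * ((res (x j) - x j) * y j) + x j * (y j - cj (y j)) + y j * (x j - cj (x j))"
      by (simp add: algebra_simps)
    also have "v \<dots> < 1"
      using res_le le[OF j] dx dy cx cy sm
      by (intro v_add_less) (auto simp: v_mult[of 2])
    finally show ?thesis .
  qed
  have "2 * (\<Sum>j\<le>m. res (x j) * res (y j)) =
      (\<Sum>j\<le>m. 2 * (res (x j) * res (y j)) - (x j * cj (y j) + y j * cj (x j)))"
    using z by (simp add: sum_subtractf sum_distrib_left)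
  then have "v (2 * (\<Sum>j\<le>m. res (x j) * res (y j))) < 1"
    using small by (simp only:) (rule v_sum_less, auto)
  then have "v (\<Sum>j\<le>m. res (x j) * res (y j)) < 1" by (simp add: v_mult)
  then show ?thesis by (simp add: red_def x_def y_def)
qed

lemma red_rows:
  assumes s: "s = 1 \<or> s = unif" and g: "g \<in> Hm s (Suc m)" and m: "m < r"
  shows "red s m g \<in> rows s m"
proof -
  have s0: "s \<noteq> 0" using s by auto
  obtain x y where xy: "red s m g = (x, y)" by (cases "red s m g")
  have "v (\<Sum>j\<le>m. x j * y j) < 1" if "s = unif"
    using red_isotropic[of g m] g m xy that by simp
  then show ?thesis
    using red_residues[OF s0 _ m, of g] red_not_zero[OF s0 g m] g xy by (auto simp: rows_def)
qed

text \<open>Every admissible residue row lifts to an exactly isotropic row with coordinates in \<open>F\<close>; only the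
  coordinate paired with the pivot has to be corrected.\<close>

lemma rows_red:
  assumes s: "s = 1 \<or> s = unif" and m: "m < r" and xy: "(x, y) \<in> rows s m"
  shows "\<exists>g\<in>Hm s (Suc m). red s m g = (x, y)"
proof -
  have s0: "s \<noteq> 0" using s by auto
  define Z where "Z b = (if m < lev b then 0 else if b < r then x b else y (b - r))" for b
  have ZT: "Z b \<in> residue_reps" for b
    using xy residue_reps(3) by (auto simp: Z_def rows_def residues_def lev_def)
  have ZF: "Z b \<in> F" and Zle: "v (Z b) \<le> 1" for b using ZT[of b] residue_reps by auto
  have "\<exists>a<2*r. lev a \<le> m \<and> Z a \<noteq> 0"
  proof (rule ccontr)
    assume n: "\<not> ?thesis"
    have "x = zero_row m" "y = zero_row m"
    proof -
      show "x = zero_row m"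
      proof (rule PiE_ext[where k = "{..m}" and s = "\<lambda>_. residue_reps"])
        show "x \<in> {..m} \<rightarrow>\<^sub>E residue_reps" "zero_row m \<in> {..m} \<rightarrow>\<^sub>E residue_reps"
          using xy residue_reps(3) by (auto simp: rows_def residues_def zero_row_def)
        fix j assume "j \<in> {..m}"
        then have "Z j = 0" using n m by (auto simp: lev_def)
        then show "x j = zero_row m j" using \<open>j \<in> {..m}\<close> m by (simp add: Z_def zero_row_def lev_def)
      qed
      show "y = zero_row m"
      proof (rule PiE_ext[where k = "{..m}" and s = "\<lambda>_. residue_reps"])
        show "y \<in> {..m} \<rightarrow>\<^sub>E residue_reps" "zero_row m \<in> {..m} \<rightarrow>\<^sub>E residue_reps"
          using xy residue_reps(3) by (auto simp: rows_def residues_def zero_row_def)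
        fix j assume "j \<in> {..m}"
        then have "Z (r + j) = 0" using n m by (auto simp: lev_def)
        then show "y j = zero_row m j" using \<open>j \<in> {..m}\<close> m by (simp add: Z_def zero_row_def lev_def)
      qed
    qed
    then show False using xy by (simp add: rows_def)
  qed
  then obtain a where a: "a < 2*r" "lev a \<le> m" "Z a \<noteq> 0" by blast
  define j0 where "j0 = lev a"
  have j0: "j0 \<le> m" "j0 < r" using a m by (auto simp: j0_def)
  have aj: "a = j0 \<or> a = r + j0" using a by (auto simp: j0_def lev_def)
  have vZa: "v (Z a) = 1" by (rule v_rep[OF ZT a(3)])
  define S where "S = (\<Sum>j\<in>{..m} - {j0}. Z j * Z (r + j))"
  \<comment> \<open>The row divided by its pivot. For \<open>s = unif\<close> the coordinate paired
    with the pivot is replaced by the solution of the isotropy equation; since the given residue row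
    is isotropic modulo \<open>unif\<close>, the change is invisible there
    (\<open>\<zeta>close\<close>).\<close>
  define \<zeta> where "\<zeta> b = (if s = unif \<and> b = pr a then - S / (Z a * Z a) else Z b / Z a)" for b
  have SF: "S \<in> F" unfolding S_def using ZF by (intro F_sum) auto
  have \<zeta>F: "\<zeta> b \<in> F" for b using ZF SF by (simp add: \<zeta>_def)
  have \<zeta>a: "\<zeta> a = 1" using a pr_neq[OF a(1)] by (simp add: \<zeta>_def)
  have \<zeta>0: "\<zeta> b = 0" if "b < 2*r" "m < lev b" for b using that a by (auto simp: \<zeta>_def Z_def)
  have vS: "v S \<le> 1" unfolding S_def using Zle by (intro v_sum_le) (auto simp: v_mult mult_le_one)
  have \<zeta>le: "v (\<zeta> b) \<le> 1" for b using Zle[of b] vS vZa by (simp add: \<zeta>_def v_divide v_mult)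
  have \<zeta>close: "v (Z a * \<zeta> b - Z b) < 1" if b: "b < 2*r" for b
  proof (cases "s = unif \<and> b = pr a")
    case True
    have "(\<Sum>j\<le>m. x j * y j) = (\<Sum>j\<le>m. Z j * Z (r + j))"
      using m by (intro sum.cong) (auto simp: Z_def lev_def)
    also have "\<dots> = Z j0 * Z (r + j0) + S"
      unfolding S_def using j0 by (intro sum.remove) auto
    also have "Z j0 * Z (r + j0) = Z a * Z (pr a)"
      using aj j0 by (elim disjE) (simp_all add: pr_def add.commute)
    finally have "v (Z a * Z (pr a) + S) < 1" using xy True by (simp add: rows_def)
    moreover have "Z a * \<zeta> b - Z b = - ((Z a * Z (pr a) + S) / Z a)"
      using True a(3) by (simp add: \<zeta>_def field_simps)
    ultimately show ?thesis using vZa by (simp add: v_divide)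
  next
    case False then show ?thesis using a(3) by (auto simp: \<zeta>_def)
  qed
  \<comment> \<open>Back from lattice coordinates to matrix entries, scaled so that the pivot is 1
    as \<open>rowE\<close> requires.\<close>
  define \<rho> where "\<rho> b = \<zeta> b * wl s a / wl s b" for b
  have \<rho>a: "\<rho> a = 1" using s0 \<zeta>a by (simp add: \<rho>_def)
  have h0: "hf \<rho> \<rho> = 0"
  proof (cases "s = 1")
    case True
    have w1: "wl s b = 1" for b using True by (simp add: wl_def)
    have c: "cj (hf \<rho> \<rho>) = hf \<rho> \<rho>" using cj_fixes \<zeta>F by (simp add: hf_def cj_sum \<rho>_def w1)
    have "2 * hf \<rho> \<rho> = hf \<rho> \<rho> + - cj (hf \<rho> \<rho>)" by (subst hf_skew[symmetric]) (rule mult_2)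
    then have "2 * hf \<rho> \<rho> = 0" unfolding c by (simp only: add.right_inverse)
    then show ?thesis by simp
  next
    case False
    then have su: "s = unif" using s by simp
    define C where "C = - (wl s a * cj (wl s a) / unif)"
    have "hf \<rho> \<rho> = (\<Sum>b<2*r. C * (\<zeta> b * \<zeta> (pr b)))"
      unfolding hf_def
    proof (rule sum.cong)
      fix b assume "b \<in> {..<2*r}"
      then have b: "b < 2*r" by simp
      \<comment> \<open>The value is the same in both halves: the change of sign in
        \<open>eps\<close> is matched by the conjugate of \<open>unif\<close>. The rescaled form is
        therefore symmetric up to one constant.\<close>
      have "eps b / (wl s b * cj (wl s (pr b))) = - (1 / unif)"
        using b su by (cases "b < r") (auto simp: eps_def wl_def pr_def)
      moreover have "eps b * \<rho> b * cj (\<rho> (pr b)) =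
        eps b / (wl s b * cj (wl s (pr b))) * (wl s a * cj (wl s a)) * (\<zeta> b * \<zeta> (pr b))"
        using cj_fixes[OF \<zeta>F] by (simp add: \<rho>_def)
      ultimately show "eps b * \<rho> b * cj (\<rho> (pr b)) = C * (\<zeta> b * \<zeta> (pr b))" by (simp add: C_def)
    qed simp
    also have "\<dots> = C * (\<Sum>b<2*r. \<zeta> b * \<zeta> (pr b))" by (simp add: sum_distrib_left)
    also have "(\<Sum>b<2*r. \<zeta> b * \<zeta> (pr b)) = (\<Sum>j<r. \<zeta> j * \<zeta> (r + j)) + (\<Sum>j<r. \<zeta> j * \<zeta> (r + j))"
      unfolding sum_split by (intro arg_cong2[where f = "(+)"] sum.cong) (auto simp: pr_def add.commute mult.commute)
    also have "(\<Sum>j<r. \<zeta> j * \<zeta> (r + j)) = (\<Sum>j\<le>m. \<zeta> j * \<zeta> (r + j))"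
      using m \<zeta>0 by (intro sum.mono_neutral_right) (auto simp: lev_def)
    also have "\<dots> = \<zeta> j0 * \<zeta> (r + j0) + (\<Sum>j\<in>{..m} - {j0}. \<zeta> j * \<zeta> (r + j))"
      using j0 by (intro sum.remove) auto
    also have "\<zeta> j0 * \<zeta> (r + j0) = \<zeta> a * \<zeta> (pr a)"
      using aj j0 by (elim disjE) (simp_all add: pr_def add.commute)
    also have "\<dots> = - S / (Z a * Z a)" using \<zeta>a su by (simp add: \<zeta>_def)
    also have "(\<Sum>j\<in>{..m} - {j0}. \<zeta> j * \<zeta> (r + j)) = S / (Z a * Z a)"
      unfolding S_def sum_divide_distrib
    proof (rule sum.cong)
      fix j assume j: "j \<in> {..m} - {j0}"
      then have "j \<noteq> pr a" "r + j \<noteq> pr a" using aj j0 m by (auto simp: pr_def)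
      then show "\<zeta> j * \<zeta> (r + j) = Z j * Z (r + j) / (Z a * Z a)" by (simp add: \<zeta>_def)
    qed simp
    finally show ?thesis by simp
  qed
  define E where "E = rowE a \<rho>"
  have EK: "E \<in> Ks s"
    unfolding E_def
  proof (rule rowE_Ks[OF s0 a(1) \<rho>a h0])
    fix b assume "b < 2*r"
    have "wt s b \<noteq> 0" using s0 by (simp add: wt_def)
    then have "v (\<rho> b) * wt s b = v (\<zeta> b) * wt s a" using s0 by (simp add: \<rho>_def v_mult v_divide)
    also have "\<dots> \<le> wt s a" using \<zeta>le[of b] wt_nonneg[of s a] mult_right_mono[of "v (\<zeta> b)" 1 "wt s a"] by simp
    finally show "v (\<rho> b) * wt s b \<le> wt s a" .
  qed
  have EB: "blk (Suc m) E"
    unfolding E_def by (rule blk_rowE[OF a(1) \<rho>a h0]) (use a \<zeta>0 in \<open>auto simp: \<rho>_def\<close>)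
  have EU: "E \<in> carrier U" using EB blk_U by blast
  \<comment> \<open>The torus element has \<open>c\<close> at position \<open>j0\<close> and
    \<open>1 / cj c\<close> at \<open>r + j0\<close>; the case distinction puts \<open>Z a\<close>
    at the pivot in either half.\<close>
  define c where "c = (if a < r then Z a else 1 / cj (Z a))"
  have c0: "c \<noteq> 0" using a by (simp add: c_def)
  have vc: "v c = 1" using vZa by (simp add: c_def v_divide)
  define D where "D = tor j0 c"
  have tc: "v (tor_coeff j0 c b) = 1" for b using vc by (simp add: tor_coeff_def v_divide)
  have DK: "D \<in> Ks s"
    unfolding D_def tor_def by (rule mono_Ks[OF tor_monomial[OF c0 j0(2)]]) (simp add: tc)
  have DB: "blk (Suc m) D"
    unfolding D_def tor_def by (rule blk_mono_mat[OF tor_monomial[OF c0 j0(2)]])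
      (use j0 in \<open>auto simp: tor_coeff_def lev_def split: if_splits\<close>)
  have Da: "tor_coeff j0 c a = Z a" using aj j0 a(3) by (auto simp: tor_coeff_def c_def)
  define W where "W = (if a < r then flip s j0 else 1\<^sub>m (2*r))"
  have WK: "W \<in> Ks s" using flip_Ks[OF s0 j0(2)] Ks_one by (simp add: W_def)
  have WB: "blk (Suc m) W"
    using blk_mono[OF _ blk_flip[OF s0 j0(2)]] j0 blk_one by (simp add: W_def)
  define P where "P = mono_mat (swap_perm j0 m) (\<lambda>_. 1)"
  note sm = swap_monomial[OF j0(2) m]
  have PK: "P \<in> Ks s"
    unfolding P_def by (rule mono_Ks[OF sm]) (use tau_less[OF j0(2) m] in \<open>auto simp: swap_perm_def wt_def\<close>)
  have PB: "blk (Suc m) P"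
    unfolding P_def by (rule blk_mono_mat[OF sm]) (use j0 m in \<open>auto simp: swap_perm_def tau_def lev_def\<close>)
  \<comment> \<open>From right to left: \<open>E\<close> produces the normalized row at the pivot,
    \<open>D\<close> multiplies it by \<open>Z a\<close>, \<open>W\<close> moves it to the second
    half if needed, and \<open>P\<close> brings it to level \<open>m\<close>.\<close>
  define g where "g = P * (W * (D * E))"
  have gB: "blk (Suc m) g" unfolding g_def by (intro blk_mult PB WB DB EB)
  have gK: "g \<in> Ks s" unfolding g_def by (intro Ks_mult[OF s0] PK WK DK EK)
  have gH: "g \<in> Hm s (Suc m)" using gK blk_Qg[OF gB] by simp
  have DEU: "D * E \<in> carrier U" "W * (D * E) \<in> carrier U" using DB EB WB blk_U by auto
  have row: "srow s m g b = Z a * \<zeta> b" if b: "b < 2*r" for b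
  proof -
    have "g $$ (r + m, b) = (W * (D * E)) $$ (r + j0, b)"
      unfolding g_def P_def using monomial_mult[OF U_carrier[OF DEU(2)] sm, of "r + m" b] m b
      by (simp add: swap_perm_def tau_def)
    also have "(W * (D * E)) $$ (r + j0, b) = (if a < r then s else 1) * (D * E) $$ (a, b)"
    proof (cases "a < r")
      case True
      then have "a = j0" using aj by auto
      then show ?thesis
        unfolding W_def flip_def using monomial_mult[OF U_carrier[OF DEU(1)] flip_monomial[OF s0 j0(2)], of "r + j0" b] j0 b True
        by (simp add: flip_perm_def flip_coeff_def lev_def pr_def)
    next
      case False
      then show ?thesis using aj DEU(1) j0 by (auto simp: W_def)
    qed
    also have "(D * E) $$ (a, b) = Z a * \<rho> b"
      unfolding D_def tor_def E_def using monomial_mult[OF rowE_carrier tor_monomial[OF c0 j0(2)] a(1) b]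
      by (simp add: Da rowE_entry a b)
    finally show ?thesis
      using s0 aj j0 by (auto simp: srow_def \<rho>_def wl_def[of s a])
  qed
  have "res (srow s m g b) = Z b" if "b < 2*r" for b
    using \<zeta>close[OF that] ZT row[OF that] srow_le[OF s0 gK m that] by (intro res_eq) auto
  then have "red s m g = (restrict (\<lambda>j. Z j) {..m}, restrict (\<lambda>j. Z (r + j)) {..m})"
    using m by (auto simp: red_def restrict_def fun_eq_iff)
  also have "\<dots> = (x, y)"
  proof -
    have "x \<in> {..m} \<rightarrow>\<^sub>E residue_reps" "y \<in> {..m} \<rightarrow>\<^sub>E residue_reps" using xy by (auto simp: rows_def residues_def)
    then have "restrict x {..m} = x" "restrict y {..m} = y" by (auto simp: PiE_def extensional_restrict)
    moreover have "restrict (\<lambda>j. Z j) {..m} = restrict x {..m}" "restrict (\<lambda>j. Z (r + j)) {..m} = restrict y {..m}"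
      using m by (auto simp: restrict_def fun_eq_iff Z_def lev_def)
    ultimately show ?thesis by simp
  qed
  finally show ?thesis using gH by blast
qed

lemma red_image:
  assumes s: "s = 1 \<or> s = unif" and m: "m < r" shows "red s m ` Hm s (Suc m) = rows s m"
proof (rule subset_antisym; rule subsetI)
  fix z assume "z \<in> red s m ` Hm s (Suc m)"
  then show "z \<in> rows s m" using red_rows[OF s _ m] by blast
next
  fix z assume z: "z \<in> rows s m"
  obtain x y where xy: "z = (x, y)" by (cases z)
  obtain g where "g \<in> Hm s (Suc m)" "red s m g = (x, y)" using rows_red[OF s m] z xy by blast
  then show "z \<in> red s m ` Hm s (Suc m)" using xy by (metis image_eqI)
qed

end

context unitary_setting
begin

section \<open>Counting the reduced rows\<close>

lemma finite_residues: "finite (residues m)" and card_residues: "card (residues m) = q ^ Suc m"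
  by (simp_all add: residues_def finite_PiE finite_residue_reps card_PiE residue_reps(2))

lemma zero_row_residues: "zero_row m \<in> residues m"
  using residue_reps(3) by (simp add: residues_def zero_row_def)

lemma zero_row_iff: "x \<in> residues m \<Longrightarrow> x = zero_row m \<longleftrightarrow> (\<forall>j\<le>m. x j = 0)"
  unfolding residues_def by (intro iffI PiE_ext[where k = "{..m}" and s = "\<lambda>_. residue_reps" and y = "zero_row m"])
    (use zero_row_residues in \<open>auto simp: residues_def zero_row_def\<close>)

text \<open>At an index where \<open>y\<close> is a unit, the coordinate of \<open>x\<close> is
  determined by the remaining ones, which are free.\<close>

lemma card_hyperplane:
  assumes y: "y \<in> residues m" "y \<noteq> zero_row m"
  shows "card {x \<in> residues m. v (\<Sum>j\<le>m. x j * y j) < 1} = q ^ m"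
proof -
  let ?A = "{x \<in> residues m. v (\<Sum>j\<le>m. x j * y j) < 1}"
  obtain i where i: "i \<le> m" "y i \<noteq> 0" using zero_row_iff[OF y(1)] y(2) by blast
  have yT: "y j \<in> residue_reps" if "j \<le> m" for j using y that by (auto simp: residues_def)
  have vi: "v (y i) = 1" using v_rep i yT by blast
  define I where "I = {..m} - {i}"
  let ?B = "PiE I (\<lambda>_. residue_reps)"
  have split: "(\<Sum>j\<le>m. x j * y j) = x i * y i + (\<Sum>j\<in>I. x j * y j)" for x
    unfolding I_def using i by (intro sum.remove) auto
  have "bij_betw (\<lambda>x. restrict x I) ?A ?B"
  proof (rule bij_betw_imageI)
    show "inj_on (\<lambda>x. restrict x I) ?A"
    proof (rule inj_onI)
      fix x x' assume x: "x \<in> ?A" "x' \<in> ?A" "restrict x I = restrict x' I"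
      have xT: "x j \<in> residue_reps" "x' j \<in> residue_reps" if "j \<le> m" for j
        using x that by (auto simp: residues_def)
      have I: "x j = x' j" if "j \<in> I" for j using x(3) that by (metis restrict_apply')
      have "v ((\<Sum>j\<le>m. x j * y j) - (\<Sum>j\<le>m. x' j * y j)) < 1"
        using x by (intro v_diff_less) auto
      moreover have "(\<Sum>j\<le>m. x j * y j) - (\<Sum>j\<le>m. x' j * y j) = (x i - x' i) * y i"
        using I by (simp add: split left_diff_distrib)
      ultimately have "v (x i - x' i) < 1" using vi by (simp add: v_mult)
      then have "res (x i) = res (x' i)" using res_eq_iff residue_reps(4) xT[OF i(1)] by simp
      then have "x i = x' i" using res_reps xT[OF i(1)] by simp
      show "x = x'"
      proof (rule PiE_ext[where k = "{..m}" and s = "\<lambda>_. residue_reps"])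
        show "x \<in> {..m} \<rightarrow>\<^sub>E residue_reps" "x' \<in> {..m} \<rightarrow>\<^sub>E residue_reps"
          using x by (auto simp: residues_def)
        show "x j = x' j" if "j \<in> {..m}" for j
          using that I[of j] \<open>x i = x' i\<close> by (cases "j = i") (auto simp: I_def)
      qed
    qed
    show "(\<lambda>x. restrict x I) ` ?A = ?B"
    proof (rule subset_antisym; rule subsetI)
      fix w assume "w \<in> (\<lambda>x. restrict x I) ` ?A"
      then obtain x where x: "x \<in> residues m" "w = restrict x I" by blast
      show "w \<in> ?B" unfolding x(2) using x(1) by (intro restrict_PiE_iff[THEN iffD2]) (auto simp: residues_def I_def)
    next
      fix w assume w: "w \<in> ?B"
      define c where "c = - (\<Sum>j\<in>I. w j * y j) / y i"
      have "v (\<Sum>j\<in>I. w j * y j) \<le> 1"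
        using w yT residue_reps(4) by (intro v_sum_le) (auto simp: v_mult I_def intro!: mult_le_one)
      then have vc: "v c \<le> 1" using vi by (simp add: c_def v_divide)
      define x where "x = w(i := res c)"
      have xA: "x \<in> residues m"
        unfolding residues_def
      proof (rule PiE_I)
        fix j assume "j \<in> {..m}"
        then show "x j \<in> residue_reps" using w res(1)[OF vc] by (cases "j = i") (auto simp: x_def I_def)
      next
        fix j assume "j \<notin> {..m}"
        then show "x j = undefined" using w i by (auto simp: x_def I_def PiE_def extensional_def)
      qed
      have "(\<Sum>j\<in>I. x j * y j) = (\<Sum>j\<in>I. w j * y j)"
        by (intro sum.cong) (auto simp: x_def I_def)
      then have "(\<Sum>j\<le>m. x j * y j) = - ((c - res c) * y i)"
        using i by (simp add: split c_def x_def left_diff_distrib)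
      then have "v (\<Sum>j\<le>m. x j * y j) < 1" using res(2)[OF vc] vi by (simp add: v_mult)
      moreover have "w = restrict x I"
        using w by (auto simp: x_def I_def fun_eq_iff restrict_def PiE_def extensional_def)
      ultimately show "w \<in> (\<lambda>x. restrict x I) ` ?A" using xA by blast
    qed
  qed
  then have "card ?A = card ?B" by (rule bij_betw_same_card)
  then show ?thesis using i by (simp add: card_PiE I_def residue_reps(2))
qed

text \<open>The condition \<open>ftype\<close> seen modulo \<open>unif\<close>. First-half entries
  are integers for \<open>s = 1\<close>, so strict dominance of the second half forces them to
  reduce to 0; for \<open>s = unif\<close> they carry a factor \<open>unif\<close>, and it is enough
  that the second half does not reduce to 0.\<close>

definition front :: "'e \<Rightarrow> nat \<Rightarrow> (nat \<Rightarrow> 'e) \<times> (nat \<Rightarrow> 'e) \<Rightarrow> bool" where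
  "front s m z \<longleftrightarrow> (if s = 1 then fst z = zero_row m else snd z \<noteq> zero_row m)"

lemma finite_rows: "finite (rows s m)"
  by (rule finite_subset[of _ "residues m \<times> residues m"]) (auto simp: rows_def finite_residues)

lemma unif_ne_1: "unif \<noteq> 1"
  using v_unif real_q_gt_1 by (metis div_by_1 divide_cancel_left less_irrefl v_1 zero_neq_one nonzero_divide_eq_eq one_eq_divide_iff)

lemma card_rows_1:
  "card {z \<in> rows 1 m. front 1 m z} = q ^ Suc m - 1"
  "card {z \<in> rows 1 m. \<not> front 1 m z} = q ^ Suc m * (q ^ Suc m - 1)"
proof -
  let ?R = "residues m - {zero_row m}"
  have c: "card ?R = q ^ Suc m - 1"
    using card_Diff_singleton[OF zero_row_residues] by (simp add: card_residues)
  have "{z \<in> rows 1 m. front 1 m z} = {zero_row m} \<times> ?R"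
    using zero_row_residues unif_ne_1 by (auto simp: rows_def front_def)
  then show "card {z \<in> rows 1 m. front 1 m z} = q ^ Suc m - 1" using c by (simp add: card_cartesian_product)
  have "{z \<in> rows 1 m. \<not> front 1 m z} = ?R \<times> residues m"
    using unif_ne_1 by (auto simp: rows_def front_def)
  then show "card {z \<in> rows 1 m. \<not> front 1 m z} = q ^ Suc m * (q ^ Suc m - 1)"
    using c by (simp add: card_cartesian_product card_residues mult.commute)
qed

text \<open>For each nonzero second half, isotropy confines the first half to a hyperplane, so q^m
  choices remain where the case \<open>s = 1\<close> has q^(m+1). With second half zero, isotropy is
  automatic.\<close>

lemma card_rows_unif:
  "card {z \<in> rows unif m. \<not> front unif m z} = q ^ Suc m - 1"
  "card {z \<in> rows unif m. front unif m z} = q ^ m * (q ^ Suc m - 1)"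
proof -
  let ?R = "residues m - {zero_row m}"
  have c: "card ?R = q ^ Suc m - 1"
    using card_Diff_singleton[OF zero_row_residues] by (simp add: card_residues)
  have "(\<Sum>j\<le>m. x j * zero_row m j) = 0" for x by (simp add: zero_row_def)
  then have "{z \<in> rows unif m. \<not> front unif m z} = ?R \<times> {zero_row m}"
    using zero_row_residues unif_ne_1 by (auto simp: rows_def front_def)
  then show "card {z \<in> rows unif m. \<not> front unif m z} = q ^ Suc m - 1"
    using c by (simp add: card_cartesian_product)
  let ?S = "SIGMA y:?R. {x \<in> residues m. v (\<Sum>j\<le>m. x j * y j) < 1}"
  have "{z \<in> rows unif m. front unif m z} = prod.swap ` ?S"
    using unif_ne_1 by (auto simp: rows_def front_def image_iff)
  then have "card {z \<in> rows unif m. front unif m z} = card ?S"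
    by (simp add: card_image)
  also have "\<dots> = (\<Sum>y\<in>?R. card {x \<in> residues m. v (\<Sum>j\<le>m. x j * y j) < 1})"
    using finite_residues by (intro card_SigmaI) auto
  also have "\<dots> = (\<Sum>y\<in>?R. q ^ m)" by (intro sum.cong card_hyperplane) auto
  finally show "card {z \<in> rows unif m. front unif m z} = q ^ m * (q ^ Suc m - 1)"
    using c by simp
qed

lemma red_zero:
  assumes s: "s \<noteq> 0" and g: "g \<in> Ks s" and m: "m < r"
  shows "fst (red s m g) = zero_row m \<longleftrightarrow> (\<forall>j\<le>m. v (srow s m g j) < 1)"
    "snd (red s m g) = zero_row m \<longleftrightarrow> (\<forall>j\<le>m. v (srow s m g (r + j)) < 1)"
  unfolding zero_row_iff[OF red_residues(1)[OF s g m]] zero_row_iff[OF red_residues(2)[OF s g m]]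
  using srow_le[OF s g m] m by (simp_all add: red_def res_eq_0_iff)

text \<open>By \<open>red_not_zero\<close> the largest of the rescaled entries has absolute value
  exactly 1, so the comparison of the halves is decided by where this maximum occurs and by the
  factor \<open>v s\<close>.\<close>

lemma ftype_front:
  assumes s: "s = 1 \<or> s = unif" and g: "g \<in> Hm s (Suc m)" and m: "m < r"
  shows "ftype m g \<longleftrightarrow> front s m (red s m g)"
proof -
  have s0: "s \<noteq> 0" using s by auto
  have gK: "g \<in> Ks s" using g by simp
  note z = red_zero[OF s0 gK m]
  define x where "x j = v (srow s m g j)" for j
  define y where "y j = v (srow s m g (r + j))" for j
  have le: "x j \<le> 1" "y j \<le> 1" if "j \<le> m" for j
    using srow_le[OF s0 gK m] that m by (auto simp: x_def y_def)
  have nz: "(\<exists>j\<le>m. x j = 1) \<or> (\<exists>j\<le>m. y j = 1)"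
    using red_not_zero[OF s0 g m] le unfolding z by (force simp: x_def y_def)
  have ft: "ftype m g \<longleftrightarrow> (\<exists>j\<le>m. \<forall>k\<le>m. v s * x k < y j)"
    unfolding ftype_def using m s0 by (auto simp: x_def y_def srow_e srow_f v_divide)
  show ?thesis
  proof (cases "s = 1")
    case True
    have "(\<exists>j\<le>m. \<forall>k\<le>m. x k < y j) \<longleftrightarrow> (\<forall>k\<le>m. x k < 1)"
    proof
      assume "\<exists>j\<le>m. \<forall>k\<le>m. x k < y j"
      then show "\<forall>k\<le>m. x k < 1" using le by (meson less_le_trans)
    next
      assume a: "\<forall>k\<le>m. x k < 1"
      then obtain j where "j \<le> m" "y j = 1" using nz by force
      then show "\<exists>j\<le>m. \<forall>k\<le>m. x k < y j" using a by auto
    qed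
    then show ?thesis using True z(1) by (simp add: ft front_def x_def)
  next
    case False
    then have su: "s = unif" using s by simp
    have vs: "v s = 1 / q" using su v_unif by simp
    have "(\<exists>j\<le>m. \<forall>k\<le>m. v s * x k < y j) \<longleftrightarrow> \<not> (\<forall>k\<le>m. y k < 1)"
    proof
      assume "\<exists>j\<le>m. \<forall>k\<le>m. v s * x k < y j"
      then obtain j where j: "j \<le> m" "\<And>k. k \<le> m \<Longrightarrow> v s * x k < y j" by blast
      show "\<not> (\<forall>k\<le>m. y k < 1)"
      proof
        assume a: "\<forall>k\<le>m. y k < 1"
        then obtain k where k: "k \<le> m" "x k = 1" using nz by force
        have "y j < 1" using a j by blast
        then have "y j \<le> 1 / q" using v_step[of "srow s m g (r + j)" 1] by (simp add: y_def)
        then show False using j(2)[OF k(1)] k(2) vs by simp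
      qed
    next
      assume "\<not> (\<forall>k\<le>m. y k < 1)"
      then obtain j where j: "j \<le> m" "y j = 1" using le by force
      have "v s * x k < y j" if "k \<le> m" for k
      proof -
        have "v s * x k \<le> v s * 1" using le(1)[OF that] by (intro mult_left_mono) auto
        also have "\<dots> < 1" using vs real_q_gt_1 by simp
        finally show ?thesis using j by simp
      qed
      then show "\<exists>j\<le>m. \<forall>k\<le>m. v s * x k < y j" using j by blast
    qed
    then show ?thesis using False z(2) by (simp add: ft front_def y_def)
  qed
qed

text \<open>Right translation by \<open>adj a * b\<close> carries the fibre over the reduced row of
  \<open>a\<close> to that of \<open>b\<close>, and by \<open>red_image\<close> every admissible row
  occurs. So counting group elements reduces to counting rows, up to one constant.\<close>

lemma uniform_fibres:
  assumes s: "s = 1 \<or> s = unif" and m: "m < r"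
  obtains \<kappa> where "0 < \<kappa>"
    "\<And>Z. Z \<subseteq> rows s m \<Longrightarrow> card {g \<in> tr 1 s (Hm s (Suc m)). red s m g \<in> Z} = \<kappa> * card Z"
proof -
  have s0: "s \<noteq> 0" using s by auto
  define H where "H = Hm s (Suc m)"
  define T where "T = tr 1 s H"
  have HK: "H \<subseteq> Ks s" and sub: "subgroup H U" using subgroup_Hm[OF s0] by (auto simp: H_def)
  have fin: "finite T" unfolding T_def by (rule finite_tr[OF s0 HK])
  have TH: "T \<subseteq> H" unfolding T_def by (rule tr_subset)
  define n where "n z = card {g \<in> T. red s m g = z}" for z
  have ns: "n z = (\<Sum>g\<in>T. if red s m g = z then 1 else 0)" for z
    using fin by (simp add: n_def sum.If_cases Int_def)
  have const: "n (red s m a) = n (red s m b)" if a: "a \<in> H" and b: "b \<in> H" for a b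
  proof -
    have U: "a \<in> carrier U" "b \<in> carrier U" using that HK Ks_U by auto
    define k where "k = adj a * b"
    have k: "k \<in> H" unfolding k_def H_def
      by (rule Hm_mult[OF s0 Hm_adj[OF s0]]) (use a b in \<open>simp_all add: H_def\<close>)
    have ak: "a * k = b" using U by (simp add: k_def U_adj_cancel)
    have "(\<Sum>g\<in>T. if red s m (g * k) = red s m b then 1 else (0::nat)) = n (red s m b)"
      unfolding ns T_def
    proof (rule tr_sum_translate(2)[OF s0 sub HK k, where \<phi> = "\<lambda>g. if red s m g = red s m b then 1 else 0"])
      fix h h' assume "h \<in> H" "h' \<in> H" "congr 1 s h h'"
      then have "red s m h = red s m h'" using congr_red[OF s0 _ _ m] HK by blast
      then show "(if red s m h = red s m b then 1 else 0) = (if red s m h' = red s m b then 1 else (0::nat))" by simp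
    qed
    moreover have "red s m (g * k) = red s m b \<longleftrightarrow> red s m g = red s m a" if "g \<in> T" for g
      using red_mult[OF s0 _ _ _ m, of g a k] that TH a k ak by (auto simp: H_def)
    ultimately show ?thesis by (simp add: ns)
  qed
  have one: "1\<^sub>m (2*r) \<in> H" by (simp add: H_def Ks_one Qg_one)
  have eq: "n z = n (red s m (1\<^sub>m (2*r)))" if "z \<in> rows s m" for z
  proof -
    have "z \<in> red s m ` H" using that red_image[OF s m] unfolding H_def by (simp only:)
    then obtain a where a: "a \<in> H" "z = red s m a" by (elim imageE)
    show ?thesis unfolding a(2) by (rule const[OF a(1) one])
  qed
  have "n (red s m (1\<^sub>m (2*r))) > 0"
  proof -
    obtain g where g: "g \<in> T" using tr_nonempty[of H 1 s] one by (auto simp: T_def)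
    have "g \<in> {g' \<in> T. red s m g' = red s m g}" using g by simp
    then have "{g' \<in> T. red s m g' = red s m g} \<noteq> {}" by blast
    moreover have "finite {g' \<in> T. red s m g' = red s m g}"
      by (rule finite_subset[OF Collect_subset fin])
    ultimately have "n (red s m g) > 0" unfolding n_def card_gt_0_iff by (intro conjI)
    moreover have "n (red s m g) = n (red s m (1\<^sub>m (2*r)))" by (rule const[OF _ one]) (use g TH in blast)
    ultimately show ?thesis by (simp only:)
  qed
  moreover have "card {g \<in> T. red s m g \<in> Z} = n (red s m (1\<^sub>m (2*r))) * card Z" if Z: "Z \<subseteq> rows s m" for Z
  proof -
    have fz: "finite Z" by (rule finite_subset[OF Z finite_rows])
    have "(\<Sum>g\<in>{g \<in> T. red s m g \<in> Z}. 1) = (\<Sum>z\<in>Z. \<Sum>g\<in>{g \<in> {g \<in> T. red s m g \<in> Z}. red s m g = z}. (1::nat))"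
      by (rule sum.group[symmetric]) (use fin fz in auto)
    also have "\<dots> = (\<Sum>z\<in>Z. n z)"
      unfolding n_def by (intro sum.cong refl) (auto intro!: arg_cong[where f = card])
    also have "\<dots> = (\<Sum>z\<in>Z. n (red s m (1\<^sub>m (2*r))))" using eq Z by (intro sum.cong) auto
    finally show ?thesis by simp
  qed
  ultimately show ?thesis using that unfolding T_def H_def by blast
qed

lemma card_ftype:
  assumes s: "s = 1 \<or> s = unif" and m: "m < r"
  defines "T \<equiv> tr 1 s (Hm s (Suc m))"
  shows "s = 1 \<Longrightarrow> 0 < card {g \<in> T. ftype m g} \<and> card {g \<in> T. \<not> ftype m g} = q ^ Suc m * card {g \<in> T. ftype m g}"
    "s = unif \<Longrightarrow> 0 < card {g \<in> T. \<not> ftype m g} \<and> card {g \<in> T. ftype m g} = q ^ m * card {g \<in> T. \<not> ftype m g}"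
proof -
  obtain \<kappa> where \<kappa>: "0 < \<kappa>" "\<And>Z. Z \<subseteq> rows s m \<Longrightarrow> card {g \<in> T. red s m g \<in> Z} = \<kappa> * card Z"
    unfolding T_def using uniform_fibres[OF s m] by blast
  have TH: "g \<in> Hm s (Suc m)" if "g \<in> T" for g using that tr_subset unfolding T_def by blast
  have mem: "red s m g \<in> rows s m" "ftype m g \<longleftrightarrow> front s m (red s m g)" if "g \<in> T" for g
    using red_rows[OF s TH[OF that] m] ftype_front[OF s TH[OF that] m] by auto
  have "{g \<in> T. ftype m g} = {g \<in> T. red s m g \<in> {z \<in> rows s m. front s m z}}"
    "{g \<in> T. \<not> ftype m g} = {g \<in> T. red s m g \<in> {z \<in> rows s m. \<not> front s m z}}"
    using mem by auto
  then have c: "card {g \<in> T. ftype m g} = \<kappa> * card {z \<in> rows s m. front s m z}"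
    "card {g \<in> T. \<not> ftype m g} = \<kappa> * card {z \<in> rows s m. \<not> front s m z}"
    using \<kappa>(2)[of "{z \<in> rows s m. front s m z}"] \<kappa>(2)[of "{z \<in> rows s m. \<not> front s m z}"] by auto
  have pos: "0 < q ^ Suc m - 1" using one_less_power[OF q_gt_1, of "Suc m"] by simp
  show "s = 1 \<Longrightarrow> 0 < card {g \<in> T. ftype m g} \<and> card {g \<in> T. \<not> ftype m g} = q ^ Suc m * card {g \<in> T. ftype m g}"
    unfolding c using card_rows_1[of m] pos \<kappa>(1) by (simp only: mult.left_commute) simp
  show "s = unif \<Longrightarrow> 0 < card {g \<in> T. \<not> ftype m g} \<and> card {g \<in> T. ftype m g} = q ^ m * card {g \<in> T. \<not> ftype m g}"
    unfolding c using card_rows_unif[of m] pos \<kappa>(1) by (simp only: mult.left_commute) simp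
qed

end

section \<open>The intertwining averages\<close>

context unitary_setting
begin

lemma flip_tor:
  assumes s: "s \<noteq> 0" "s' \<noteq> 0" and m: "m < r" shows "flip s' m = flip s m * tor m (s' / s)"
proof (rule eq_matI)
  have x: "s' / s \<noteq> 0" using s by simp
  have fc: "flip s m \<in> carrier_mat (2*r) (2*r)" by (simp add: flip_def)
  show "dim_row (flip s' m) = dim_row (flip s m * tor m (s' / s))"
    "dim_col (flip s' m) = dim_col (flip s m * tor m (s' / s))"
    by (simp_all add: flip_def tor_def mono_mat_def)
  fix a b assume "a < dim_row (flip s m * tor m (s' / s))" "b < dim_col (flip s m * tor m (s' / s))"
  then have ab: "a < 2*r" "b < 2*r" by (simp_all add: flip_def tor_def mono_mat_def)
  have "(flip s m * tor m (s' / s)) $$ (a, b) = flip s m $$ (a, b) * tor_coeff m (s' / s) b"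
    unfolding tor_def by (rule mult_monomial[OF fc tor_monomial[OF x m] ab])
  also have "\<dots> = flip s' m $$ (a, b)"
  proof (cases "b = flip_perm m a")
    case False then show ?thesis using ab by (simp add: flip_def mono_entry)
  next
    case True
    consider "a = m" | "a = r + m" | "a \<noteq> m" "a \<noteq> r + m" by blast
    then show ?thesis
    proof cases
      case 3
      then have "lev a \<noteq> m" using ab by (auto simp: lev_def)
      then have "b = a" using True by (simp add: flip_perm_def)
      then show ?thesis using 3 ab True by (simp add: flip_def mono_entry flip_coeff_def tor_coeff_def)
    qed (use ab True s m in \<open>auto simp: flip_def mono_entry flip_perm_def lev_def pr_def flip_coeff_def tor_coeff_def field_simps\<close>)
  qed
  finally show "flip s' m $$ (a, b) = (flip s m * tor m (s' / s)) $$ (a, b)" by simp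
qed

lemma blk_tor_commute:
  assumes x: "x \<noteq> 0" and m: "m < r" and k: "blk m k" shows "k * tor m x = tor m x * k"
proof (rule eq_matI)
  have kc: "k \<in> carrier_mat (2*r) (2*r)" using U_carrier[OF blk_U[OF k]] .
  show "dim_row (k * tor m x) = dim_row (tor m x * k)" "dim_col (k * tor m x) = dim_col (tor m x * k)"
    using kc by (simp_all add: tor_def mono_mat_def)
  fix a b assume "a < dim_row (tor m x * k)" "b < dim_col (tor m x * k)"
  then have ab: "a < 2*r" "b < 2*r" using kc by (simp_all add: tor_def mono_mat_def)
  have "(k * tor m x) $$ (a, b) = k $$ (a, b) * tor_coeff m x b"
    unfolding tor_def by (rule mult_monomial[OF kc tor_monomial[OF x m] ab])
  also have "\<dots> = tor_coeff m x a * k $$ (a, b)"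
  proof (cases "m \<le> lev a \<or> m \<le> lev b")
    case True
    then show ?thesis using blk_entry[OF k ab] by simp
  next
    case False
    then have "a \<noteq> m" "b \<noteq> m" "a \<noteq> r + m" "b \<noteq> r + m" using m by (auto simp: lev_def)
    then show ?thesis by (simp add: tor_coeff_def)
  qed
  also have "\<dots> = (tor m x * k) $$ (a, b)"
    unfolding tor_def by (rule monomial_mult[OF kc tor_monomial[OF x m] ab, symmetric])
  finally show "(k * tor m x) $$ (a, b) = (tor m x * k) $$ (a, b)" .
qed

end

context principal_setting
begin

text \<open>The compact factor of \<open>h\<close> lies in \<open>blk m\<close> and commutes with a
  torus element at level \<open>m\<close>, so the torus element moves to the Borel factor and comes
  out through \<open>\<tau>\<close>. For general \<open>h\<close> this right translation would not
  act by a scalar.\<close>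

lemma sph_tor:
  assumes s: "s = 1 \<or> s = unif" and x: "x \<noteq> 0" and m: "m < r" and h: "h \<in> Qg m"
  shows "sph s (h * tor m x) = \<tau> (tor m x) * sph s h"
proof -
  have s0: "s \<noteq> 0" using s by auto
  obtain k where k: "k \<in> Ks s" "blk m k" "h * k \<in> Qg 0" using iwasawa[OF s h] m by auto
  have U: "h \<in> carrier U" "k \<in> carrier U" "tor m x \<in> carrier U" using h Qg_U k Ks_U tor_U[OF x m] by auto
  note t = tor_Qg0[OF x m]
  have ak: "adj k \<in> Ks s" by (rule Ks_adj[OF s0 k(1)])
  have "h * tor m x = (h * k) * (adj k * tor m x)" using U by (simp add: U_assoc U_adj_cancel)
  also have "adj k * tor m x = tor m x * adj k" by (rule blk_tor_commute[OF x m blk_adj[OF k(2)]])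
  also have "(h * k) * (tor m x * adj k) = (h * k * tor m x) * adj k" using U by (simp add: U_assoc)
  finally have "sph s (h * tor m x) = \<tau> (h * k * tor m x)"
    using sph_eq[OF s Qg_mult[OF k(3) t] ak] by simp
  also have "\<dots> = \<tau> (h * k) * \<tau> (tor m x)" by (rule \<tau>_mult[OF k(3) t])
  also have "\<tau> (h * k) = sph s h"
    using sph_eq[OF s k(3) ak] U by (simp add: U_adj_cancel)
  finally show ?thesis by simp
qed

lemma sph_congr:
  assumes s: "s = 1 \<or> s = unif" "s' = 1 \<or> s' = unif" and h: "h \<in> Ks s" "h' \<in> Ks s" and c: "congr 1 s h h'"
  shows "sph s' h = sph s' h'"
proof -
  have U: "h \<in> carrier U" "h' \<in> carrier U" using h Ks_U by auto
  have "sph s' (h * (adj h * h')) = sph s' h" by (rule sph_right[OF s(2) congr_one_Ks[OF s h c] U(1)])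
  then show ?thesis using U by (simp add: U_adj_cancel)
qed

text \<open>Splitting \<open>Hm s (Suc m)\<close> by the type of the row \<open>r + m\<close> reduces the average to \<open>Hm s m\<close>; rows led by the
  isotropic vector opposite to the flag pick up the factor \<open>\<tau> (tor m (s' / s))\<close>.\<close>

lemma sph_average_step:
  assumes s: "s = 1 \<or> s = unif" "s' = 1 \<or> s' = unif" and m: "m < r"
  defines "T \<equiv> \<lambda>m. tr 1 s (Hm s m)"
  shows "of_nat (card (T m)) * (\<Sum>g\<in>T (Suc m). sph s' g) =
    (of_nat (card {g \<in> T (Suc m). ftype m g}) +
     of_nat (card {g \<in> T (Suc m). \<not> ftype m g}) * \<tau> (tor m (s' / s))) * (\<Sum>h\<in>T m. sph s' h)"
proof -
  have s0: "s \<noteq> 0" "s' \<noteq> 0" using s by auto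
  let ?t = "\<tau> (tor m (s' / s))" and ?S = "\<Sum>h\<in>T m. sph s' h"
  have TH: "g \<in> Hm s n" if "g \<in> T n" for g n using that tr_subset unfolding T_def by blast
  have fin: "finite (T n)" for n unfolding T_def by (rule finite_tr[OF s0(1)]) auto
  have up: "h \<in> Hm s (Suc m)" if "h \<in> Hm s m" for h using that Qg_mono[of m "Suc m"] by auto
  have KU: "h \<in> carrier U" if "h \<in> Hm s n" for h n using that Ks_U by auto
  have inv: "sph s' h = sph s' h'" if "h \<in> Hm s n" "h' \<in> Hm s n" "congr 1 s h h'" for h h' n
    using sph_congr[OF s _ _ that(3)] that by simp
  have left: "(\<Sum>g\<in>T (Suc m). sph s' (h * g)) = (\<Sum>g\<in>T (Suc m). sph s' g)" if "h \<in> T m" for h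
    unfolding T_def
    by (rule tr_sum_translate(1)[OF s0(1) subgroup_Hm[OF s0(1)] Int_lower1 up[OF TH[OF that]], where \<phi> = "sph s'"])
      (rule inv)
  have right: "(\<Sum>h\<in>T m. sph s' (h * k)) = ?S" if "k \<in> Hm s m" for k
    unfolding T_def
    by (rule tr_sum_translate(2)[OF s0(1) subgroup_Hm[OF s0(1)] Int_lower1 that, where \<phi> = "sph s'"]) (rule inv)
  have inner: "(\<Sum>h\<in>T m. sph s' (h * g)) = (if ftype m g then 1 else ?t) * ?S" if g: "g \<in> T (Suc m)" for g
  proof -
    have gH: "g \<in> Ks s" "g \<in> Qg (Suc m)" "g \<in> carrier U" using TH[OF g] Ks_U by auto
    have hU: "h \<in> carrier U" if "h \<in> T m" for h using KU[OF TH[OF that]] .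
    show ?thesis
    proof (cases "ftype m g")
      case True
      obtain k where k: "k \<in> Ks 1" "k \<in> Ks unif" "g * k \<in> Qg m"
        using step_ftype[OF gH(2) m True] by blast
      have ks: "k \<in> Ks s" "k \<in> Ks s'" and kU: "k \<in> carrier U" using k s Ks_U by auto
      have "sph s' (h * g) = sph s' (h * (g * k))" if "h \<in> T m" for h
        using sph_right[OF s(2) ks(2), of "h * g"] hU[OF that] gH kU by (simp add: U_assoc)
      then have "(\<Sum>h\<in>T m. sph s' (h * g)) = (\<Sum>h\<in>T m. sph s' (h * (g * k)))" by simp
      also have "\<dots> = ?S" using right[of "g * k"] k(3) Ks_mult[OF s0(1) gH(1) ks(1)] by simp
      finally show ?thesis using True by simp
    next
      case False
      obtain k where k: "k \<in> Ks 1" "k \<in> Ks unif" "g * k * flip s m \<in> Qg m"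
        using step_etype[OF gH(2) m False s0(1)] by blast
      have ks: "k \<in> Ks s" "k \<in> Ks s'" and kU: "k \<in> carrier U" using k s Ks_U by auto
      note fl = flip_Ks[OF s0(1) m] flip_Ks[OF s0(2) m]
      have fU: "flip s m \<in> carrier U" "flip s' m \<in> carrier U" using fl Ks_U by auto
      have x: "s' / s \<noteq> 0" using s0 by simp
      define h0 where "h0 = g * k * flip s m"
      have h0: "h0 \<in> Hm s m" unfolding h0_def
        using k(3) Ks_mult[OF s0(1) Ks_mult[OF s0(1) gH(1) ks(1)] fl(1)] by simp
      have "sph s' (h * g) = ?t * sph s' (h * h0)" if h: "h \<in> T m" for h
      proof -
        \<comment> \<open>Invariance of \<open>sph s'\<close> calls for the reflection of
          \<open>Ks s'\<close>, but the reduced element stays in \<open>Hm s m\<close> only with the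
          reflection of \<open>Ks s\<close>. The discrepancy is the torus element.\<close>
        have "sph s' (h * g) = sph s' (h * g * (k * flip s' m))"
          using sph_right[OF s(2) Ks_mult[OF s0(2) ks(2) fl(2)], of "h * g"] hU[OF h] gH by simp
        also have "h * g * (k * flip s' m) = h * h0 * tor m (s' / s)"
          unfolding h0_def flip_tor[OF s0 m] using hU[OF h] gH kU fU tor_U[OF x m] by (simp add: U_assoc)
        also have "sph s' (h * h0 * tor m (s' / s)) = ?t * sph s' (h * h0)"
          using sph_tor[OF s(2) x m] Qg_mult TH[OF h] h0 by blast
        finally show ?thesis .
      qed
      then have "(\<Sum>h\<in>T m. sph s' (h * g)) = ?t * (\<Sum>h\<in>T m. sph s' (h * h0))"
        by (simp add: sum_distrib_left)
      then show ?thesis using False right[OF h0] by simp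
    qed
  qed
  \<comment> \<open>By left invariance the additional sum over the smaller group costs only the
    factor \<open>card (T m)\<close>. After exchanging the sums, right invariance of the inner one
    absorbs the reduced element.\<close>
  have "of_nat (card (T m)) * (\<Sum>g\<in>T (Suc m). sph s' g) = (\<Sum>h\<in>T m. \<Sum>g\<in>T (Suc m). sph s' (h * g))"
    using left by simp
  also have "\<dots> = (\<Sum>g\<in>T (Suc m). \<Sum>h\<in>T m. sph s' (h * g))" by (rule sum.swap)
  also have "\<dots> = (\<Sum>g\<in>T (Suc m). (if ftype m g then 1 else ?t) * ?S)" using inner by simp
  also have "\<dots> = (\<Sum>g\<in>T (Suc m). if ftype m g then 1 else ?t) * ?S" by (simp add: sum_distrib_right)
  also have "(\<Sum>g\<in>T (Suc m). if ftype m g then 1 else ?t) = of_nat (card {g \<in> T (Suc m). ftype m g}) +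
     of_nat (card {g \<in> T (Suc m). \<not> ftype m g}) * ?t"
    by (simp add: sum.If_cases[OF fin] Int_def)
  finally show ?thesis .
qed

text \<open>Induction along the chain \<open>Hm s m\<close>, each step multiplying by a nonzero
  constant. At \<open>m = 0\<close> the group lies in the Borel subgroup, where the function is 1 on
  integral points; at \<open>m = r\<close> the group is \<open>Ks s\<close>.\<close>

lemma sph_average_nonzero:
  assumes s: "s = 1 \<or> s = unif" "s' = 1 \<or> s' = unif"
    and nz: "\<And>m. m < r \<Longrightarrow> of_nat (card {g \<in> tr 1 s (Hm s (Suc m)). ftype m g}) +
      of_nat (card {g \<in> tr 1 s (Hm s (Suc m)). \<not> ftype m g}) * \<tau> (tor m (s' / s)) \<noteq> 0"
  shows "(\<Sum>h\<in>tr 1 s (Ks s). sph s' h) \<noteq> 0"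
proof -
  have s0: "s \<noteq> 0" using s by auto
  have fin: "finite (tr 1 s (Hm s n))" for n by (rule finite_tr[OF s0]) auto
  have "(\<Sum>h\<in>tr 1 s (Hm s m). sph s' h) \<noteq> 0" if "m \<le> r" for m
    using that
  proof (induction m)
    case 0
    have "sph s' h = 1" if "h \<in> tr 1 s (Hm s 0)" for h
    proof -
      have h: "h \<in> Ks s" "h \<in> Qg 0" using that tr_subset by blast+
      then show ?thesis
        using sph_eq[OF s(2) h(2) Ks_one] \<tau>_unit[OF s(1) h(2,1)] Qg_carrier[OF h(2)] by simp
    qed
    then have "(\<Sum>h\<in>tr 1 s (Hm s 0). sph s' h) = of_nat (card (tr 1 s (Hm s 0)))" by simp
    moreover have "tr 1 s (Hm s 0) \<noteq> {}" using tr_nonempty[of "Hm s 0"] Ks_one Qg_one by blast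
    ultimately show ?case using fin by simp
  next
    case (Suc m)
    have m: "m < r" by (rule Suc_le_lessD[OF Suc.prems])
    have IH: "(\<Sum>h\<in>tr 1 s (Hm s m). sph s' h) \<noteq> 0" by (rule Suc.IH[OF Suc_leD[OF Suc.prems]])
    show ?case
    proof
      assume "(\<Sum>h\<in>tr 1 s (Hm s (Suc m)). sph s' h) = 0"
      then show False using no_zero_divisors[OF nz[OF m] IH]
        unfolding sph_average_step[OF s m, symmetric] by (simp only: mult_zero_right)
    qed
  qed
  from this[of r] show ?thesis by (simp add: Qg_r Int_absorb2 Ks_U subsetI)
qed

section \<open>Evaluation of the two averages and comparison of the constituents\<close>

lemma sqrt_odd_power: "sqrt (real q ^ (2 * m + 1)) = real q ^ m * sqrt (real q)"
proof -
  have "real q ^ (2 * m + 1) = (real q ^ m)\<^sup>2 * real q" by (simp add: power_mult[symmetric] mult.commute)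
  then show ?thesis by (simp only: real_sqrt_mult real_sqrt_abs) simp
qed

lemma q_powr_half:
  "(of_nat q :: complex) powr (1 / 2) = of_real (sqrt (real q))"
  "(of_nat q :: complex) powr (- 1 / 2) = 1 / of_real (sqrt (real q))"
proof -
  have "(of_nat q :: complex) powr of_real (1 / 2) = of_real (real q powr (1 / 2))"
    using powr_of_real[of "real q" "1 / 2"] by simp
  then show h: "(of_nat q :: complex) powr (1 / 2) = of_real (sqrt (real q))"
    by (simp add: powr_half_sqrt)
  have "(of_nat q :: complex) powr (- 1 / 2) = of_nat q powr (- (1 / 2))" by (simp only: minus_divide_left)
  also have "\<dots> = inverse (of_nat q powr (1 / 2))" by (rule powr_minus)
  also have "\<dots> = 1 / of_real (sqrt (real q))" unfolding h by (rule inverse_eq_divide)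
  finally show "(of_nat q :: complex) powr (- 1 / 2) = 1 / of_real (sqrt (real q))" .
qed

lemma \<tau>_tor_unif:
  assumes m: "m < r"
  shows "\<tau> (tor m (1 / unif)) = of_nat q ^ m * of_real (sqrt (real q)) * of_nat q powr \<sigma> m"
    "\<tau> (tor m unif) = 1 / \<tau> (tor m (1 / unif))"
proof -
  have "v (1 / unif) = q" using v_unif real_q_pos by (simp add: v_divide)
  then show "\<tau> (tor m (1 / unif)) = of_nat q ^ m * of_real (sqrt (real q)) * of_nat q powr \<sigma> m"
    using \<tau>_tor[OF m, of "1 / unif"] by (simp only: sqrt_odd_power) simp
  have Q: "tor m unif \<in> Qg 0" "tor m (1 / unif) \<in> Qg 0" using tor_Qg0 m by auto
  have "tor m unif * tor m (1 / unif) = 1\<^sub>m (2*r)"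
    using tor_U[of unif m] m by (simp flip: tor_adj)
  then have "\<tau> (tor m unif) * \<tau> (tor m (1 / unif)) = 1" using \<tau>_mult[OF Q] by simp
  then show "\<tau> (tor m unif) = 1 / \<tau> (tor m (1 / unif))" using \<tau>_nz[OF Q(2)] by (simp add: field_simps)
qed

text \<open>The count q^m of elements of type \<open>ftype\<close> matches the power q^m in
  \<open>\<tau>\<close>; what remains is 1 + q^(1/2) q^(\<sigma> m), which vanishes only at the
  value - q^(-1/2).\<close>

lemma average_unif_nonzero:
  assumes "\<And>m. m < r \<Longrightarrow> (of_nat q :: complex) powr \<sigma> m \<noteq> - (of_nat q powr (- 1 / 2))"
  shows "(\<Sum>h\<in>tr 1 unif (Ks unif). sph 1 h) \<noteq> 0"
proof (rule sph_average_nonzero)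
  fix m assume m: "m < r"
  define A where "A = card {g \<in> tr 1 unif (Hm unif (Suc m)). \<not> ftype m g}"
  define Q where "Q = (of_nat q :: complex) powr \<sigma> m"
  define w where "w = complex_of_real (sqrt (real q))"
  have w: "w \<noteq> 0" using q_gt_1 by (simp add: w_def)
  have c: "0 < A" "card {g \<in> tr 1 unif (Hm unif (Suc m)). ftype m g} = q ^ m * A"
    using card_ftype(2)[of unif m] m by (auto simp: A_def)
  have "Q \<noteq> - (1 / w)" using assms[OF m] unfolding q_powr_half Q_def w_def .
  then have "1 + w * Q \<noteq> 0" using w by (metis add_eq_0_iff minus_divide_left nonzero_mult_div_cancel_left)
  then have "of_nat q ^ m * of_nat A * (1 + w * Q) \<noteq> 0" using c q_gt_1 by simp
  then show "of_nat (card {g \<in> tr 1 unif (Hm unif (Suc m)). ftype m g}) +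
      of_nat (card {g \<in> tr 1 unif (Hm unif (Suc m)). \<not> ftype m g}) * \<tau> (tor m (1 / unif)) \<noteq> 0"
    unfolding \<tau>_tor_unif(1)[OF m] c(2) A_def[symmetric] by (simp add: Q_def w_def algebra_simps)
qed auto

text \<open>Here \<open>\<tau>\<close> occurs inverted, and the count q^(m+1) divided by q^(m+1/2)
  leaves 1 + q^(1/2) q^(-\<sigma> m), which vanishes only at the value - q^(1/2).\<close>

lemma average_one_nonzero:
  assumes "\<And>m. m < r \<Longrightarrow> (of_nat q :: complex) powr \<sigma> m \<noteq> - (of_nat q powr (1 / 2))"
  shows "(\<Sum>h\<in>tr 1 1 (Ks 1). sph unif h) \<noteq> 0"
proof (rule sph_average_nonzero)
  fix m assume m: "m < r"
  define A where "A = card {g \<in> tr 1 1 (Hm 1 (Suc m)). ftype m g}"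
  define Q where "Q = (of_nat q :: complex) powr \<sigma> m"
  define w where "w = complex_of_real (sqrt (real q))"
  have w: "w \<noteq> 0" using q_gt_1 by (simp add: w_def)
  have ww: "w * w = of_nat q" by (simp add: w_def flip: of_real_mult)
  have Q: "Q \<noteq> 0" using q_gt_1 by (simp add: Q_def)
  have q0: "(of_nat q :: complex) \<noteq> 0" using q_gt_1 by simp
  have c: "0 < A" "card {g \<in> tr 1 1 (Hm 1 (Suc m)). \<not> ftype m g} = q ^ Suc m * A"
    using card_ftype(1)[of 1 m] m by (auto simp: A_def)
  have "Q \<noteq> - w" using assms[OF m] unfolding q_powr_half Q_def w_def .
  then have "Q + w \<noteq> 0" by (metis add_eq_0_iff2)
  then have "of_nat A * (Q + w) / Q \<noteq> 0" using c Q by simp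
  moreover have "of_nat A * (Q + w) / Q = of_nat A + of_nat (q ^ Suc m * A) * (1 / (of_nat q ^ m * w * Q))"
  proof -
    have "of_nat (q ^ Suc m * A) * (1 / (of_nat q ^ m * w * Q)) =
      of_nat q ^ m * (w * w) * of_nat A / (of_nat q ^ m * w * Q)" by (simp add: ww)
    also have "\<dots> = of_nat A * w / Q" using w q0 by simp
    finally show ?thesis using Q by (simp add: distrib_left add_divide_distrib)
  qed
  moreover have "\<tau> (tor m (unif / 1)) = 1 / (of_nat q ^ m * w * Q)"
    using \<tau>_tor_unif[OF m] by (simp add: Q_def w_def)
  ultimately show "of_nat (card {g \<in> tr 1 1 (Hm 1 (Suc m)). ftype m g}) +
      of_nat (card {g \<in> tr 1 1 (Hm 1 (Suc m)). \<not> ftype m g}) * \<tau> (tor m (unif / 1)) \<noteq> 0"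
    unfolding c(2) A_def[symmetric] by (simp only:) simp
qed auto

text \<open>A pair isolating \<open>sph unif\<close> also isolates \<open>sph 1\<close>: the larger
  space contains \<open>sph 1\<close> because \<open>sph unif\<close> generates it, and the smaller
  one cannot, since it would then contain \<open>sph unif\<close>. Uniqueness for
  \<open>sph 1\<close> finishes the comparison.\<close>

lemma constituents_iso:
  assumes nz: "(\<Sum>h\<in>tr 1 unif (Ks unif). sph 1 h) \<noteq> 0" "(\<Sum>h\<in>tr 1 1 (Ks 1). sph unif h) \<noteq> 0"
    and \<pi>: "unique_constituent_with_fixed U V (Ks unif) \<pi>" "unique_constituent_with_fixed U V (Ks 1) \<pi>'"
  shows "rep_iso U \<pi> \<pi>'"
proof -
  interpret L: fixed_line U V "Ks unif" "sph unif" by (rule fixed_line_sph) simp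
  interpret K: fixed_line U V "Ks 1" "sph 1" by (rule fixed_line_sph) simp
  obtain A B where L: "L.isolates A B" "\<pi> = quotient_rep (V\<lparr>carrier := A\<rparr>) B"
    using \<pi>(1) unfolding L.unique_constituent_iff by blast
  obtain A' B' where K: "K.isolates A' B'" "\<pi>' = quotient_rep (V\<lparr>carrier := A'\<rparr>) B'"
    using \<pi>(2) unfolding K.unique_constituent_iff by blast
  have gen: "sph 1 \<in> V.gen (sph unif)" "sph unif \<in> V.gen (sph 1)" using sph_in_gen nz by auto
  have AB: "subrep U V A" "subrep U V B" "sph unif \<in> A" "sph unif \<notin> B" using L(1) by (auto simp: L.isolates_def)
  have "sph 1 \<in> A" using gen(1) V.gen_least[OF AB(1,3)] by blast
  moreover have "sph 1 \<notin> B" using gen(2) V.gen_least[OF AB(2)] AB(4) by blast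
  ultimately have "K.isolates A B" using L(1) unfolding K.isolates_def L.isolates_def by blast
  then show ?thesis unfolding L(2) K(2) using K.isolates_iso K(1) by blast
qed

lemma constituent_exists:
  assumes s: "s = 1 \<or> s = unif" shows "\<exists>\<pi>. unique_constituent_with_fixed U V (Ks s) \<pi>"
proof -
  interpret fixed_line U V "Ks s" "sph s" by (rule fixed_line_sph[OF s])
  show ?thesis using isolates_exists unfolding unique_constituent_iff by blast
qed

end

theorem theorem3p43:
  fixes p r :: nat
    and v :: "'e::field_char_0 \<Rightarrow> real" and F :: "'e set" and cj :: "'e \<Rightarrow> 'e" and unif :: 'e
    and \<sigma> :: "nat \<Rightarrow> complex"
  assumes "ramified_quadratic_extension p v F cj unif"
    and "odd p"
    and "\<And>i. i < r \<Longrightarrow>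
           (of_nat (residue_card v F) :: complex) powr \<sigma> i
             \<notin> {- (of_nat (residue_card v F) powr (1 / 2)), - (of_nat (residue_card v F) powr (- 1 / 2))}"
  shows "(\<exists>\<pi>L. unique_constituent_with_fixed (unitary_group cj r) (principal_series v cj r \<sigma>)
                 (group_L v cj unif r) \<pi>L) \<and>
         (\<exists>\<pi>K. unique_constituent_with_fixed (unitary_group cj r) (principal_series v cj r \<sigma>)
                 (group_K v cj r) \<pi>K) \<and>
         (\<forall>\<pi>L \<pi>K.
            unique_constituent_with_fixed (unitary_group cj r) (principal_series v cj r \<sigma>)
              (group_L v cj unif r) \<pi>L \<longrightarrow>
            unique_constituent_with_fixed (unitary_group cj r) (principal_series v cj r \<sigma>)
              (group_K v cj r) \<pi>K \<longrightarrow>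
            rep_iso (unitary_group cj r) \<pi>L \<pi>K)"
proof -
  interpret principal_setting p v F cj unif r \<sigma>
    unfolding principal_setting_def unitary_setting_def odd_ramified_extension_def odd_ramified_extension_axioms_def
    using assms(1,2) by blast
  have nz: "(\<Sum>h\<in>tr 1 unif (Ks unif). sph 1 h) \<noteq> 0" "(\<Sum>h\<in>tr 1 1 (Ks 1). sph unif h) \<noteq> 0"
    using average_unif_nonzero average_one_nonzero assms(3) by auto
  show ?thesis
    unfolding group_K_eq group_L_eq using constituents_iso[OF nz] constituent_exists by blast
qed


end
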